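(* Let $c_0>0$, $M>0$. Let $n,p\ge1$ be integers, $\sigma>0$, let $\mathbf X\in\mathbb R^{n\times p}$ and a positive integer $k_0$ satisfy (i) $\|\mathbf X\|_{\mathrm{op}}/\sigma\ge c_0$; (ii) $A_1\ge c_0(n\wedge p)\|\mathbf X\|_{\mathrm{op}}^2$ and $A_2\ge c_0(n\wedge p)\|\mathbf X\|_{\mathrm{op}}^4$; (iii) $A_k\ge c_0^k\|\mathbf X\|_{\mathrm{op}}^{2k}\,p\,(\tfrac np\wedge1)^k$ for all $3\le k\le k_0$; let the prior $g$ be subgaussian with constant $M$, and let $\mathbf y=\mathbf X\boldsymbol\beta+\boldsymbol\varepsilon$ with $\beta_1,\dots,\beta_p$ i.i.d. from $g$ and $\boldsymbol\varepsilon\sim N(0,\sigma^2\mathbf I_n)$ independent of $\boldsymbol\beta$. Let $N:=n\wedge p$, and suppose that $0<\varepsilon\le1/2$ and $n\ge p^{1-\varepsilon}$. Let $$k=\Big\lfloor c\min\Big\{\frac1{\sqrt\varepsilon},\sqrt{\frac{\log N}{\log\log N}}\Big\}\Big\rfloor,\qquad L=2k-1,$$ where $c>0$ is any sufficiently small constant, and suppose that $N\ge3$, $k\ge1$ and $L\le k_0$. Let $A=\sqrt{C_Ak\log k}$ where $C_A>0$ is a sufficiently large constant. (Here $c$ and $C_A$ are constants chosen depending only on $c_0,M$, and "sufficiently small/large" refers to thresholds depending only on $c_0,M$.) Let $\tilde g$ be the DMM (denoised method of moments) estimator on $[-A,A]$ applied to the centered moment vector $(0,\hat\mu_2,\dots,\hat\mu_L)$,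 and let $\hat g=\tau_{\hat m_1}\#\tilde g$ be the pushforward of $\tilde g$ under the translation $\tau_a(x):=x+a$ with $a=\hat m_1$. Then there exist constants $C_1,C_2,C>0$ depending only on $c_0$ and $M$ such that $$\mathbb P\Big(W_1(g,\hat g)>C\sqrt{\frac{\log k}{k}}\Big)\le\frac{k^{C_1k^2}}{N}+k^{-C_2}.$$
   Context: Notation: $a\wedge b=\min$, $a\vee b=\max$; $\|\cdot\|$ Euclidean norm, $\|\cdot\|_{\mathrm{op}}$ operator norm; $\mathbf 1$ is the all-ones vector in $\mathbb R^p$; $W_1$ is the 1-Wasserstein distance between probability distributions on $\mathbb R$. The design $\mathbf X$ is treated as fixed, with columns $\mathbf x_1,\dots,\mathbf x_p$. Prior: $g$ is a probability distribution on $\mathbb R$ with mean $m_1=\mathbb E_{\beta\sim g}[\beta]$ and central moments $\mu_\ell=\mathbb E_{\beta\sim g}[(\beta-m_1)^\ell]$. It is subgaussian with constant $M$ if $(\mathbb E_{\beta\sim g}|\beta-m_1|^q)^{1/q}\le M\sqrt q$ for all positive integers $q$. Let $\mathbf H=\mathbf X^\top\mathbf X=(H_{ij})$ and $A_k=\sum_{i,j=1}^pH_{ij}^k$ (so $A_1=\|\mathbf X\mathbf 1\|^2$, $A_2=\|\mathbf X^\top\mathbf X\|_F^2$). For positive integers $d_1,\dots,d_t$ with $d_1+\dots+d_t=k$ let $$\gamma^{(d_1,\dots,d_t)}=\binom{k}{d_1,\dots,d_t}\sum_{1\le s_1<\dots<s_t\le p}\ \sum_{j=1}^pH_{j,s_1}^{d_1}\cdots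 H_{j,s_t}^{d_t}.$$ Let $\mathrm{He}_k(x)=(-1)^ke^{x^2/2}\frac{d^k}{dx^k}e^{-x^2/2}$ and, for $\mathbf z\in\mathbb R^n$, $F_k(\mathbf z)=\sum_{j=1}^p(\sigma\|\mathbf x_j\|)^k\mathrm{He}_k\big(\frac{\mathbf x_j^\top\mathbf z}{\sigma\|\mathbf x_j\|}\big)$ (a summand with $\mathbf x_j=0$ is interpreted as $0$). EBMoM estimators: $\hat m_1=\frac{\mathbf 1^\top\mathbf X^\top\mathbf y}{\|\mathbf X\mathbf 1\|^2}$, $\hat{\mathbf y}=\mathbf y-\hat m_1\mathbf X\mathbf 1$, and recursively for $\ell\ge2$, $$\hat\mu_\ell=\frac1{A_\ell}\Big[F_\ell(\hat{\mathbf y})-\sum_{t=2}^\ell\ \sum_{\substack{d_1+\dots+d_t=\ell\\ d_j\ge2}}\hat\mu_{d_1}\cdots\hat\mu_{d_t}\,\gamma^{(d_1,\dots,d_t)}\Big],$$ the inner sum being over ordered tuples. DMM estimator: for a distribution $\pi$ let $\boldsymbol m_L(\pi)=(m_1(\pi),\dots,m_L(\pi))$ be its vector of (raw) moments $m_\ell(\pi)=\mathbb E_{x\sim\pi}[x^\ell]$, and let $\mathcal M_L([-A,A])=\{\boldsymbol m_L(\pi):\pi\text{ supported on }[-A,A]\}$. Given a vector $\hat{\boldsymbol\mu}_L\in\mathbb R^L$ with $L=2k-1$, let $\tilde{\boldsymbol\mu}_L$ be the minimizer of $\|\mathbf m-\hat{\boldsymbol\mu}_L\|$ over $\mathbf m\in\mathcal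 M_L([-A,A])$; the DMM estimator $\tilde g$ is a discrete distribution on $[-A,A]$ with at most $k$ atoms whose first $L$ moments equal $\tilde{\boldsymbol\mu}_L$ (e.g. obtained by Gauss quadrature). *)

theory Defs
  imports "HOL-Probability.Probability"
begin

text \<open>
  A vector in \<open>\<real>\<^sup>n\<close> is a function \<open>nat \<Rightarrow> real\<close> read on the indices \<open>{..<n}\<close>, and an
  \<open>n \<times> p\<close> matrix a function \<open>X i j\<close> read for \<open>i < n\<close>, \<open>j < p\<close>; the dimensions have to be
  variables because the constants of the theorem must not depend on them.
\<close>

definition mat_vec :: "nat \<Rightarrow> (nat \<Rightarrow> nat \<Rightarrow> real) \<Rightarrow> (nat \<Rightarrow> real) \<Rightarrow> nat \<Rightarrow> real" where
  "mat_vec p X v = (\<lambda>i. \<Sum>j<p. X i j * v j)"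

definition vec_norm :: "nat \<Rightarrow> (nat \<Rightarrow> real) \<Rightarrow> real" where
  "vec_norm n v = L2_set v {..<n}"

definition op_norm :: "nat \<Rightarrow> nat \<Rightarrow> (nat \<Rightarrow> nat \<Rightarrow> real) \<Rightarrow> real" where
  "op_norm n p X = (SUP v\<in>{v. vec_norm p v \<le> 1}. vec_norm n (mat_vec p X v))"

definition gram :: "nat \<Rightarrow> (nat \<Rightarrow> nat \<Rightarrow> real) \<Rightarrow> nat \<Rightarrow> nat \<Rightarrow> real" where
  "gram n X = (\<lambda>i j. \<Sum>r<n. X r i * X r j)"

definition gram_sum :: "nat \<Rightarrow> nat \<Rightarrow> (nat \<Rightarrow> nat \<Rightarrow> real) \<Rightarrow> nat \<Rightarrow> real" where
  "gram_sum n p X k = (\<Sum>i<p. \<Sum>j<p. gram n X i j ^ k)"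

definition mean :: "real measure \<Rightarrow> real" where
  "mean g = (\<integral>x. x \<partial>g)"

definition subgaussian :: "real \<Rightarrow> real measure \<Rightarrow> bool" where
  "subgaussian M g \<longleftrightarrow> integrable g (\<lambda>x. x) \<and>
     (\<forall>q::nat. q \<ge> 1 \<longrightarrow> integrable g (\<lambda>x. \<bar>x - mean g\<bar> ^ q) \<and>
        root q (\<integral>x. \<bar>x - mean g\<bar> ^ q \<partial>g) \<le> M * sqrt (real q))"

text \<open>The joint law of the coefficients and the noise.\<close>

definition model :: "nat \<Rightarrow> nat \<Rightarrow> real \<Rightarrow> real measure \<Rightarrow> ((nat \<Rightarrow> real) \<times> (nat \<Rightarrow> real)) measure" where
  "model n p \<sigma> g =
     (\<Pi>\<^sub>M j\<in>{..<p}. g) \<Otimes>\<^sub>M (\<Pi>\<^sub>M i\<in>{..<n}. density lborel (normal_density 0 \<sigma>))"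

definition response ::
    "nat \<Rightarrow> (nat \<Rightarrow> nat \<Rightarrow> real) \<Rightarrow> (nat \<Rightarrow> real) \<times> (nat \<Rightarrow> real) \<Rightarrow> nat \<Rightarrow> real" where
  "response p X = (\<lambda>(b, e) i. mat_vec p X b i + e i)"

definition Hermite :: "nat \<Rightarrow> real \<Rightarrow> real" where
  "Hermite k x = (-1) ^ k * exp (x\<^sup>2 / 2) * (deriv ^^ k) (\<lambda>u. exp (- u\<^sup>2 / 2)) x"

definition F_stat ::
    "nat \<Rightarrow> nat \<Rightarrow> real \<Rightarrow> (nat \<Rightarrow> nat \<Rightarrow> real) \<Rightarrow> nat \<Rightarrow> (nat \<Rightarrow> real) \<Rightarrow> real" where
  "F_stat n p \<sigma> X k z = (\<Sum>j<p.
     if \<forall>i<n. X i j = 0 then 0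
     else (\<sigma> * vec_norm n (\<lambda>i. X i j)) ^ k *
          Hermite k ((\<Sum>i<n. X i j * z i) / (\<sigma> * vec_norm n (\<lambda>i. X i j))))"

text \<open>A tuple \<open>s\<^sub>1 < \<dots> < s\<^sub>t\<close> or \<open>(d\<^sub>1, \<dots>, d\<^sub>t)\<close> is a list of length \<open>t\<close>.\<close>

definition increasing_tuples :: "nat \<Rightarrow> nat \<Rightarrow> nat list set" where
  "increasing_tuples p t = {s. length s = t \<and> sorted_wrt (<) s \<and> set s \<subseteq> {..<p}}"

definition compositions2 :: "nat \<Rightarrow> nat \<Rightarrow> nat list set" where
  "compositions2 l t = {ds. length ds = t \<and> sum_list ds = l \<and> (\<forall>d\<in>set ds. 2 \<le> d)}"

lemma finite_increasing_tuples: "finite (increasing_tuples p t)"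
  by (rule finite_subset[OF _ finite_lists_length_eq[of "{..<p}" t]])
    (auto simp: increasing_tuples_def)

lemma finite_compositions2: "finite (compositions2 l t)"
  by (rule finite_subset[OF _ finite_lists_length_eq[of "{..l}" t]])
    (auto simp: compositions2_def dest: member_le_sum_list)

lemma compositions2_less:
  assumes "ds \<in> compositions2 l t" "t \<ge> 2" "d \<in> set ds"
  shows "d < l"
proof -
  have len: "length (remove1 d ds) = t - 1" and sum: "sum_list ds = d + sum_list (remove1 d ds)"
    using assms by (auto simp: compositions2_def length_remove1 sum_list_map_remove1[of d ds "\<lambda>x. x", simplified])
  then obtain e where e: "e \<in> set (remove1 d ds)"
    using assms(2) by (cases "remove1 d ds") auto
  then have "2 \<le> e"
    using assms(1) set_remove1_subset[of d ds] by (auto simp: compositions2_def)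
  moreover have "e \<le> sum_list (remove1 d ds)"
    using e by (auto intro: member_le_sum_list)
  ultimately show ?thesis
    using sum assms(1) by (simp add: compositions2_def)
qed

definition gamma_coeff :: "nat \<Rightarrow> nat \<Rightarrow> (nat \<Rightarrow> nat \<Rightarrow> real) \<Rightarrow> nat list \<Rightarrow> real" where
  "gamma_coeff n p X ds =
     fact (sum_list ds) / (\<Prod>d\<leftarrow>ds. fact d) *
     (\<Sum>s\<in>increasing_tuples p (length ds). \<Sum>j<p.
        \<Prod>i<length ds. gram n X j (s ! i) ^ (ds ! i))"

definition m1_hat :: "nat \<Rightarrow> nat \<Rightarrow> (nat \<Rightarrow> nat \<Rightarrow> real) \<Rightarrow> (nat \<Rightarrow> real) \<Rightarrow> real" where
  "m1_hat n p X y =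
     (\<Sum>i<n. mat_vec p X (\<lambda>_. 1) i * y i) / (vec_norm n (mat_vec p X (\<lambda>_. 1)))\<^sup>2"

definition y_hat :: "nat \<Rightarrow> nat \<Rightarrow> (nat \<Rightarrow> nat \<Rightarrow> real) \<Rightarrow> (nat \<Rightarrow> real) \<Rightarrow> nat \<Rightarrow> real" where
  "y_hat n p X y = (\<lambda>i. y i - m1_hat n p X y * mat_vec p X (\<lambda>_. 1) i)"

text \<open>The value at index 1 is the leading entry \<open>0\<close> of the centered moment vector.\<close>

function mu_hat ::
    "nat \<Rightarrow> nat \<Rightarrow> real \<Rightarrow> (nat \<Rightarrow> nat \<Rightarrow> real) \<Rightarrow> (nat \<Rightarrow> real) \<Rightarrow> nat \<Rightarrow> real" where
  "mu_hat n p \<sigma> X y l =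
     (if l < 2 then 0
      else (F_stat n p \<sigma> X l (y_hat n p X y)
            - (\<Sum>t\<in>{2..l}. \<Sum>ds\<in>compositions2 l t.
                 (\<Prod>d\<leftarrow>ds. mu_hat n p \<sigma> X y d) * gamma_coeff n p X ds))
           / gram_sum n p X l)"
  by pat_completeness auto
termination
  by (relation "Wellfounded.measure (\<lambda>(n, p, \<sigma>, X, y, l). l)") (auto intro: compositions2_less)

declare mu_hat.simps [simp del]

definition moment :: "real measure \<Rightarrow> nat \<Rightarrow> real" where
  "moment \<pi> l = (\<integral>x. x ^ l \<partial>\<pi>)"

definition moment_space :: "nat \<Rightarrow> real \<Rightarrow> (nat \<Rightarrow> real) set" where
  "moment_space L A =
     {restrict (moment \<pi>) {1..L} | \<pi>. real_distribution \<pi> \<and> measure \<pi> {-A..A} = 1}"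

text \<open>
  \<open>is_dmm A k v \<pi>\<close>: \<open>\<pi>\<close> is the DMM estimator on \<open>[-A, A]\<close> for the moment vector
  \<open>(v 1, \<dots>, v (2k - 1))\<close>. For \<open>A \<ge> 0\<close> and \<open>k \<ge> 1\<close> there is exactly one such \<open>\<pi>\<close>: the moment
  space is nonempty, closed and convex, each of its points is attained with at most \<open>k\<close> atoms (Gauss
  quadrature), and a distribution with at most \<open>k\<close> atoms is determined by its first \<open>2k - 1\<close> moments.
\<close>

definition is_dmm :: "real \<Rightarrow> nat \<Rightarrow> (nat \<Rightarrow> real) \<Rightarrow> real measure \<Rightarrow> bool" where
  "is_dmm A k v \<pi> \<longleftrightarrow>
     real_distribution \<pi> \<and>
     (\<exists>S. finite S \<and> card S \<le> k \<and> S \<subseteq> {-A..A} \<and> measure \<pi> S = 1) \<and>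
     (\<exists>m. is_arg_min (\<lambda>m. L2_set (\<lambda>l. m l - v l) {1..2 * k - 1})
                     (\<lambda>m. m \<in> moment_space (2 * k - 1) A) m \<and>
          (\<forall>l\<in>{1..2 * k - 1}. moment \<pi> l = m l))"

definition couplings :: "real measure \<Rightarrow> real measure \<Rightarrow> (real \<times> real) measure set" where
  "couplings \<mu> \<nu> = {\<rho>. sets \<rho> = sets (borel \<Otimes>\<^sub>M borel) \<and>
                        distr \<rho> borel fst = \<mu> \<and> distr \<rho> borel snd = \<nu>}"

definition W1 :: "real measure \<Rightarrow> real measure \<Rightarrow> ennreal" where
  "W1 \<mu> \<nu> = (INF \<rho>\<in>couplings \<mu> \<nu>. \<integral>\<^sup>+ (x, y). ennreal \<bar>x - y\<bar> \<partial>\<rho>)"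

text \<open>
  \<open>D\<close> is a DMM map from moment vectors to distributions; the result is its output on the centered
  moment vector, translated by \<open>m1_hat\<close>.
\<close>

definition g_hat ::
    "((nat \<Rightarrow> real) \<Rightarrow> real measure) \<Rightarrow> nat \<Rightarrow> nat \<Rightarrow> real \<Rightarrow> (nat \<Rightarrow> nat \<Rightarrow> real) \<Rightarrow> (nat \<Rightarrow> real) \<Rightarrow> real measure" where
  "g_hat D n p \<sigma> X y = distr (D (mu_hat n p \<sigma> X y)) borel (\<lambda>x. x + m1_hat n p X y)"

end

theory Submission
  imports Defs "HOL-Computational_Algebra.Computational_Algebra" "HOL-Real_Asymp.Real_Asymp"
begin

text \<open>
  In the independent coordinates (centered coefficients, noise), \<open>F\<^sub>\<ell>\<close> evaluated with the true mean is a
  sum of Hermite polynomials in linear forms, and its generating function shows that its expectation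
  satisfies exactly the recursion defining the moment estimators. The Efron-Stein inequality bounds its variance
  by \<open>p\<^bsup>3/2\<^esup>\<close> times \<open>b\<^bsup>2\<ell>\<^esup>\<close> and a constant of order \<open>\<ell>\<^bsup>O(\<ell>)\<^esup>\<close>, where \<open>b\<close> is of the order of the squared
  operator norm; the lower bounds on the \<open>A\<^sub>\<ell>\<close> then make every relative error a negative power of \<open>N\<close>,
  up to factors \<open>(k p / N)\<^bsup>O(k)\<^esup>\<close>. Running the recursion costs a factor of the form \<open>(k p / N)\<^bsup>O(k\<^sup>2)\<^esup>\<close>, which is
  at most a small power of \<open>N\<close> because \<open>k\<^sup>2 \<le> c\<^sup>2/\<epsilon>\<close> and \<open>k\<^sup>2 log log N \<le> c\<^sup>2 log N\<close>. Hence outside an event of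
  probability at most \<open>1/k\<close> all moments are estimated up to an error that beats \<open>9\<^sup>k\<close>.

  By duality \<open>W\<^sub>1\<close> is the difference of the integrals of a Lipschitz function. Jackson approximation by a
  polynomial of degree below \<open>2k\<close> costs \<open>O(A/k) = O(sqrt (log k / k))\<close>, the coefficients of the
  polynomial are at most \<open>9\<^sup>k\<close> up to polynomial factors, and the mass of the prior outside \<open>[-A, A]\<close> is
  at most of order \<open>k\<^bsup>-t k\<^esup>\<close> with \<open>t\<close> proportional to \<open>C\<^sub>A\<close>.
\<close>

section \<open>The Wasserstein distance on the line\<close>

text \<open>The obstacle is the variance of F_l: deleting one coordinate changes it by powers of
  that coordinate times sums depending on the same coordinate. Bounded weights would give a variance
  of order p; the dependence raises this to p^(3/2). That is affordable: up to powers of p / N,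
  \<open>gram_sum n p X l\<close> is at least \<open>p * b ^ l\<close>, so a standard deviation
  p^(3/4) leaves a relative error p^(-1/4). The eighth root of N splits this gain between Markov's
  inequality and the estimate itself.

  The k^2 in the exponents has one source: a step of the recursion multiplies the error by at most
  Y^(10 k), where Y is a constant times k p / N, and there are fewer than 2 k steps.

  Expectations are computed with formal power series, since only finitely many coefficients matter.
  A Gaussian coordinate contributes exp(v t^2 / 2) and the Hermite polynomials contribute exp(- v
  t^2 / 2), so the noise cancels exactly. Centering removes the linear coefficients; this is why
  only parts d_j of size at least 2 occur in the recursion.\<close>

lemma sets_between_coordinates:
  fixes t :: real
  shows "{z. fst z \<le> t \<and> t < snd z} \<in> sets (borel \<Otimes>\<^sub>M borel)"
    and "{z. snd z \<le> t \<and> t < fst z} \<in> sets (borel \<Otimes>\<^sub>M borel)"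
    and "{z. fst z \<le> t} \<in> sets (borel \<Otimes>\<^sub>M (borel :: real measure))"
    and "{z. snd z \<le> t} \<in> sets ((borel :: real measure) \<Otimes>\<^sub>M borel)"
proof -
  let ?B = "borel \<Otimes>\<^sub>M borel :: (real \<times> real) measure"
  have "{z\<in>space ?B. fst z \<le> t \<and> t < snd z} \<in> sets ?B" "{z\<in>space ?B. snd z \<le> t \<and> t < fst z} \<in> sets ?B"
    "{z\<in>space ?B. fst z \<le> t} \<in> sets ?B" "{z\<in>space ?B. snd z \<le> t} \<in> sets ?B"
    by measurable
  then show "{z. fst z \<le> t \<and> t < snd z} \<in> sets ?B" "{z. snd z \<le> t \<and> t < fst z} \<in> sets ?B"
    "{z. fst z \<le> t} \<in> sets ?B" "{z. snd z \<le> t} \<in> sets ?B"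
    by (simp_all add: space_pair_measure)
qed

text \<open>The interval is half-open so that \<open>t\<close> lies in \<open>{x..<y}\<close>
  exactly when \<open>x \<le> t\<close> holds and \<open>y \<le> t\<close> fails, the two
  comparisons that enter cdfs at \<open>t\<close>.\<close>

lemma abs_diff_eq_nn_integral:
  fixes x y :: real
  shows "ennreal \<bar>x - y\<bar> = (\<integral>\<^sup>+t. indicator {x..<y} t + indicator {y..<x} t \<partial>lborel)"
  by (subst nn_integral_add) (auto simp: abs_if ennreal_neg)

text \<open>Tonelli: the cost of a coupling is the integral over all levels \<open>t\<close> of the
  probability that \<open>t\<close> separates the two coordinates. Both inequalities between
  \<open>W1\<close> and the cdfs are read off from this form.\<close>

lemma nn_integral_abs_diff_eq:
  fixes \<rho> :: "(real \<times> real) measure"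
  assumes "prob_space \<rho>" "sets \<rho> = sets (borel \<Otimes>\<^sub>M borel)"
  shows "(\<integral>\<^sup>+(x, y). ennreal \<bar>x - y\<bar> \<partial>\<rho>) =
    (\<integral>\<^sup>+t. emeasure \<rho> {z. fst z \<le> t \<and> t < snd z} + emeasure \<rho> {z. snd z \<le> t \<and> t < fst z} \<partial>lborel)"
proof -
  interpret prob_space \<rho> by fact
  interpret pair_sigma_finite \<rho> "lborel :: real measure" ..
  have [measurable_cong, simp]: "sets \<rho> = sets (borel \<Otimes>\<^sub>M borel)" by fact
  have [simp]: "space \<rho> = UNIV"
    using sets_eq_imp_space_eq[OF assms(2)] by (simp add: space_pair_measure)
  have "(\<integral>\<^sup>+(x, y). ennreal \<bar>x - y\<bar> \<partial>\<rho>) =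
      (\<integral>\<^sup>+z. (\<integral>\<^sup>+t. indicator {fst z..<snd z} t + indicator {snd z..<fst z} t \<partial>lborel) \<partial>\<rho>)"
    by (intro nn_integral_cong) (auto simp: abs_diff_eq_nn_integral)
  also have "\<dots> = (\<integral>\<^sup>+z. (\<integral>\<^sup>+t. indicator {z. fst z \<le> t \<and> t < snd z} z
      + indicator {z. snd z \<le> t \<and> t < fst z} z \<partial>lborel) \<partial>\<rho>)"
    by (intro nn_integral_cong) (auto simp: indicator_def)
  also have "\<dots> = (\<integral>\<^sup>+t. (\<integral>\<^sup>+z. indicator {z. fst z \<le> t \<and> t < snd z} z
      + indicator {z. snd z \<le> t \<and> t < fst z} z \<partial>\<rho>) \<partial>lborel)"
    by (rule Fubini'[symmetric]) (simp add: indicator_def)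
  also have "\<dots> = (\<integral>\<^sup>+t. emeasure \<rho> {z. fst z \<le> t \<and> t < snd z} + emeasure \<rho> {z. snd z \<le> t \<and> t < fst z} \<partial>lborel)"
  proof (rule nn_integral_cong)
    fix t :: real
    have m: "{z. fst z \<le> t \<and> t < snd z} \<in> sets \<rho>" "{z. snd z \<le> t \<and> t < fst z} \<in> sets \<rho>"
      by (simp_all add: sets_between_coordinates)
    show "(\<integral>\<^sup>+z. indicator {z. fst z \<le> t \<and> t < snd z} z + indicator {z. snd z \<le> t \<and> t < fst z} z \<partial>\<rho>) =
      emeasure \<rho> {z. fst z \<le> t \<and> t < snd z} + emeasure \<rho> {z. snd z \<le> t \<and> t < fst z}"
      using m by (subst nn_integral_add) auto
  qed
  finally show ?thesis .
qed

text \<open>Under any coupling the cdfs at \<open>t\<close> differ by the difference of the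
  probabilities of the two ways in which \<open>t\<close> can separate the coordinates, hence by at
  most their sum.\<close>

lemma W1_ge_cdf:
  assumes "real_distribution \<mu>" "real_distribution \<nu>"
  shows "(\<integral>\<^sup>+t. ennreal \<bar>cdf \<mu> t - cdf \<nu> t\<bar> \<partial>lborel) \<le> W1 \<mu> \<nu>"
  unfolding W1_def
proof (rule INF_greatest)
  fix \<rho> assume \<rho>: "\<rho> \<in> couplings \<mu> \<nu>"
  then have s[measurable_cong, simp]: "sets \<rho> = sets (borel \<Otimes>\<^sub>M borel)"
    and f: "distr \<rho> borel fst = \<mu>" and g: "distr \<rho> borel snd = \<nu>"
    by (auto simp: couplings_def)
  have [simp]: "space \<rho> = UNIV"
    using sets_eq_imp_space_eq[OF s] by (simp add: space_pair_measure)
  interpret \<mu>: real_distribution \<mu> by fact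
  \<comment> \<open>\<open>couplings\<close> does not mention total mass; that it is 1 is inherited
    from the first marginal.\<close>
  have "emeasure \<rho> (space \<rho>) = emeasure (distr \<rho> borel fst) UNIV"
    by (subst emeasure_distr) auto
  then interpret prob_space \<rho>
    using \<mu>.emeasure_space_1 by (intro prob_spaceI) (simp add: f)
  have *: "\<bar>cdf \<mu> t - cdf \<nu> t\<bar> \<le> measure \<rho> {z. fst z \<le> t \<and> t < snd z} + measure \<rho> {z. snd z \<le> t \<and> t < fst z}" for t
  proof -
    have m: "{z. fst z \<le> t \<and> t < snd z} \<in> sets \<rho>" "{z. snd z \<le> t \<and> t < fst z} \<in> sets \<rho>"
      "{z. fst z \<le> t} \<in> sets \<rho>" "{z. snd z \<le> t} \<in> sets \<rho>"
      by (simp_all add: sets_between_coordinates)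
    have 1: "cdf \<mu> t = measure \<rho> {z. fst z \<le> t}"
      by (simp add: f[symmetric] cdf_def measure_distr vimage_def)
    have 2: "cdf \<nu> t = measure \<rho> {z. snd z \<le> t}"
      by (simp add: g[symmetric] cdf_def measure_distr vimage_def)
    have "measure \<rho> {z. fst z \<le> t} \<le> measure \<rho> ({z. snd z \<le> t} \<union> {z. fst z \<le> t \<and> t < snd z})"
      using m by (intro finite_measure_mono) auto
    also have "\<dots> \<le> measure \<rho> {z. snd z \<le> t} + measure \<rho> {z. fst z \<le> t \<and> t < snd z}"
      using m by (intro measure_Un_le) auto
    finally have a: "measure \<rho> {z. fst z \<le> t} \<le> measure \<rho> {z. snd z \<le> t} + measure \<rho> {z. fst z \<le> t \<and> t < snd z}" .
    have "measure \<rho> {z. snd z \<le> t} \<le> measure \<rho> ({z. fst z \<le> t} \<union> {z. snd z \<le> t \<and> t < fst z})"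
      using m by (intro finite_measure_mono) auto
    also have "\<dots> \<le> measure \<rho> {z. fst z \<le> t} + measure \<rho> {z. snd z \<le> t \<and> t < fst z}"
      using m by (intro measure_Un_le) auto
    finally show ?thesis using a measure_nonneg[of \<rho> "{z. fst z \<le> t \<and> t < snd z}"]
       measure_nonneg[of \<rho> "{z. snd z \<le> t \<and> t < fst z}"] unfolding 1 2 by linarith
  qed
  have "(\<integral>\<^sup>+t. ennreal \<bar>cdf \<mu> t - cdf \<nu> t\<bar> \<partial>lborel) \<le>
    (\<integral>\<^sup>+t. emeasure \<rho> {z. fst z \<le> t \<and> t < snd z} + emeasure \<rho> {z. snd z \<le> t \<and> t < fst z} \<partial>lborel)"
    by (intro nn_integral_mono)
      (simp add: emeasure_eq_measure ennreal_plus[symmetric] * del: ennreal_plus)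
  also have "\<dots> = (\<integral>\<^sup>+(x, y). ennreal \<bar>x - y\<bar> \<partial>\<rho>)"
    by (rule nn_integral_abs_diff_eq[symmetric]) (rule prob_space_axioms s)+
  finally show "(\<integral>\<^sup>+t. ennreal \<bar>cdf \<mu> t - cdf \<nu> t\<bar> \<partial>lborel) \<le> (\<integral>\<^sup>+(x, y). ennreal \<bar>x - y\<bar> \<partial>\<rho>)" .
qed

text \<open>The quantile coupling is optimal: both variables are the pseudo-inverses
  \<open>I\<close> of the cdfs at the same uniform variable. Then \<open>t\<close> separates them
  only when the uniform variable falls between the two cdf values at \<open>t\<close>.\<close>

lemma W1_le_cdf:
  assumes "real_distribution \<mu>" "real_distribution \<nu>"
  shows "W1 \<mu> \<nu> \<le> (\<integral>\<^sup>+t. ennreal \<bar>cdf \<mu> t - cdf \<nu> t\<bar> \<partial>lborel)"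
proof -
  interpret \<mu>: cdf_distribution \<mu> unfolding cdf_distribution_def by fact
  interpret \<nu>: cdf_distribution \<nu> unfolding cdf_distribution_def by fact
  let ?\<Omega> = "restrict_space lborel {0<..<1} :: real measure"
  interpret \<Omega>: prob_space ?\<Omega>
    by (auto simp add: emeasure_restrict_space space_restrict_space intro!: prob_spaceI)
  have [measurable]: "\<mu>.I \<in> borel_measurable ?\<Omega>" "\<nu>.I \<in> borel_measurable ?\<Omega>"
    using \<mu>.measurable_CI \<nu>.measurable_CI
    by (simp_all add: measurable_def space_restrict_space sets_restrict_space)
  define T where "T = (\<lambda>\<omega>. (\<mu>.I \<omega>, \<nu>.I \<omega>))"
  have T[measurable]: "T \<in> ?\<Omega> \<rightarrow>\<^sub>M borel \<Otimes>\<^sub>M borel" unfolding T_def by measurable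
  define \<rho> where "\<rho> = distr ?\<Omega> (borel \<Otimes>\<^sub>M borel) T"
  have s: "sets \<rho> = sets (borel \<Otimes>\<^sub>M borel)" by (simp add: \<rho>_def)
  have p: "prob_space \<rho>" unfolding \<rho>_def by (rule \<Omega>.prob_space_distr) fact
  have c: "\<rho> \<in> couplings \<mu> \<nu>"
    unfolding couplings_def \<rho>_def
    using \<mu>.distr_I_eq_M \<nu>.distr_I_eq_M by (simp add: distr_distr comp_def T_def)
  \<comment> \<open>\<open>ennreal\<close> sends negative numbers to 0, so the bound also covers the
    empty case \<open>F < G\<close>.\<close>
  have one: "emeasure ?\<Omega> {\<omega>\<in>space ?\<Omega>. G < \<omega> \<and> \<omega> \<le> F} \<le> ennreal (F - G)" for F G :: real
  proof -
    have "emeasure ?\<Omega> {\<omega>\<in>space ?\<Omega>. G < \<omega> \<and> \<omega> \<le> F} = emeasure lborel {\<omega>\<in>space ?\<Omega>. G < \<omega> \<and> \<omega> \<le> F}"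
      by (subst emeasure_restrict_space) (auto simp: space_restrict_space)
    also have "\<dots> \<le> emeasure lborel {G<..F}"
      by (intro emeasure_mono) auto
    also have "\<dots> \<le> ennreal (F - G)"
      by (cases "G \<le> F") (auto simp: ennreal_neg)
    finally show ?thesis .
  qed
  have 1: "emeasure \<rho> {z. fst z \<le> t \<and> t < snd z} \<le> ennreal (cdf \<mu> t - cdf \<nu> t)" for t
  proof -
    have m: "{z. fst z \<le> t \<and> t < snd z} \<in> sets (borel \<Otimes>\<^sub>M (borel :: real measure) :: (real \<times> real) measure)"
      by (rule sets_between_coordinates)
    have "emeasure \<rho> {z. fst z \<le> t \<and> t < snd z} = emeasure ?\<Omega> {\<omega>\<in>space ?\<Omega>. cdf \<nu> t < \<omega> \<and> \<omega> \<le> cdf \<mu> t}"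
      unfolding \<rho>_def using m
    proof (subst emeasure_distr)
      show "emeasure ?\<Omega> (T -` {z. fst z \<le> t \<and> t < snd z} \<inter> space ?\<Omega>) = emeasure ?\<Omega> {\<omega>\<in>space ?\<Omega>. cdf \<nu> t < \<omega> \<and> \<omega> \<le> cdf \<mu> t}"
        using \<mu>.pseudoinverse[of _ t] \<nu>.pseudoinverse[of _ t]
        by (intro arg_cong2[where f=emeasure] refl)
          (force simp: T_def space_restrict_space not_le intro: leI)
    qed (use T in auto)
    then show ?thesis using one by simp
  qed
  have 2: "emeasure \<rho> {z. snd z \<le> t \<and> t < fst z} \<le> ennreal (cdf \<nu> t - cdf \<mu> t)" for t
  proof -
    have m: "{z. snd z \<le> t \<and> t < fst z} \<in> sets (borel \<Otimes>\<^sub>M (borel :: real measure) :: (real \<times> real) measure)"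
      by (rule sets_between_coordinates)
    have "emeasure \<rho> {z. snd z \<le> t \<and> t < fst z} = emeasure ?\<Omega> {\<omega>\<in>space ?\<Omega>. cdf \<mu> t < \<omega> \<and> \<omega> \<le> cdf \<nu> t}"
      unfolding \<rho>_def using m
    proof (subst emeasure_distr)
      show "emeasure ?\<Omega> (T -` {z. snd z \<le> t \<and> t < fst z} \<inter> space ?\<Omega>) = emeasure ?\<Omega> {\<omega>\<in>space ?\<Omega>. cdf \<mu> t < \<omega> \<and> \<omega> \<le> cdf \<nu> t}"
        using \<mu>.pseudoinverse[of _ t] \<nu>.pseudoinverse[of _ t]
        by (intro arg_cong2[where f=emeasure] refl)
          (force simp: T_def space_restrict_space not_le intro: leI)
    qed (use T in auto)
    then show ?thesis using one by simp
  qed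
  have "W1 \<mu> \<nu> \<le> (\<integral>\<^sup>+(x, y). ennreal \<bar>x - y\<bar> \<partial>\<rho>)"
    unfolding W1_def using c by (rule INF_lower)
  also have "\<dots> = (\<integral>\<^sup>+t. emeasure \<rho> {z. fst z \<le> t \<and> t < snd z} + emeasure \<rho> {z. snd z \<le> t \<and> t < fst z} \<partial>lborel)"
    by (rule nn_integral_abs_diff_eq[OF p s])
  also have "\<dots> \<le> (\<integral>\<^sup>+t. ennreal \<bar>cdf \<mu> t - cdf \<nu> t\<bar> \<partial>lborel)"
  proof (rule nn_integral_mono)
    fix t
    have "emeasure \<rho> {z. fst z \<le> t \<and> t < snd z} + emeasure \<rho> {z. snd z \<le> t \<and> t < fst z}
      \<le> ennreal (cdf \<mu> t - cdf \<nu> t) + ennreal (cdf \<nu> t - cdf \<mu> t)"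
      by (intro add_mono 1 2)
    also have "\<dots> = ennreal \<bar>cdf \<mu> t - cdf \<nu> t\<bar>"
      by (auto simp: abs_if ennreal_neg)
    finally show "emeasure \<rho> {z. fst z \<le> t \<and> t < snd z} + emeasure \<rho> {z. snd z \<le> t \<and> t < fst z}
      \<le> ennreal \<bar>cdf \<mu> t - cdf \<nu> t\<bar>" .
  qed
  finally show ?thesis .
qed

lemma W1_eq_cdf:
  assumes "real_distribution \<mu>" "real_distribution \<nu>"
  shows "W1 \<mu> \<nu> = (\<integral>\<^sup>+t. ennreal \<bar>cdf \<mu> t - cdf \<nu> t\<bar> \<partial>lborel)"
  by (intro antisym W1_le_cdf W1_ge_cdf assms)

text \<open>The coupling through the common source point. It is used for clamping the prior and for
  the error in the location shift.\<close>

lemma W1_distr_le: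
  assumes "real_distribution \<mu>" and [measurable]: "f \<in> borel_measurable borel" "h \<in> borel_measurable borel"
  shows "W1 (distr \<mu> borel f) (distr \<mu> borel h) \<le> (\<integral>\<^sup>+x. ennreal \<bar>f x - h x\<bar> \<partial>\<mu>)"
proof -
  interpret \<mu>: real_distribution \<mu> by fact
  let ?\<rho> = "distr \<mu> (borel \<Otimes>\<^sub>M borel) (\<lambda>x. (f x, h x))"
  have "?\<rho> \<in> couplings (distr \<mu> borel f) (distr \<mu> borel h)"
    unfolding couplings_def by (simp add: distr_distr comp_def)
  then have "W1 (distr \<mu> borel f) (distr \<mu> borel h) \<le> (\<integral>\<^sup>+(x, y). ennreal \<bar>x - y\<bar> \<partial>?\<rho>)"
    unfolding W1_def by (rule INF_lower)
  also have "\<dots> = (\<integral>\<^sup>+x. ennreal \<bar>f x - h x\<bar> \<partial>\<mu>)"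
    by (subst nn_integral_distr) auto
  finally show ?thesis .
qed

text \<open>The cdf formula turns this into the triangle inequality of L1, in place of gluing two
  couplings.\<close>

lemma W1_triangle:
  assumes "real_distribution \<mu>" "real_distribution \<nu>" "real_distribution \<pi>"
  shows "W1 \<mu> \<pi> \<le> W1 \<mu> \<nu> + W1 \<nu> \<pi>"
proof -
  interpret \<mu>: cdf_distribution \<mu> unfolding cdf_distribution_def by fact
  interpret \<nu>: cdf_distribution \<nu> unfolding cdf_distribution_def by fact
  interpret \<pi>: cdf_distribution \<pi> unfolding cdf_distribution_def by fact
  show ?thesis
    unfolding W1_eq_cdf[OF assms(1,2)] W1_eq_cdf[OF assms(1,3)] W1_eq_cdf[OF assms(2,3)]
    by (subst nn_integral_add[symmetric])
      (auto intro!: nn_integral_mono simp: ennreal_plus[symmetric] simp del: ennreal_plus)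
qed

lemma cdf_distr_translate:
  assumes "real_distribution \<mu>"
  shows "cdf (distr \<mu> borel (\<lambda>x. x + a)) t = cdf \<mu> (t - a)"
proof -
  interpret \<mu>: real_distribution \<mu> by fact
  have "(\<lambda>x. x + a) -` {..t} = {..t - a}" by auto
  then show ?thesis
    by (simp add: cdf_def measure_distr)
qed

lemma real_distribution_distr_real:
  "real_distribution \<mu> \<Longrightarrow> f \<in> borel_measurable borel \<Longrightarrow> real_distribution (distr \<mu> borel f)"
  using prob_space.prob_space_distr[of \<mu> f borel]
  by (auto simp: real_distribution_def real_distribution_axioms_def measurable_def)

lemma W1_translate:
  assumes "real_distribution \<mu>" "real_distribution \<nu>"
  shows "W1 (distr \<mu> borel (\<lambda>x. x + a)) (distr \<nu> borel (\<lambda>x. x + a)) = W1 \<mu> \<nu>"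
proof -
  interpret \<mu>: cdf_distribution \<mu> unfolding cdf_distribution_def by fact
  interpret \<nu>: cdf_distribution \<nu> unfolding cdf_distribution_def by fact
  show ?thesis
    using nn_integral_real_affine[of "\<lambda>t. ennreal \<bar>cdf \<mu> t - cdf \<nu> t\<bar>" 1 "-a"]
    by (simp add: W1_eq_cdf assms real_distribution_distr_real cdf_distr_translate)
qed

section \<open>Hermite polynomials\<close>

text \<open>The formal series of exp(- v t^2 / 2). For negative \<open>v\<close> it is the moment
  generating function of a centered Gaussian of variance \<open>- v\<close>, so that noise and
  Hermite correction are inverse to each other under \<open>gauss_fps_mult\<close>.\<close>

definition gauss_fps :: "real \<Rightarrow> real fps" where
  "gauss_fps v = fps_exp (- v / 2) oo fps_X ^ 2"

lemma gauss_fps_nth: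
  "gauss_fps v $ n = (if even n then (- v / 2) ^ (n div 2) / fact (n div 2) else 0)"
  by (simp add: gauss_fps_def fps_nth_compose_X_power)

lemma gauss_fps_mult: "gauss_fps v * gauss_fps w = gauss_fps (v + w)"
proof -
  have "fps_exp (- v / 2) * fps_exp (- w / 2) = fps_exp (- (v + w) / 2)"
    by (subst fps_exp_add_mult[symmetric]) (simp add: field_simps)
  then show ?thesis
    unfolding gauss_fps_def by (subst fps_compose_mult_distrib[symmetric]) simp_all
qed

lemma gauss_fps_0: "gauss_fps 0 = 1"
  by (simp add: gauss_fps_def)

lemma gauss_fps_prod: "finite I \<Longrightarrow> (\<Prod>i\<in>I. gauss_fps (v i)) = gauss_fps (\<Sum>i\<in>I. v i)"
  by (induction I rule: finite_induct) (auto simp: gauss_fps_0 gauss_fps_mult)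

lemma fps_deriv_gauss_fps: "fps_deriv (gauss_fps v) = fps_const (- v) * fps_X * gauss_fps v"
proof -
  have "fps_deriv (gauss_fps v) = (fps_const (- v / 2) * fps_exp (- v / 2) oo fps_X ^ 2) * (2 * fps_X)"
    unfolding gauss_fps_def by (subst fps_compose_deriv) (simp_all add: fps_deriv_power power2_eq_square numeral_fps_const)
  also have "fps_const (- v / 2) * fps_exp (- v / 2) oo fps_X ^ 2 = fps_const (- v / 2) * gauss_fps v"
    unfolding gauss_fps_def by (subst fps_compose_mult_distrib) simp_all
  also have "fps_const (- v / 2) * gauss_fps v * (2 * fps_X) = (fps_const (- v / 2) * 2) * fps_X * gauss_fps v"
    by (simp add: mult_ac)
  also have "fps_const (- v / 2) * 2 = fps_const (- v)"
    by (simp add: numeral_fps_const fps_const_mult[symmetric] del: fps_const_mult)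
  finally show ?thesis .
qed

text \<open>\<open>hermite_hom l v x = \<tau>\<^sup>l He\<^sub>l (x / \<tau>)\<close> for \<open>v = \<tau>\<^sup>2\<close>, read off the generating function
  \<open>exp (x t - v t\<^sup>2 / 2)\<close>.\<close>

definition hermite_hom :: "nat \<Rightarrow> real \<Rightarrow> real \<Rightarrow> real" where
  "hermite_hom l v x = fact l * (fps_exp x * gauss_fps v) $ l"

lemma hermite_hom_sum:
  "hermite_hom l v x = (\<Sum>i\<le>l. fact l / fact i * gauss_fps v $ (l - i) * x ^ i)"
  by (simp add: hermite_hom_def fps_mult_nth sum_distrib_left atLeast0AtMost mult_ac)

lemma hermite_hom_0 [simp]: "hermite_hom 0 v x = 1"
  by (simp add: hermite_hom_def gauss_fps_nth)

lemma hermite_hom_Suc: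
  "hermite_hom (Suc l) v x = x * hermite_hom l v x - real l * v * hermite_hom (l - 1) v x"
proof -
  define E where "E = fps_exp x * gauss_fps v"
  have d: "fps_deriv E = fps_const x * E + fps_const (- v) * (fps_X * E)"
    by (simp add: E_def fps_deriv_gauss_fps algebra_simps)
  have "real (Suc l) * E $ Suc l = fps_deriv E $ l" by simp
  also have "\<dots> = x * E $ l - v * (if l = 0 then 0 else E $ (l - 1))"
    unfolding d by simp
  finally have "fact l * (real (Suc l) * E $ Suc l) = fact l * (x * E $ l - v * (if l = 0 then 0 else E $ (l - 1)))"
    by simp
  then show ?thesis
    unfolding hermite_hom_def E_def[symmetric]
    by (cases l) (simp_all add: algebra_simps)
qed

text \<open>For a zero column both the variance and the linear form are 0, so for
  \<open>l \<ge> 1\<close> the value is 0: the convention built into \<open>F_stat\<close>.\<close>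

lemma hermite_hom_zero_var: "hermite_hom l 0 x = x ^ l"
  by (simp add: hermite_hom_def gauss_fps_0)

text \<open>The Appell property: a shift by \<open>y\<close> multiplies the generating function by
  exp(y t). It expands both the deletion of a coordinate and the replacement of the true mean by its
  estimate.\<close>

lemma hermite_hom_add:
  "hermite_hom l v (x + y) = (\<Sum>i\<le>l. real (l choose i) * y ^ i * hermite_hom (l - i) v x)"
proof -
  have "hermite_hom l v (x + y) = fact l * (fps_exp y * (fps_exp x * gauss_fps v)) $ l"
    by (simp add: hermite_hom_def fps_exp_add_mult mult_ac)
  also have "\<dots> = (\<Sum>i\<le>l. fact l * (y ^ i / fact i * (fps_exp x * gauss_fps v) $ (l - i)))"
    by (subst fps_mult_nth) (simp add: sum_distrib_left atLeast0AtMost)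
  also have "\<dots> = (\<Sum>i\<le>l. real (l choose i) * y ^ i * hermite_hom (l - i) v x)"
    by (intro sum.cong refl) (simp add: hermite_hom_def binomial_fact)
  finally show ?thesis .
qed

text \<open>Connects the generating function with \<open>Hermite\<close>, which is defined by
  iterated derivatives. The induction differentiates the three-term recurrence.\<close>

lemma has_real_derivative_hermite_hom:
  "(hermite_hom l v has_real_derivative real l * hermite_hom (l - 1) v x) (at x)"
proof (induction l rule: less_induct)
  case (less l)
  show ?case
  proof (cases l)
    case 0
    have "hermite_hom 0 v = (\<lambda>x. 1)" by auto
    then show ?thesis using 0 by simp
  next
    case (Suc m)
    have e: "hermite_hom l v = (\<lambda>x. x * hermite_hom m v x - real m * v * hermite_hom (m - 1) v x)"
      unfolding Suc by (rule ext) (rule hermite_hom_Suc)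
    show ?thesis
    proof (cases m)
      case 0
      have "hermite_hom l v = (\<lambda>x. x)" using e by (simp add: 0)
      then show ?thesis using Suc 0 by simp
    next
      case (Suc q)
      have d: "(hermite_hom m v has_real_derivative real m * hermite_hom (m - 1) v x) (at x)"
        "(hermite_hom (m - 1) v has_real_derivative real (m - 1) * hermite_hom (m - 1 - 1) v x) (at x)"
        using less[of m] less[of "m - 1"] \<open>l = Suc m\<close> by auto
      have r: "hermite_hom m v x = x * hermite_hom q v x - real q * v * hermite_hom (q - 1) v x"
        unfolding Suc by (rule hermite_hom_Suc)
      show ?thesis unfolding e
        by (rule derivative_eq_intros d refl)+
          (use arg_cong[OF r, of "(*) (1 + real q)"] in \<open>simp add: \<open>l = Suc m\<close> Suc algebra_simps\<close>)
    qed
  qed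
qed

lemma deriv_exp_neg_half_square:
  "(deriv ^^ k) (\<lambda>u. exp (- u\<^sup>2 / 2)) = (\<lambda>x. (-1) ^ k * hermite_hom k 1 x * exp (- x\<^sup>2 / 2))"
proof (induction k)
  case (Suc k)
  have "(deriv ^^ Suc k) (\<lambda>u. exp (- u\<^sup>2 / 2)) = deriv (\<lambda>x. (-1) ^ k * hermite_hom k 1 x * exp (- x\<^sup>2 / 2))"
    using Suc.IH by simp
  also have "\<dots> = (\<lambda>x. (-1) ^ Suc k * hermite_hom (Suc k) 1 x * exp (- x\<^sup>2 / 2))"
  proof
    fix x :: real
    show "deriv (\<lambda>x. (-1) ^ k * hermite_hom k 1 x * exp (- x\<^sup>2 / 2)) x
       = (-1) ^ Suc k * hermite_hom (Suc k) 1 x * exp (- x\<^sup>2 / 2)"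
      by (rule DERIV_imp_deriv)
        (rule derivative_eq_intros has_real_derivative_hermite_hom refl | simp add: hermite_hom_Suc algebra_simps)+
  qed
  finally show ?case .
qed auto

lemma Hermite_eq: "Hermite k x = hermite_hom k 1 x"
proof -
  have "(-1) ^ k * (-1) ^ k = (1::real)" by (simp add: power_mult_distrib[symmetric])
  moreover have "exp (x\<^sup>2 / 2) * exp (- x\<^sup>2 / 2) = 1" by (simp add: exp_add[symmetric])
  moreover have "Hermite k x = ((-1) ^ k * (-1) ^ k) * (exp (x\<^sup>2 / 2) * exp (- x\<^sup>2 / 2)) * hermite_hom k 1 x"
    by (simp only: Hermite_def deriv_exp_neg_half_square mult_ac)
  ultimately show ?thesis by simp
qed

lemma hermite_hom_scale:
  assumes "\<tau> \<noteq> 0"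
  shows "\<tau> ^ l * hermite_hom l 1 (x / \<tau>) = hermite_hom l (\<tau>\<^sup>2) x"
proof (induction l rule: less_induct)
  case (less l)
  show ?case
  proof (cases l)
    case (Suc m)
    have "\<tau> ^ l * hermite_hom l 1 (x / \<tau>)
        = x * (\<tau> ^ m * hermite_hom m 1 (x / \<tau>)) - real m * (\<tau> * \<tau> ^ m * hermite_hom (m - 1) 1 (x / \<tau>))"
      using assms unfolding Suc by (simp add: hermite_hom_Suc algebra_simps)
    also have "real m * (\<tau> * \<tau> ^ m * hermite_hom (m - 1) 1 (x / \<tau>))
        = real m * \<tau>\<^sup>2 * (\<tau> ^ (m - 1) * hermite_hom (m - 1) 1 (x / \<tau>))"
      by (cases m) (simp_all add: power2_eq_square)
    also have "\<tau> ^ m * hermite_hom m 1 (x / \<tau>) = hermite_hom m (\<tau>\<^sup>2) x"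
      using less Suc by simp
    also have "\<tau> ^ (m - 1) * hermite_hom (m - 1) 1 (x / \<tau>) = hermite_hom (m - 1) (\<tau>\<^sup>2) x"
      using less[of "m - 1"] Suc by simp
    finally show ?thesis unfolding Suc by (simp add: hermite_hom_Suc)
  qed simp
qed

text \<open>Each step of the recurrence costs at most one factor
  \<open>\<bar>x\<bar> + real l * \<tau>\<close>. Crudeness in \<open>l\<close> costs only factors
  l^O(l), which the final bounds absorb.\<close>

lemma abs_hermite_hom_le:
  assumes "\<tau> \<ge> 0"
  shows "\<bar>hermite_hom l (\<tau>\<^sup>2) x\<bar> \<le> (\<bar>x\<bar> + real l * \<tau>) ^ l"
proof (induction l rule: less_induct)
  case (less l)
  show ?case
  proof (cases l)
    case (Suc m)
    note S = Suc
    define y where "y = \<bar>x\<bar> + real l * \<tau>"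
    have "1 * \<tau> \<le> real l * \<tau>" "real m * \<tau> \<le> real l * \<tau>" "real (m - 1) * \<tau> \<le> real l * \<tau>"
      using assms Suc by (intro mult_right_mono; simp)+
    then have y: "y \<ge> 0" "\<bar>x\<bar> + real m * \<tau> \<le> y" "\<bar>x\<bar> + real (m - 1) * \<tau> \<le> y" "\<tau> \<le> y"
      using assms by (auto simp: y_def)
    have a: "\<bar>hermite_hom m (\<tau>\<^sup>2) x\<bar> \<le> y ^ m"
      using less[of m] Suc y assms by (intro order_trans[OF less[of m]] power_mono) auto
    have b: "real m * \<tau>\<^sup>2 * \<bar>hermite_hom (m - 1) (\<tau>\<^sup>2) x\<bar> \<le> real m * \<tau> * y ^ m"
    proof (cases m)
      case (Suc q)
      have "\<bar>hermite_hom (m - 1) (\<tau>\<^sup>2) x\<bar> \<le> y ^ (m - 1)"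
        using S y assms by (intro order_trans[OF less[of "m - 1"]] power_mono) auto
      then have "\<tau> * \<bar>hermite_hom (m - 1) (\<tau>\<^sup>2) x\<bar> \<le> y * y ^ (m - 1)"
        using y assms by (intro mult_mono) auto
      then have "real m * \<tau> * (\<tau> * \<bar>hermite_hom (m - 1) (\<tau>\<^sup>2) x\<bar>) \<le> real m * \<tau> * (y * y ^ (m - 1))"
        using assms by (intro mult_left_mono) auto
      then show ?thesis using Suc by (simp add: power2_eq_square mult_ac)
    qed simp
    have "\<bar>hermite_hom l (\<tau>\<^sup>2) x\<bar> \<le> \<bar>x\<bar> * \<bar>hermite_hom m (\<tau>\<^sup>2) x\<bar> + real m * \<tau>\<^sup>2 * \<bar>hermite_hom (m - 1) (\<tau>\<^sup>2) x\<bar>"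
      unfolding Suc hermite_hom_Suc by (rule order_trans[OF abs_triangle_ineq4]) (simp add: abs_mult)
    also have "\<dots> \<le> \<bar>x\<bar> * y ^ m + real m * \<tau> * y ^ m"
      using a b by (intro add_mono mult_left_mono) auto
    also have "\<dots> = (\<bar>x\<bar> + real m * \<tau>) * y ^ m" by (simp add: algebra_simps)
    also have "\<dots> \<le> y * y ^ m" using y by (intro mult_right_mono) auto
    finally show ?thesis by (simp add: Suc y_def)
  qed simp
qed

lemma hermite_hom_measurable [measurable]:
  "f \<in> borel_measurable M \<Longrightarrow> (\<lambda>x. hermite_hom l v (f x)) \<in> borel_measurable M"
  unfolding hermite_hom_sum by measurable

section \<open>Coefficients of products of power series without linear term\<close>

lemma sum_geometric_from_2_le:
  fixes \<rho> :: real
  assumes "0 \<le> \<rho>" "\<rho> \<le> 1 / 2"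
  shows "(\<Sum>i\<le>m. if i = 0 then 1 else if i = 1 then 0 else \<rho> ^ i) \<le> 1 + 2 * \<rho>\<^sup>2"
proof (cases m)
  case (Suc n)
  \<comment> \<open>The subtracted \<open>2 * \<rho> ^ (n + 2)\<close> is what makes the induction
    close: since \<open>\<rho> \<le> 1 / 2\<close> it pays for the next summand and leaves twice the
    one after.\<close>
  have "(\<Sum>i\<le>Suc n. if i = 0 then 1 else if i = 1 then 0 else \<rho> ^ i) \<le> 1 + 2 * \<rho>\<^sup>2 - 2 * \<rho> ^ (n + 2)" for n
  proof (induction n)
    case (Suc n)
    have "\<rho> * \<rho> ^ (n + 2) \<le> 1 / 2 * \<rho> ^ (n + 2)" using assms by (intro mult_right_mono) auto
    with Suc show ?case by simp
  qed (simp add: power2_eq_square)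
  from this[of n] have "(\<Sum>i\<le>m. if i = 0 then 1 else if i = 1 then 0 else \<rho> ^ i) \<le> 1 + 2 * \<rho>\<^sup>2 - 2 * \<rho> ^ (n + 2)"
    by (simp only: Suc)
  moreover have "0 \<le> \<rho> ^ (n + 2)" using assms by (intro zero_le_power)
  ultimately show ?thesis by linarith
qed simp

text \<open>Convolution with one factor at a time. In units of \<open>R\<close> a factor with
  vanishing linear coefficient exceeds 1 only by a quadratic amount, so a product of many factors
  stays bounded as long as the sum of the squares \<open>(q s)\<^sup>2\<close> is of order
  \<open>R\<^sup>2\<close>.\<close>

lemma abs_nth_prod_fps_le:
  fixes \<Phi> :: "'a \<Rightarrow> real fps" and q :: "'a \<Rightarrow> real"
  assumes "finite I" "R > 0"
    and "\<And>s. s \<in> I \<Longrightarrow> \<Phi> s $ 0 = 1" "\<And>s. s \<in> I \<Longrightarrow> \<Phi> s $ 1 = 0"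
    and "\<And>s i. s \<in> I \<Longrightarrow> \<bar>\<Phi> s $ i\<bar> \<le> q s ^ i" "\<And>s. s \<in> I \<Longrightarrow> 0 \<le> q s" "\<And>s. s \<in> I \<Longrightarrow> 2 * q s \<le> R"
  shows "\<bar>(\<Prod>s\<in>I. \<Phi> s) $ m\<bar> \<le> R ^ m * (\<Prod>s\<in>I. 1 + 2 * (q s)\<^sup>2 / R\<^sup>2)"
  using assms
proof (induction I arbitrary: m rule: finite_induct)
  case empty
  then show ?case by (auto simp: fps_one_nth)
next
  case (insert s I)
  define P where "P = (\<Prod>s\<in>I. 1 + 2 * (q s)\<^sup>2 / R\<^sup>2)"
  define \<rho> where "\<rho> = q s / R"
  have P: "P \<ge> 0" unfolding P_def by (intro prod_nonneg) auto
  have \<rho>: "0 \<le> \<rho>" "\<rho> \<le> 1 / 2" using insert.prems by (auto simp: \<rho>_def field_simps)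
  have IH: "\<bar>(\<Prod>s\<in>I. \<Phi> s) $ m\<bar> \<le> R ^ m * P" for m
    unfolding P_def using insert by auto
  have one: "\<bar>\<Phi> s $ i\<bar> \<le> R ^ i * (if i = 0 then 1 else if i = 1 then 0 else \<rho> ^ i)" for i
    using insert.prems(2,3,4)[of s] insert.prems(4)[of s i] \<open>R > 0\<close> by (auto simp: \<rho>_def power_divide)
  have "\<bar>(\<Prod>s\<in>insert s I. \<Phi> s) $ m\<bar> \<le> (\<Sum>i\<le>m. \<bar>\<Phi> s $ i\<bar> * \<bar>(\<Prod>s\<in>I. \<Phi> s) $ (m - i)\<bar>)"
    using insert.hyps
    by (auto simp: fps_mult_nth atLeast0AtMost abs_mult[symmetric] intro!: order_trans[OF sum_abs])
  also have "\<dots> \<le> (\<Sum>i\<le>m. (R ^ i * (if i = 0 then 1 else if i = 1 then 0 else \<rho> ^ i)) * (R ^ (m - i) * P))"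
    using IH one \<open>R > 0\<close> \<rho> by (intro sum_mono mult_mono) auto
  also have "\<dots> = (\<Sum>i\<le>m. R ^ m * P * (if i = 0 then 1 else if i = 1 then 0 else \<rho> ^ i))"
  proof (intro sum.cong refl)
    fix i assume "i \<in> {..m}"
    then have "R ^ m = R ^ i * R ^ (m - i)" by (simp add: power_add[symmetric])
    then show "(R ^ i * (if i = 0 then 1 else if i = 1 then 0 else \<rho> ^ i)) * (R ^ (m - i) * P)
      = R ^ m * P * (if i = 0 then 1 else if i = 1 then 0 else \<rho> ^ i)" by simp
  qed
  also have "\<dots> = R ^ m * P * (\<Sum>i\<le>m. if i = 0 then 1 else if i = 1 then 0 else \<rho> ^ i)"
    by (simp add: sum_distrib_left)
  also have "\<dots> \<le> R ^ m * P * (1 + 2 * \<rho>\<^sup>2)"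
    using sum_geometric_from_2_le[OF \<rho>] P \<open>R > 0\<close> by (intro mult_left_mono) auto
  also have "\<dots> = R ^ m * (\<Prod>s\<in>insert s I. 1 + 2 * (q s)\<^sup>2 / R\<^sup>2)"
    using insert.hyps by (simp add: P_def \<rho>_def power_divide)
  finally show ?case .
qed

text \<open>The hypothesis bounds the product of the quadratic corrections by exp(1/2), which is at
  most 2, whatever the number of factors.\<close>

lemma abs_nth_prod_fps_le_2:
  fixes \<Phi> :: "'a \<Rightarrow> real fps" and q :: "'a \<Rightarrow> real"
  assumes "finite I" "R > 0" "4 * (\<Sum>s\<in>I. (q s)\<^sup>2) \<le> R\<^sup>2"
    and "\<And>s. s \<in> I \<Longrightarrow> \<Phi> s $ 0 = 1" "\<And>s. s \<in> I \<Longrightarrow> \<Phi> s $ 1 = 0"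
    and "\<And>s i. s \<in> I \<Longrightarrow> \<bar>\<Phi> s $ i\<bar> \<le> q s ^ i" "\<And>s. s \<in> I \<Longrightarrow> 0 \<le> q s"
  shows "\<bar>(\<Prod>s\<in>I. \<Phi> s) $ m\<bar> \<le> 2 * R ^ m"
proof -
  have q: "2 * q s \<le> R" if "s \<in> I" for s
  proof -
    have "(q s)\<^sup>2 \<le> (\<Sum>s\<in>I. (q s)\<^sup>2)" using that assms(1) by (intro member_le_sum) auto
    then have "(2 * q s)\<^sup>2 \<le> R\<^sup>2" using assms(3) by (simp add: power_mult_distrib)
    then show ?thesis using assms(2) power2_le_imp_le[of "2 * q s" R] by simp
  qed
  have "(\<Prod>s\<in>I. 1 + 2 * (q s)\<^sup>2 / R\<^sup>2) \<le> (\<Prod>s\<in>I. exp (2 * (q s)\<^sup>2 / R\<^sup>2))"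
    by (intro prod_mono) (auto intro: exp_ge_add_one_self)
  also have "\<dots> = exp (\<Sum>s\<in>I. 2 * (q s)\<^sup>2 / R\<^sup>2)" using assms(1) by (simp add: exp_sum)
  also have "(\<Sum>s\<in>I. 2 * (q s)\<^sup>2 / R\<^sup>2) = 2 * (\<Sum>s\<in>I. (q s)\<^sup>2) / R\<^sup>2"
    by (simp add: sum_divide_distrib sum_distrib_left)
  also have "exp (2 * (\<Sum>s\<in>I. (q s)\<^sup>2) / R\<^sup>2) \<le> exp (1 / 2)"
    using assms(2,3) by (simp add: field_simps)
  also have "exp (1 / 2 :: real) \<le> 2" using exp_bound_half[of "1/2::real"] by simp
  finally have "(\<Prod>s\<in>I. 1 + 2 * (q s)\<^sup>2 / R\<^sup>2) \<le> 2" .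
  then have "R ^ m * (\<Prod>s\<in>I. 1 + 2 * (q s)\<^sup>2 / R\<^sup>2) \<le> R ^ m * 2" using assms(2) by (intro mult_left_mono) auto
  then have "R ^ m * (\<Prod>s\<in>I. 1 + 2 * (q s)\<^sup>2 / R\<^sup>2) \<le> 2 * R ^ m" by (simp only: mult.commute)
  moreover have "\<bar>(\<Prod>s\<in>I. \<Phi> s) $ m\<bar> \<le> R ^ m * (\<Prod>s\<in>I. 1 + 2 * (q s)\<^sup>2 / R\<^sup>2)"
    by (rule abs_nth_prod_fps_le) (use assms q in auto)
  ultimately show ?thesis by linarith
qed

section \<open>Variance bounds for functions of independent coordinates\<close>

text \<open>A class closed under sums and products, so that integrability of every polynomial in the
  coordinates follows from structural rules.\<close>

definition all_moments :: "'a measure \<Rightarrow> ('a \<Rightarrow> real) \<Rightarrow> bool" where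
  "all_moments M f \<longleftrightarrow> f \<in> borel_measurable M \<and> (\<forall>m. integrable M (\<lambda>x. \<bar>f x\<bar> ^ m))"

lemma all_moments_measurable: "all_moments M f \<Longrightarrow> f \<in> borel_measurable M"
  by (simp add: all_moments_def)

lemma all_moments_integrable_power: "all_moments M f \<Longrightarrow> integrable M (\<lambda>x. f x ^ m)"
  unfolding all_moments_def
  by (elim conjE allE[of _ m], rule Bochner_Integration.integrable_bound) (auto simp: power_abs)

lemma all_moments_integrable: "all_moments M f \<Longrightarrow> integrable M f"
  using all_moments_integrable_power[of M f 1] by simp

lemma all_moments_mult:
  assumes "all_moments M f" "all_moments M g"
  shows "all_moments M (\<lambda>x. f x * g x)"
  unfolding all_moments_def
proof (intro conjI allI)
  note [measurable] = assms[THEN all_moments_measurable]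
  show "(\<lambda>x. f x * g x) \<in> borel_measurable M" by measurable
  fix m
  show "integrable M (\<lambda>x. \<bar>f x * g x\<bar> ^ m)"
  proof (rule Bochner_Integration.integrable_bound)
    show "integrable M (\<lambda>x. f x ^ (2 * m) + g x ^ (2 * m))"
      by (intro Bochner_Integration.integrable_add all_moments_integrable_power assms)
    show "AE x in M. norm (\<bar>f x * g x\<bar> ^ m) \<le> norm (f x ^ (2 * m) + g x ^ (2 * m))"
    proof (rule AE_I2)
      fix x
      have "2 * (\<bar>f x\<bar> ^ m * \<bar>g x\<bar> ^ m) \<le> (\<bar>f x\<bar> ^ m)\<^sup>2 + (\<bar>g x\<bar> ^ m)\<^sup>2"
        using sum_squares_bound[of "\<bar>f x\<bar> ^ m" "\<bar>g x\<bar> ^ m"] by simp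
      moreover have "0 \<le> \<bar>f x\<bar> ^ m * \<bar>g x\<bar> ^ m" by simp
      moreover have "(\<bar>f x\<bar> ^ m)\<^sup>2 = f x ^ (2 * m)" "(\<bar>g x\<bar> ^ m)\<^sup>2 = g x ^ (2 * m)"
        by (simp_all add: power_mult[symmetric] mult.commute[of m] power_even_abs)
      ultimately have "\<bar>f x\<bar> ^ m * \<bar>g x\<bar> ^ m \<le> f x ^ (2 * m) + g x ^ (2 * m)" by linarith
      then show "norm (\<bar>f x * g x\<bar> ^ m) \<le> norm (f x ^ (2 * m) + g x ^ (2 * m))"
        by (simp add: abs_mult power_mult_distrib)
    qed
  qed simp
qed

lemma all_moments_add:
  assumes "all_moments M f" "all_moments M g"
  shows "all_moments M (\<lambda>x. f x + g x)"
  unfolding all_moments_def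
proof (intro conjI allI)
  note [measurable] = assms[THEN all_moments_measurable]
  show "(\<lambda>x. f x + g x) \<in> borel_measurable M" by measurable
  fix m
  show "integrable M (\<lambda>x. \<bar>f x + g x\<bar> ^ m)"
  proof (rule Bochner_Integration.integrable_bound)
    show "integrable M (\<lambda>x. 2 ^ m * (\<bar>f x\<bar> ^ m + \<bar>g x\<bar> ^ m))"
      using assms unfolding all_moments_def
      by (intro integrable_mult_right Bochner_Integration.integrable_add) auto
    show "AE x in M. norm (\<bar>f x + g x\<bar> ^ m) \<le> norm (2 ^ m * (\<bar>f x\<bar> ^ m + \<bar>g x\<bar> ^ m))"
    proof (rule AE_I2)
      fix x
      have "\<bar>f x + g x\<bar> ^ m \<le> (2 * max \<bar>f x\<bar> \<bar>g x\<bar>) ^ m" by (intro power_mono) auto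
      also have "\<dots> = 2 ^ m * max \<bar>f x\<bar> \<bar>g x\<bar> ^ m" by (simp add: power_mult_distrib)
      also have "max \<bar>f x\<bar> \<bar>g x\<bar> ^ m \<le> \<bar>f x\<bar> ^ m + \<bar>g x\<bar> ^ m" by (auto simp: max_def)
      finally show "norm (\<bar>f x + g x\<bar> ^ m) \<le> norm (2 ^ m * (\<bar>f x\<bar> ^ m + \<bar>g x\<bar> ^ m))" by simp
    qed
  qed simp
qed

lemma (in finite_measure) all_moments_const: "all_moments M (\<lambda>_. c)"
  by (simp add: all_moments_def)

lemma (in finite_measure) all_moments_cmult:
  "all_moments M f \<Longrightarrow> all_moments M (\<lambda>x. c * f x)"
  by (rule all_moments_mult[OF all_moments_const])

lemma (in finite_measure) all_moments_power:
  assumes "all_moments M f"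
  shows "all_moments M (\<lambda>x. f x ^ n)"
  by (induction n) (auto intro: all_moments_mult assms all_moments_const)

lemma (in finite_measure) all_moments_sum:
  "(\<And>i. i \<in> A \<Longrightarrow> all_moments M (f i)) \<Longrightarrow> all_moments M (\<lambda>x. \<Sum>i\<in>A. f i x)"
  by (induction A rule: infinite_finite_induct) (auto intro: all_moments_add all_moments_const)

lemma (in finite_measure) all_moments_diff:
  assumes "all_moments M f" "all_moments M g"
  shows "all_moments M (\<lambda>x. f x - g x)"
  using all_moments_add[OF assms(1) all_moments_cmult[OF assms(2), of "-1"]] by simp

lemma (in finite_measure) all_moments_hermite_hom:
  assumes "all_moments M f"
  shows "all_moments M (\<lambda>x. hermite_hom l v (f x))"
  unfolding hermite_hom_sum by (intro all_moments_sum all_moments_cmult all_moments_power assms)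

section \<open>The Efron-Stein inequality\<close>

text \<open>The left side is the variance plus the squared bias relative to \<open>m\<close>, and
  the variance is the least second moment about a constant. In the application \<open>m\<close> is
  the overall mean and \<open>M\<close> the law of a single coordinate.\<close>

lemma (in prob_space) variance_le_second_moment_about:
  fixes h :: "'a \<Rightarrow> real"
  assumes "integrable M h" "integrable M (\<lambda>x. (h x)\<^sup>2)"
  shows "(\<integral>x. (h x - m)\<^sup>2 \<partial>M) \<le> (\<integral>x. (h x - c)\<^sup>2 \<partial>M) + ((\<integral>x. h x \<partial>M) - m)\<^sup>2"
proof -
  have *: "(\<integral>x. (h x - a)\<^sup>2 \<partial>M) = (\<integral>x. (h x)\<^sup>2 \<partial>M) - 2 * a * (\<integral>x. h x \<partial>M) + a\<^sup>2" for a
  proof -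
    have "(\<integral>x. (h x - a)\<^sup>2 \<partial>M) = (\<integral>x. ((h x)\<^sup>2 - 2 * a * h x) + a\<^sup>2 \<partial>M)"
      by (simp add: power2_eq_square algebra_simps)
    also have "\<dots> = (\<integral>x. (h x)\<^sup>2 \<partial>M) - 2 * a * (\<integral>x. h x \<partial>M) + a\<^sup>2"
      using assms by (simp add: prob_space)
    finally show ?thesis .
  qed
  have "0 \<le> ((\<integral>x. h x \<partial>M) - c)\<^sup>2" by simp
  then show ?thesis unfolding * by (simp add: power2_eq_square algebra_simps)
qed

lemma (in prob_space) square_integral_le:
  fixes h :: "'a \<Rightarrow> real"
  assumes "integrable M h" "integrable M (\<lambda>x. (h x)\<^sup>2)"
  shows "(\<integral>x. h x \<partial>M)\<^sup>2 \<le> (\<integral>x. (h x)\<^sup>2 \<partial>M)"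
proof -
  have "0 \<le> (\<integral>x. (h x - (\<integral>x. h x \<partial>M))\<^sup>2 \<partial>M)" by simp
  also have "\<dots> = (\<integral>x. ((h x)\<^sup>2 - 2 * (\<integral>x. h x \<partial>M) * h x) + (\<integral>x. h x \<partial>M)\<^sup>2 \<partial>M)"
    by (simp add: power2_eq_square algebra_simps)
  also have "\<dots> = (\<integral>x. (h x)\<^sup>2 \<partial>M) - (\<integral>x. h x \<partial>M)\<^sup>2"
    using assms by (simp add: prob_space power2_eq_square)
  finally show ?thesis by simp
qed

lemma integrable_square_diff:
  fixes f g :: "'a \<Rightarrow> real"
  assumes [measurable]: "f \<in> borel_measurable M" "g \<in> borel_measurable M"
    and "integrable M (\<lambda>x. (f x)\<^sup>2)" "integrable M (\<lambda>x. (g x)\<^sup>2)"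
  shows "integrable M (\<lambda>x. (f x - g x)\<^sup>2)"
proof (rule Bochner_Integration.integrable_bound)
  show "integrable M (\<lambda>x. 2 * (f x)\<^sup>2 + 2 * (g x)\<^sup>2)" using assms by simp
  have "(f x - g x)\<^sup>2 \<le> 2 * (f x)\<^sup>2 + 2 * (g x)\<^sup>2" for x
    using sum_squares_bound[of "f x" "- g x"] by (simp add: power2_diff)
  then show "AE x in M. norm ((f x - g x)\<^sup>2) \<le> norm (2 * (f x)\<^sup>2 + 2 * (g x)\<^sup>2)" by simp
qed simp

context pair_prob_space
begin

lemma Jensen_square_fst:
  fixes u :: "'a \<times> 'b \<Rightarrow> real"
  assumes [measurable]: "u \<in> borel_measurable (M1 \<Otimes>\<^sub>M M2)" and i: "integrable (M1 \<Otimes>\<^sub>M M2) (\<lambda>z. (u z)\<^sup>2)"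
  shows "integrable M1 (\<lambda>x. (\<integral>y. u (x, y) \<partial>M2)\<^sup>2)"
    and "(\<integral>x. (\<integral>y. u (x, y) \<partial>M2)\<^sup>2 \<partial>M1) \<le> (\<integral>z. (u z)\<^sup>2 \<partial>(M1 \<Otimes>\<^sub>M M2))"
proof -
  have i1: "integrable (M1 \<Otimes>\<^sub>M M2) u" by (rule P.square_integrable_imp_integrable[OF _ i]) simp
  have ae: "AE x in M1. (\<integral>y. u (x, y) \<partial>M2)\<^sup>2 \<le> (\<integral>y. (u (x, y))\<^sup>2 \<partial>M2)"
    using AE_integrable_fst'[OF i1] AE_integrable_fst'[OF i]
    by eventually_elim (rule M2.square_integral_le)
  show i2: "integrable M1 (\<lambda>x. (\<integral>y. u (x, y) \<partial>M2)\<^sup>2)"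
    by (rule Bochner_Integration.integrable_bound[OF integrable_fst'[OF i]])
      (use ae in \<open>auto elim!: eventually_mono\<close>)
  have "(\<integral>x. (\<integral>y. u (x, y) \<partial>M2)\<^sup>2 \<partial>M1) \<le> (\<integral>x. (\<integral>y. (u (x, y))\<^sup>2 \<partial>M2) \<partial>M1)"
    by (rule integral_mono_AE[OF i2 integrable_fst'[OF i] ae])
  also have "\<dots> = (\<integral>z. (u z)\<^sup>2 \<partial>(M1 \<Otimes>\<^sub>M M2))" by (rule integral_fst'[OF i])
  finally show "(\<integral>x. (\<integral>y. u (x, y) \<partial>M2)\<^sup>2 \<partial>M1) \<le> (\<integral>z. (u z)\<^sup>2 \<partial>(M1 \<Otimes>\<^sub>M M2))" .
qed

text \<open>Averaging over a component contracts L2 distances. In the induction for Efron-Stein this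
  brings the averaged functions back to the original ones.\<close>

lemma square_dist_marginals_le:
  fixes f h :: "'a \<times> 'b \<Rightarrow> real"
  assumes [measurable]: "f \<in> borel_measurable (M1 \<Otimes>\<^sub>M M2)" "h \<in> borel_measurable (M1 \<Otimes>\<^sub>M M2)"
    and f: "integrable (M1 \<Otimes>\<^sub>M M2) (\<lambda>z. (f z)\<^sup>2)" and h: "integrable (M1 \<Otimes>\<^sub>M M2) (\<lambda>z. (h z)\<^sup>2)"
  shows "(\<integral>x. ((\<integral>y. f (x, y) \<partial>M2) - (\<integral>y. h (x, y) \<partial>M2))\<^sup>2 \<partial>M1) \<le> (\<integral>z. (f z - h z)\<^sup>2 \<partial>(M1 \<Otimes>\<^sub>M M2))"
proof -
  have i: "integrable (M1 \<Otimes>\<^sub>M M2) f" "integrable (M1 \<Otimes>\<^sub>M M2) h"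
    by (rule P.square_integrable_imp_integrable; simp add: f h)+
  have "AE x in M1. ((\<integral>y. f (x, y) \<partial>M2) - (\<integral>y. h (x, y) \<partial>M2))\<^sup>2 = (\<integral>y. f (x, y) - h (x, y) \<partial>M2)\<^sup>2"
    using AE_integrable_fst'[OF i(1)] AE_integrable_fst'[OF i(2)] by eventually_elim simp
  then have "(\<integral>x. ((\<integral>y. f (x, y) \<partial>M2) - (\<integral>y. h (x, y) \<partial>M2))\<^sup>2 \<partial>M1)
      = (\<integral>x. (\<integral>y. f (x, y) - h (x, y) \<partial>M2)\<^sup>2 \<partial>M1)"
    by (intro integral_cong_AE) auto
  also have "\<dots> \<le> (\<integral>z. (f z - h z)\<^sup>2 \<partial>(M1 \<Otimes>\<^sub>M M2))"
    by (rule Jensen_square_fst(2)[of "\<lambda>z. f z - h z"]) (auto intro: integrable_square_diff f h)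
  finally show ?thesis .
qed

text \<open>One step of Efron-Stein. Given the first component \<open>g\<close> is a constant, so
  the conditional variance of \<open>f\<close> is at most the conditional mean of the squared
  distance to \<open>g\<close>; the conditional mean of \<open>f\<close> carries the rest.\<close>

lemma variance_le_fst:
  fixes f g :: "'a \<times> 'b \<Rightarrow> real"
  assumes [measurable]: "f \<in> borel_measurable (M1 \<Otimes>\<^sub>M M2)" "g \<in> borel_measurable (M1 \<Otimes>\<^sub>M M2)"
    and f: "integrable (M1 \<Otimes>\<^sub>M M2) (\<lambda>z. (f z)\<^sup>2)" and g: "integrable (M1 \<Otimes>\<^sub>M M2) (\<lambda>z. (g z)\<^sup>2)"
    and indep: "\<And>x y y'. g (x, y) = g (x, y')"
  shows "(\<integral>z. (f z - m)\<^sup>2 \<partial>(M1 \<Otimes>\<^sub>M M2)) \<le>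
    (\<integral>z. (f z - g z)\<^sup>2 \<partial>(M1 \<Otimes>\<^sub>M M2)) + (\<integral>x. ((\<integral>y. f (x, y) \<partial>M2) - m)\<^sup>2 \<partial>M1)"
proof -
  have i: "integrable (M1 \<Otimes>\<^sub>M M2) f" by (rule P.square_integrable_imp_integrable; simp add: f)
  have i1: "integrable (M1 \<Otimes>\<^sub>M M2) (\<lambda>z. (f z - m)\<^sup>2)" by (rule integrable_square_diff) (auto simp: f)
  have i2: "integrable (M1 \<Otimes>\<^sub>M M2) (\<lambda>z. (f z - g z)\<^sup>2)" by (rule integrable_square_diff) (auto simp: f g)
  have i3: "integrable M1 (\<lambda>x. ((\<integral>y. f (x, y) \<partial>M2) - m)\<^sup>2)"
    by (rule integrable_square_diff) (auto intro: Jensen_square_fst f)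
  have ae: "AE x in M1. (\<integral>y. (f (x, y) - m)\<^sup>2 \<partial>M2) \<le>
      (\<integral>y. (f (x, y) - g (x, y))\<^sup>2 \<partial>M2) + ((\<integral>y. f (x, y) \<partial>M2) - m)\<^sup>2"
    using AE_integrable_fst'[OF i] AE_integrable_fst'[OF f]
  proof eventually_elim
    case (elim x)
    define c where "c = g (x, undefined)"
    have "g (x, y) = c" for y unfolding c_def by (rule indep)
    then show ?case using M2.variance_le_second_moment_about[OF elim, of m c] by simp
  qed
  have "(\<integral>z. (f z - m)\<^sup>2 \<partial>(M1 \<Otimes>\<^sub>M M2)) = (\<integral>x. (\<integral>y. (f (x, y) - m)\<^sup>2 \<partial>M2) \<partial>M1)"
    by (rule integral_fst'[OF i1, symmetric])
  also have "\<dots> \<le> (\<integral>x. (\<integral>y. (f (x, y) - g (x, y))\<^sup>2 \<partial>M2) + ((\<integral>y. f (x, y) \<partial>M2) - m)\<^sup>2 \<partial>M1)"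
    using integrable_fst'[OF i1] integrable_fst'[OF i2] i3
    by (intro integral_mono_AE ae Bochner_Integration.integrable_add)
  also have "\<dots> = (\<integral>z. (f z - g z)\<^sup>2 \<partial>(M1 \<Otimes>\<^sub>M M2)) + (\<integral>x. ((\<integral>y. f (x, y) \<partial>M2) - m)\<^sup>2 \<partial>M1)"
    using integrable_fst'[OF i2] i3 by (simp add: integral_fst'[OF i2])
  finally show ?thesis .
qed

end

text \<open>The new coordinate comes second because the pair lemmas above average over the second
  component.\<close>

lemma (in product_prob_space) PiM_insert_eq_distr:
  "PiM (insert i J) M = distr (PiM J M \<Otimes>\<^sub>M M i) (PiM (insert i J) M) (\<lambda>(X, x). X(i := x))"
proof -
  interpret J: product_prob_space M J by standard
  interpret Q: pair_prob_space "PiM J M" "M i" ..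
  have m1: "(\<lambda>(x, X). X(i := x)) \<in> M i \<Otimes>\<^sub>M PiM J M \<rightarrow>\<^sub>M PiM (insert i J) M" by measurable
  have m2: "(\<lambda>(x, y). (y, x)) \<in> PiM J M \<Otimes>\<^sub>M M i \<rightarrow>\<^sub>M M i \<Otimes>\<^sub>M PiM J M" by measurable
  have "PiM (insert i J) M = distr (M i \<Otimes>\<^sub>M PiM J M) (PiM (insert i J) M) (\<lambda>(x, X). X(i := x))"
    by (rule distr_pair_PiM_eq_PiM[symmetric]) (rule prob_space)+
  also have "M i \<Otimes>\<^sub>M PiM J M = distr (PiM J M \<Otimes>\<^sub>M M i) (M i \<Otimes>\<^sub>M PiM J M) (\<lambda>(x, y). (y, x))"
    by (rule pair_sigma_finite.distr_pair_swap) (rule pair_sigma_finite.intro; unfold_locales)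
  also have "distr (distr (PiM J M \<Otimes>\<^sub>M M i) (M i \<Otimes>\<^sub>M PiM J M) (\<lambda>(x, y). (y, x))) (PiM (insert i J) M) (\<lambda>(x, X). X(i := x))
    = distr (PiM J M \<Otimes>\<^sub>M M i) (PiM (insert i J) M) (\<lambda>(X, x). X(i := x))"
    by (subst distr_distr[OF m1 m2]) (simp add: comp_def case_prod_beta')
  finally show ?thesis .
qed

text \<open>Any \<open>h s\<close> that ignores coordinate \<open>s\<close> may replace the leave-one-out conditional expectation, which
  only increases the right-hand side.\<close>

lemma (in product_prob_space) Efron_Stein:
  fixes f :: "('i \<Rightarrow> 'a) \<Rightarrow> real" and h :: "'i \<Rightarrow> ('i \<Rightarrow> 'a) \<Rightarrow> real"
  assumes "finite J" "f \<in> borel_measurable (PiM J M)" "integrable (PiM J M) (\<lambda>x. (f x)\<^sup>2)"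
    and "\<And>s. s \<in> J \<Longrightarrow> h s \<in> borel_measurable (PiM J M)"
    and "\<And>s. s \<in> J \<Longrightarrow> integrable (PiM J M) (\<lambda>x. (h s x)\<^sup>2)"
    and "\<And>s y x. s \<in> J \<Longrightarrow> h s (y(s := x)) = h s y"
  shows "(\<integral>x. (f x - (\<integral>x. f x \<partial>PiM J M))\<^sup>2 \<partial>PiM J M) \<le> (\<Sum>s\<in>J. \<integral>x. (f x - h s x)\<^sup>2 \<partial>PiM J M)"
  using assms
proof (induction J arbitrary: f h rule: finite_induct)
  case empty
  show ?case by (simp add: PiM_empty lebesgue_integral_count_space_finite)
next
  case (insert i J)
  interpret J: product_prob_space M J by standard
  interpret Q: pair_prob_space "PiM J M" "M i" ..
  let ?P = "PiM J M \<Otimes>\<^sub>M M i"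
  let ?U = "\<lambda>(X, x). X(i := x)"
  have U[measurable]: "?U \<in> ?P \<rightarrow>\<^sub>M PiM (insert i J) M" by measurable
  have eq: "PiM (insert i J) M = distr ?P (PiM (insert i J) M) ?U" by (rule PiM_insert_eq_distr)
  have int: "(\<integral>x. u x \<partial>PiM (insert i J) M) = (\<integral>z. u (?U z) \<partial>?P)"
    if "u \<in> borel_measurable (PiM (insert i J) M)" for u :: "('i \<Rightarrow> 'a) \<Rightarrow> real"
    by (subst eq, rule integral_distr[OF U that])
  have inte: "integrable (PiM (insert i J) M) u \<longleftrightarrow> integrable ?P (\<lambda>z. u (?U z))"
    if "u \<in> borel_measurable (PiM (insert i J) M)" for u :: "('i \<Rightarrow> 'a) \<Rightarrow> real"
    by (subst eq, rule integrable_distr_eq[OF U that])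
  define F where "F = (\<lambda>z. f (?U z))"
  define G where "G = (\<lambda>s z. h s (?U z))"
  note fm[measurable] = insert.prems(1) and hm[measurable (raw)] = insert.prems(3)
  have [measurable]: "F \<in> borel_measurable ?P" unfolding F_def by measurable
  have Gm[measurable]: "G s \<in> borel_measurable ?P" if "s \<in> insert i J" for s
    unfolding G_def by (rule measurable_compose[OF U hm[OF that]])
  have F2: "integrable ?P (\<lambda>z. (F z)\<^sup>2)" using insert.prems(2) by (subst (asm) inte) (auto simp: F_def)
  have G2: "integrable ?P (\<lambda>z. (G s z)\<^sup>2)" if "s \<in> insert i J" for s
    using insert.prems(4)[OF that] hm[OF that] by (subst (asm) inte) (auto simp: G_def)
  have F1: "integrable ?P F" by (rule Q.P.square_integrable_imp_integrable[OF _ F2]) simp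
  define m where "m = (\<integral>x. f x \<partial>PiM (insert i J) M)"
  have mF: "m = (\<integral>z. F z \<partial>?P)" unfolding m_def F_def by (rule int) (rule fm)
  \<comment> \<open>The induction hypothesis is applied to averages over the new coordinate
    \<open>i\<close>; since \<open>s \<noteq> i\<close>, averaging keeps \<open>h s\<close>
    independent of coordinate \<open>s\<close>.\<close>
  define Fb where "Fb = (\<lambda>X. \<integral>x. F (X, x) \<partial>M i)"
  define Gb where "Gb = (\<lambda>s X. \<integral>x. G s (X, x) \<partial>M i)"
  have mb: "(\<integral>X. Fb X \<partial>PiM J M) = m"
    unfolding Fb_def mF by (rule Q.integral_fst'[OF F1])
  have "(\<integral>X. (Fb X - (\<integral>X. Fb X \<partial>PiM J M))\<^sup>2 \<partial>PiM J M) \<le> (\<Sum>s\<in>J. \<integral>X. (Fb X - Gb s X)\<^sup>2 \<partial>PiM J M)"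
  proof (rule insert.IH)
    show "Fb \<in> borel_measurable (PiM J M)" unfolding Fb_def by measurable
    show "integrable (PiM J M) (\<lambda>x. (Fb x)\<^sup>2)" unfolding Fb_def by (rule Q.Jensen_square_fst(1)[OF _ F2]) simp
  next
    fix s assume s: "s \<in> J"
    then have si: "s \<in> insert i J" "s \<noteq> i" using insert.hyps by auto
    note [measurable] = Gm[OF si(1)]
    show "Gb s \<in> borel_measurable (PiM J M)" unfolding Gb_def by measurable
    show "integrable (PiM J M) (\<lambda>x. (Gb s x)\<^sup>2)" unfolding Gb_def by (rule Q.Jensen_square_fst(1)[OF _ G2[OF si(1)]]) simp
    fix y x
    show "Gb s (y(s := x)) = Gb s y"
    proof -
      have "h s (y(s := x, i := z)) = h s (y(i := z))" for z
        using insert.prems(5)[OF si(1), of "y(i := z)" x] fun_upd_twist[OF si(2), of y x z] by (simp only:)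
      then show ?thesis by (simp add: Gb_def G_def)
    qed
  qed
  also have "\<dots> \<le> (\<Sum>s\<in>J. \<integral>z. (F z - G s z)\<^sup>2 \<partial>?P)"
    unfolding Fb_def Gb_def by (intro sum_mono Q.square_dist_marginals_le F2 G2) auto
  finally have IH: "(\<integral>X. (Fb X - m)\<^sup>2 \<partial>PiM J M) \<le> (\<Sum>s\<in>J. \<integral>z. (F z - G s z)\<^sup>2 \<partial>?P)"
    unfolding mb .
  have "(\<integral>z. (F z - m)\<^sup>2 \<partial>?P) \<le> (\<integral>z. (F z - G i z)\<^sup>2 \<partial>?P) + (\<integral>X. (Fb X - m)\<^sup>2 \<partial>PiM J M)"
    unfolding Fb_def
  proof (rule Q.variance_le_fst[OF _ _ F2 G2])
    fix x y y'
    show "G i (x, y) = G i (x, y')"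
      using insert.prems(5)[of i x y] insert.prems(5)[of i x y'] by (simp add: G_def del: fun_upd_apply)
  qed auto
  also have "\<dots> \<le> (\<Sum>s\<in>insert i J. \<integral>z. (F z - G s z)\<^sup>2 \<partial>?P)"
    using IH insert.hyps by simp
  also have "\<dots> = (\<Sum>s\<in>insert i J. \<integral>x. (f x - h s x)\<^sup>2 \<partial>PiM (insert i J) M)"
    unfolding F_def G_def by (intro sum.cong refl int[symmetric] borel_measurable_power borel_measurable_diff fm hm)
  also have "(\<integral>z. (F z - m)\<^sup>2 \<partial>?P) = (\<integral>x. (f x - m)\<^sup>2 \<partial>PiM (insert i J) M)"
    unfolding F_def by (intro int[symmetric]) measurable
  finally show ?case unfolding m_def .
qed

section \<open>Moments of linear forms in independent centered coordinates\<close>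

text \<open>The moment hypothesis bounds the coefficients of the moment generating function by
  \<open>K ^ i\<close>. Subgaussian priors and Gaussian noise both satisfy it, and it is the form of
  input that the product estimate for power series takes.\<close>

locale centered_coordinates = product_prob_space M I
  for M :: "'i \<Rightarrow> real measure" and I :: "'i set" +
  fixes K :: real
  assumes finite_I: "finite I"
    and sets_M [measurable_cong, simp]: "\<And>s. sets (M s) = sets borel"
    and all_moments_M: "\<And>s. s \<in> I \<Longrightarrow> all_moments (M s) (\<lambda>x. x)"
    and mean_M: "\<And>s. s \<in> I \<Longrightarrow> (\<integral>x. x \<partial>M s) = 0"
    and moment_M: "\<And>s i. s \<in> I \<Longrightarrow> \<bar>\<integral>x. x ^ i \<partial>M s\<bar> \<le> fact i * K ^ i"
    and K_ge: "1 \<le> K"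
begin

lemma space_M [simp]: "space (M s) = UNIV"
  using sets_eq_imp_space_eq[OF sets_M[of s]] by simp

definition linear_form :: "('i \<Rightarrow> real) \<Rightarrow> 'i set \<Rightarrow> ('i \<Rightarrow> real) \<Rightarrow> real" where
  "linear_form a J x = (\<Sum>s\<in>J. a s * x s)"

text \<open>The moment generating function of \<open>a s * x s\<close> as a formal series.\<close>

definition coordinate_fps :: "('i \<Rightarrow> real) \<Rightarrow> 'i \<Rightarrow> real fps" where
  "coordinate_fps a s = Abs_fps (\<lambda>i. a s ^ i * (\<integral>x. x ^ i \<partial>M s) / fact i)"

lemma component_integrable:
  fixes f :: "real \<Rightarrow> real"
  assumes "s \<in> J" "integrable (M s) f"
  shows "integrable (PiM J M) (\<lambda>x. f (x s))"
proof -
  have "integrable (distr (PiM J M) (M s) (\<lambda>x. x s)) f"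
    using assms prob_space by (subst distr_PiM_component) auto
  moreover have "f \<in> borel_measurable (M s)" using assms(2) by (rule borel_measurable_integrable)
  ultimately show ?thesis
    using integrable_distr[of "\<lambda>x. x s" "PiM J M" "M s" f] assms(1) by auto
qed

lemma component_integral:
  fixes f :: "real \<Rightarrow> real"
  assumes "s \<in> J" "f \<in> borel_measurable (M s)"
  shows "(\<integral>x. f (x s) \<partial>PiM J M) = (\<integral>x. f x \<partial>M s)"
proof -
  have "(\<integral>x. f x \<partial>M s) = (\<integral>x. f x \<partial>distr (PiM J M) (M s) (\<lambda>x. x s))"
    using assms prob_space by (subst distr_PiM_component) auto
  also have "\<dots> = (\<integral>x. f (x s) \<partial>PiM J M)"
    by (rule integral_distr) (use assms in auto)
  finally show ?thesis ..
qed

lemma all_moments_component: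
  assumes "s \<in> J" "J \<subseteq> I"
  shows "all_moments (PiM J M) (\<lambda>x. x s)"
  using all_moments_M[of s] assms
  by (auto simp: all_moments_def intro!: component_integrable[where f="\<lambda>x. \<bar>x\<bar> ^ m" for m])

lemma prob_space_PiM_M: "prob_space (PiM J M)"
  by (rule prob_space_PiM) (rule prob_space)

lemma finite_measure_PiM_M: "finite_measure (PiM J M)"
  using prob_space_PiM_M by (rule prob_space.axioms)

lemma all_moments_linear_form:
  assumes "J \<subseteq> I"
  shows "all_moments (PiM J M) (linear_form a J)"
proof -
  interpret J: finite_measure "PiM J M" by (rule finite_measure_PiM_M)
  have "linear_form a J = (\<lambda>x. \<Sum>s\<in>J. a s * x s)" by (auto simp: linear_form_def)
  then show ?thesis
    using assms by (simp only:) (intro J.all_moments_sum J.all_moments_cmult all_moments_component)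
qed

text \<open>Moment generating functions of independent variables multiply: splitting off one
  coordinate turns the binomial theorem into the Cauchy product.\<close>

lemma moments_linear_form:
  assumes "J \<subseteq> I"
  shows "(\<integral>x. linear_form a J x ^ m \<partial>PiM J M) = fact m * (\<Prod>s\<in>J. coordinate_fps a s) $ m"
proof -
  have "finite J" using assms finite_I finite_subset by blast
  then show ?thesis using assms
  proof (induction J arbitrary: m rule: finite_induct)
    case empty
    show ?case
      by (cases m) (simp_all add: PiM_empty lebesgue_integral_count_space_finite linear_form_def)
  next
    case (insert i J)
    interpret J: prob_space "PiM J M" by (rule prob_space_PiM_M)
    have i: "i \<in> I" and J: "J \<subseteq> I" using insert.prems by auto
    have split: "linear_form a (insert i J) (x(i := y)) = linear_form a J x + a i * y" for x y
    proof -
      have "(\<Sum>s\<in>J. a s * (x(i := y)) s) = (\<Sum>s\<in>J. a s * x s)"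
        using insert.hyps by (intro sum.cong) auto
      then show ?thesis using insert.hyps by (simp add: linear_form_def)
    qed
    have im: "integrable (M i) (\<lambda>y. y ^ j)" for j
      using all_moments_integrable_power[OF all_moments_M[OF i]] .
    have iS: "integrable (PiM J M) (\<lambda>x. linear_form a J x ^ j)" for j
      using all_moments_integrable_power[OF all_moments_linear_form[OF J]] .
    have "(\<integral>x. linear_form a (insert i J) x ^ m \<partial>PiM (insert i J) M)
        = (\<integral>x. (\<integral>y. (linear_form a J x + a i * y) ^ m \<partial>M i) \<partial>PiM J M)"
      by (subst product_integral_insert[OF insert.hyps all_moments_integrable_power[OF all_moments_linear_form[OF insert.prems]]])
        (simp only: split)
    also have "\<dots> = (\<integral>x. (\<Sum>j\<le>m. real (m choose j) * (a i ^ j * (\<integral>y. y ^ j \<partial>M i)) * linear_form a J x ^ (m - j)) \<partial>PiM J M)"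
    proof (rule Bochner_Integration.integral_cong[OF refl])
      fix x
      have "(\<integral>y. (linear_form a J x + a i * y) ^ m \<partial>M i)
        = (\<integral>y. (\<Sum>j\<le>m. (real (m choose j) * a i ^ j * linear_form a J x ^ (m - j)) * y ^ j) \<partial>M i)"
        by (subst add.commute, subst binomial_ring) (simp add: power_mult_distrib mult_ac)
      also have "\<dots> = (\<Sum>j\<le>m. real (m choose j) * (a i ^ j * (\<integral>y. y ^ j \<partial>M i)) * linear_form a J x ^ (m - j))"
        by (subst Bochner_Integration.integral_sum) (auto intro: im simp: mult_ac)
      finally show "(\<integral>y. (linear_form a J x + a i * y) ^ m \<partial>M i)
        = (\<Sum>j\<le>m. real (m choose j) * (a i ^ j * (\<integral>y. y ^ j \<partial>M i)) * linear_form a J x ^ (m - j))" .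
    qed
    also have "\<dots> = (\<Sum>j\<le>m. real (m choose j) * (a i ^ j * (\<integral>y. y ^ j \<partial>M i)) * (\<integral>x. linear_form a J x ^ (m - j) \<partial>PiM J M))"
      by (subst Bochner_Integration.integral_sum) (auto intro: iS)
    also have "\<dots> = (\<Sum>j\<le>m. fact m * (coordinate_fps a i $ j * (\<Prod>s\<in>J. coordinate_fps a s) $ (m - j)))"
      by (intro sum.cong refl) (simp add: insert.IH[OF J] binomial_fact coordinate_fps_def)
    also have "\<dots> = fact m * (\<Prod>s\<in>insert i J. coordinate_fps a s) $ m"
      using insert.hyps by (simp add: fps_mult_nth sum_distrib_left atLeast0AtMost)
    finally show ?case .
  qed
qed

text \<open>Taking expectations multiplies the Hermite series by the moment series. For a suitable
  \<open>v\<close> the factor \<open>gauss_fps v\<close> undoes the Gaussian coordinates.\<close>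

lemma hermite_hom_linear_form:
  "(\<integral>x. hermite_hom l v (linear_form a I x) \<partial>PiM I M) =
    fact l * ((\<Prod>s\<in>I. coordinate_fps a s) * gauss_fps v) $ l"
proof -
  have i: "integrable (PiM I M) (\<lambda>x. fact l / fact i * gauss_fps v $ (l - i) * linear_form a I x ^ i)" for i
    by (intro integrable_mult_right all_moments_integrable_power[OF all_moments_linear_form] subset_refl)
  have "(\<integral>x. hermite_hom l v (linear_form a I x) \<partial>PiM I M)
      = (\<Sum>i\<le>l. fact l / fact i * gauss_fps v $ (l - i) * (\<integral>x. linear_form a I x ^ i \<partial>PiM I M))"
    unfolding hermite_hom_sum
    using i by (subst Bochner_Integration.integral_sum) simp_all
  also have "\<dots> = (\<Sum>i\<le>l. fact l * ((\<Prod>s\<in>I. coordinate_fps a s) $ i * gauss_fps v $ (l - i)))"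
    by (simp add: moments_linear_form mult_ac)
  also have "\<dots> = fact l * ((\<Prod>s\<in>I. coordinate_fps a s) * gauss_fps v) $ l"
    by (simp add: fps_mult_nth sum_distrib_left atLeast0AtMost)
  finally show ?thesis .
qed

text \<open>\<open>R\<close> is of the order of the Euclidean norm of the coefficients, so the
  moments grow like \<open>fact m * R ^ m\<close> uniformly in the number of coordinates.\<close>

lemma moment_linear_form_le:
  assumes R: "R > 0" "4 * K\<^sup>2 * (\<Sum>s\<in>I. (a s)\<^sup>2) \<le> R\<^sup>2"
  shows "\<bar>\<integral>x. linear_form a I x ^ m \<partial>PiM I M\<bar> \<le> 2 * fact m * R ^ m"
proof -
  have "\<bar>(\<Prod>s\<in>I. coordinate_fps a s) $ m\<bar> \<le> 2 * R ^ m"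
  proof (rule abs_nth_prod_fps_le_2[where q="\<lambda>s. K * \<bar>a s\<bar>"])
    show "4 * (\<Sum>s\<in>I. (K * \<bar>a s\<bar>)\<^sup>2) \<le> R\<^sup>2"
      using R(2) by (simp add: power_mult_distrib sum_distrib_left mult_ac)
    fix s assume s: "s \<in> I"
    show "coordinate_fps a s $ 0 = 1" using M.prob_space[of s] by (simp add: coordinate_fps_def)
    show "coordinate_fps a s $ 1 = 0" using mean_M[OF s] by (simp add: coordinate_fps_def)
    show "0 \<le> K * \<bar>a s\<bar>" using K_ge by simp
    fix i
    have "\<bar>coordinate_fps a s $ i\<bar> = \<bar>a s\<bar> ^ i * (\<bar>\<integral>x. x ^ i \<partial>M s\<bar> / fact i)"
      by (simp add: coordinate_fps_def abs_mult power_abs)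
    also have "\<dots> \<le> \<bar>a s\<bar> ^ i * K ^ i"
      using moment_M[OF s, of i] by (intro mult_left_mono) (auto simp: field_simps)
    finally show "\<bar>coordinate_fps a s $ i\<bar> \<le> (K * \<bar>a s\<bar>) ^ i"
      by (simp add: power_mult_distrib mult_ac)
  qed (use finite_I R in auto)
  then show ?thesis
    unfolding moments_linear_form[OF subset_refl] by (simp add: abs_mult mult_left_mono)
qed

lemma even_moment_linear_form_le:
  assumes "R > 0" "4 * K\<^sup>2 * (\<Sum>s\<in>I. (a s)\<^sup>2) \<le> R\<^sup>2" "even m"
  shows "(\<integral>x. \<bar>linear_form a I x\<bar> ^ m \<partial>PiM I M) \<le> 2 * fact m * R ^ m"
  using moment_linear_form_le[OF assms(1,2), of m] assms(3) by (simp add: power_even_abs)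

end

section \<open>Operator norm bounds for entrywise powers of a matrix\<close>

text \<open>The operator norm of an entrywise power is at most \<open>b ^ i\<close>. For
  \<open>i \<ge> 2\<close>, Cauchy-Schwarz spends one factor \<open>B s j\<close> on a row norm, a
  second one pays for a column norm after exchanging the sums, and the others are bounded
  entrywise.\<close>

lemma sum_power_op_bound:
  fixes B :: "'i \<Rightarrow> nat \<Rightarrow> real" and v :: "nat \<Rightarrow> real"
  assumes "finite I" "i \<ge> 1" "b \<ge> 0"
    and op: "\<And>v. (\<Sum>s\<in>I. (\<Sum>j<p. B s j * v j)\<^sup>2) \<le> b\<^sup>2 * (\<Sum>j<p. (v j)\<^sup>2)"
    and row: "\<And>s. s \<in> I \<Longrightarrow> (\<Sum>j<p. (B s j)\<^sup>2) \<le> b\<^sup>2"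
    and col: "\<And>j. j < p \<Longrightarrow> (\<Sum>s\<in>I. (B s j)\<^sup>2) \<le> b\<^sup>2"
    and entry: "\<And>s j. s \<in> I \<Longrightarrow> j < p \<Longrightarrow> \<bar>B s j\<bar> \<le> b"
  shows "(\<Sum>s\<in>I. (\<Sum>j<p. B s j ^ i * v j)\<^sup>2) \<le> b ^ (2 * i) * (\<Sum>j<p. (v j)\<^sup>2)"
proof (cases "i = 1")
  case True
  then show ?thesis using op[of v] by simp
next
  case False
  then obtain q where q: "i = Suc (Suc q)" using assms(2) by (cases i; cases "i - 1") auto
  have "(\<Sum>j<p. B s j ^ i * v j)\<^sup>2 \<le> b\<^sup>2 * (\<Sum>j<p. b ^ (2 * q) * ((B s j)\<^sup>2 * (v j)\<^sup>2))" if s: "s \<in> I" for s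
  proof -
    have "(\<Sum>j<p. B s j ^ i * v j)\<^sup>2 = (\<Sum>j<p. B s j * (B s j ^ Suc q * v j))\<^sup>2"
      by (simp add: q mult_ac)
    also have "\<dots> \<le> (\<Sum>j<p. (B s j)\<^sup>2) * (\<Sum>j<p. (B s j ^ Suc q * v j)\<^sup>2)"
      by (rule Cauchy_Schwarz_ineq_sum)
    also have "\<dots> \<le> b\<^sup>2 * (\<Sum>j<p. b ^ (2 * q) * ((B s j)\<^sup>2 * (v j)\<^sup>2))"
    proof (intro mult_mono row s sum_mono)
      fix j assume j: "j \<in> {..<p}"
      have "(B s j ^ Suc q * v j)\<^sup>2 = (B s j ^ q)\<^sup>2 * ((B s j)\<^sup>2 * (v j)\<^sup>2)"
        by (simp add: power_mult_distrib)
      also have "(B s j ^ q)\<^sup>2 = \<bar>B s j\<bar> ^ (2 * q)"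
        by (simp add: power_mult[symmetric] mult.commute[of q] power_even_abs)
      also have "\<bar>B s j\<bar> ^ (2 * q) * ((B s j)\<^sup>2 * (v j)\<^sup>2) \<le> b ^ (2 * q) * ((B s j)\<^sup>2 * (v j)\<^sup>2)"
        using entry[OF s] j by (intro mult_right_mono power_mono) auto
      finally show "(B s j ^ Suc q * v j)\<^sup>2 \<le> b ^ (2 * q) * ((B s j)\<^sup>2 * (v j)\<^sup>2)" .
    qed (auto intro: sum_nonneg)
    finally show ?thesis .
  qed
  then have "(\<Sum>s\<in>I. (\<Sum>j<p. B s j ^ i * v j)\<^sup>2) \<le> (\<Sum>s\<in>I. b\<^sup>2 * (\<Sum>j<p. b ^ (2 * q) * ((B s j)\<^sup>2 * (v j)\<^sup>2)))"
    by (rule sum_mono)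
  also have "\<dots> = b ^ (2 * Suc q) * (\<Sum>j<p. \<Sum>s\<in>I. (B s j)\<^sup>2 * (v j)\<^sup>2)"
    by (subst sum.swap) (simp add: sum_distrib_left mult_ac power2_eq_square)
  also have "\<dots> \<le> b ^ (2 * Suc q) * (\<Sum>j<p. b\<^sup>2 * (v j)\<^sup>2)"
    using col assms(3) by (intro mult_left_mono sum_mono) (auto simp: sum_distrib_right[symmetric] intro: mult_right_mono)
  also have "\<dots> = b ^ (2 * i) * (\<Sum>j<p. (v j)\<^sup>2)"
    by (simp add: q sum_distrib_left[symmetric] power2_eq_square)
  finally show ?thesis .
qed

text \<open>A bound for a single row that keeps its squared norm. Unlike
  \<open>sum_power_op_bound\<close> it can be multiplied by a weight depending on the row before
  summing; the squared norms then add up to at most \<open>p * b\<^sup>2\<close>.\<close>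

lemma row_power_bound:
  fixes B :: "nat \<Rightarrow> real" and v :: "nat \<Rightarrow> real"
  assumes "i \<ge> 1" "b \<ge> 0" and entry: "\<And>j. j < p \<Longrightarrow> \<bar>B j\<bar> \<le> b"
  shows "(\<Sum>j<p. B j ^ i * v j)\<^sup>2 \<le> b ^ (2 * i - 2) * (\<Sum>j<p. (B j)\<^sup>2) * (\<Sum>j<p. (v j)\<^sup>2)"
proof -
  obtain q where q: "i = Suc q" using assms(1) by (cases i) auto
  have 1: "(\<Sum>j<p. B j ^ i * v j)\<^sup>2 \<le> (\<Sum>j<p. (B j ^ i)\<^sup>2) * (\<Sum>j<p. (v j)\<^sup>2)"
    by (rule Cauchy_Schwarz_ineq_sum)
  have 2: "(\<Sum>j<p. (B j ^ i)\<^sup>2) \<le> (\<Sum>j<p. b ^ (2 * i - 2) * (B j)\<^sup>2)"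
  proof (rule sum_mono)
    fix j assume "j \<in> {..<p}"
    then have "\<bar>B j\<bar> ^ (2 * q) * (B j)\<^sup>2 \<le> b ^ (2 * q) * (B j)\<^sup>2"
      using entry[of j] by (intro mult_right_mono power_mono) auto
    moreover have "(B j ^ i)\<^sup>2 = \<bar>B j\<bar> ^ (2 * q) * (B j)\<^sup>2"
      by (simp add: q power_mult_distrib power_mult[symmetric] mult.commute[of q] power_even_abs)
    ultimately show "(B j ^ i)\<^sup>2 \<le> b ^ (2 * i - 2) * (B j)\<^sup>2" by (simp add: q)
  qed
  show ?thesis
    using mult_right_mono[OF 2, of "\<Sum>j<p. (v j)\<^sup>2"] 1
    by (simp add: sum_distrib_left[symmetric] sum_nonneg)
qed

section \<open>The variance of the Hermite statistic\<close>

text \<open>\<open>B s j\<close> is the coefficient of coordinate \<open>s\<close> in the linear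
  form of column \<open>j\<close>, and \<open>\<tau> j\<close> will be the standard deviation of its
  Gaussian part. One bound \<open>b\<close> for both makes every estimate homogeneous in
  \<open>b\<close>.\<close>

locale design_coordinates = centered_coordinates M I K
  for M :: "'i \<Rightarrow> real measure" and I :: "'i set" and K :: real +
  fixes B :: "'i \<Rightarrow> nat \<Rightarrow> real" and p :: nat and b :: real and \<tau> :: "nat \<Rightarrow> real"
  assumes B_op: "\<And>v. (\<Sum>s\<in>I. (\<Sum>j<p. B s j * v j)\<^sup>2) \<le> b\<^sup>2 * (\<Sum>j<p. (v j)\<^sup>2)"
    and b_pos: "b > 0" and \<tau>: "\<And>j. j < p \<Longrightarrow> 0 \<le> \<tau> j \<and> \<tau> j \<le> b" and p_pos: "p \<ge> 1"
begin

text \<open>The row itself serves as the test vector; this gives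
  \<open>r\<^sup>2 \<le> b\<^sup>2 * r\<close> for its squared norm \<open>r\<close>.\<close>

lemma B_row: "s \<in> I \<Longrightarrow> (\<Sum>j<p. (B s j)\<^sup>2) \<le> b\<^sup>2"
proof -
  assume s: "s \<in> I"
  define r where "r = (\<Sum>j<p. (B s j)\<^sup>2)"
  have r0: "r \<ge> 0" unfolding r_def by (intro sum_nonneg) auto
  have "r\<^sup>2 = (\<Sum>j<p. B s j * B s j)\<^sup>2" by (simp add: r_def power2_eq_square)
  also have "\<dots> \<le> (\<Sum>s'\<in>I. (\<Sum>j<p. B s' j * B s j)\<^sup>2)"
    using s finite_I by (intro member_le_sum[of s I "\<lambda>s'. (\<Sum>j<p. B s' j * B s j)\<^sup>2"]) auto
  also have "\<dots> \<le> b\<^sup>2 * r" unfolding r_def by (rule B_op)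
  finally have "r * r \<le> b\<^sup>2 * r" by (simp add: power2_eq_square)
  then show ?thesis
    using r0 b_pos unfolding r_def[symmetric]
    by (cases "r = 0") (auto simp: mult_le_cancel_right)
qed

lemma B_col:
  assumes "j < p"
  shows "(\<Sum>s\<in>I. (B s j)\<^sup>2) \<le> b\<^sup>2"
proof -
  let ?e = "\<lambda>i. if i = j then 1 else 0 :: real"
  have 1: "(\<Sum>i<p. B s i * ?e i) = B s j" for s
    using assms by (simp add: if_distrib[of "\<lambda>z. _ * z"] cong: if_cong)
  have "(\<Sum>i<p. (?e i)\<^sup>2) = (\<Sum>i<p. ?e i)" by (intro sum.cong) auto
  also have "\<dots> = 1" using assms by simp
  finally show ?thesis using B_op[of ?e] unfolding 1 by simp
qed

lemma B_entry: "s \<in> I \<Longrightarrow> j < p \<Longrightarrow> \<bar>B s j\<bar> \<le> b"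
proof -
  assume s: "s \<in> I" "j < p"
  have "(B s j)\<^sup>2 \<le> (\<Sum>j<p. (B s j)\<^sup>2)" using s by (intro member_le_sum) auto
  then have "\<bar>B s j\<bar>\<^sup>2 \<le> b\<^sup>2" using B_row[OF s(1)] by simp
  then show ?thesis by (rule power2_le_imp_le) (use b_pos in simp)
qed

definition S :: "nat \<Rightarrow> ('i \<Rightarrow> real) \<Rightarrow> real" where
  "S j x = linear_form (\<lambda>s. B s j) I x"

definition hterm :: "nat \<Rightarrow> nat \<Rightarrow> ('i \<Rightarrow> real) \<Rightarrow> real" where
  "hterm l j x = hermite_hom l ((\<tau> j)\<^sup>2) (S j x)"

definition Fsum :: "nat \<Rightarrow> ('i \<Rightarrow> real) \<Rightarrow> real" where
  "Fsum l x = (\<Sum>j<p. hterm l j x)"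

text \<open>The squared Euclidean norm of the vector of Hermite terms. It is what Cauchy-Schwarz
  leaves over whenever a coordinate or the mean is changed.\<close>

definition Wsum :: "nat \<Rightarrow> ('i \<Rightarrow> real) \<Rightarrow> real" where
  "Wsum l x = (\<Sum>j<p. (hterm l j x)\<^sup>2)"

lemma all_moments_S: "all_moments (PiM I M) (S j)"
  using all_moments_linear_form[OF subset_refl] unfolding S_def by simp

lemma all_moments_hterm: "all_moments (PiM I M) (hterm l j)"
  using P.all_moments_hermite_hom[OF all_moments_S] unfolding hterm_def by simp

lemma all_moments_Fsum: "all_moments (PiM I M) (Fsum l)"
  using P.all_moments_sum[of "{..<p}" "hterm l"] all_moments_hterm unfolding Fsum_def by simp

lemma all_moments_Wsum: "all_moments (PiM I M) (Wsum l)"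
  using P.all_moments_sum[of "{..<p}" "\<lambda>j x. (hterm l j x)\<^sup>2"] P.all_moments_power[OF all_moments_hterm]
  unfolding Wsum_def by simp

lemma even_moment_S_le:
  assumes "j < p" "even m"
  shows "(\<integral>x. \<bar>S j x\<bar> ^ m \<partial>PiM I M) \<le> 2 * fact m * (2 * K * b) ^ m"
  unfolding S_def
  by (rule even_moment_linear_form_le)
    (use B_col[OF assms(1)] b_pos K_ge assms(2) in \<open>auto simp: power_mult_distrib mult_left_mono\<close>)

lemma moment_hterm_le:
  assumes j: "j < p" and q: "even q" "q > 0"
  shows "(\<integral>x. hterm l j x ^ q \<partial>PiM I M) \<le> (12 * real (q * l) * K * b) ^ (q * l)"
proof (cases "l = 0")
  case True
  then show ?thesis by (simp add: hterm_def P.prob_space)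
next
  case False
  define m where "m = q * l"
  have m: "even m" "m \<ge> 1" "l \<le> m" using False q by (auto simp: m_def)
  have iS: "integrable (PiM I M) (\<lambda>x. \<bar>S j x\<bar> ^ m)"
    using all_moments_S[of j] by (simp add: all_moments_def)
  have "(\<integral>x. hterm l j x ^ q \<partial>PiM I M) \<le> (\<integral>x. 2 ^ m * (\<bar>S j x\<bar> ^ m + (real l * b) ^ m) \<partial>PiM I M)"
  proof (rule integral_mono)
    show "integrable (PiM I M) (\<lambda>x. hterm l j x ^ q)"
      by (rule all_moments_integrable_power[OF all_moments_hterm])
    show "integrable (PiM I M) (\<lambda>x. 2 ^ m * (\<bar>S j x\<bar> ^ m + (real l * b) ^ m))"
      using iS by simp
    fix x
    have "hterm l j x ^ q = \<bar>hterm l j x\<bar> ^ q" using q by (simp add: power_even_abs)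
    also have "\<dots> \<le> ((\<bar>S j x\<bar> + real l * \<tau> j) ^ l) ^ q"
      unfolding hterm_def using \<tau>[OF j] by (intro power_mono abs_hermite_hom_le) auto
    also have "\<dots> = (\<bar>S j x\<bar> + real l * \<tau> j) ^ m" by (simp add: m_def power_mult[symmetric] mult.commute)
    also have "\<dots> \<le> (2 * max \<bar>S j x\<bar> (real l * b)) ^ m"
    proof (rule power_mono)
      have "real l * \<tau> j \<le> real l * b" using \<tau>[OF j] by (intro mult_left_mono) auto
      then show "\<bar>S j x\<bar> + real l * \<tau> j \<le> 2 * max \<bar>S j x\<bar> (real l * b)" by linarith
    qed (use \<tau>[OF j] in auto)
    also have "\<dots> = 2 ^ m * max \<bar>S j x\<bar> (real l * b) ^ m" by (simp add: power_mult_distrib)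
    also have "max \<bar>S j x\<bar> (real l * b) ^ m \<le> \<bar>S j x\<bar> ^ m + (real l * b) ^ m"
      using b_pos by (auto simp: max_def)
    finally show "hterm l j x ^ q \<le> 2 ^ m * (\<bar>S j x\<bar> ^ m + (real l * b) ^ m)" by simp
  qed
  also have "\<dots> = 2 ^ m * ((\<integral>x. \<bar>S j x\<bar> ^ m \<partial>PiM I M) + (real l * b) ^ m)"
    using iS by (simp add: P.prob_space)
  also have "\<dots> \<le> 2 ^ m * (2 * fact m * (2 * K * b) ^ m + (real l * b) ^ m)"
    using even_moment_S_le[OF j m(1)] by simp
  also have "\<dots> \<le> 2 ^ m * (2 * (real m ^ m) * (2 * K * b) ^ m + (2 * real m * K * b) ^ m)"
  proof (intro mult_left_mono add_mono mult_right_mono power_mono)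
    show "fact m \<le> real m ^ m" using fact_le_power[of m, where 'a=real] by simp
    have "real l * 1 \<le> real m * (2 * K)" using m K_ge by (intro mult_mono) auto
    then show "real l \<le> 2 * real m * K" by (simp add: mult_ac)
  qed (use b_pos K_ge in auto)
  also have "\<dots> = 3 * (4 * real m * K * b) ^ m"
    by (simp add: power_mult_distrib mult_ac flip: power_mult_distrib)
  also have "\<dots> \<le> 3 ^ m * (4 * real m * K * b) ^ m"
    using m(2) b_pos K_ge self_le_power[of "3::real" m] by (intro mult_right_mono) auto
  also have "\<dots> = (12 * real m * K * b) ^ m" by (simp add: power_mult_distrib[symmetric] mult_ac)
  finally show ?thesis by (simp add: m_def)
qed

lemma moment_component_le:
  assumes "s \<in> I" "even m"
  shows "(\<integral>x. x s ^ m \<partial>PiM I M) \<le> (real m * K) ^ m"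
proof -
  have "(\<integral>x. x s ^ m \<partial>PiM I M) = (\<integral>x. x ^ m \<partial>M s)"
    by (rule component_integral[of s I "\<lambda>x. x ^ m"]) (use assms in auto)
  also have "\<dots> \<le> fact m * K ^ m" using moment_M[OF assms(1), of m] by simp
  also have "\<dots> \<le> real m ^ m * K ^ m"
    using fact_le_power[of m, where 'a=real] K_ge by (intro mult_right_mono) auto
  finally show ?thesis by (simp add: power_mult_distrib)
qed

text \<open>One constant for all orders up to \<open>L\<close>. The 48 is 12 * 4: the base in
  \<open>moment_hterm_le\<close> is \<open>12 * real (q * l) * K * b\<close>, and exponents
  \<open>q \<le> 4\<close> suffice.\<close>

context
  fixes L :: nat and \<Omega> :: real
  assumes L: "L \<ge> 1" and \<Omega>_def: "\<Omega> = (48 * real L * K) ^ L"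
begin

lemma \<Omega>_ge_1: "\<Omega> \<ge> 1"
proof -
  have "1 * 1 \<le> real L * K" using L K_ge by (intro mult_mono) auto
  then show ?thesis unfolding \<Omega>_def by (intro one_le_power) auto
qed

lemma moment_hterm_le_\<Omega>:
  assumes j: "j < p" and l: "l \<le> L" and q: "even q" "q > 0" "q \<le> 4"
  shows "(\<integral>x. hterm l j x ^ q \<partial>PiM I M) \<le> \<Omega> ^ q * b ^ (q * l)"
proof (cases "l = 0")
  case True
  then show ?thesis using \<Omega>_ge_1 by (simp add: hterm_def P.prob_space)
next
  case False
  have LK: "1 * 1 \<le> real L * K" using L K_ge by (intro mult_mono) auto
  have "(\<integral>x. hterm l j x ^ q \<partial>PiM I M) \<le> (12 * real (q * l) * K * b) ^ (q * l)"
    by (rule moment_hterm_le[OF j q(1,2)])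
  also have "\<dots> = (12 * real (q * l) * K) ^ (q * l) * b ^ (q * l)" by (simp add: power_mult_distrib)
  also have "(12 * real (q * l) * K) ^ (q * l) \<le> (48 * real L * K) ^ (q * L)"
  proof -
    have "real q * real l \<le> 4 * real L" using q l by (intro mult_mono) auto
    then have "12 * real (q * l) * K \<le> 48 * real L * K" using K_ge by (intro mult_right_mono) (auto simp: mult.commute)
    then have "(12 * real (q * l) * K) ^ (q * l) \<le> (48 * real L * K) ^ (q * l)"
      using K_ge by (intro power_mono) auto
    also have "\<dots> \<le> (48 * real L * K) ^ (q * L)" using LK l by (intro power_increasing) auto
    finally show ?thesis .
  qed
  also have "(48 * real L * K) ^ (q * L) = \<Omega> ^ q" by (simp add: \<Omega>_def power_mult[symmetric] mult.commute)
  finally show ?thesis using b_pos by simp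
qed

lemma expectation_Wsum_le:
  assumes l: "l \<le> L"
  shows "(\<integral>x. Wsum l x \<partial>PiM I M) \<le> real p * \<Omega>\<^sup>2 * b ^ (2 * l)"
proof -
  have "(\<integral>x. Wsum l x \<partial>PiM I M) = (\<Sum>j<p. \<integral>x. (hterm l j x)\<^sup>2 \<partial>PiM I M)"
    unfolding Wsum_def
    by (rule Bochner_Integration.integral_sum) (rule all_moments_integrable_power[OF all_moments_hterm])
  also have "\<dots> \<le> (\<Sum>j<p. \<Omega>\<^sup>2 * b ^ (2 * l))"
    by (intro sum_mono) (use moment_hterm_le_\<Omega>[OF _ l, of _ 2] in simp)
  finally show ?thesis by (simp add: mult_ac)
qed

lemma expectation_Wsum_square_le:
  assumes l: "l \<le> L"
  shows "(\<integral>x. (Wsum l x)\<^sup>2 \<partial>PiM I M) \<le> (real p)\<^sup>2 * \<Omega> ^ 4 * b ^ (4 * l)"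
proof -
  have i: "integrable (PiM I M) (\<lambda>x. hterm l j x ^ 4)" for j
    by (rule all_moments_integrable_power[OF all_moments_hterm])
  have "(\<integral>x. (Wsum l x)\<^sup>2 \<partial>PiM I M) \<le> (\<integral>x. real p * (\<Sum>j<p. hterm l j x ^ 4) \<partial>PiM I M)"
  proof (rule integral_mono)
    show "integrable (PiM I M) (\<lambda>x. (Wsum l x)\<^sup>2)"
      by (rule all_moments_integrable_power[OF all_moments_Wsum])
    show "integrable (PiM I M) (\<lambda>x. real p * (\<Sum>j<p. hterm l j x ^ 4))"
      using i by simp
    fix x
    have "(Wsum l x)\<^sup>2 = (\<Sum>j<p. 1 * (hterm l j x)\<^sup>2)\<^sup>2" by (simp add: Wsum_def)
    also have "\<dots> \<le> (\<Sum>j<p. 1\<^sup>2) * (\<Sum>j<p. ((hterm l j x)\<^sup>2)\<^sup>2)" by (rule Cauchy_Schwarz_ineq_sum)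
    finally show "(Wsum l x)\<^sup>2 \<le> real p * (\<Sum>j<p. hterm l j x ^ 4)" by simp
  qed
  also have "\<dots> = real p * (\<Sum>j<p. \<integral>x. hterm l j x ^ 4 \<partial>PiM I M)"
    using i by simp
  also have "\<dots> \<le> real p * (\<Sum>j<p. \<Omega> ^ 4 * b ^ (4 * l))"
    by (intro mult_left_mono sum_mono) (use moment_hterm_le_\<Omega>[OF _ l, of _ 4] in auto)
  finally show ?thesis by (simp add: power2_eq_square mult_ac)
qed

text \<open>The two factors are dependent, so they are separated by a weighted AM-GM inequality, at
  the price of an eighth power of the coordinate and the square of \<open>Wsum\<close>.\<close>

lemma expectation_component_Wsum_le:
  assumes s: "s \<in> I" and i: "i \<le> L" and l: "l \<le> L"
  shows "(\<integral>x. x s ^ (4 * i) * Wsum l x \<partial>PiM I M) \<le> real p * \<Omega> ^ 6 * b ^ (2 * l)"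
proof -
  \<comment> \<open>The weight that balances AM-GM: the bound
    \<open>real p * \<Omega>\<^sup>2 * b ^ (2 * l)\<close> for the root mean square of
    \<open>Wsum\<close>, divided by the bound \<open>\<Omega> ^ 4\<close> for that of the power of
    \<open>x s\<close>.\<close>
  define \<alpha> where "\<alpha> = real p * b ^ (2 * l) / \<Omega>\<^sup>2"
  have \<alpha>: "\<alpha> > 0" using p_pos b_pos \<Omega>_ge_1 by (simp add: \<alpha>_def)
  have ix: "integrable (PiM I M) (\<lambda>x. x s ^ m)" for m
    by (rule all_moments_integrable_power[OF all_moments_component[OF s subset_refl]])
  have iW: "integrable (PiM I M) (\<lambda>x. (Wsum l x)\<^sup>2)"
    by (rule all_moments_integrable_power[OF all_moments_Wsum])
  have "(\<integral>x. x s ^ (4 * i) * Wsum l x \<partial>PiM I M) \<le> (\<integral>x. \<alpha> / 2 * x s ^ (8 * i) + 1 / (2 * \<alpha>) * (Wsum l x)\<^sup>2 \<partial>PiM I M)"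
  proof (rule integral_mono)
    show "integrable (PiM I M) (\<lambda>x. x s ^ (4 * i) * Wsum l x)"
      by (rule all_moments_integrable[OF all_moments_mult[OF P.all_moments_power all_moments_Wsum]])
        (rule all_moments_component[OF s subset_refl])
    show "integrable (PiM I M) (\<lambda>x. \<alpha> / 2 * x s ^ (8 * i) + 1 / (2 * \<alpha>) * (Wsum l x)\<^sup>2)"
      using ix iW by simp
    fix x :: "'i \<Rightarrow> real"
    have "0 \<le> (\<alpha> * x s ^ (4 * i) - Wsum l x)\<^sup>2 / (2 * \<alpha>)" using \<alpha> by simp
    also have "\<dots> = \<alpha> / 2 * (x s ^ (4 * i))\<^sup>2 + 1 / (2 * \<alpha>) * (Wsum l x)\<^sup>2 - x s ^ (4 * i) * Wsum l x"
      using \<alpha> by (simp add: power2_eq_square field_simps)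
    also have "(x s ^ (4 * i))\<^sup>2 = x s ^ (8 * i)" by (simp add: power_mult[symmetric] mult.commute)
    finally show "x s ^ (4 * i) * Wsum l x \<le> \<alpha> / 2 * x s ^ (8 * i) + 1 / (2 * \<alpha>) * (Wsum l x)\<^sup>2" by simp
  qed
  also have "\<dots> = \<alpha> / 2 * (\<integral>x. x s ^ (8 * i) \<partial>PiM I M) + 1 / (2 * \<alpha>) * (\<integral>x. (Wsum l x)\<^sup>2 \<partial>PiM I M)"
    using ix iW by simp
  also have "\<dots> \<le> \<alpha> / 2 * \<Omega> ^ 8 + 1 / (2 * \<alpha>) * ((real p)\<^sup>2 * \<Omega> ^ 4 * b ^ (4 * l))"
  proof (intro add_mono mult_left_mono expectation_Wsum_square_le l)
    have LK: "1 * 1 \<le> real L * K" using L K_ge by (intro mult_mono) auto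
    have "(\<integral>x. x s ^ (8 * i) \<partial>PiM I M) \<le> (real (8 * i) * K) ^ (8 * i)"
      by (rule moment_component_le[OF s]) simp
    also have "\<dots> \<le> (48 * real L * K) ^ (8 * i)"
      using i K_ge by (intro power_mono mult_right_mono) auto
    also have "\<dots> \<le> (48 * real L * K) ^ (8 * L)" using LK i by (intro power_increasing) auto
    also have "\<dots> = \<Omega> ^ 8" by (simp add: \<Omega>_def power_mult[symmetric] mult.commute)
    finally show "(\<integral>x. x s ^ (8 * i) \<partial>PiM I M) \<le> \<Omega> ^ 8" .
  qed (use \<alpha> in auto)
  also have "\<alpha> / 2 * \<Omega> ^ 8 = real p * \<Omega> ^ 6 * b ^ (2 * l) / 2"
    using \<Omega>_ge_1 by (simp add: \<alpha>_def field_simps power2_eq_square flip: power_Suc)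
  also have "1 / (2 * \<alpha>) * ((real p)\<^sup>2 * \<Omega> ^ 4 * b ^ (4 * l)) = real p * \<Omega> ^ 6 * b ^ (2 * l) / 2"
  proof -
    have "b ^ (4 * l) = b ^ (2 * l) * b ^ (2 * l)" by (simp add: power_add[symmetric])
    moreover have "\<Omega> ^ 6 = \<Omega>\<^sup>2 * \<Omega> ^ 4" by (simp add: power_add[symmetric])
    ultimately show ?thesis
      using p_pos b_pos \<Omega>_ge_1 by (simp add: \<alpha>_def field_simps power2_eq_square)
  qed
  finally show ?thesis by simp
qed

lemma sum_binomial_square_le: "(\<Sum>i\<in>{1..l}. (real (l choose i))\<^sup>2) \<le> 4 ^ l"
proof -
  have "(\<Sum>i\<in>{1..l}. (real (l choose i))\<^sup>2) \<le> (\<Sum>i\<in>{1..l}. real (l choose i) * 2 ^ l)"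
  proof (rule sum_mono)
    fix i assume "i \<in> {1..l}"
    then have "l choose i \<le> (\<Sum>i\<le>l. l choose i)" by (intro member_le_sum) auto
    then have "real (l choose i) \<le> 2 ^ l" unfolding choose_row_sum by (metis numeral_power_eq_of_nat_cancel_iff of_nat_le_iff)
    then show "(real (l choose i))\<^sup>2 \<le> real (l choose i) * 2 ^ l"
      unfolding power2_eq_square by (intro mult_left_mono) auto
  qed
  also have "\<dots> = real (\<Sum>i\<in>{1..l}. l choose i) * 2 ^ l" by (simp add: sum_distrib_right)
  also have "\<dots> \<le> real (\<Sum>i\<le>l. l choose i) * 2 ^ l"
    by (intro mult_right_mono of_nat_mono sum_mono2) auto
  also have "\<dots> = 4 ^ l" unfolding choose_row_sum by (simp add: power_mult_distrib[symmetric])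
  finally show ?thesis .
qed

text \<open>Up to a binomial coefficient and a power of \<open>- x s\<close>, the term of order
  \<open>i\<close> in the change of \<open>Fsum\<close> when coordinate \<open>s\<close> is set to
  0.\<close>

definition usum :: "nat \<Rightarrow> nat \<Rightarrow> 'i \<Rightarrow> ('i \<Rightarrow> real) \<Rightarrow> real" where
  "usum l i s x = (\<Sum>j<p. B s j ^ i * hterm (l - i) j x)"

lemma all_moments_usum: "all_moments (PiM I M) (usum l i s)"
  using P.all_moments_sum[of "{..<p}" "\<lambda>j x. B s j ^ i * hterm (l - i) j x"] P.all_moments_cmult[OF all_moments_hterm]
  unfolding usum_def by simp

text \<open>Deleting a coordinate shifts the linear form of column \<open>j\<close> by
  \<open>- B s j * x s\<close>; the Appell expansion then has \<open>Fsum l x\<close> as its term of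
  order 0.\<close>

lemma Fsum_zero_coordinate:
  assumes "s \<in> I"
  shows "Fsum l (x(s := 0)) = Fsum l x + (\<Sum>i\<in>{1..l}. real (l choose i) * (- x s) ^ i * usum l i s x)"
proof -
  have shift: "S j (x(s := 0)) = S j x + - (B s j * x s)" for j
  proof -
    have "S j (x(s := 0)) = (\<Sum>t\<in>I - {s}. B t j * x t)"
      unfolding S_def linear_form_def using finite_I assms
      by (subst sum.remove[of _ s]) auto
    also have "\<dots> = S j x - B s j * x s"
      unfolding S_def linear_form_def using finite_I assms
      by (subst (2) sum.remove[of _ s]) auto
    finally show ?thesis by simp
  qed
  have "Fsum l (x(s := 0)) = (\<Sum>j<p. \<Sum>i\<le>l. real (l choose i) * (- (B s j * x s)) ^ i * hterm (l - i) j x)"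
    by (simp only: Fsum_def hterm_def shift hermite_hom_add)
  also have "\<dots> = (\<Sum>i\<le>l. real (l choose i) * (- x s) ^ i * usum l i s x)"
    by (subst sum.swap) (simp add: usum_def sum_distrib_left power_mult_distrib mult_ac power_minus[of "x s * _"] power_minus[of "_ * x s"] power_minus[of "x s"])
  also have "\<dots> = Fsum l x + (\<Sum>i\<in>{1..l}. real (l choose i) * (- x s) ^ i * usum l i s x)"
  proof -
    have "{..l} = insert 0 {1..l}" by auto
    then show ?thesis by (simp add: usum_def Fsum_def)
  qed
  finally show ?thesis .
qed

text \<open>Efron-Stein, with coordinate \<open>s\<close> set to 0 as the leave-one-out version. The
  weights \<open>x s ^ (2 * i)\<close> depend on the same variables as \<open>usum\<close>, so they
  are first bounded by \<open>r + x s ^ (4 * i) / r\<close>. The constant part allows the operator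
  bound for all \<open>s\<close> at once and has total order r p; the random part needs the bound
  row by row and has total order p^2 / r. The choice r = sqrt p balances them.\<close>

lemma variance_Fsum_le:
  assumes l: "1 \<le> l" "l \<le> L"
  shows "(\<integral>x. (Fsum l x - (\<integral>x. Fsum l x \<partial>PiM I M))\<^sup>2 \<partial>PiM I M)
    \<le> 2 * real l * 4 ^ l * \<Omega> ^ 6 * (real p * sqrt (real p)) * b ^ (2 * l)"
proof -
  define r where "r = sqrt (real p)"
  have r: "r > 0" "r * r = real p" using p_pos by (auto simp: r_def)
  define D where "D = (\<lambda>s x. \<Sum>i\<in>{1..l}. real (l choose i) * (- x s) ^ i * usum l i s x)"
  have am_comp: "all_moments (PiM I M) (\<lambda>x. x s)" if "s \<in> I" for s
    by (rule all_moments_component[OF that subset_refl])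
  have am_D: "all_moments (PiM I M) (D s)" if "s \<in> I" for s
  proof -
    have "all_moments (PiM I M) (\<lambda>x. \<Sum>i\<in>{1..l}. real (l choose i) * ((- 1) ^ i * x s ^ i * usum l i s x))"
      by (intro P.all_moments_sum P.all_moments_cmult all_moments_mult P.all_moments_power am_comp that all_moments_usum)
    then show ?thesis by (simp add: D_def power_minus[of "_ s"] mult.assoc)
  qed
  have zero: "(\<lambda>x. Fsum l (x(s := 0))) = (\<lambda>x. Fsum l x + D s x)" if "s \<in> I" for s
    unfolding D_def using Fsum_zero_coordinate[OF that] by auto
  have am0: "all_moments (PiM I M) (\<lambda>x. Fsum l (x(s := 0)))" if "s \<in> I" for s
    unfolding zero[OF that] by (intro all_moments_add all_moments_Fsum am_D that)
  \<comment> \<open>The two parts after summation over \<open>s\<close>: only \<open>Wsum\<close>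
    and \<open>x s ^ (4 * i) * Wsum\<close> remain to be integrated.\<close>
  define T where "T = (\<lambda>i x. r * b ^ (2 * i) * Wsum (l - i) x +
     1 / r * (\<Sum>s\<in>I. b ^ (2 * i - 2) * (\<Sum>j<p. (B s j)\<^sup>2) * (x s ^ (4 * i) * Wsum (l - i) x)))"
  have am_W: "all_moments (PiM I M) (\<lambda>x. x s ^ (4 * i) * Wsum (l - i) x)" if "s \<in> I" for s i
    by (intro all_moments_mult P.all_moments_power am_comp that all_moments_Wsum)
  have am_T: "all_moments (PiM I M) (T i)" for i
    unfolding T_def by (intro all_moments_add P.all_moments_cmult all_moments_Wsum P.all_moments_sum am_W)
  have pointwise: "(\<Sum>s\<in>I. (D s x)\<^sup>2) \<le> (\<Sum>i\<in>{1..l}. real l * (real (l choose i))\<^sup>2 * T i x)" for x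
  proof -
    have "(D s x)\<^sup>2 \<le> real l * (\<Sum>i\<in>{1..l}. (real (l choose i))\<^sup>2 * (x s ^ (2 * i) * (usum l i s x)\<^sup>2))" for s
    proof -
      have "(D s x)\<^sup>2 = (\<Sum>i\<in>{1..l}. 1 * (real (l choose i) * (- x s) ^ i * usum l i s x))\<^sup>2"
        by (simp add: D_def)
      also have "\<dots> \<le> (\<Sum>i\<in>{1..l}. 1\<^sup>2) * (\<Sum>i\<in>{1..l}. (real (l choose i) * (- x s) ^ i * usum l i s x)\<^sup>2)"
        by (rule Cauchy_Schwarz_ineq_sum)
      also have "\<dots> = real l * (\<Sum>i\<in>{1..l}. (real (l choose i))\<^sup>2 * (x s ^ (2 * i) * (usum l i s x)\<^sup>2))"
        by (simp add: power_mult_distrib power_mult[symmetric] mult.commute[of _ 2] mult.assoc)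
      finally show ?thesis .
    qed
    then have "(\<Sum>s\<in>I. (D s x)\<^sup>2) \<le> (\<Sum>s\<in>I. real l * (\<Sum>i\<in>{1..l}. (real (l choose i))\<^sup>2 * (x s ^ (2 * i) * (usum l i s x)\<^sup>2)))"
      by (rule sum_mono)
    also have "\<dots> = (\<Sum>i\<in>{1..l}. real l * (real (l choose i))\<^sup>2 * (\<Sum>s\<in>I. x s ^ (2 * i) * (usum l i s x)\<^sup>2))"
      by (simp add: sum_distrib_left mult.assoc) (subst sum.swap, simp)
    also have "\<dots> \<le> (\<Sum>i\<in>{1..l}. real l * (real (l choose i))\<^sup>2 * T i x)"
    proof (intro sum_mono mult_left_mono)
      fix i assume i: "i \<in> {1..l}"
      have "x s ^ (2 * i) * (usum l i s x)\<^sup>2 \<le> r * (usum l i s x)\<^sup>2 +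
         1 / r * (b ^ (2 * i - 2) * (\<Sum>j<p. (B s j)\<^sup>2) * (x s ^ (4 * i) * Wsum (l - i) x))" if s: "s \<in> I" for s
      proof -
        have x4: "(x s ^ (2 * i))\<^sup>2 = x s ^ (4 * i)" by (simp add: power_mult[symmetric] mult.commute)
        have "0 \<le> x s ^ (2 * i)" by (simp add: power_mult)
        moreover have "0 \<le> (x s ^ (2 * i) - r)\<^sup>2 / r" using r by simp
        then have "2 * x s ^ (2 * i) \<le> r + x s ^ (4 * i) / r"
          using r unfolding x4[symmetric] by (simp add: power2_eq_square field_simps)
        ultimately have "x s ^ (2 * i) \<le> r + x s ^ (4 * i) / r" by linarith
        then have "x s ^ (2 * i) * (usum l i s x)\<^sup>2 \<le> (r + x s ^ (4 * i) / r) * (usum l i s x)\<^sup>2"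
          by (intro mult_right_mono) auto
        also have "\<dots> = r * (usum l i s x)\<^sup>2 + x s ^ (4 * i) / r * (usum l i s x)\<^sup>2"
          by (simp add: algebra_simps)
        also have "x s ^ (4 * i) / r * (usum l i s x)\<^sup>2 \<le>
            x s ^ (4 * i) / r * (b ^ (2 * i - 2) * (\<Sum>j<p. (B s j)\<^sup>2) * Wsum (l - i) x)"
          unfolding usum_def Wsum_def using i r b_pos
          by (intro mult_left_mono row_power_bound B_entry s) (auto simp: x4[symmetric])
        finally show ?thesis by (simp add: mult_ac)
      qed
      then have "(\<Sum>s\<in>I. x s ^ (2 * i) * (usum l i s x)\<^sup>2) \<le> (\<Sum>s\<in>I. r * (usum l i s x)\<^sup>2 +
         1 / r * (b ^ (2 * i - 2) * (\<Sum>j<p. (B s j)\<^sup>2) * (x s ^ (4 * i) * Wsum (l - i) x)))"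
        by (rule sum_mono)
      also have "\<dots> = r * (\<Sum>s\<in>I. (usum l i s x)\<^sup>2) + 1 / r * (\<Sum>s\<in>I. b ^ (2 * i - 2) * (\<Sum>j<p. (B s j)\<^sup>2) * (x s ^ (4 * i) * Wsum (l - i) x))"
        by (simp only: sum.distrib sum_distrib_left)
      also have "r * (\<Sum>s\<in>I. (usum l i s x)\<^sup>2) \<le> r * (b ^ (2 * i) * Wsum (l - i) x)"
        unfolding usum_def Wsum_def using i r b_pos
        by (intro mult_left_mono sum_power_op_bound finite_I B_op B_row B_col B_entry) auto
      finally show "(\<Sum>s\<in>I. x s ^ (2 * i) * (usum l i s x)\<^sup>2) \<le> T i x"
        by (simp add: T_def mult.assoc)
    qed auto
    finally show ?thesis .
  qed
  have ET: "(\<integral>x. T i x \<partial>PiM I M) \<le> 2 * \<Omega> ^ 6 * (real p * r) * b ^ (2 * l)" if i: "i \<in> {1..l}" for i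
  proof -
    have iW: "integrable (PiM I M) (Wsum (l - i))" by (rule all_moments_integrable[OF all_moments_Wsum])
    have ixW: "integrable (PiM I M) (\<lambda>x. x s ^ (4 * i) * Wsum (l - i) x)" if "s \<in> I" for s
      by (rule all_moments_integrable[OF am_W[OF that]])
    have "2 * l = 2 * i + 2 * (l - i)" using i by auto
    then have il: "b ^ (2 * l) = b ^ (2 * i) * b ^ (2 * (l - i))" by (metis power_add)
    have "2 * i = (2 * i - 2) + 2" using i by auto
    then have ib: "b ^ (2 * i) = b ^ (2 * i - 2) * b\<^sup>2" by (metis power_add)
    have pr: "real p / r = r" using r by (simp add: field_simps)
    have "(\<integral>x. T i x \<partial>PiM I M) = r * b ^ (2 * i) * (\<integral>x. Wsum (l - i) x \<partial>PiM I M) +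
     1 / r * (\<Sum>s\<in>I. b ^ (2 * i - 2) * (\<Sum>j<p. (B s j)\<^sup>2) * (\<integral>x. x s ^ (4 * i) * Wsum (l - i) x \<partial>PiM I M))"
      unfolding T_def using iW ixW by (simp del: times_divide_eq_left)
    also have "\<dots> \<le> r * b ^ (2 * i) * (real p * \<Omega>\<^sup>2 * b ^ (2 * (l - i))) +
     1 / r * (\<Sum>s\<in>I. b ^ (2 * i - 2) * (\<Sum>j<p. (B s j)\<^sup>2) * (real p * \<Omega> ^ 6 * b ^ (2 * (l - i))))"
      using l i r b_pos
      by (intro add_mono mult_left_mono sum_mono expectation_Wsum_le expectation_component_Wsum_le)
        (auto intro!: sum_nonneg mult_nonneg_nonneg)
    also have "(\<Sum>s\<in>I. b ^ (2 * i - 2) * (\<Sum>j<p. (B s j)\<^sup>2) * (real p * \<Omega> ^ 6 * b ^ (2 * (l - i))))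
      = b ^ (2 * i - 2) * (\<Sum>j<p. \<Sum>s\<in>I. (B s j)\<^sup>2) * (real p * \<Omega> ^ 6 * b ^ (2 * (l - i)))"
      by (subst sum.swap) (simp only: sum_distrib_left sum_distrib_right)
    also have "\<dots> \<le> b ^ (2 * i - 2) * (\<Sum>j<p. b\<^sup>2) * (real p * \<Omega> ^ 6 * b ^ (2 * (l - i)))"
      using B_col \<Omega>_ge_1 b_pos by (intro mult_left_mono mult_right_mono sum_mono) auto
    also have "\<dots> = real p * real p * \<Omega> ^ 6 * b ^ (2 * l)"
      by (simp only: sum_constant card_lessThan il ib) (simp add: mult_ac)
    also have "r * b ^ (2 * i) * (real p * \<Omega>\<^sup>2 * b ^ (2 * (l - i))) = \<Omega>\<^sup>2 * (real p * r * b ^ (2 * l))"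
      by (simp only: il) (simp only: mult_ac)
    also have "\<Omega>\<^sup>2 * (real p * r * b ^ (2 * l)) \<le> \<Omega> ^ 6 * (real p * r * b ^ (2 * l))"
      using \<Omega>_ge_1 r b_pos by (intro mult_right_mono power_increasing) auto
    also have "1 / r * (real p * real p * \<Omega> ^ 6 * b ^ (2 * l)) = (real p / r) * real p * \<Omega> ^ 6 * b ^ (2 * l)"
      by simp
    finally show ?thesis using r b_pos \<Omega>_ge_1 unfolding pr by (simp add: mult_ac divide_right_mono)
  qed
  have "(\<integral>x. (Fsum l x - (\<integral>x. Fsum l x \<partial>PiM I M))\<^sup>2 \<partial>PiM I M)
     \<le> (\<Sum>s\<in>I. \<integral>x. (Fsum l x - Fsum l (x(s := 0)))\<^sup>2 \<partial>PiM I M)"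
    by (rule Efron_Stein[where h="\<lambda>s x. Fsum l (x(s := 0))"])
      (auto intro: finite_I all_moments_measurable all_moments_Fsum am0 all_moments_integrable_power)
  also have "\<dots> = (\<Sum>s\<in>I. \<integral>x. (D s x)\<^sup>2 \<partial>PiM I M)"
  proof (intro sum.cong refl)
    fix s assume "s \<in> I"
    from fun_cong[OF zero[OF this]]
    show "(\<integral>x. (Fsum l x - Fsum l (x(s := 0)))\<^sup>2 \<partial>PiM I M) = (\<integral>x. (D s x)\<^sup>2 \<partial>PiM I M)" by simp
  qed
  also have "\<dots> = (\<integral>x. (\<Sum>s\<in>I. (D s x)\<^sup>2) \<partial>PiM I M)"
    by (intro Bochner_Integration.integral_sum[symmetric] all_moments_integrable_power am_D)
  also have "\<dots> \<le> (\<integral>x. (\<Sum>i\<in>{1..l}. real l * (real (l choose i))\<^sup>2 * T i x) \<partial>PiM I M)"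
    by (intro integral_mono pointwise all_moments_integrable P.all_moments_sum P.all_moments_cmult P.all_moments_power am_D am_T)
  also have "\<dots> = (\<Sum>i\<in>{1..l}. real l * (real (l choose i))\<^sup>2 * (\<integral>x. T i x \<partial>PiM I M))"
    using all_moments_integrable[OF am_T] by simp
  also have "\<dots> \<le> (\<Sum>i\<in>{1..l}. real l * (real (l choose i))\<^sup>2 * (2 * \<Omega> ^ 6 * (real p * r) * b ^ (2 * l)))"
    by (intro sum_mono mult_left_mono ET) auto
  also have "\<dots> = real l * (2 * \<Omega> ^ 6 * (real p * r) * b ^ (2 * l)) * (\<Sum>i\<in>{1..l}. (real (l choose i))\<^sup>2)"
    by (simp add: sum_distrib_left mult_ac)
  also have "\<dots> \<le> real l * (2 * \<Omega> ^ 6 * (real p * r) * b ^ (2 * l)) * 4 ^ l"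
    using r b_pos \<Omega>_ge_1 by (intro mult_left_mono sum_binomial_square_le) auto
  finally show ?thesis by (simp add: r_def mult_ac)
qed

end

end

section \<open>Combinatorics of the moment recursion\<close>

text \<open>\<open>compositions2\<close> with the length left free, as the coefficients of a product
  of series require; \<open>parts2_eq_UN\<close> sorts by length again.\<close>

definition parts2 :: "nat \<Rightarrow> nat list set" where
  "parts2 l = {ds. sum_list ds = l \<and> (\<forall>d\<in>set ds. 2 \<le> d)}"

text \<open>For \<open>c s d = x s ^ d\<close> this is the monomial quasisymmetric polynomial of the
  composition \<open>ds\<close> in \<open>p\<close> variables.\<close>

definition tuple_sum :: "(nat \<Rightarrow> nat \<Rightarrow> real) \<Rightarrow> nat \<Rightarrow> nat list \<Rightarrow> real" where
  "tuple_sum c p ds = (\<Sum>s\<in>increasing_tuples p (length ds). \<Prod>i<length ds. c (s ! i) (ds ! i))"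

lemma length_le_sum_list: "\<forall>d\<in>set ds. (2::nat) \<le> d \<Longrightarrow> 2 * length ds \<le> sum_list ds"
  by (induction ds) auto

lemma parts2_eq_UN: "parts2 l = (\<Union>t\<in>{..l}. compositions2 l t)"
  using length_le_sum_list by (fastforce simp: parts2_def compositions2_def)

lemma finite_parts2: "finite (parts2 l)"
  by (simp add: parts2_eq_UN finite_compositions2)

lemma parts2_0: "parts2 0 = {[]}"
proof -
  have "ds = []" if "sum_list ds = 0" "\<forall>d\<in>set ds. (2::nat) \<le> d" for ds
    using that by (cases ds) auto
  then show ?thesis by (auto simp: parts2_def)
qed

text \<open>The last part belongs to the largest index of an increasing tuple, so splitting it off
  mirrors splitting the last factor off a product over \<open>s < Suc p\<close>.\<close>

lemma sum_parts2_snoc: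
  assumes "l \<ge> 1"
  shows "(\<Sum>ds\<in>parts2 l. f ds) = (\<Sum>d\<in>{2..l}. \<Sum>ds\<in>parts2 (l - d). f (ds @ [d]) :: real)"
proof -
  have "(\<Sum>d\<in>{2..l}. \<Sum>ds\<in>parts2 (l - d). f (ds @ [d])) = (\<Sum>(d, ds)\<in>(SIGMA d:{2..l}. parts2 (l - d)). f (ds @ [d]))"
    by (rule sum.Sigma) (auto simp: finite_parts2)
  also have "\<dots> = (\<Sum>ds\<in>parts2 l. f ds)"
  proof (rule sum.reindex_bij_witness[where j="\<lambda>(d, ds). ds @ [d]" and i="\<lambda>ds. (last ds, butlast ds)"])
    fix ds assume ds: "ds \<in> parts2 l"
    then have "ds \<noteq> []" using assms by (auto simp: parts2_def)
    then obtain es e where e: "ds = es @ [e]" by (metis rev_exhaust)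
    show "(case (last ds, butlast ds) of (d, ds) \<Rightarrow> ds @ [d]) = ds" using e by simp
    show "(last ds, butlast ds) \<in> (SIGMA d:{2..l}. parts2 (l - d))"
      using ds e by (auto simp: parts2_def)
  next
    fix z assume "z \<in> (SIGMA d:{2..l}. parts2 (l - d))"
    then show "(case z of (d, ds) \<Rightarrow> ds @ [d]) \<in> parts2 l"
      by (auto simp: parts2_def)
  qed auto
  finally show ?thesis ..
qed

lemma increasing_tuples_0: "increasing_tuples p 0 = {[]}"
  by (auto simp: increasing_tuples_def)

lemma increasing_tuples_0_Suc: "increasing_tuples 0 (Suc t) = {}"
  by (auto simp: increasing_tuples_def)

lemma increasing_tuples_Suc_Suc:
  "increasing_tuples (Suc p) (Suc t) = increasing_tuples p (Suc t) \<union> (\<lambda>s. s @ [p]) ` increasing_tuples p t"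
proof (intro equalityI subsetI)
  fix s assume s: "s \<in> increasing_tuples (Suc p) (Suc t)"
  then obtain q e where e: "s = q @ [e]" by (cases s rule: rev_exhaust) (auto simp: increasing_tuples_def)
  have q: "sorted_wrt (<) q" "\<forall>x\<in>set q. x < e" "length q = t" "e < Suc p"
    using s by (auto simp: e increasing_tuples_def sorted_wrt_append)
  show "s \<in> increasing_tuples p (Suc t) \<union> (\<lambda>s. s @ [p]) ` increasing_tuples p t"
  proof (cases "e = p")
    case True
    then have "q \<in> increasing_tuples p t" using q by (auto simp: increasing_tuples_def)
    then show ?thesis using True e by auto
  next
    case False
    then show ?thesis using q s by (auto simp: e increasing_tuples_def)
  qed
next
  fix s assume "s \<in> increasing_tuples p (Suc t) \<union> (\<lambda>s. s @ [p]) ` increasing_tuples p t"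
  then show "s \<in> increasing_tuples (Suc p) (Suc t)"
    by (auto simp: increasing_tuples_def sorted_wrt_append)
qed

lemma tuple_sum_Nil: "tuple_sum c p [] = 1"
  by (simp add: tuple_sum_def increasing_tuples_0)

lemma tuple_sum_0_snoc: "tuple_sum c 0 (ds @ [d]) = 0"
  by (simp add: tuple_sum_def increasing_tuples_0_Suc)

text \<open>Either the largest index is below \<open>p\<close>, or it equals \<open>p\<close> and
  carries the last part.\<close>

lemma tuple_sum_Suc_snoc:
  "tuple_sum c (Suc p) (ds @ [d]) = tuple_sum c p (ds @ [d]) + tuple_sum c p ds * c p d"
proof -
  let ?f = "\<lambda>s. \<Prod>i<length (ds @ [d]). c (s ! i) ((ds @ [d]) ! i)"
  have disj: "increasing_tuples p (Suc (length ds)) \<inter> (\<lambda>s. s @ [p]) ` increasing_tuples p (length ds) = {}"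
    by (auto simp: increasing_tuples_def)
  have inj: "inj_on (\<lambda>s. s @ [p]) (increasing_tuples p (length ds))" by (auto simp: inj_on_def)
  have "tuple_sum c (Suc p) (ds @ [d]) = (\<Sum>s\<in>increasing_tuples p (Suc (length ds)). ?f s)
      + (\<Sum>s\<in>(\<lambda>s. s @ [p]) ` increasing_tuples p (length ds). ?f s)"
    unfolding tuple_sum_def using disj
    by (simp only: length_append_singleton increasing_tuples_Suc_Suc)
      (rule sum.union_disjoint; simp add: finite_increasing_tuples)
  also have "(\<Sum>s\<in>(\<lambda>s. s @ [p]) ` increasing_tuples p (length ds). ?f s)
      = (\<Sum>s\<in>increasing_tuples p (length ds). ?f (s @ [p]))"
    by (rule sum.reindex[OF inj, unfolded comp_def])
  also have "\<dots> = (\<Sum>s\<in>increasing_tuples p (length ds). (\<Prod>i<length ds. c (s ! i) (ds ! i)) * c p d)"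
  proof (rule sum.cong[OF refl])
    fix s assume "s \<in> increasing_tuples p (length ds)"
    then have len: "length s = length ds" by (simp add: increasing_tuples_def)
    have "(\<Prod>i<length ds. c ((s @ [p]) ! i) ((ds @ [d]) ! i)) = (\<Prod>i<length ds. c (s ! i) (ds ! i))"
      using len by (intro prod.cong) (auto simp: nth_append)
    then show "?f (s @ [p]) = (\<Prod>i<length ds. c (s ! i) (ds ! i)) * c p d"
      using len by (simp add: nth_append)
  qed
  finally show ?thesis by (simp add: tuple_sum_def sum_distrib_right)
qed

text \<open>Expanding the product means choosing the factors that contribute a nonconstant term,
  listed in increasing order. As the linear coefficients vanish, each of them contributes degree at
  least 2.\<close>

lemma nth_prod_fps_eq_tuple_sum:
  fixes \<Phi> :: "nat \<Rightarrow> real fps"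
  assumes "\<And>s. \<Phi> s $ 0 = 1" "\<And>s. \<Phi> s $ 1 = 0"
  shows "(\<Prod>s<p. \<Phi> s) $ l = (\<Sum>ds\<in>parts2 l. tuple_sum (\<lambda>s d. \<Phi> s $ d) p ds)"
proof (induction p arbitrary: l)
  case 0
  show ?case
  proof (cases "l = 0")
    case True
    then show ?thesis by (simp add: parts2_0 tuple_sum_Nil)
  next
    case False
    then show ?thesis by (simp add: sum_parts2_snoc tuple_sum_0_snoc)
  qed
next
  case (Suc p)
  let ?T = "tuple_sum (\<lambda>s d. \<Phi> s $ d)"
  show ?case
  proof (cases "l = 0")
    case True
    have "(\<Prod>s<Suc p. \<Phi> s) $ 0 = 1"
      using assms(1) by (induction p) (simp_all add: fps_mult_nth)
    then show ?thesis using True by (simp add: parts2_0 tuple_sum_Nil)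
  next
    case False
    have "(\<Prod>s<Suc p. \<Phi> s) $ l = (\<Sum>d\<le>l. \<Phi> p $ d * (\<Prod>s<p. \<Phi> s) $ (l - d))"
      by (simp add: fps_mult_nth atLeast0AtMost mult.commute[of _ "\<Phi> p"])
    also have "\<dots> = (\<Prod>s<p. \<Phi> s) $ l + (\<Sum>d\<in>{2..l}. \<Phi> p $ d * (\<Prod>s<p. \<Phi> s) $ (l - d))"
    proof -
      have "(\<Sum>d\<le>l. \<Phi> p $ d * (\<Prod>s<p. \<Phi> s) $ (l - d)) = (\<Sum>d\<in>insert 0 {2..l}. \<Phi> p $ d * (\<Prod>s<p. \<Phi> s) $ (l - d))"
      proof (rule sum.mono_neutral_right)
        show "\<forall>d\<in>{..l} - insert 0 {2..l}. \<Phi> p $ d * (\<Prod>s<p. \<Phi> s) $ (l - d) = 0"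
        proof
          fix d assume "d \<in> {..l} - insert 0 {2..l}"
          then have "d = 1" by auto
          then show "\<Phi> p $ d * (\<Prod>s<p. \<Phi> s) $ (l - d) = 0" using assms(2) by simp
        qed
      qed auto
      then show ?thesis using assms(1) by simp
    qed
    also have "\<dots> = (\<Sum>d\<in>{2..l}. \<Sum>ds\<in>parts2 (l - d). ?T p (ds @ [d]) + ?T p ds * \<Phi> p $ d)"
      using False by (simp add: Suc.IH sum_parts2_snoc sum.distrib sum_distrib_left mult.commute)
    also have "\<dots> = (\<Sum>ds\<in>parts2 l. ?T (Suc p) ds)"
      using False by (simp add: sum_parts2_snoc tuple_sum_Suc_snoc)
    finally show ?thesis .
  qed
qed

text \<open>For nonnegative terms the ordering constraint on the indices may be dropped, and then
  the sum factorises.\<close>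

lemma tuple_sum_le:
  assumes c: "\<And>s d. 0 \<le> c s d"
  shows "tuple_sum c p ds \<le> (\<Prod>d\<leftarrow>ds. \<Sum>s<p. c s d)"
proof (induction ds rule: rev_induct)
  case Nil
  then show ?case by (simp add: tuple_sum_Nil)
next
  case (snoc d ds)
  have nonneg: "0 \<le> tuple_sum c p ds" for p ds
    unfolding tuple_sum_def by (intro sum_nonneg prod_nonneg ballI c)
  have mono: "tuple_sum c p ds \<le> tuple_sum c (Suc p) ds" for p ds
    by (cases ds rule: rev_exhaust) (simp_all add: tuple_sum_Nil tuple_sum_Suc_snoc nonneg c)
  have "tuple_sum c p (ds @ [d]) \<le> tuple_sum c p ds * (\<Sum>s<p. c s d)"
  proof (induction p)
    case (Suc p)
    have "tuple_sum c (Suc p) (ds @ [d]) \<le> tuple_sum c p ds * (\<Sum>s<p. c s d) + tuple_sum c p ds * c p d"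
      using Suc by (simp add: tuple_sum_Suc_snoc)
    also have "\<dots> = tuple_sum c p ds * (\<Sum>s<Suc p. c s d)" by (simp add: algebra_simps)
    also have "\<dots> \<le> tuple_sum c (Suc p) ds * (\<Sum>s<Suc p. c s d)"
      by (intro mult_right_mono mono sum_nonneg c)
    finally show ?case .
  qed (simp add: tuple_sum_0_snoc)
  also have "\<dots> \<le> (\<Prod>d\<leftarrow>ds. \<Sum>s<p. c s d) * (\<Sum>s<p. c s d)"
    by (intro mult_right_mono snoc.IH sum_nonneg c)
  finally show ?case by simp
qed

lemma prod_list_conv_prod_nth: "(\<Prod>d\<leftarrow>ds. f d :: real) = (\<Prod>i<length ds. f (ds ! i))"
  by (subst prod.list_conv_set_nth) (simp add: atLeast0LessThan)

lemma tuple_sum_mult: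
  "tuple_sum (\<lambda>s d. f d * c s d) p ds = (\<Prod>d\<leftarrow>ds. f d) * tuple_sum c p ds"
  by (simp add: tuple_sum_def prod.distrib prod_list_conv_prod_nth sum_distrib_left)

lemma gamma_coeff_eq:
  "gamma_coeff n p X ds = fact (sum_list ds) / (\<Prod>d\<leftarrow>ds. fact d) *
     (\<Sum>j<p. tuple_sum (\<lambda>s d. gram n X j s ^ d) p ds)"
  unfolding gamma_coeff_def tuple_sum_def by (subst sum.swap) simp

text \<open>The composition of length one isolates the unknown moment of highest order; this is why
  \<open>gram_sum\<close> is the divisor in the recursion.\<close>

lemma gamma_coeff_singleton: "gamma_coeff n p X [l] = gram_sum n p X l"
proof -
  have "tuple_sum c p [l] = (\<Sum>s<p. c s l)" for c
  proof (induction p)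
    case 0 show ?case using tuple_sum_0_snoc[of c "[]" l] by simp
  next
    case (Suc p) then show ?case using tuple_sum_Suc_snoc[of c p "[]" l] by (simp add: tuple_sum_Nil)
  qed
  then show ?thesis by (simp add: gamma_coeff_eq gram_sum_def)
qed

text \<open>For the central moments \<open>\<mu>\<close> the left side will be the expectation of
  the Hermite statistic at the true mean, so the true moments satisfy the recursion of
  \<open>mu_hat\<close> with the statistic replaced by its expectation.\<close>

lemma sum_gamma_coeff:
  fixes \<mu> :: "nat \<Rightarrow> real"
  assumes "\<mu> 0 = 1" "\<mu> 1 = 0" "l \<ge> 2"
  shows "(\<Sum>j<p. fact l * (\<Prod>s<p. Abs_fps (\<lambda>d. gram n X j s ^ d * \<mu> d / fact d)) $ l) =
    \<mu> l * gram_sum n p X l + (\<Sum>t\<in>{2..l}. \<Sum>ds\<in>compositions2 l t. (\<Prod>d\<leftarrow>ds. \<mu> d) * gamma_coeff n p X ds)"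
proof -
  let ?g = "\<lambda>ds. (\<Prod>d\<leftarrow>ds. \<mu> d) * gamma_coeff n p X ds"
  have "(\<Sum>j<p. fact l * (\<Prod>s<p. Abs_fps (\<lambda>d. gram n X j s ^ d * \<mu> d / fact d)) $ l)
    = (\<Sum>j<p. fact l * (\<Sum>ds\<in>parts2 l. tuple_sum (\<lambda>s d. \<mu> d / fact d * gram n X j s ^ d) p ds))"
    using assms by (subst nth_prod_fps_eq_tuple_sum) (auto simp: tuple_sum_def mult_ac)
  also have "\<dots> = (\<Sum>ds\<in>parts2 l. fact l * ((\<Prod>d\<leftarrow>ds. \<mu> d / fact d) * (\<Sum>j<p. tuple_sum (\<lambda>s d. gram n X j s ^ d) p ds)))"
    unfolding tuple_sum_mult by (simp add: sum_distrib_left) (rule sum.swap)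
  also have "\<dots> = (\<Sum>ds\<in>parts2 l. ?g ds)"
  proof (rule sum.cong[OF refl])
    fix ds assume "ds \<in> parts2 l"
    then have "sum_list ds = l" by (simp add: parts2_def)
    moreover have "(\<Prod>d\<leftarrow>ds. \<mu> d / fact d) = (\<Prod>d\<leftarrow>ds. \<mu> d) / (\<Prod>d\<leftarrow>ds. fact d)"
      by (induction ds) auto
    ultimately show "fact l * ((\<Prod>d\<leftarrow>ds. \<mu> d / fact d) * (\<Sum>j<p. tuple_sum (\<lambda>s d. gram n X j s ^ d) p ds)) = ?g ds"
      by (simp add: gamma_coeff_eq)
  qed
  also have "\<dots> = (\<Sum>t\<le>l. \<Sum>ds\<in>compositions2 l t. ?g ds)"
    unfolding parts2_eq_UN
    by (rule sum.UNION_disjoint) (simp_all add: finite_compositions2, auto simp: compositions2_def)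
  also have "{..l} = insert 0 (insert 1 {2..l})" using assms(3) by auto
  also have "(\<Sum>t\<in>insert 0 (insert 1 {2..l}). \<Sum>ds\<in>compositions2 l t. ?g ds)
    = (\<Sum>ds\<in>compositions2 l 0. ?g ds) + ((\<Sum>ds\<in>compositions2 l 1. ?g ds) + (\<Sum>t\<in>{2..l}. \<Sum>ds\<in>compositions2 l t. ?g ds))"
    by simp
  also have "compositions2 l 0 = {}" using assms(3) by (auto simp: compositions2_def)
  also have "compositions2 l 1 = {[l]}" using assms(3) by (auto simp: compositions2_def length_Suc_conv)
  finally show ?thesis by (simp add: gamma_coeff_singleton)
qed

lemma prod_fact_ge_1: "(1::real) \<le> (\<Prod>d\<leftarrow>ds. fact d)"
  by (induction ds) (auto intro: order_trans[OF _ mult_mono[of 1 _ 1]])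

text \<open>Multinomial coefficients are positive integers.\<close>

lemma prod_fact_le_fact: "(\<Prod>d\<leftarrow>ds. fact d) \<le> (fact (sum_list ds) :: real)"
proof (induction ds)
  case (Cons d ds)
  have "(fact d * fact (sum_list ds) :: nat) dvd fact (d + sum_list ds)" by (rule fact_fact_dvd_fact)
  then have "fact d * fact (sum_list ds) \<le> (fact (d + sum_list ds) :: nat)" by (rule dvd_imp_le) simp
  then have "fact d * fact (sum_list ds) \<le> (fact (d + sum_list ds) :: real)"
    by (metis of_nat_fact of_nat_le_iff of_nat_mult)
  moreover have "fact d * (\<Prod>d\<leftarrow>ds. fact d) \<le> (fact d * fact (sum_list ds) :: real)"
    using Cons by (intro mult_left_mono) auto
  ultimately have "fact d * (\<Prod>d\<leftarrow>ds. fact d) \<le> (fact (d + sum_list ds) :: real)"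
    by (rule order_trans[rotated])
  then show ?case by simp
qed simp

text \<open>Every part is at least 2, so two factors of each power are summed by a row norm and the
  remaining ones are bounded entrywise. The only power of \<open>p\<close> comes from the outer sum
  over \<open>j\<close>.\<close>

lemma abs_gamma_coeff_le:
  assumes rows: "\<And>j. j < p \<Longrightarrow> (\<Sum>s<p. (gram n X j s)\<^sup>2) \<le> b\<^sup>2" and "b \<ge> 0"
    and ds: "ds \<in> compositions2 l t"
  shows "\<bar>gamma_coeff n p X ds\<bar> \<le> fact l * (real p * b ^ l)"
proof -
  have sum: "sum_list ds = l" and ge: "\<forall>d\<in>set ds. 2 \<le> d" using ds by (auto simp: compositions2_def)
  have one: "(\<Sum>s<p. \<bar>gram n X j s\<bar> ^ d) \<le> b ^ d" if "j < p" "2 \<le> d" for j d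
  proof -
    obtain e where e: "d = e + 2" using \<open>2 \<le> d\<close> by (metis add.commute le_Suc_ex)
    have ent: "\<bar>gram n X j s\<bar> \<le> b" if "s < p" for s
    proof -
      have "(gram n X j s)\<^sup>2 \<le> (\<Sum>s<p. (gram n X j s)\<^sup>2)" using that by (intro member_le_sum) auto
      then have "\<bar>gram n X j s\<bar>\<^sup>2 \<le> b\<^sup>2" using rows[OF \<open>j < p\<close>] by simp
      then show ?thesis using \<open>b \<ge> 0\<close> by (rule power2_le_imp_le)
    qed
    have "(\<Sum>s<p. \<bar>gram n X j s\<bar> ^ d) \<le> (\<Sum>s<p. b ^ e * (gram n X j s)\<^sup>2)"
      unfolding e power_add using ent by (intro sum_mono) (auto intro!: mult_right_mono power_mono)
    also have "\<dots> = b ^ e * (\<Sum>s<p. (gram n X j s)\<^sup>2)" by (simp add: sum_distrib_left)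
    also have "\<dots> \<le> b ^ e * b\<^sup>2" using rows[OF \<open>j < p\<close>] \<open>b \<ge> 0\<close> by (intro mult_left_mono) auto
    finally show ?thesis by (simp only: e power_add)
  qed
  have T: "\<bar>tuple_sum (\<lambda>s d. gram n X j s ^ d) p ds\<bar> \<le> b ^ l" if j: "j < p" for j
  proof -
    have "\<bar>tuple_sum (\<lambda>s d. gram n X j s ^ d) p ds\<bar> \<le> tuple_sum (\<lambda>s d. \<bar>gram n X j s\<bar> ^ d) p ds"
      unfolding tuple_sum_def by (rule order_trans[OF sum_abs]) (simp add: abs_prod power_abs)
    also have "\<dots> \<le> (\<Prod>d\<leftarrow>ds. \<Sum>s<p. \<bar>gram n X j s\<bar> ^ d)" by (rule tuple_sum_le) simp
    also have "\<dots> \<le> b ^ sum_list ds"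
      using ge
    proof (induction ds)
      case (Cons d ds)
      have "(\<Sum>s<p. \<bar>gram n X j s\<bar> ^ d) * (\<Prod>d\<leftarrow>ds. \<Sum>s<p. \<bar>gram n X j s\<bar> ^ d) \<le> b ^ d * b ^ sum_list ds"
        using Cons one[OF j, of d] \<open>b \<ge> 0\<close> by (intro mult_mono prod_list_nonneg) (auto intro: sum_nonneg)
      then show ?case by (simp add: power_add)
    qed simp
    finally show ?thesis by (simp add: sum)
  qed
  have "\<bar>gamma_coeff n p X ds\<bar> = fact l / (\<Prod>d\<leftarrow>ds. fact d) * \<bar>\<Sum>j<p. tuple_sum (\<lambda>s d. gram n X j s ^ d) p ds\<bar>"
    using prod_fact_ge_1[of ds] unfolding gamma_coeff_eq sum by (simp add: abs_mult)
  also have "\<dots> \<le> fact l * (\<Sum>j<p. b ^ l)"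
  proof (rule mult_mono)
    show "fact l / (\<Prod>d\<leftarrow>ds. fact d) \<le> (fact l :: real)"
      using prod_fact_ge_1[of ds] by (simp add: divide_le_eq)
    show "\<bar>\<Sum>j<p. tuple_sum (\<lambda>s d. gram n X j s ^ d) p ds\<bar> \<le> (\<Sum>j<p. b ^ l)"
      by (rule order_trans[OF sum_abs]) (intro sum_mono T; simp)
  qed auto
  finally show ?thesis by simp
qed

text \<open>Factors are exchanged one at a time. Since each \<open>\<beta> d\<close> is at least 1,
  a factor missing from one of the terms may be put in for free.\<close>

lemma abs_prod_list_diff_le:
  fixes u v \<beta> :: "nat \<Rightarrow> real"
  assumes "\<And>d. d \<in> set ds \<Longrightarrow> \<bar>u d - v d\<bar> \<le> \<delta>" "\<And>d. d \<in> set ds \<Longrightarrow> \<bar>u d\<bar> \<le> \<beta> d"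
    and "\<And>d. d \<in> set ds \<Longrightarrow> \<bar>v d\<bar> \<le> \<beta> d" "\<And>d. d \<in> set ds \<Longrightarrow> 1 \<le> \<beta> d" "\<delta> \<ge> 0"
  shows "\<bar>(\<Prod>d\<leftarrow>ds. u d) - (\<Prod>d\<leftarrow>ds. v d)\<bar> \<le> real (length ds) * \<delta> * (\<Prod>d\<leftarrow>ds. \<beta> d)"
    and "\<bar>\<Prod>d\<leftarrow>ds. v d\<bar> \<le> (\<Prod>d\<leftarrow>ds. \<beta> d)" and "1 \<le> (\<Prod>d\<leftarrow>ds. \<beta> d)"
proof -
  have "\<bar>(\<Prod>d\<leftarrow>ds. u d) - (\<Prod>d\<leftarrow>ds. v d)\<bar> \<le> real (length ds) * \<delta> * (\<Prod>d\<leftarrow>ds. \<beta> d) \<and>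
     \<bar>\<Prod>d\<leftarrow>ds. v d\<bar> \<le> (\<Prod>d\<leftarrow>ds. \<beta> d) \<and> 1 \<le> (\<Prod>d\<leftarrow>ds. \<beta> d)"
    using assms(1-4)
  proof (induction ds)
    case (Cons d ds)
    define U where "U = (\<Prod>d\<leftarrow>ds. u d)"
    define V where "V = (\<Prod>d\<leftarrow>ds. v d)"
    define Bt where "Bt = (\<Prod>d\<leftarrow>ds. \<beta> d)"
    have IH: "\<bar>U - V\<bar> \<le> real (length ds) * \<delta> * Bt" "\<bar>V\<bar> \<le> Bt" "1 \<le> Bt"
      using Cons by (auto simp: U_def V_def Bt_def)
    have d: "\<bar>u d - v d\<bar> \<le> \<delta>" "\<bar>u d\<bar> \<le> \<beta> d" "\<bar>v d\<bar> \<le> \<beta> d" "1 \<le> \<beta> d" using Cons.prems by auto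
    have "\<bar>u d * U - v d * V\<bar> = \<bar>u d * (U - V) + (u d - v d) * V\<bar>" by (simp add: algebra_simps)
    also have "\<dots> \<le> \<bar>u d\<bar> * \<bar>U - V\<bar> + \<bar>u d - v d\<bar> * \<bar>V\<bar>"
      by (rule order_trans[OF abs_triangle_ineq]) (simp add: abs_mult)
    also have "\<dots> \<le> \<beta> d * (real (length ds) * \<delta> * Bt) + \<delta> * Bt"
      using d IH assms(5) by (intro add_mono mult_mono) auto
    also have "\<delta> * Bt \<le> \<delta> * (\<beta> d * Bt)"
      using d IH assms(5) mult_right_mono[of 1 "\<beta> d" Bt] by (intro mult_left_mono) auto
    finally have 1: "\<bar>u d * U - v d * V\<bar> \<le> real (length (d # ds)) * \<delta> * (\<beta> d * Bt)"
      by (simp add: algebra_simps)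
    have "\<bar>v d * V\<bar> \<le> \<beta> d * Bt" unfolding abs_mult using d IH by (intro mult_mono) auto
    moreover have "1 * 1 \<le> \<beta> d * Bt" using d IH by (intro mult_mono) auto
    ultimately show ?case using 1 by (simp add: U_def V_def Bt_def)
  qed simp
  then show "\<bar>(\<Prod>d\<leftarrow>ds. u d) - (\<Prod>d\<leftarrow>ds. v d)\<bar> \<le> real (length ds) * \<delta> * (\<Prod>d\<leftarrow>ds. \<beta> d)"
    "\<bar>\<Prod>d\<leftarrow>ds. v d\<bar> \<le> (\<Prod>d\<leftarrow>ds. \<beta> d)" "1 \<le> (\<Prod>d\<leftarrow>ds. \<beta> d)" by auto
qed

section \<open>Jackson approximation\<close>

fun cheb :: "nat \<Rightarrow> real poly" where
  "cheb 0 = 1"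
| "cheb (Suc 0) = [:0, 1:]"
| "cheb (Suc (Suc n)) = smult 2 (pCons 0 (cheb (Suc n))) - cheb n"

lemma poly_cheb_cos: "poly (cheb n) (cos \<theta>) = cos (real n * \<theta>)"
proof (induction n rule: cheb.induct)
  case (3 n)
  have "cos (real (Suc (Suc n)) * \<theta>) + cos (real n * \<theta>) = 2 * cos \<theta> * cos (real (Suc n) * \<theta>)"
    by (subst cos_plus_cos) (simp add: algebra_simps add_divide_distrib)
  then show ?case using 3 by simp
qed auto

lemma degree_cheb_le: "degree (cheb n) \<le> n"
proof (induction n rule: cheb.induct)
  case (3 n)
  have "degree (smult 2 (pCons 0 (cheb (Suc n)))) \<le> Suc (Suc n)"
    by (rule order_trans[OF degree_smult_le order_trans[OF degree_pCons_le]]) (use 3 in simp)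
  then show ?case unfolding cheb.simps using 3 by (intro degree_diff_le) auto
qed auto

text \<open>The recurrence gives growth rate 1 + sqrt 2, rounded up to 3. With degrees below
  \<open>2 * k\<close> this is the source of the \<open>9 ^ k\<close> in the final error.\<close>

lemma sum_abs_coeff_cheb_le: "(\<Sum>i<N. \<bar>coeff (cheb n) i\<bar>) \<le> 3 ^ n"
proof (induction n arbitrary: N rule: cheb.induct)
  case 1
  have "(\<Sum>i<N. \<bar>coeff (1::real poly) i\<bar>) \<le> (\<Sum>i<Suc N. \<bar>coeff (1::real poly) i\<bar>)"
    by (intro sum_mono2) auto
  also have "\<dots> = 1" by (subst sum.lessThan_Suc_shift) simp
  finally show ?case by simp
next
  case 2
  have "(\<Sum>i<N. \<bar>coeff [:0, 1::real:] i\<bar>) \<le> (\<Sum>i<Suc (Suc N). \<bar>coeff [:0, 1::real:] i\<bar>)"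
    by (intro sum_mono2) auto
  also have "\<dots> = 1" by (subst sum.lessThan_Suc_shift, subst sum.lessThan_Suc_shift) simp
  finally show ?case by simp
next
  case (3 n)
  have "(\<Sum>i<N. \<bar>coeff (cheb (Suc (Suc n))) i\<bar>) \<le> (\<Sum>i<N. 2 * \<bar>coeff (pCons 0 (cheb (Suc n))) i\<bar> + \<bar>coeff (cheb n) i\<bar>)"
    by (intro sum_mono) (auto simp: coeff_pCons abs_mult split: nat.splits intro: order_trans[OF abs_triangle_ineq4])
  also have "\<dots> = 2 * (\<Sum>i<N. \<bar>coeff (pCons 0 (cheb (Suc n))) i\<bar>) + (\<Sum>i<N. \<bar>coeff (cheb n) i\<bar>)"
    by (simp add: sum.distrib sum_distrib_left)
  also have "(\<Sum>i<N. \<bar>coeff (pCons 0 (cheb (Suc n))) i\<bar>) \<le> (\<Sum>i<Suc N. \<bar>coeff (pCons 0 (cheb (Suc n))) i\<bar>)"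
    by (intro sum_mono2) auto
  also have "\<dots> = (\<Sum>i<N. \<bar>coeff (cheb (Suc n)) i\<bar>)"
    by (subst sum.lessThan_Suc_shift) simp
  also have "2 * (\<Sum>i<N. \<bar>coeff (cheb (Suc n)) i\<bar>) + (\<Sum>i<N. \<bar>coeff (cheb n) i\<bar>) \<le> 2 * 3 ^ Suc n + 3 ^ n"
    using 3 by (intro add_mono mult_left_mono) auto
  also have "\<dots> \<le> 3 ^ Suc (Suc n)" by simp
  finally show ?case by simp
qed

lemma poly_eq_sum_lessThan:
  fixes p :: "real poly"
  assumes "degree p < N"
  shows "poly p x = (\<Sum>i<N. coeff p i * x ^ i)"
  unfolding poly_altdef using assms
  by (intro sum.mono_neutral_left) (auto simp: coeff_eq_0)

lemma integral_cos_int: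
  fixes m :: int and \<theta> :: real
  shows "integral {-pi..pi} (\<lambda>t. cos (of_int m * (\<theta> - t))) = (if m = 0 then 2 * pi else 0)"
proof (cases "m = 0")
  case False
  define G where "G = (\<lambda>t. - sin (of_int m * (\<theta> - t)) / of_int m)"
  have "((\<lambda>t. cos (of_int m * (\<theta> - t))) has_integral (G pi - G (-pi))) {-pi..pi}"
  proof (rule fundamental_theorem_of_calculus)
    fix x assume "x \<in> {-pi..pi}"
    show "(G has_vector_derivative cos (of_int m * (\<theta> - x))) (at x within {-pi..pi})"
      unfolding G_def has_real_derivative_iff_has_vector_derivative[symmetric]
      using False by (auto intro!: derivative_eq_intros)
  qed simp
  moreover have "sin (of_int m * (\<theta> - pi)) = sin (of_int m * (\<theta> + pi))"
  proof -
    have "of_int m * (\<theta> + pi) = of_int m * (\<theta> - pi) + of_int m * (2 * pi)" by (simp add: algebra_simps)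
    then show ?thesis by (simp add: sin_add sin_int_2pin cos_int_2pin mult.commute[of _ "2 * pi"])
  qed
  then have "G pi = G (-pi)" by (simp add: G_def)
  ultimately show ?thesis using False by (simp add: integral_unique)
qed simp

section \<open>The squared Fejer kernel\<close>

text \<open>\<open>k\<close> times the usual Fejer kernel, written as cosines so that integrals and
  convolutions are finite sums.\<close>

definition Fejer_sum :: "nat \<Rightarrow> real \<Rightarrow> real" where
  "Fejer_sum k u = (\<Sum>a<k. \<Sum>b<k. cos ((real a - real b) * u))"

lemma Fejer_sum_eq: "Fejer_sum k u = (cmod (\<Sum>a<k. cis (real a * u)))\<^sup>2"
proof -
  have "(cmod (\<Sum>a<k. cis (real a * u)))\<^sup>2 = (\<Sum>a<k. cos (real a * u))\<^sup>2 + (\<Sum>a<k. sin (real a * u))\<^sup>2"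
    by (simp add: cmod_power2)
  also have "\<dots> = (\<Sum>a<k. \<Sum>b<k. cos (real a * u) * cos (real b * u) + sin (real a * u) * sin (real b * u))"
    by (simp add: power2_eq_square sum_product sum.distrib)
  also have "\<dots> = Fejer_sum k u"
    by (simp add: Fejer_sum_def cos_diff left_diff_distrib)
  finally show ?thesis ..
qed

lemma Fejer_sum_nonneg: "Fejer_sum k u \<ge> 0"
  by (simp add: Fejer_sum_eq)

text \<open>Summing the geometric series shows that the product is the squared sine of k u / 2. It
  serves to trade one factor of the squared kernel for the smallness of the sine.\<close>

lemma sin_square_Fejer_sum_le: "(sin (u / 2))\<^sup>2 * Fejer_sum k u \<le> 1"
proof -
  have "(cis u - 1) * (\<Sum>a<k. cis (real a * u)) = cis (real k * u) - 1"
    by (induction k) (simp_all add: algebra_simps cis_mult)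
  then have "cmod (cis u - 1) * cmod (\<Sum>a<k. cis (real a * u)) = cmod (cis (real k * u) - 1)"
    by (metis norm_mult)
  also have "\<dots> \<le> 2" using norm_triangle_ineq4[of "cis (real k * u)" 1] by simp
  finally have "(cmod (cis u - 1) * cmod (\<Sum>a<k. cis (real a * u)))\<^sup>2 \<le> 2\<^sup>2"
    by (intro power_mono) auto
  then have *: "(cmod (cis u - 1))\<^sup>2 * Fejer_sum k u \<le> 4"
    by (simp add: power_mult_distrib Fejer_sum_eq)
  have "(cmod (cis u - 1))\<^sup>2 = (cos u - 1)\<^sup>2 + (sin u)\<^sup>2" by (simp add: cmod_power2)
  also have "\<dots> = 2 - 2 * cos u" using sin_cos_squared_add[of u] by (simp add: power2_eq_square algebra_simps)
  also have "cos u = 1 - 2 * (sin (u / 2))\<^sup>2" using cos_double_sin[of "u / 2"] by simp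
  finally show ?thesis using * by simp
qed

lemma sum_sin_antisym: "(\<Sum>c<k. \<Sum>d<k. sin ((real c - real d) * u)) = 0"
proof -
  have "(\<Sum>c<k. \<Sum>d<k. sin ((real c - real d) * u)) = (\<Sum>d<k. \<Sum>c<k. sin ((real c - real d) * u))"
    by (rule sum.swap)
  also have "\<dots> = (\<Sum>d<k. \<Sum>c<k. - sin ((real d - real c) * u))"
    by (intro sum.cong refl) (simp add: sin_minus[symmetric] algebra_simps)
  finally show ?thesis by (simp add: sum_negf)
qed

text \<open>The square of \<open>Fejer_sum\<close> is a sum of \<open>k ^ 4\<close> cosines;
  indexing them by quadruples avoids computing the multiplicity of each frequency.\<close>

definition Jackson_index :: "nat \<Rightarrow> (nat \<times> nat \<times> nat \<times> nat) set" where
  "Jackson_index k = {..<k} \<times> {..<k} \<times> {..<k} \<times> {..<k}"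

fun Jackson_freq :: "nat \<times> nat \<times> nat \<times> nat \<Rightarrow> int" where
  "Jackson_freq (a, b, c, d) = int a - int b + (int c - int d)"

lemma Jackson_freq_conv:
  "Jackson_freq q = int (fst q) - int (fst (snd q)) + (int (fst (snd (snd q))) - int (snd (snd (snd q))))"
  by (cases q) simp

definition Jackson_kernel :: "nat \<Rightarrow> real \<Rightarrow> real" where
  "Jackson_kernel k u = (\<Sum>q\<in>Jackson_index k. cos (of_int (Jackson_freq q) * u))"

lemma Jackson_kernel_eq: "Jackson_kernel k u = (Fejer_sum k u)\<^sup>2"
proof -
  have "Jackson_kernel k u = (\<Sum>a<k. \<Sum>b<k. \<Sum>c<k. \<Sum>d<k. cos ((real a - real b) * u + (real c - real d) * u))"
    unfolding Jackson_kernel_def Jackson_index_def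
    by (simp only: sum.cartesian_product split_def Jackson_freq_conv)
      (intro sum.cong refl arg_cong[where f=cos]; simp add: algebra_simps)
  also have "\<dots> = (\<Sum>a<k. \<Sum>b<k. cos ((real a - real b) * u) * Fejer_sum k u)"
  proof (intro sum.cong refl)
    fix a b
    have "(\<Sum>c<k. \<Sum>d<k. cos ((real a - real b) * u + (real c - real d) * u))
      = cos ((real a - real b) * u) * (\<Sum>c<k. \<Sum>d<k. cos ((real c - real d) * u))
      - sin ((real a - real b) * u) * (\<Sum>c<k. \<Sum>d<k. sin ((real c - real d) * u))"
      by (simp add: cos_add sum_subtractf sum_distrib_left)
    then show "(\<Sum>c<k. \<Sum>d<k. cos ((real a - real b) * u + (real c - real d) * u)) = cos ((real a - real b) * u) * Fejer_sum k u"
      by (simp add: sum_sin_antisym Fejer_sum_def)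
  qed
  also have "\<dots> = (Fejer_sum k u)\<^sup>2" by (simp add: sum_distrib_right[symmetric] Fejer_sum_def power2_eq_square)
  finally show ?thesis .
qed

lemma finite_Jackson_index: "finite (Jackson_index k)" by (simp add: Jackson_index_def)

lemma card_Jackson_index: "card (Jackson_index k) = k ^ 4"
  by (simp add: Jackson_index_def card_cartesian_product eval_nat_numeral)

lemma abs_Jackson_freq: "q \<in> Jackson_index k \<Longrightarrow> nat \<bar>Jackson_freq q\<bar> < 2 * k"
  by (cases q) (auto simp: Jackson_index_def)

lemma integral_Fejer_sum: "integral {-pi..pi} (\<lambda>t. Fejer_sum k (\<theta> - t)) = 2 * pi * real k"
proof -
  have "integral {-pi..pi} (\<lambda>t. Fejer_sum k (\<theta> - t)) = (\<Sum>a<k. \<Sum>b<k. integral {-pi..pi} (\<lambda>t. cos ((real a - real b) * (\<theta> - t))))"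
    unfolding Fejer_sum_def
    by (subst integral_sum; (intro sum.cong refl)?) (auto intro!: integral_sum integrable_continuous_real continuous_intros)
  also have "\<dots> = (\<Sum>a<k. \<Sum>b<k. if a = b then 2 * pi else 0)"
  proof (intro sum.cong refl)
    fix a b :: nat
    show "integral {-pi..pi} (\<lambda>t. cos ((real a - real b) * (\<theta> - t))) = (if a = b then 2 * pi else 0)"
      using integral_cos_int[of "int a - int b" \<theta>] by simp
  qed
  also have "\<dots> = 2 * pi * real k" by simp
  finally show ?thesis .
qed

definition Jackson_mass :: "nat \<Rightarrow> real" where
  "Jackson_mass k = integral {-pi..pi} (\<lambda>t. Jackson_kernel k (0 - t))"

lemma Jackson_kernel_continuous: "continuous_on S (\<lambda>t. Jackson_kernel k (\<theta> - t))"
  unfolding Jackson_kernel_def by (intro continuous_intros)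

lemma Fejer_sum_continuous: "continuous_on S (\<lambda>t. Fejer_sum k (\<theta> - t))"
  unfolding Fejer_sum_def by (intro continuous_intros)

lemma integral_Jackson_kernel: "integral {-pi..pi} (\<lambda>t. Jackson_kernel k (\<theta> - t)) = Jackson_mass k"
proof -
  have "integral {-pi..pi} (\<lambda>t. Jackson_kernel k (\<theta> - t))
    = (\<Sum>q\<in>Jackson_index k. if Jackson_freq q = 0 then 2 * pi else 0)" for \<theta>
    unfolding Jackson_kernel_def integral_cos_int[symmetric, of _ \<theta>]
    by (rule integral_sum) (auto intro!: finite_Jackson_index integrable_continuous_real continuous_intros)
  then show ?thesis unfolding Jackson_mass_def by metis
qed

text \<open>For \<open>t\<close> within 1 / (2 k) of 0 every cosine is at least 7/8. Hence the
  kernel is at least 49/64 \<open>k ^ 4\<close> on an interval of length 1 / k.\<close>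

lemma Jackson_mass_ge:
  assumes "k \<ge> 1"
  shows "Jackson_mass k \<ge> real k ^ 3 / 2"
proof -
  have cosge: "cos x \<ge> 7 / 8" if "\<bar>x\<bar> \<le> 1 / 2" for x :: real
  proof -
    have "\<bar>x\<bar>\<^sup>2 \<le> (1 / 2)\<^sup>2" using that by (intro power_mono) auto
    moreover have "cos x = 1 - 2 * (sin (x / 2))\<^sup>2" using cos_double_sin[of "x / 2"] by simp
    moreover have "\<bar>sin (x / 2)\<bar>\<^sup>2 \<le> \<bar>x / 2\<bar>\<^sup>2" by (intro power_mono abs_sin_x_le_abs_x) auto
    ultimately show ?thesis by (simp add: power_divide power2_eq_square)
  qed
  define r where "r = 1 / (2 * real k)"
  have r: "0 < r" "r \<le> 1 / 2" using assms by (auto simp: r_def field_simps)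
  have sub: "{-r..r} \<subseteq> {-pi..pi}" using r pi_gt3 by auto
  have low: "Jackson_kernel k (0 - t) \<ge> real k ^ 4 / 2" if "t \<in> {-r..r}" for t
  proof -
    have "Fejer_sum k (0 - t) \<ge> (\<Sum>a<k. \<Sum>b<k. 7 / 8)"
      unfolding Fejer_sum_def
    proof (intro sum_mono cosge)
      fix a b assume "a \<in> {..<k}" "b \<in> {..<k}"
      then have "\<bar>real a - real b\<bar> \<le> real k" by auto
      moreover have "\<bar>0 - t\<bar> \<le> r" using that by auto
      ultimately have "\<bar>real a - real b\<bar> * \<bar>0 - t\<bar> \<le> real k * r" by (intro mult_mono) auto
      then show "\<bar>(real a - real b) * (0 - t)\<bar> \<le> 1 / 2" using assms by (simp add: abs_mult r_def)
    qed
    then have "Fejer_sum k (0 - t) \<ge> 7 / 8 * (real k)\<^sup>2" by (simp add: power2_eq_square)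
    then have "(7 / 8 * (real k)\<^sup>2)\<^sup>2 \<le> (Fejer_sum k (0 - t))\<^sup>2" by (intro power_mono) auto
    then have "49 / 64 * real k ^ 4 \<le> Jackson_kernel k (0 - t)"
      unfolding Jackson_kernel_eq by (simp add: power_mult_distrib power_divide power_mult[symmetric])
    moreover have "0 \<le> real k ^ 4" by simp
    ultimately show ?thesis by linarith
  qed
  have "real k ^ 3 / 2 = integral {-r..r} (\<lambda>t. real k ^ 4 / 2)"
    using assms r by (simp add: r_def eval_nat_numeral field_simps)
  also have "\<dots> \<le> integral {-r..r} (\<lambda>t. Jackson_kernel k (0 - t))"
    using low by (intro integral_le integrable_continuous_real Jackson_kernel_continuous) (auto intro!: continuous_intros)
  also have "\<dots> \<le> integral {-pi..pi} (\<lambda>t. Jackson_kernel k (0 - t))"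
    using sub by (intro integral_subset_le integrable_continuous_real Jackson_kernel_continuous)
      (auto simp: Jackson_kernel_eq)
  finally show ?thesis unfolding Jackson_mass_def .
qed

text \<open>With u = \<theta> - t, the difference of the cosines is at most 2 |sin(u/2)|, hence by
  AM-GM at most 1/k + k sin^2(u/2). The sine square is absorbed by one of the two kernel factors.
  What remains integrates to A/k times the mass plus 2 pi A k^2, and the lower bound on the mass
  makes the second part comparable with the first.\<close>

lemma Jackson_error:
  fixes h :: "real \<Rightarrow> real"
  assumes k: "k \<ge> 1" and h: "continuous_on UNIV h" "\<And>s t. \<bar>h s - h t\<bar> \<le> A * \<bar>cos s - cos t\<bar>" and A: "A \<ge> 0"
  shows "\<bar>integral {-pi..pi} (\<lambda>t. h t * Jackson_kernel k (\<theta> - t)) / Jackson_mass k - h \<theta>\<bar> \<le> (1 + 4 * pi) * A / real k"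
proof -
  define Z where "Z = Jackson_mass k"
  have Z: "Z \<ge> real k ^ 3 / 2" unfolding Z_def by (rule Jackson_mass_ge[OF k])
  then have Z0: "Z > 0" using k by (intro less_le_trans[OF _ Z]) auto
  have hc: "continuous_on {-pi..pi} h" using h(1) continuous_on_subset by blast
  note ci = integrable_continuous_real continuous_intros Jackson_kernel_continuous Fejer_sum_continuous hc
  have "integral {-pi..pi} (\<lambda>t. h t * Jackson_kernel k (\<theta> - t)) - h \<theta> * Z
    = integral {-pi..pi} (\<lambda>t. h t * Jackson_kernel k (\<theta> - t)) - integral {-pi..pi} (\<lambda>t. h \<theta> * Jackson_kernel k (\<theta> - t))"
    by (simp add: Z_def integral_Jackson_kernel)
  also have "\<dots> = integral {-pi..pi} (\<lambda>t. h t * Jackson_kernel k (\<theta> - t) - h \<theta> * Jackson_kernel k (\<theta> - t))"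
    by (intro integral_diff[symmetric] ci)
  also have "\<bar>\<dots>\<bar> \<le> integral {-pi..pi} (\<lambda>t. A / real k * Jackson_kernel k (\<theta> - t) + A * real k * Fejer_sum k (\<theta> - t))"
    unfolding real_norm_def[symmetric]
  proof (rule integral_norm_bound_integral)
    show "(\<lambda>t. h t * Jackson_kernel k (\<theta> - t) - h \<theta> * Jackson_kernel k (\<theta> - t)) integrable_on {-pi..pi}"
      "(\<lambda>t. A / real k * Jackson_kernel k (\<theta> - t) + A * real k * Fejer_sum k (\<theta> - t)) integrable_on {-pi..pi}"
      by (intro ci)+
    fix t
    define u where "u = \<theta> - t"
    define x where "x = \<bar>sin (u / 2)\<bar>"
    have F: "Fejer_sum k u \<ge> 0" by (rule Fejer_sum_nonneg)
    have "\<bar>cos t - cos \<theta>\<bar> = 2 * (\<bar>sin ((t + \<theta>) / 2)\<bar> * x)"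
      by (simp add: cos_diff_cos abs_mult x_def u_def)
    also have "\<dots> \<le> 2 * (1 * x)" by (intro mult_left_mono mult_right_mono) (auto simp: x_def)
    also have "2 * (1 * x) \<le> 1 / real k + real k * x\<^sup>2"
    proof -
      have "0 \<le> (1 - real k * x)\<^sup>2 / real k" using k by simp
      also have "\<dots> = 1 / real k + real k * x\<^sup>2 - 2 * x" using k by (simp add: power2_eq_square field_simps)
      finally show ?thesis by simp
    qed
    finally have "\<bar>h t - h \<theta>\<bar> \<le> A * (1 / real k + real k * x\<^sup>2)"
      using h(2)[of t \<theta>] mult_left_mono[OF _ A] by (meson order_trans)
    then have "\<bar>h t - h \<theta>\<bar> * (Fejer_sum k u)\<^sup>2 \<le> A * (1 / real k + real k * x\<^sup>2) * (Fejer_sum k u)\<^sup>2"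
      by (intro mult_right_mono) auto
    also have "\<dots> = A / real k * (Fejer_sum k u)\<^sup>2 + A * real k * Fejer_sum k u * (x\<^sup>2 * Fejer_sum k u)"
      by (simp add: power2_eq_square algebra_simps)
    also have "\<dots> \<le> A / real k * (Fejer_sum k u)\<^sup>2 + A * real k * Fejer_sum k u * 1"
      using sin_square_Fejer_sum_le[of u k] A F
      by (intro add_left_mono mult_left_mono mult_nonneg_nonneg) (auto simp: x_def)
    finally show "norm (h t * Jackson_kernel k (\<theta> - t) - h \<theta> * Jackson_kernel k (\<theta> - t))
       \<le> A / real k * Jackson_kernel k (\<theta> - t) + A * real k * Fejer_sum k (\<theta> - t)"
      by (simp add: Jackson_kernel_eq left_diff_distrib[symmetric] abs_mult u_def)
  qed
  also have "\<dots> = A / real k * Z + A * real k * (2 * pi * real k)"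
    using k by (subst integral_add) (auto intro!: ci simp: Z_def integral_Jackson_kernel integral_Fejer_sum)
  finally have *: "\<bar>integral {-pi..pi} (\<lambda>t. h t * Jackson_kernel k (\<theta> - t)) - h \<theta> * Z\<bar> \<le> A / real k * Z + 2 * pi * A * (real k)\<^sup>2"
    by (simp add: power2_eq_square mult_ac)
  have "2 * pi * A * (real k)\<^sup>2 = 4 * pi * A / real k * (real k ^ 3 / 2)"
    using k by (simp add: eval_nat_numeral)
  also have "\<dots> \<le> 4 * pi * A / real k * Z" using Z A by (intro mult_left_mono) auto
  finally have "\<bar>integral {-pi..pi} (\<lambda>t. h t * Jackson_kernel k (\<theta> - t)) - h \<theta> * Z\<bar> \<le> (1 + 4 * pi) * A / real k * Z"
    using * by (simp add: algebra_simps add_divide_distrib)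
  moreover have "integral {-pi..pi} (\<lambda>t. h t * Jackson_kernel k (\<theta> - t)) / Z - h \<theta>
     = (integral {-pi..pi} (\<lambda>t. h t * Jackson_kernel k (\<theta> - t)) - h \<theta> * Z) / Z"
    using Z0 by (simp add: field_simps)
  ultimately show ?thesis using Z0 unfolding Z_def[symmetric] by (simp add: abs_divide divide_le_eq)
qed

text \<open>The approximant is the convolution of \<open>f (A cos t)\<close> with the normalised square of the Fejer
  kernel, written in Chebyshev polynomials of \<open>x / A\<close>.\<close>

lemma Jackson_Lipschitz:
  fixes f :: "real \<Rightarrow> real"
  assumes k: "k \<ge> 1" and A: "A > 0" and lip: "\<And>x y. \<bar>f x - f y\<bar> \<le> \<bar>x - y\<bar>" and F: "\<And>x. \<bar>f x\<bar> \<le> F"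
  obtains e :: "nat \<Rightarrow> real" where
    "\<And>x. x \<in> {-A..A} \<Longrightarrow> \<bar>(\<Sum>i<2 * k. e i * (x / A) ^ i) - f x\<bar> \<le> (1 + 4 * pi) * A / real k"
    "(\<Sum>i<2 * k. \<bar>e i\<bar>) \<le> 4 * pi * F * real k * 9 ^ k"
proof -
  define h where "h = (\<lambda>t. f (A * cos t))"
  define Z where "Z = Jackson_mass k"
  have Z: "Z \<ge> real k ^ 3 / 2" unfolding Z_def by (rule Jackson_mass_ge[OF k])
  then have Z0: "Z > 0" using k by (intro less_le_trans[OF _ Z]) auto
  have F0: "F \<ge> 0" using F[of 0] by linarith
  have "continuous_on UNIV f"
  proof (rule continuous_onI)
    fix x e :: real assume e: "e > 0"
    have "dist (f y) (f x) \<le> e" if "dist y x < e" for y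
      using lip[of y x] that by (simp add: dist_real_def)
    then show "\<exists>d>0. \<forall>y\<in>UNIV. dist y x < d \<longrightarrow> dist (f y) (f x) \<le> e" using e by blast
  qed
  then have hc: "continuous_on S h" for S
    unfolding h_def by (rule continuous_on_compose2[of UNIV f]) (auto intro!: continuous_intros)
  have hlip: "\<bar>h s - h t\<bar> \<le> A * \<bar>cos s - cos t\<bar>" for s t
    using lip[of "A * cos s" "A * cos t"] A by (simp add: h_def right_diff_distrib[symmetric] abs_mult)
  define c where "c = (\<lambda>q. integral {-pi..pi} (\<lambda>t. h t * cos (of_int (Jackson_freq q) * t)))"
  define P where "P = (\<Sum>q\<in>Jackson_index k. smult (c q / Z) (cheb (nat \<bar>Jackson_freq q\<bar>)))"
  define e where "e = coeff P"
  have conv: "integral {-pi..pi} (\<lambda>t. h t * Jackson_kernel k (\<theta> - t)) / Z = poly P (cos \<theta>)" for \<theta>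
  proof -
    have one: "integral {-pi..pi} (\<lambda>t. h t * cos (of_int m * (\<theta> - t)))
      = integral {-pi..pi} (\<lambda>t. h t * cos (of_int m * t)) * cos (of_int m * \<theta>)" for m :: int
    proof -
      let ?s = "\<lambda>t. h t * sin (of_int m * t)"
      \<comment> \<open>\<open>h\<close> is a function of the cosine, hence even, and its sine
        integrals vanish. Only cosines of multiples of \<open>\<theta>\<close> survive, and these
        are Chebyshev polynomials of \<open>cos \<theta>\<close>.\<close>
      have "integral {-pi..pi} ?s = integral {-pi..pi} (\<lambda>t. ?s (-t))"
        using Henstock_Kurzweil_Integration.integral_reflect_real[of pi "-pi" ?s] by simp
      also have "\<dots> = - integral {-pi..pi} ?s" by (simp add: h_def)
      finally have s0: "integral {-pi..pi} ?s = 0" by simp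
      have "integral {-pi..pi} (\<lambda>t. h t * cos (of_int m * (\<theta> - t)))
        = integral {-pi..pi} (\<lambda>t. cos (of_int m * \<theta>) * (h t * cos (of_int m * t)) + sin (of_int m * \<theta>) * ?s t)"
        by (simp add: right_diff_distrib cos_diff algebra_simps)
      also have "\<dots> = cos (of_int m * \<theta>) * integral {-pi..pi} (\<lambda>t. h t * cos (of_int m * t)) + sin (of_int m * \<theta>) * integral {-pi..pi} ?s"
        by (subst integral_add) (auto intro!: integrable_continuous_real continuous_intros hc)
      finally show ?thesis using s0 by simp
    qed
    have "integral {-pi..pi} (\<lambda>t. h t * Jackson_kernel k (\<theta> - t))
      = (\<Sum>q\<in>Jackson_index k. integral {-pi..pi} (\<lambda>t. h t * cos (of_int (Jackson_freq q) * (\<theta> - t))))"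
      unfolding Jackson_kernel_def sum_distrib_left
      by (rule integral_sum) (auto intro!: finite_Jackson_index integrable_continuous_real continuous_intros hc)
    also have "\<dots> = (\<Sum>q\<in>Jackson_index k. c q * cos (of_int (Jackson_freq q) * \<theta>))"
      by (simp add: one c_def)
    also have "\<dots> = (\<Sum>q\<in>Jackson_index k. c q * poly (cheb (nat \<bar>Jackson_freq q\<bar>)) (cos \<theta>))"
    proof (intro sum.cong refl)
      fix q
      have "cos (real_of_int \<bar>m\<bar> * \<theta>) = cos (of_int m * \<theta>)" for m :: int
        by (cases "m \<ge> 0") auto
      then show "c q * cos (of_int (Jackson_freq q) * \<theta>) = c q * poly (cheb (nat \<bar>Jackson_freq q\<bar>)) (cos \<theta>)"
        by (simp add: poly_cheb_cos)
    qed
    finally show ?thesis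
      by (simp add: P_def poly_sum sum_divide_distrib)
  qed
  have degP: "degree P < 2 * k"
  proof -
    have "degree P \<le> 2 * k - 1"
      unfolding P_def
    proof (rule degree_sum_le[OF finite_Jackson_index])
      fix q assume "q \<in> Jackson_index k"
      then show "degree (smult (c q / Z) (cheb (nat \<bar>Jackson_freq q\<bar>))) \<le> 2 * k - 1"
        using abs_Jackson_freq[of q k] degree_cheb_le[of "nat \<bar>Jackson_freq q\<bar>"]
        by (intro order_trans[OF degree_smult_le]) linarith
    qed
    then show ?thesis using k by linarith
  qed
  show ?thesis
  proof (rule that[of e])
    fix x assume x: "x \<in> {-A..A}"
    define \<theta> where "\<theta> = arccos (x / A)"
    have "- 1 \<le> x / A" "x / A \<le> 1" using x A by (auto simp: field_simps)
    then have cx: "cos \<theta> = x / A" by (simp add: \<theta>_def)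
    have "\<bar>poly P (cos \<theta>) - h \<theta>\<bar> \<le> (1 + 4 * pi) * A / real k"
      unfolding conv[symmetric] Z_def
      by (rule Jackson_error[OF k hc hlip]) (use A in auto)
    then show "\<bar>(\<Sum>i<2 * k. e i * (x / A) ^ i) - f x\<bar> \<le> (1 + 4 * pi) * A / real k"
      using A by (simp add: poly_eq_sum_lessThan[OF degP] cx h_def e_def)
  next
    have cq: "\<bar>c q\<bar> \<le> 2 * pi * F" for q
    proof -
      have "norm (c q) \<le> integral {-pi..pi} (\<lambda>t. F)"
        unfolding c_def
      proof (rule integral_norm_bound_integral)
        fix t :: real
        have "\<bar>h t\<bar> * \<bar>cos (of_int (Jackson_freq q) * t)\<bar> \<le> F * 1"
          using F[of "A * cos t"] F0 by (intro mult_mono) (auto simp: h_def)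
        then show "norm (h t * cos (of_int (Jackson_freq q) * t)) \<le> F" by (simp add: abs_mult)
      qed (auto intro!: integrable_continuous_real continuous_intros hc)
      then show ?thesis by simp
    qed
    have "(\<Sum>i<2 * k. \<bar>e i\<bar>) \<le> (\<Sum>i<2 * k. \<Sum>q\<in>Jackson_index k. \<bar>c q\<bar> / Z * \<bar>coeff (cheb (nat \<bar>Jackson_freq q\<bar>)) i\<bar>)"
      unfolding e_def P_def using Z0
      by (intro sum_mono) (auto simp: coeff_sum abs_mult intro!: order_trans[OF sum_abs])
    also have "\<dots> = (\<Sum>q\<in>Jackson_index k. \<bar>c q\<bar> / Z * (\<Sum>i<2 * k. \<bar>coeff (cheb (nat \<bar>Jackson_freq q\<bar>)) i\<bar>))"
      by (subst sum.swap) (simp add: sum_distrib_left)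
    also have "\<dots> \<le> (\<Sum>q\<in>Jackson_index k. 2 * pi * F / Z * 9 ^ k)"
    proof (intro sum_mono mult_mono divide_right_mono cq)
      fix q assume q: "q \<in> Jackson_index k"
      have "(\<Sum>i<2 * k. \<bar>coeff (cheb (nat \<bar>Jackson_freq q\<bar>)) i\<bar>) \<le> 3 ^ nat \<bar>Jackson_freq q\<bar>"
        by (rule sum_abs_coeff_cheb_le)
      also have "\<dots> \<le> 3 ^ (2 * k)" using abs_Jackson_freq[OF q] by (intro power_increasing) auto
      finally show "(\<Sum>i<2 * k. \<bar>coeff (cheb (nat \<bar>Jackson_freq q\<bar>)) i\<bar>) \<le> 9 ^ k" by (simp add: power_mult)
    qed (use Z0 F0 in \<open>auto intro: sum_nonneg\<close>)
    also have "\<dots> = 2 * pi * F * 9 ^ k * real k ^ 4 / Z" by (simp add: card_Jackson_index)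
    also have "\<dots> \<le> 2 * pi * F * 9 ^ k * real k ^ 4 / (real k ^ 3 / 2)"
      using Z Z0 k F0 by (intro divide_left_mono) auto
    also have "\<dots> = 4 * pi * F * real k * 9 ^ k" using k by (simp add: eval_nat_numeral)
    finally show "(\<Sum>i<2 * k. \<bar>e i\<bar>) \<le> 4 * pi * F * real k * 9 ^ k" .
  qed
qed

section \<open>Wasserstein distance and moments\<close>

lemma cdf_outside_support:
  assumes "real_distribution \<mu>" "measure \<mu> {-A..A} = 1"
  shows "t < -A \<Longrightarrow> cdf \<mu> t = 0" and "A \<le> t \<Longrightarrow> cdf \<mu> t = 1"
proof -
  interpret real_distribution \<mu> by fact
  show "cdf \<mu> t = 0" if "t < -A"
  proof -
    have "measure \<mu> {..t} + measure \<mu> {-A..A} = measure \<mu> ({..t} \<union> {-A..A})"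
      using that by (intro finite_measure_Union[symmetric]) auto
    also have "\<dots> \<le> 1" by (rule prob_le_1)
    finally show ?thesis using assms(2) measure_nonneg[of \<mu> "{..t}"] by (simp add: cdf_def)
  qed
  show "cdf \<mu> t = 1" if "A \<le> t"
  proof -
    have "measure \<mu> {-A..A} \<le> measure \<mu> {..t}" using that by (intro finite_measure_mono) auto
    then show ?thesis using assms(2) prob_le_1[of "{..t}"] by (simp add: cdf_def)
  qed
qed

lemma AE_support:
  assumes "real_distribution \<mu>" "measure \<mu> {-A..A} = 1"
  shows "AE x in \<mu>. x \<in> {-A..A}"
proof -
  interpret real_distribution \<mu> by fact
  show ?thesis using assms(2) prob_eq_1[of "{-A..A}"] by simp
qed

text \<open>Lebesgue measure on the interval outside which the two cdfs agree. Being finite, it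
  makes the bounded integrands below integrable, as Fubini's theorem demands.\<close>

definition clip_int :: "real \<Rightarrow> real measure" where
  "clip_int A = density lborel (indicator {-A..A})"

lemma finite_measure_clip_int: "finite_measure (clip_int A)"
  by (rule finite_measureI) (simp add: clip_int_def emeasure_density emeasure_lborel_Icc_eq)

lemma sets_clip_int [measurable_cong, simp]: "sets (clip_int A) = sets borel"
  by (simp add: clip_int_def)

lemma space_clip_int [simp]: "space (clip_int A) = UNIV"
  by (simp add: clip_int_def)

text \<open>With \<open>\<phi> = sgn (cdf \<nu> - cdf \<mu>)\<close> the primitive \<open>f\<close> is a Lipschitz function attaining the distance.\<close>

lemma W1_eq_Lipschitz_difference:
  assumes \<mu>: "real_distribution \<mu>" "measure \<mu> {-A..A} = 1"
    and \<nu>: "real_distribution \<nu>" "measure \<nu> {-A..A} = 1" and A: "A > 0"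
  obtains f :: "real \<Rightarrow> real" where
    "\<And>x y. \<bar>f x - f y\<bar> \<le> \<bar>x - y\<bar>" "\<And>x. \<bar>f x\<bar> \<le> 2 * A"
    "W1 \<mu> \<nu> = ennreal ((\<integral>x. f x \<partial>\<mu>) - (\<integral>x. f x \<partial>\<nu>))"
proof -
  interpret \<mu>: cdf_distribution \<mu> unfolding cdf_distribution_def by fact
  interpret \<nu>: cdf_distribution \<nu> unfolding cdf_distribution_def by fact
  interpret l: finite_measure "clip_int A" by (rule finite_measure_clip_int)
  note [measurable] = \<mu>.measurable_C \<nu>.measurable_C
  define \<phi> where "\<phi> = (\<lambda>t. sgn (cdf \<nu> t - cdf \<mu> t))"
  have [measurable]: "\<phi> \<in> borel_measurable borel" unfolding \<phi>_def sgn_real_def by measurable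
  have \<phi>1: "\<bar>\<phi> t\<bar> \<le> 1" for t by (simp add: \<phi>_def sgn_real_def)
  define f where "f = (\<lambda>x. \<integral>t. \<phi> t * indicator {..<x} t \<partial>clip_int A)"
  have int[simp]: "integrable (clip_int A) (\<lambda>t. \<phi> t * indicator {..<x} t)" for x
    by (rule l.integrable_const_bound[where B=1]) (auto simp: abs_mult indicator_def \<phi>1)
  have m: "measure (clip_int A) UNIV = 2 * A" using A
    by (simp add: measure_def clip_int_def emeasure_density emeasure_lborel_Icc_eq)
  have bound: "\<bar>f x\<bar> \<le> 2 * A" for x
  proof -
    have "\<bar>f x\<bar> \<le> (\<integral>t. 1 \<partial>clip_int A)" unfolding f_def real_norm_def[symmetric]
      by (rule Bochner_Integration.integral_norm_bound_integral)
        (rule int, simp_all add: abs_mult indicator_def \<phi>1)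
    then show ?thesis using m by simp
  qed
  have lip1: "\<bar>f x - f y\<bar> \<le> x - y" if "y \<le> x" for x y
  proof -
    have "f x - f y = (\<integral>t. \<phi> t * indicator {..<x} t - \<phi> t * indicator {..<y} t \<partial>clip_int A)"
      unfolding f_def by (rule Bochner_Integration.integral_diff[symmetric]) auto
    also have "\<bar>\<dots>\<bar> \<le> (\<integral>t. indicator {y..<x} t \<partial>clip_int A)" unfolding real_norm_def[symmetric]
    proof (rule Bochner_Integration.integral_norm_bound_integral)
      fix t show "norm (\<phi> t * indicator {..<x} t - \<phi> t * indicator {..<y} t) \<le> indicator {y..<x} t"
        using \<phi>1[of t] that by (auto simp: indicator_def)
    qed (auto simp: less_top[symmetric])
    also have "\<dots> \<le> x - y"
    proof -
      have "emeasure (clip_int A) {y..<x} = (\<integral>\<^sup>+t. indicator {-A..A} t * indicator {y..<x} t \<partial>lborel)"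
        unfolding clip_int_def by (rule emeasure_density) auto
      also have "\<dots> \<le> (\<integral>\<^sup>+t. indicator {y..<x} t \<partial>lborel)"
        by (intro nn_integral_mono) (auto simp: indicator_def)
      also have "\<dots> = ennreal (x - y)" using that by simp
      finally have "emeasure (clip_int A) {y..<x} \<le> ennreal (x - y)" .
      then have "measure (clip_int A) {y..<x} \<le> x - y"
        using that by (simp add: l.emeasure_eq_measure)
      then show ?thesis by simp
    qed
    finally show ?thesis .
  qed
  have lip: "\<bar>f x - f y\<bar> \<le> \<bar>x - y\<bar>" for x y
    using lip1[of x y] lip1[of y x] by (cases "y \<le> x") auto
  \<comment> \<open>Integration by parts in the form of Fubini: \<open>f\<close> is a primitive of
    \<open>\<phi>\<close>, so its expectation pairs \<open>\<phi>\<close> with the tail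
    \<open>1 - cdf \<pi>\<close>.\<close>
  have Ef: "(\<integral>x. f x \<partial>\<pi>) = (\<integral>t. \<phi> t * (1 - cdf \<pi> t) \<partial>clip_int A)" if \<pi>: "real_distribution \<pi>" for \<pi>
  proof -
    interpret \<pi>: cdf_distribution \<pi> unfolding cdf_distribution_def by fact
    interpret p: pair_sigma_finite \<pi> "clip_int A" ..
    interpret pf: finite_measure "\<pi> \<Otimes>\<^sub>M clip_int A"
      by (rule finite_measure_pair_measure) unfold_locales
    have "integrable (\<pi> \<Otimes>\<^sub>M clip_int A) (\<lambda>(x, t). \<phi> t * indicator {..<x} t)"
      by (rule pf.integrable_const_bound[where B=1]) (auto simp: abs_mult indicator_def \<phi>1 lessThan_def)
    then have "(\<integral>x. f x \<partial>\<pi>) = (\<integral>t. (\<integral>x. \<phi> t * indicator {..<x} t \<partial>\<pi>) \<partial>clip_int A)"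
      unfolding f_def by (rule p.Fubini_integral[symmetric])
    also have "\<dots> = (\<integral>t. \<phi> t * (1 - cdf \<pi> t) \<partial>clip_int A)"
    proof (rule Bochner_Integration.integral_cong[OF refl])
      fix t
      have "(\<integral>x. \<phi> t * indicator {..<x} t \<partial>\<pi>) = \<phi> t * (\<integral>x. indicator (UNIV - {..t}) x \<partial>\<pi>)"
        by (subst integral_mult_right_zero[symmetric]) (auto intro!: Bochner_Integration.integral_cong simp: indicator_def)
      also have "(\<integral>x. indicator (UNIV - {..t}) x \<partial>\<pi>) = 1 - cdf \<pi> t"
        using \<pi>.prob_compl[of "{..t}"] by (simp add: cdf_def)
      finally show "(\<integral>x. \<phi> t * indicator {..<x} t \<partial>\<pi>) = \<phi> t * (1 - cdf \<pi> t)" .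
    qed
    finally show ?thesis .
  qed
  have i: "integrable (clip_int A) (\<lambda>t. \<phi> t * (1 - cdf \<mu> t))" "integrable (clip_int A) (\<lambda>t. \<phi> t * (1 - cdf \<nu> t))"
    using \<phi>1 \<mu>.cdf_bounded_prob \<nu>.cdf_bounded_prob \<mu>.cdf_nonneg \<nu>.cdf_nonneg
    by (auto intro!: l.integrable_const_bound[where B=1] simp: abs_mult mult_le_one)
  have "(\<integral>x. f x \<partial>\<mu>) - (\<integral>x. f x \<partial>\<nu>) = (\<integral>t. \<phi> t * (1 - cdf \<mu> t) - \<phi> t * (1 - cdf \<nu> t) \<partial>clip_int A)"
    unfolding Ef[OF \<mu>(1)] Ef[OF \<nu>(1)] using i by simp
  also have "\<dots> = (\<integral>t. \<bar>cdf \<mu> t - cdf \<nu> t\<bar> \<partial>clip_int A)"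
    by (intro Bochner_Integration.integral_cong refl) (auto simp: \<phi>_def sgn_real_def algebra_simps)
  finally have eq: "(\<integral>x. f x \<partial>\<mu>) - (\<integral>x. f x \<partial>\<nu>) = (\<integral>t. \<bar>cdf \<mu> t - cdf \<nu> t\<bar> \<partial>clip_int A)" .
  have ii: "integrable (clip_int A) (\<lambda>t. \<bar>cdf \<mu> t - cdf \<nu> t\<bar>)"
    using \<mu>.cdf_bounded_prob \<nu>.cdf_bounded_prob \<mu>.cdf_nonneg \<nu>.cdf_nonneg
    by (auto intro!: l.integrable_const_bound[where B=2] AE_I2 simp: abs_le_iff)
      (smt (verit) \<mu>.cdf_bounded_prob \<nu>.cdf_bounded_prob \<mu>.cdf_nonneg \<nu>.cdf_nonneg)+
  have "W1 \<mu> \<nu> = (\<integral>\<^sup>+t. ennreal \<bar>cdf \<mu> t - cdf \<nu> t\<bar> \<partial>lborel)" by (rule W1_eq_cdf[OF \<mu>(1) \<nu>(1)])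
  also have "\<dots> = (\<integral>\<^sup>+t. indicator {-A..A} t * ennreal \<bar>cdf \<mu> t - cdf \<nu> t\<bar> \<partial>lborel)"
  proof (rule nn_integral_cong)
    fix t
    show "ennreal \<bar>cdf \<mu> t - cdf \<nu> t\<bar> = indicator {-A..A} t * ennreal \<bar>cdf \<mu> t - cdf \<nu> t\<bar>"
      using cdf_outside_support[OF \<mu>, of t] cdf_outside_support[OF \<nu>, of t]
      by (cases "t < -A"; cases "A < t") (auto simp: indicator_def)
  qed
  also have "\<dots> = (\<integral>\<^sup>+t. ennreal \<bar>cdf \<mu> t - cdf \<nu> t\<bar> \<partial>clip_int A)"
    unfolding clip_int_def by (rule nn_integral_density[symmetric]) auto
  also have "\<dots> = ennreal (\<integral>t. \<bar>cdf \<mu> t - cdf \<nu> t\<bar> \<partial>clip_int A)"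
    by (rule nn_integral_eq_integral[OF ii]) simp
  finally have "W1 \<mu> \<nu> = ennreal ((\<integral>x. f x \<partial>\<mu>) - (\<integral>x. f x \<partial>\<nu>))" unfolding eq .
  with lip bound that show thesis by blast
qed

lemma integrable_bounded_support:
  fixes h :: "real \<Rightarrow> real"
  assumes "real_distribution \<mu>" "measure \<mu> {-A..A} = 1" "h \<in> borel_measurable borel"
    and "\<And>x. x \<in> {-A..A} \<Longrightarrow> \<bar>h x\<bar> \<le> c"
  shows "integrable \<mu> h"
proof -
  interpret real_distribution \<mu> by fact
  show ?thesis
    by (rule integrable_const_bound[where B=c]) (use AE_support[OF assms(1,2)] assms(3,4) in auto)
qed

lemma integral_le_bounded_support:
  fixes h :: "real \<Rightarrow> real"
  assumes "real_distribution \<mu>" "measure \<mu> {-A..A} = 1" "h \<in> borel_measurable borel"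
    and "\<And>x. x \<in> {-A..A} \<Longrightarrow> \<bar>h x\<bar> \<le> c"
  shows "\<bar>\<integral>x. h x \<partial>\<mu>\<bar> \<le> c"
proof -
  interpret real_distribution \<mu> by fact
  have i: "integrable \<mu> h" by (rule integrable_bounded_support[OF assms])
  have "\<bar>\<integral>x. h x \<partial>\<mu>\<bar> \<le> (\<integral>x. \<bar>h x\<bar> \<partial>\<mu>)" by (rule integral_abs_bound)
  also have "\<dots> \<le> (\<integral>x. c \<partial>\<mu>)"
    using i by (intro integral_mono_AE) (use AE_support[OF assms(1,2)] assms(4) in auto)
  finally show ?thesis using prob_space by simp
qed

text \<open>The tolerance is relative to \<open>A ^ i\<close> because the approximating polynomial
  is one in \<open>x / A\<close>; the sum of its coefficients times \<open>\<eta>\<close> bounds the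
  difference of its two integrals. The Jackson error enters twice, once for each
  distribution.\<close>

lemma W1_le_moments:
  assumes \<mu>: "real_distribution \<mu>" "measure \<mu> {-A..A} = 1"
    and \<nu>: "real_distribution \<nu>" "measure \<nu> {-A..A} = 1" and A: "A > 0" and k: "k \<ge> 1"
    and mom: "\<And>i. i \<in> {1..2 * k - 1} \<Longrightarrow> \<bar>moment \<mu> i - moment \<nu> i\<bar> \<le> \<eta> * A ^ i"
  shows "W1 \<mu> \<nu> \<le> ennreal (2 * (1 + 4 * pi) * A / real k + 8 * pi * A * real k * 9 ^ k * \<eta>)"
proof -
  interpret \<mu>: real_distribution \<mu> by fact
  interpret \<nu>: real_distribution \<nu> by fact
  obtain f where lip: "\<And>x y. \<bar>f x - f y\<bar> \<le> \<bar>x - y\<bar>" and F: "\<And>x. \<bar>f x\<bar> \<le> 2 * A"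
    and W: "W1 \<mu> \<nu> = ennreal ((\<integral>x. f x \<partial>\<mu>) - (\<integral>x. f x \<partial>\<nu>))"
    using W1_eq_Lipschitz_difference[OF \<mu> \<nu> A] by blast
  obtain e where e: "\<And>x. x \<in> {-A..A} \<Longrightarrow> \<bar>(\<Sum>i<2 * k. e i * (x / A) ^ i) - f x\<bar> \<le> (1 + 4 * pi) * A / real k"
    and es: "(\<Sum>i<2 * k. \<bar>e i\<bar>) \<le> 4 * pi * (2 * A) * real k * 9 ^ k"
    using Jackson_Lipschitz[OF k A lip F] by blast
  define P where "P = (\<lambda>x. \<Sum>i<2 * k. e i * (x / A) ^ i)"
  have "continuous_on UNIV f"
  proof (rule continuous_onI)
    fix x \<epsilon> :: real assume \<epsilon>: "\<epsilon> > 0"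
    have "dist (f y) (f x) \<le> \<epsilon>" if "dist y x < \<epsilon>" for y
      using lip[of y x] that by (simp add: dist_real_def)
    then show "\<exists>d>0. \<forall>y\<in>UNIV. dist y x < d \<longrightarrow> dist (f y) (f x) \<le> \<epsilon>" using \<epsilon> by blast
  qed
  then have [measurable]: "f \<in> borel_measurable borel" by (rule borel_measurable_continuous_onI)
  have [measurable]: "P \<in> borel_measurable borel" unfolding P_def by measurable
  have approx: "\<bar>(\<integral>x. P x \<partial>\<pi>) - (\<integral>x. f x \<partial>\<pi>)\<bar> \<le> (1 + 4 * pi) * A / real k"
    and EP: "(\<integral>x. P x \<partial>\<pi>) = (\<Sum>i<2 * k. e i / A ^ i * moment \<pi> i)"
    if \<pi>: "real_distribution \<pi>" "measure \<pi> {-A..A} = 1" for \<pi>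
  proof -
    have ix: "integrable \<pi> (\<lambda>x. x ^ i)" for i
      by (rule integrable_bounded_support[OF \<pi>, of _ "A ^ i"]) (auto simp: power_abs intro!: power_mono)
    have Pe: "P = (\<lambda>x. \<Sum>i<2 * k. e i / A ^ i * x ^ i)" by (simp add: P_def power_divide)
    have iP: "integrable \<pi> P" unfolding Pe using ix by simp
    have "integrable \<pi> f" by (rule integrable_bounded_support[OF \<pi> _ F]) simp
    with iP have "(\<integral>x. P x \<partial>\<pi>) - (\<integral>x. f x \<partial>\<pi>) = (\<integral>x. P x - f x \<partial>\<pi>)" by simp
    also have "\<bar>\<dots>\<bar> \<le> (1 + 4 * pi) * A / real k"
      by (rule integral_le_bounded_support[OF \<pi>]) (use e in \<open>auto simp: P_def\<close>)
    finally show "\<bar>(\<integral>x. P x \<partial>\<pi>) - (\<integral>x. f x \<partial>\<pi>)\<bar> \<le> (1 + 4 * pi) * A / real k" .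
    show "(\<integral>x. P x \<partial>\<pi>) = (\<Sum>i<2 * k. e i / A ^ i * moment \<pi> i)"
      unfolding Pe moment_def using ix by simp
  qed
  have "\<bar>(\<integral>x. P x \<partial>\<mu>) - (\<integral>x. P x \<partial>\<nu>)\<bar> = \<bar>\<Sum>i<2 * k. e i / A ^ i * (moment \<mu> i - moment \<nu> i)\<bar>"
    by (simp add: EP[OF \<mu>] EP[OF \<nu>] sum_subtractf right_diff_distrib)
  also have "\<dots> \<le> (\<Sum>i<2 * k. \<bar>e i\<bar> * \<eta>)"
  proof (rule order_trans[OF sum_abs], rule sum_mono)
    fix i assume i: "i \<in> {..<2 * k}"
    have "1 \<in> {1..2 * k - 1}" using k by auto
    from mom[OF this] have "0 \<le> \<eta> * A ^ 1" using abs_ge_zero order_trans by blast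
    then have \<eta>: "\<eta> \<ge> 0" using A by (simp add: zero_le_mult_iff)
    have "\<bar>moment \<mu> i - moment \<nu> i\<bar> \<le> \<eta> * A ^ i"
    proof (cases "i = 0")
      case True
      then show ?thesis using \<eta> \<mu>.prob_space \<nu>.prob_space by (simp add: moment_def)
    qed (use mom i in auto)
    then have "\<bar>e i\<bar> / A ^ i * \<bar>moment \<mu> i - moment \<nu> i\<bar> \<le> \<bar>e i\<bar> / A ^ i * (\<eta> * A ^ i)"
      using A by (intro mult_left_mono) auto
    then show "\<bar>e i / A ^ i * (moment \<mu> i - moment \<nu> i)\<bar> \<le> \<bar>e i\<bar> * \<eta>"
      using A by (simp add: abs_mult)
  qed
  also have "\<dots> = (\<Sum>i<2 * k. \<bar>e i\<bar>) * \<eta>" by (simp add: sum_distrib_right)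
  also have "\<dots> \<le> 4 * pi * (2 * A) * real k * 9 ^ k * \<eta>"
  proof (rule mult_right_mono[OF es])
    have "1 \<in> {1..2 * k - 1}" using k by auto
    from mom[OF this] have "0 \<le> \<eta> * A ^ 1" using abs_ge_zero order_trans by blast
    then show "\<eta> \<ge> 0" using A by (simp add: zero_le_mult_iff)
  qed
  finally have "(\<integral>x. f x \<partial>\<mu>) - (\<integral>x. f x \<partial>\<nu>) \<le> 2 * ((1 + 4 * pi) * A / real k) + 4 * pi * (2 * A) * real k * 9 ^ k * \<eta>"
    using approx[OF \<mu>] approx[OF \<nu>] by linarith
  then show ?thesis unfolding W by (intro ennreal_leI) (simp add: mult_ac)
qed

section \<open>The denoised method of moments estimator\<close>

definition atomic_moment :: "nat \<Rightarrow> (nat \<Rightarrow> real) \<Rightarrow> (nat \<Rightarrow> real) \<Rightarrow> nat \<Rightarrow> real" where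
  "atomic_moment k x w l = (\<Sum>i<k. w i * x i ^ l)"

definition atomic_cdf :: "nat \<Rightarrow> (nat \<Rightarrow> real) \<Rightarrow> (nat \<Rightarrow> real) \<Rightarrow> real \<Rightarrow> real" where
  "atomic_cdf k x w t = (\<Sum>i<k. w i * indicator {x i..} t)"

definition atom_params :: "nat \<Rightarrow> real \<Rightarrow> ((nat \<Rightarrow> real) \<times> (nat \<Rightarrow> real)) set" where
  "atom_params k A = {(x, w). (\<forall>i. x i \<in> {-A..A}) \<and> (\<forall>i. w i \<in> {0..1}) \<and> (\<Sum>i<k. w i) = 1}"

lemma tendsto_apply_fun:
  fixes f :: "'a \<Rightarrow> 'b \<Rightarrow> 'c::topological_space"
  assumes "(f \<longlongrightarrow> l) F"
  shows "((\<lambda>n. f n i) \<longlongrightarrow> l i) F"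
  using continuous_on_tendsto_compose[OF continuous_on_product_coordinates assms] by simp

lemma compact_atom_params: "compact (atom_params k A)"
proof -
  have c: "compact (PiE UNIV (\<lambda>_. {a..b}) :: (nat \<Rightarrow> real) set)" for a b :: real
  proof -
    have "compactin (product_topology (\<lambda>_. euclidean) UNIV) (PiE UNIV (\<lambda>_. {a..b}) :: (nat \<Rightarrow> real) set)"
      unfolding compactin_PiE by simp
    then show ?thesis by (simp add: euclidean_product_topology)
  qed
  have "compact ((PiE UNIV (\<lambda>_. {-A..A}) \<times> PiE UNIV (\<lambda>_. {0..1})) \<inter> {(x :: nat \<Rightarrow> real, w). (\<Sum>i<k. w i) = (1::real)})"
  proof (rule compact_Int_closed[OF compact_Times[OF c c]])
    have "continuous_on UNIV (\<lambda>z :: (nat \<Rightarrow> real) \<times> (nat \<Rightarrow> real). \<Sum>i<k. snd z i)"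
      by (intro continuous_on_sum continuous_on_product_then_coordinatewise[OF continuous_on_snd[OF continuous_on_id]])
    then have "closed ((\<lambda>z :: (nat \<Rightarrow> real) \<times> (nat \<Rightarrow> real). \<Sum>i<k. snd z i) -` {1})"
      by (intro closed_vimage) auto
    then show "closed {(x :: nat \<Rightarrow> real, w). (\<Sum>i<k. w i) = (1::real)}"
      by (simp add: vimage_def split_def)
  qed
  also have "(PiE UNIV (\<lambda>_. {-A..A}) \<times> PiE UNIV (\<lambda>_. {0..1})) \<inter> {(x :: nat \<Rightarrow> real, w). (\<Sum>i<k. w i) = (1::real)} = atom_params k A"
    by (auto simp: atom_params_def PiE_UNIV_domain)
  finally show ?thesis .
qed

lemma finite_support_repr:
  assumes \<pi>: "real_distribution \<pi>" and S: "finite S" "card S \<le> k" "S \<subseteq> {-A..A}" "measure \<pi> S = 1"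
  obtains x w where "(x, w) \<in> atom_params k A" "\<And>l. moment \<pi> l = atomic_moment k x w l" "\<And>t. cdf \<pi> t = atomic_cdf k x w t"
proof -
  interpret real_distribution \<pi> by fact
  have ne: "S \<noteq> {}" using S(4) by auto
  obtain h where h: "bij_betw h {..<card S} S"
    using ex_bij_betw_nat_finite[OF S(1)] by (auto simp: atLeast0LessThan)
  define m where "m = card S"
  have m: "m \<ge> 1" "m \<le> k" using ne S by (auto simp: m_def Suc_le_eq card_gt_0_iff)
  \<comment> \<open>If there are fewer than \<open>k\<close> atoms, the list is filled up with
    copies of \<open>h 0\<close> of weight 0.\<close>
  define x where "x = (\<lambda>i. if i < m then h i else h 0)"
  define w where "w = (\<lambda>i. if i < m then measure \<pi> {h i} else 0)"
  have hS: "h i \<in> S" if "i < m" for i using h that by (auto simp: bij_betw_def m_def)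
  have int: "(\<integral>y. f y \<partial>\<pi>) = (\<Sum>i<k. w i * f (x i))" if [measurable]: "f \<in> borel_measurable borel" for f :: "real \<Rightarrow> real"
  proof -
    have ae: "AE y in \<pi>. y \<in> S" using S(4) prob_eq_1[of S] S(1) by (simp add: finite_imp_closed)
    have "(\<integral>y. f y \<partial>\<pi>) = (\<integral>y. (\<Sum>s\<in>S. f s * indicator {s} y) \<partial>\<pi>)"
    proof (rule integral_cong_AE)
      show "AE y in \<pi>. f y = (\<Sum>s\<in>S. f s * indicator {s} y)"
        using ae by eventually_elim (simp add: indicator_def S(1) if_distrib[of "\<lambda>z. _ * z"] cong: if_cong)
    qed auto
    also have "\<dots> = (\<Sum>s\<in>S. f s * measure \<pi> {s})"
      by (subst Bochner_Integration.integral_sum) (auto simp: less_top[symmetric])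
    also have "\<dots> = (\<Sum>i<m. f (h i) * measure \<pi> {h i})"
      using sum.reindex_bij_betw[OF h, of "\<lambda>s. f s * measure \<pi> {s}"] by (simp add: m_def)
    also have "\<dots> = (\<Sum>i<m. w i * f (x i))" by (simp add: w_def x_def mult.commute)
    also have "\<dots> = (\<Sum>i<k. w i * f (x i))"
      using m by (intro sum.mono_neutral_left) (auto simp: w_def)
    finally show ?thesis .
  qed
  have "(x, w) \<in> atom_params k A"
  proof -
    have "x i \<in> {-A..A}" for i using hS[of i] hS[of 0] m S(3) by (auto simp: x_def)
    moreover have "w i \<in> {0..1}" for i by (auto simp: w_def)
    moreover have "(\<Sum>i<k. w i) = 1" using int[of "\<lambda>_. 1"] prob_space by simp
    ultimately show ?thesis by (simp add: atom_params_def)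
  qed
  moreover have "moment \<pi> l = atomic_moment k x w l" for l
    unfolding moment_def atomic_moment_def by (rule int) simp
  moreover have "cdf \<pi> t = atomic_cdf k x w t" for t
  proof -
    have "cdf \<pi> t = (\<integral>y. indicator {..t} y \<partial>\<pi>)" by (simp add: cdf_def)
    also have "\<dots> = atomic_cdf k x w t"
      unfolding atomic_cdf_def by (subst int) (auto simp: indicator_def)
    finally show ?thesis .
  qed
  ultimately show thesis by (rule that)
qed

text \<open>The number of atoms is arbitrary because it will also be applied to midpoints of two
  \<open>k\<close>-atom distributions.\<close>

lemma atomic_moment_space:
  assumes x: "\<And>i. i < n \<Longrightarrow> x i \<in> {-A..A}" and w: "\<And>i. i < n \<Longrightarrow> 0 \<le> w i" "(\<Sum>i<n. w i) = 1"
  shows "restrict (atomic_moment n x w) {1..L} \<in> moment_space L A"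
proof -
  define P where "P = point_measure {..<n} (\<lambda>i. ennreal (w i))"
  define \<pi> where "\<pi> = distr P borel x"
  have P: "prob_space P"
    unfolding P_def using w sum_ennreal[of "{..<n}" w]
    by (intro prob_spaceI) (simp add: space_point_measure emeasure_point_measure_finite)
  interpret P: prob_space P by fact
  have meas: "x \<in> P \<rightarrow>\<^sub>M borel" by (simp add: P_def measurable_point_measure_eq1 space_point_measure sets_point_measure measurable_def)
  have \<pi>: "real_distribution \<pi>" unfolding \<pi>_def
    using P.prob_space_distr[OF meas] by (simp add: real_distribution_def real_distribution_axioms_def)
  have int: "(\<integral>y. f y \<partial>\<pi>) = (\<Sum>i<n. w i * f (x i))" if "f \<in> borel_measurable borel" for f :: "real \<Rightarrow> real"
  proof -
    have "(\<integral>y. f y \<partial>\<pi>) = (\<integral>i. f (x i) \<partial>P)" unfolding \<pi>_def by (rule integral_distr[OF meas that])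
    also have "\<dots> = (\<Sum>i<n. w i * f (x i))"
      unfolding P_def using w by (subst lebesgue_integral_point_measure_finite) auto
    finally show ?thesis .
  qed
  interpret \<pi>: real_distribution \<pi> by fact
  have "measure \<pi> {-A..A} = (\<integral>y. indicator {-A..A} y \<partial>\<pi>)" by simp
  also have "\<dots> = (\<Sum>i<n. w i * indicator {-A..A} (x i))" by (rule int) simp
  also have "\<dots> = 1" using x w(2) by (simp add: indicator_def)
  finally have 1: "measure \<pi> {-A..A} = 1" .
  have "restrict (atomic_moment n x w) {1..L} = restrict (moment \<pi>) {1..L}"
    unfolding moment_def atomic_moment_def by (intro restrict_ext int[symmetric]) auto
  then show ?thesis unfolding moment_space_def using \<pi> 1 by blast
qed

text \<open>Together the two distributions have at most \<open>2 * k\<close> nodes. A polynomial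
  vanishing at all nodes but one has degree below \<open>2 * k\<close>, so equal moments force equal
  mass at that node.\<close>

lemma atomic_cdf_unique:
  assumes w: "(\<Sum>i<k. w i) = 1" "(\<Sum>i<k. w' i) = 1"
    and eq: "\<And>l. l \<in> {1..2 * k - 1} \<Longrightarrow> atomic_moment k x w l = atomic_moment k x' w' l"
  shows "atomic_cdf k x w t = atomic_cdf k x' w' t"
proof -
  define Z where "Z = x ` {..<k} \<union> x' ` {..<k}"
  have finZ: "finite Z" by (simp add: Z_def)
  have cardZ: "card Z \<le> 2 * k"
    unfolding Z_def using card_Un_le[of "x ` {..<k}" "x' ` {..<k}"] card_image_le[of "{..<k}" x] card_image_le[of "{..<k}" x'] by simp
  have poly_eq: "(\<Sum>i<k. w i * poly P (x i)) = (\<Sum>i<k. w' i * poly P (x' i))" if P: "degree P < 2 * k" for P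
  proof -
    have mom: "(\<Sum>i<k. u i * poly P (y i)) = (\<Sum>l<2 * k. coeff P l * atomic_moment k y u l)" for u y :: "nat \<Rightarrow> real"
      unfolding poly_eq_sum_lessThan[OF P] atomic_moment_def sum_distrib_left
      by (subst sum.swap) (simp add: mult_ac)
    have "atomic_moment k x w l = atomic_moment k x' w' l" if "l < 2 * k" for l
      using eq[of l] that w by (cases "l = 0") (auto simp: atomic_moment_def)
    then show ?thesis unfolding mom by simp
  qed
  have mass: "(\<Sum>i<k. if x i = z then w i else 0) = (\<Sum>i<k. if x' i = z then w' i else 0)" if z: "z \<in> Z" for z
  proof -
    define P where "P = (\<Prod>y\<in>Z - {z}. [:- y, 1:])"
    have fz: "finite (Z - {z})" using finZ by simp
    have "degree P \<le> card (Z - {z})"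
      unfolding P_def using degree_prod_sum_le[OF fz, of "\<lambda>y. [:- y, 1:]"] by (simp add: comp_def)
    also have "\<dots> < card Z" using z finZ by (intro psubset_card_mono) auto
    finally have deg: "degree P < 2 * k" using cardZ by simp
    have Pz: "poly P z \<noteq> 0" using finZ by (simp add: P_def poly_prod)
    have Py: "poly P y = (if y = z then poly P z else 0)" if "y \<in> Z" for y
      using finZ that by (auto simp: P_def poly_prod)
    have "(\<Sum>i<k. w i * poly P (x i)) = (\<Sum>i<k. if x i = z then w i else 0) * poly P z"
      unfolding sum_distrib_right by (intro sum.cong refl, subst Py) (auto simp: Z_def)
    moreover have "(\<Sum>i<k. w' i * poly P (x' i)) = (\<Sum>i<k. if x' i = z then w' i else 0) * poly P z"
      unfolding sum_distrib_right by (intro sum.cong refl, subst Py) (auto simp: Z_def)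
    ultimately show ?thesis using poly_eq[OF deg] Pz by simp
  qed
  have cdf: "atomic_cdf k y u t = (\<Sum>z\<in>Z. indicator {z..} t * (\<Sum>i<k. if y i = z then u i else 0))"
    if "y ` {..<k} \<subseteq> Z" for y u
  proof -
    have "(\<Sum>z\<in>Z. indicator {z..} t * (\<Sum>i<k. if y i = z then u i else 0)) = (\<Sum>i<k. \<Sum>z\<in>Z. if z = y i then indicator {z..} t * u i else 0)"
      unfolding sum_distrib_left by (subst sum.swap) (intro sum.cong refl, auto)
    also have "\<dots> = (\<Sum>i<k. u i * indicator {y i..} t)"
      using that finZ by (intro sum.cong refl) (auto simp: mult.commute)
    finally show ?thesis by (simp add: atomic_cdf_def)
  qed
  show ?thesis using cdf[of x w] cdf[of x' w'] mass by (simp add: Z_def)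
qed

text \<open>The parallelogram identity, that is, strict convexity of the Euclidean ball.\<close>

lemma L2_set_midpoint_less:
  fixes m m' v :: "nat \<Rightarrow> real"
  assumes "finite J" "L2_set (\<lambda>l. m l - v l) J \<le> r" "L2_set (\<lambda>l. m' l - v l) J \<le> r"
    and "l \<in> J" "m l \<noteq> m' l"
  shows "L2_set (\<lambda>l. (m l + m' l) / 2 - v l) J < r"
proof -
  have r0: "r \<ge> 0" using assms(2) L2_set_nonneg order_trans by blast
  have midpoint: "4 * a + b = 2 * c + 2 * d \<Longrightarrow> 0 < b \<Longrightarrow> c \<le> e \<Longrightarrow> d \<le> e \<Longrightarrow> a < e" for a b c d e :: real
    by linarith
  have sq: "(\<Sum>l\<in>J. (m l - v l)\<^sup>2) \<le> r\<^sup>2" "(\<Sum>l\<in>J. (m' l - v l)\<^sup>2) \<le> r\<^sup>2"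
    using assms(2,3) unfolding L2_set_def by (auto intro: sqrt_le_D)
  have "4 * (\<Sum>l\<in>J. ((m l + m' l) / 2 - v l)\<^sup>2) + (\<Sum>l\<in>J. (m l - m' l)\<^sup>2)
      = 2 * (\<Sum>l\<in>J. (m l - v l)\<^sup>2) + 2 * (\<Sum>l\<in>J. (m' l - v l)\<^sup>2)"
    unfolding sum_distrib_left sum.distrib[symmetric]
    by (intro sum.cong refl) (simp add: power2_eq_square field_simps)
  moreover have "(\<Sum>l\<in>J. (m l - m' l)\<^sup>2) > 0"
    using assms by (intro sum_pos2[of J l]) auto
  ultimately have "(\<Sum>l\<in>J. ((m l + m' l) / 2 - v l)\<^sup>2) < r\<^sup>2"
    using sq by (rule midpoint)
  then have "sqrt (\<Sum>l\<in>J. ((m l + m' l) / 2 - v l)\<^sup>2) < sqrt (r\<^sup>2)" by (rule real_sqrt_less_mono)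
  then show ?thesis using r0 by (simp add: L2_set_def)
qed

lemma atom_params_sum: "z \<in> atom_params k A \<Longrightarrow> (\<Sum>i<k. snd z i) = 1"
  by (cases z) (auto simp: atom_params_def)

section \<open>Measurability of the estimation error\<close>

definition moment_dist :: "nat \<Rightarrow> (nat \<Rightarrow> real) \<times> (nat \<Rightarrow> real) \<Rightarrow> (nat \<Rightarrow> real) \<Rightarrow> real" where
  "moment_dist k z v = L2_set (\<lambda>l. atomic_moment k (fst z) (snd z) l - v l) {1..2 * k - 1}"

definition W1_atomic :: "real measure \<Rightarrow> nat \<Rightarrow> (nat \<Rightarrow> real) \<times> (nat \<Rightarrow> real) \<Rightarrow> real \<Rightarrow> ennreal" where
  "W1_atomic g k z a = (\<integral>\<^sup>+t. ennreal \<bar>cdf g t - atomic_cdf k (fst z) (snd z) (t - a)\<bar> \<partial>lborel)"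

text \<open>The selection \<open>D\<close> is not assumed measurable. Minimality over a compact set of atoms and weights
  makes the graph condition closed, so the sublevel sets of the error are closed in the pair
  (moment vector, shift).\<close>

definition dmm_sublevel :: "real measure \<Rightarrow> nat \<Rightarrow> real \<Rightarrow> ennreal \<Rightarrow> ((nat \<Rightarrow> real) \<times> real) set" where
  "dmm_sublevel g k A c = {(v, a). \<exists>z\<in>atom_params k A.
     (\<forall>y\<in>atom_params k A. moment_dist k z v \<le> moment_dist k y v) \<and> W1_atomic g k z a \<le> c}"

lemma atom_params_moment_space:
  "z \<in> atom_params k A \<Longrightarrow> restrict (atomic_moment k (fst z) (snd z)) {1..L} \<in> moment_space L A"
  by (rule atomic_moment_space) (auto simp: atom_params_def)

lemma is_dmm_repr:
  assumes "is_dmm A k v \<pi>"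
  obtains z where "z \<in> atom_params k A" "\<And>t. cdf \<pi> t = atomic_cdf k (fst z) (snd z) t"
    "\<And>m. m \<in> moment_space (2 * k - 1) A \<Longrightarrow> moment_dist k z v \<le> L2_set (\<lambda>l. m l - v l) {1..2 * k - 1}"
proof -
  from assms obtain S m where \<pi>: "real_distribution \<pi>" and S: "finite S" "card S \<le> k" "S \<subseteq> {-A..A}" "measure \<pi> S = 1"
    and m: "is_arg_min (\<lambda>m. L2_set (\<lambda>l. m l - v l) {1..2 * k - 1}) (\<lambda>m. m \<in> moment_space (2 * k - 1) A) m"
      "\<And>l. l \<in> {1..2 * k - 1} \<Longrightarrow> moment \<pi> l = m l"
    unfolding is_dmm_def by blast
  obtain x w where xw: "(x, w) \<in> atom_params k A" "\<And>l. moment \<pi> l = atomic_moment k x w l" "\<And>t. cdf \<pi> t = atomic_cdf k x w t"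
    using finite_support_repr[OF \<pi> S] by blast
  have "moment_dist k (x, w) v = L2_set (\<lambda>l. m l - v l) {1..2 * k - 1}"
    unfolding moment_dist_def by (intro L2_set_cong refl) (use m(2) xw(2) in auto)
  then show thesis
    using m(1) xw by (intro that[of "(x, w)"]) (auto simp: is_arg_min_linorder)
qed

text \<open>\<open>\<pi>\<close> minimises over the whole moment space, a witness in
  \<open>dmm_sublevel\<close> only over \<open>k\<close>-atom parameters. If their moments differed,
  the midpoint, realised with 2 k atoms, would be a point of the moment space strictly closer to
  \<open>v\<close>. So the moments agree and, by \<open>atomic_cdf_unique\<close>, so do the cdfs;
  the right side no longer mentions the selected \<open>\<pi>\<close>.\<close>

lemma W1_dmm_le_iff:
  assumes g: "real_distribution g" and dmm: "is_dmm A k v \<pi>" and A: "A \<ge> 0"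
  shows "W1 g (distr \<pi> borel (\<lambda>x. x + a)) \<le> c \<longleftrightarrow> (v, a) \<in> dmm_sublevel g k A c"
proof -
  obtain z where z: "z \<in> atom_params k A" "\<And>t. cdf \<pi> t = atomic_cdf k (fst z) (snd z) t"
    "\<And>m. m \<in> moment_space (2 * k - 1) A \<Longrightarrow> moment_dist k z v \<le> L2_set (\<lambda>l. m l - v l) {1..2 * k - 1}"
    using is_dmm_repr[OF dmm] by blast
  have \<pi>: "real_distribution \<pi>" using dmm by (simp add: is_dmm_def)
  have W: "W1 g (distr \<pi> borel (\<lambda>x. x + a)) = W1_atomic g k z a"
    unfolding W1_atomic_def
    by (subst W1_eq_cdf[OF g real_distribution_distr_real[OF \<pi>]]) (simp_all add: cdf_distr_translate[OF \<pi>] z(2))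
  have restr: "L2_set (\<lambda>l. restrict (atomic_moment k (fst y) (snd y)) {1..2 * k - 1} l - v l) {1..2 * k - 1} = moment_dist k y v" for y
    unfolding moment_dist_def by (intro L2_set_cong) auto
  have zmin: "moment_dist k z v \<le> moment_dist k y v" if "y \<in> atom_params k A" for y
    using z(3)[OF atom_params_moment_space[OF that]] unfolding restr .
  show ?thesis
  proof
    assume "W1 g (distr \<pi> borel (\<lambda>x. x + a)) \<le> c"
    then show "(v, a) \<in> dmm_sublevel g k A c"
      unfolding dmm_sublevel_def W using z(1) zmin by blast
  next
    assume "(v, a) \<in> dmm_sublevel g k A c"
    then obtain y where y: "y \<in> atom_params k A" "\<And>u. u \<in> atom_params k A \<Longrightarrow> moment_dist k y v \<le> moment_dist k u v"
      "W1_atomic g k y a \<le> c"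
      unfolding dmm_sublevel_def by blast
    have mom: "atomic_moment k (fst y) (snd y) l = atomic_moment k (fst z) (snd z) l" if l: "l \<in> {1..2 * k - 1}" for l
    proof (rule ccontr)
      assume ne: "atomic_moment k (fst y) (snd y) l \<noteq> atomic_moment k (fst z) (snd z) l"
      let ?mid = "\<lambda>l. (atomic_moment k (fst y) (snd y) l + atomic_moment k (fst z) (snd z) l) / 2"
      have less: "L2_set (\<lambda>l. ?mid l - v l) {1..2 * k - 1} < moment_dist k z v"
        by (rule L2_set_midpoint_less[where m="atomic_moment k (fst y) (snd y)" and m'="atomic_moment k (fst z) (snd z)", OF _ _ _ l ne]) (use y(2)[OF z(1)] in \<open>auto simp: moment_dist_def\<close>)
      define X where "X = (\<lambda>i. if i < k then fst y i else fst z (i - k))"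
      define V where "V = (\<lambda>i. (if i < k then snd y i else snd z (i - k)) / 2)"
      have split: "(\<Sum>i<k + k. f i) = (\<Sum>i<k. f i) + (\<Sum>i<k. f (i + k))" for f :: "nat \<Rightarrow> real"
      proof -
        have "(\<Sum>i<k + k. f i) = (\<Sum>i<k. f i) + (\<Sum>i=k..<k + k. f i)"
          by (simp add: lessThan_atLeast0 sum.atLeastLessThan_concat)
        also have "(\<Sum>i=k..<k + k. f i) = (\<Sum>i<k. f (i + k))"
          using sum.shift_bounds_nat_ivl[of f 0 k k] by (simp add: lessThan_atLeast0)
        finally show ?thesis .
      qed
      have "restrict (atomic_moment (k + k) X V) {1..2 * k - 1} \<in> moment_space (2 * k - 1) A"
      proof (rule atomic_moment_space)
        fix i assume "i < k + k"
        then show "X i \<in> {-A..A}" using y(1) z(1) by (auto simp: X_def atom_params_def split_beta)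
        show "0 \<le> V i" using y(1) z(1) by (auto simp: V_def atom_params_def split_beta)
      next
        show "(\<Sum>i<k + k. V i) = 1"
          unfolding split using atom_params_sum[OF y(1)] atom_params_sum[OF z(1)]
          by (simp add: V_def sum_divide_distrib[symmetric])
      qed
      from z(3)[OF this] have "moment_dist k z v \<le> L2_set (\<lambda>l. restrict (atomic_moment (k + k) X V) {1..2 * k - 1} l - v l) {1..2 * k - 1}" .
      also have "\<dots> = L2_set (\<lambda>l. ?mid l - v l) {1..2 * k - 1}"
        by (intro L2_set_cong refl)
          (simp add: atomic_moment_def split X_def V_def sum_divide_distrib[symmetric] add_divide_distrib)
      finally show False using less by simp
    qed
    have "atomic_cdf k (fst y) (snd y) t = atomic_cdf k (fst z) (snd z) t" for t
      by (rule atomic_cdf_unique[OF _ _ mom]) (use y(1) z(1) in \<open>auto simp: atom_params_def\<close>)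
    then show "W1 g (distr \<pi> borel (\<lambda>x. x + a)) \<le> c" using y(3) unfolding W W1_atomic_def by simp
  qed
qed

text \<open>Witnesses lie in a compact set, so a subsequence of them converges. Minimality passes to
  the limit by continuity, and the bound on the distance by Fatou's lemma.\<close>

lemma closed_dmm_sublevel:
  assumes g: "real_distribution g"
  shows "closed (dmm_sublevel g k A c)"
  unfolding closed_sequential_limits
proof (intro allI impI, elim conjE)
  interpret g: cdf_distribution g unfolding cdf_distribution_def by fact
  fix u :: "nat \<Rightarrow> (nat \<Rightarrow> real) \<times> real" and l
  assume u: "\<forall>n. u n \<in> dmm_sublevel g k A c" and lim: "u \<longlonglongrightarrow> l"
  then have "\<forall>n. \<exists>z. z \<in> atom_params k A \<and>
     (\<forall>y\<in>atom_params k A. moment_dist k z (fst (u n)) \<le> moment_dist k y (fst (u n))) \<and> W1_atomic g k z (snd (u n)) \<le> c"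
    unfolding dmm_sublevel_def by (force simp: split_beta)
  then obtain z where z: "\<And>n. z n \<in> atom_params k A"
     "\<And>n y. y \<in> atom_params k A \<Longrightarrow> moment_dist k (z n) (fst (u n)) \<le> moment_dist k y (fst (u n))"
     "\<And>n. W1_atomic g k (z n) (snd (u n)) \<le> c"
    by metis
  obtain q r where q: "q \<in> atom_params k A" and r: "strict_mono r" and zq: "(z \<circ> r) \<longlonglongrightarrow> q"
    using compact_atom_params[of k A] z(1) unfolding compact_def by metis
  have ul: "(\<lambda>n. u (r n)) \<longlonglongrightarrow> l" using LIMSEQ_subseq_LIMSEQ[OF lim r] by (simp add: comp_def)
  have zq': "(\<lambda>n. z (r n)) \<longlonglongrightarrow> q" using zq by (simp add: comp_def)
  have lv: "(\<lambda>n. fst (u (r n)) i) \<longlonglongrightarrow> fst l i" for i by (rule tendsto_apply_fun[OF tendsto_fst[OF ul]])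
  have la: "(\<lambda>n. snd (u (r n))) \<longlonglongrightarrow> snd l" by (rule tendsto_snd[OF ul])
  have qx: "(\<lambda>n. fst (z (r n)) i) \<longlonglongrightarrow> fst q i" for i by (rule tendsto_apply_fun[OF tendsto_fst[OF zq']])
  have qw: "(\<lambda>n. snd (z (r n)) i) \<longlonglongrightarrow> snd q i" for i by (rule tendsto_apply_fun[OF tendsto_snd[OF zq']])
  have min: "moment_dist k q (fst l) \<le> moment_dist k y (fst l)" if y: "y \<in> atom_params k A" for y
  proof (rule LIMSEQ_le)
    show "(\<lambda>n. moment_dist k (z (r n)) (fst (u (r n)))) \<longlonglongrightarrow> moment_dist k q (fst l)"
      unfolding moment_dist_def atomic_moment_def L2_set_def by (intro tendsto_intros qx qw lv)
    show "(\<lambda>n. moment_dist k y (fst (u (r n)))) \<longlonglongrightarrow> moment_dist k y (fst l)"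
      unfolding moment_dist_def atomic_moment_def L2_set_def by (intro tendsto_intros lv)
  qed (use z(2)[OF y] in blast)
  have cdfm: "(\<lambda>t. atomic_cdf k x w (t - a)) \<in> borel_measurable borel" for x w a
    unfolding atomic_cdf_def by measurable
  have "W1_atomic g k q (snd l) \<le> c"
  proof -
    define f where "f = (\<lambda>n t. ennreal \<bar>cdf g t - atomic_cdf k (fst (z (r n))) (snd (z (r n))) (t - snd (u (r n)))\<bar>)"
    have fm: "f n \<in> borel_measurable lborel" for n
      unfolding f_def using cdfm g.measurable_C by measurable
    \<comment> \<open>The jumps of the limiting cdf; convergence may fail there, but they form a
      null set.\<close>
    define Bad where "Bad = (\<lambda>i. fst q i + snd l) ` {..<k}"
    have ae: "AE t in lborel. t \<notin> Bad"
      unfolding Bad_def by (intro AE_not_in finite_imp_null_set_lborel) simp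
    have conv: "(\<lambda>n. f n t) \<longlonglongrightarrow> ennreal \<bar>cdf g t - atomic_cdf k (fst q) (snd q) (t - snd l)\<bar>" if t: "t \<notin> Bad" for t
    proof -
      have ind: "(\<lambda>n. indicator {fst (z (r n)) i..} (t - snd (u (r n))) :: real) \<longlonglongrightarrow> indicator {fst q i..} (t - snd l)"
        if i: "i < k" for i
      proof -
        have lim: "(\<lambda>n. t - snd (u (r n)) - fst (z (r n)) i) \<longlonglongrightarrow> t - snd l - fst q i"
          by (intro tendsto_intros la qx)
        have ne: "t - snd l - fst q i \<noteq> 0" using t i by (auto simp: Bad_def image_iff algebra_simps)
        have "eventually (\<lambda>n. indicator {fst (z (r n)) i..} (t - snd (u (r n))) = (indicator {fst q i..} (t - snd l) :: real)) sequentially"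
        proof (cases "t - snd l - fst q i > 0")
          case True
          show ?thesis using order_tendstoD(1)[OF lim True]
            by eventually_elim (use True in \<open>auto simp: indicator_def\<close>)
        next
          case False
          then have n: "t - snd l - fst q i < 0" using ne by simp
          show ?thesis using order_tendstoD(2)[OF lim n]
            by eventually_elim (use n in \<open>auto simp: indicator_def\<close>)
        qed
        then show ?thesis by (rule tendsto_eventually)
      qed
      show ?thesis unfolding f_def atomic_cdf_def
        by (intro tendsto_ennrealI tendsto_rabs tendsto_diff tendsto_const tendsto_sum tendsto_mult qw ind) simp
    qed
    have "W1_atomic g k q (snd l) = (\<integral>\<^sup>+t. liminf (\<lambda>n. f n t) \<partial>lborel)"
      unfolding W1_atomic_def
    proof (rule nn_integral_cong_AE)
      show "AE t in lborel. ennreal \<bar>cdf g t - atomic_cdf k (fst q) (snd q) (t - snd l)\<bar> = liminf (\<lambda>n. f n t)"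
        using ae by eventually_elim (use conv in \<open>auto intro!: lim_imp_Liminf[symmetric]\<close>)
    qed
    also have "\<dots> \<le> liminf (\<lambda>n. \<integral>\<^sup>+t. f n t \<partial>lborel)" by (rule nn_integral_liminf[OF fm])
    also have "\<dots> \<le> c"
    proof (rule order_trans[OF Liminf_mono[where g="\<lambda>_. c"]])
      show "\<forall>\<^sub>F n in sequentially. (\<integral>\<^sup>+t. f n t \<partial>lborel) \<le> c"
        using z(3) unfolding W1_atomic_def f_def by (intro always_eventually allI)
    qed (simp add: Liminf_const)
    finally show ?thesis .
  qed
  then have "(fst l, snd l) \<in> dmm_sublevel g k A c"
    unfolding dmm_sublevel_def mem_Collect_eq prod.case using q min by blast
  then show "l \<in> dmm_sublevel g k A c" by simp
qed

lemma measurable_prod_list [measurable (raw)]: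
  fixes f :: "'b \<Rightarrow> 'a \<Rightarrow> real"
  assumes "\<And>d. d \<in> set ds \<Longrightarrow> f d \<in> borel_measurable M"
  shows "(\<lambda>x. \<Prod>d\<leftarrow>ds. f d x) \<in> borel_measurable M"
  using assms by (induction ds) auto

lemma F_stat_eq:
  assumes "l \<ge> 1" "\<sigma> > 0"
  shows "F_stat n p \<sigma> X l z = (\<Sum>j<p. hermite_hom l ((\<sigma> * vec_norm n (\<lambda>i. X i j))\<^sup>2) (\<Sum>i<n. X i j * z i))"
  unfolding F_stat_def
proof (intro sum.cong refl)
  fix j
  define \<tau> where "\<tau> = \<sigma> * vec_norm n (\<lambda>i. X i j)"
  show "(if \<forall>i<n. X i j = 0 then 0
     else (\<sigma> * vec_norm n (\<lambda>i. X i j)) ^ l * Hermite l ((\<Sum>i<n. X i j * z i) / (\<sigma> * vec_norm n (\<lambda>i. X i j))))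
     = hermite_hom l ((\<sigma> * vec_norm n (\<lambda>i. X i j))\<^sup>2) (\<Sum>i<n. X i j * z i)"
  proof (cases "\<forall>i<n. X i j = 0")
    case True
    then have "vec_norm n (\<lambda>i. X i j) = 0" by (simp add: vec_norm_def L2_set_eq_0_iff)
    then show ?thesis using True assms by (simp add: hermite_hom_zero_var)
  next
    case False
    then have "vec_norm n (\<lambda>i. X i j) \<noteq> 0" by (auto simp: vec_norm_def L2_set_eq_0_iff)
    then have "\<tau> \<noteq> 0" using assms by (simp add: \<tau>_def)
    then show ?thesis
      unfolding if_not_P[OF False] Hermite_eq \<tau>_def[symmetric] by (rule hermite_hom_scale)
  qed
qed

context
  fixes M :: "'a measure" and y :: "'a \<Rightarrow> nat \<Rightarrow> real" and n :: nat
  assumes y: "\<And>i. i < n \<Longrightarrow> (\<lambda>\<omega>. y \<omega> i) \<in> borel_measurable M"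
begin

lemma measurable_m1_hat: "(\<lambda>\<omega>. m1_hat n p X (y \<omega>)) \<in> borel_measurable M"
  unfolding m1_hat_def
  by (intro borel_measurable_divide borel_measurable_sum borel_measurable_times borel_measurable_const y) simp

lemma measurable_y_hat: "i < n \<Longrightarrow> (\<lambda>\<omega>. y_hat n p X (y \<omega>) i) \<in> borel_measurable M"
  unfolding y_hat_def
  by (intro borel_measurable_diff borel_measurable_times borel_measurable_const y measurable_m1_hat)

lemma measurable_mu_hat:
  assumes "\<sigma> > 0"
  shows "(\<lambda>\<omega>. mu_hat n p \<sigma> X (y \<omega>) l) \<in> borel_measurable M"
proof (induction l rule: less_induct)
  case (less l)
  show ?case
  proof (cases "l < 2")
    case True
    then show ?thesis by (simp add: mu_hat.simps[of _ _ _ _ _ l])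
  next
    case False
    have "(\<lambda>\<omega>. F_stat n p \<sigma> X l (y_hat n p X (y \<omega>))) \<in> borel_measurable M"
      using False assms measurable_y_hat
      by (subst F_stat_eq) (auto intro!: borel_measurable_sum hermite_hom_measurable borel_measurable_times borel_measurable_const)
    then show ?thesis using False
      by (subst mu_hat.simps)
        (auto intro!: borel_measurable_divide borel_measurable_diff borel_measurable_sum borel_measurable_times
          measurable_prod_list less compositions2_less)
  qed
qed

lemma measurable_W1_g_hat:
  assumes g: "real_distribution g" and D: "\<And>v. is_dmm A k v (D v)" and "A \<ge> 0" "\<sigma> > 0"
  shows "Measurable.pred M (\<lambda>\<omega>. c < W1 g (g_hat D n p \<sigma> X (y \<omega>)))"
proof -
  have m: "(\<lambda>\<omega>. (mu_hat n p \<sigma> X (y \<omega>), m1_hat n p X (y \<omega>))) \<in> M \<rightarrow>\<^sub>M borel"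
    unfolding borel_prod[symmetric]
    by (intro measurable_Pair measurable_coordinatewise_then_product measurable_mu_hat measurable_m1_hat assms)
  have "Measurable.pred M (\<lambda>\<omega>. (mu_hat n p \<sigma> X (y \<omega>), m1_hat n p X (y \<omega>)) \<in> dmm_sublevel g k A c)"
    by (rule pred_sets2[OF borel_closed[OF closed_dmm_sublevel[OF g]] m])
  then have "Measurable.pred M (\<lambda>\<omega>. W1 g (g_hat D n p \<sigma> X (y \<omega>)) \<le> c)"
    unfolding g_hat_def W1_dmm_le_iff[OF g D \<open>A \<ge> 0\<close>] .
  then have "Measurable.pred M (\<lambda>\<omega>. \<not> W1 g (g_hat D n p \<sigma> X (y \<omega>)) \<le> c)" by measurable
  then show ?thesis by (simp add: not_le)
qed

end

section \<open>The deterministic error bound for the DMM estimator\<close>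

lemma clamp_power_diff_le:
  fixes x :: real
  assumes "A \<ge> 0"
  shows "\<bar>(max (-A) (min A x)) ^ l - x ^ l\<bar> \<le> 2 * (\<bar>x\<bar> ^ l * indicator {x. A < \<bar>x\<bar>} x)"
proof (cases "A < \<bar>x\<bar>")
  case True
  have "\<bar>(max (-A) (min A x)) ^ l - x ^ l\<bar> \<le> \<bar>max (-A) (min A x)\<bar> ^ l + \<bar>x\<bar> ^ l"
    using abs_triangle_ineq4[of "(max (-A) (min A x)) ^ l" "x ^ l"] by (simp add: power_abs)
  also have "\<bar>max (-A) (min A x)\<bar> ^ l \<le> \<bar>x\<bar> ^ l"
    using assms True by (intro power_mono) auto
  finally show ?thesis using True by simp
next
  case False
  then have "max (-A) (min A x) = x" by auto
  then show ?thesis by simp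
qed

text \<open>\<open>g\<close> need not live on [-A, A], so it is first replaced by its image
  \<open>g1\<close> under clamping. The moments of \<open>g1\<close> belong to the moment space,
  hence the projection is at least as close to \<open>v\<close> as they are, and
  \<open>W1_le_moments\<close> compares \<open>g1\<close> with \<open>\<pi>\<close>.\<close>

lemma W1_dmm_le:
  assumes g: "real_distribution g" and dmm: "is_dmm A k v \<pi>" and A: "A \<ge> 1" and k: "k \<ge> 1"
    and int: "\<And>l. l \<in> {1..2 * k - 1} \<Longrightarrow> integrable g (\<lambda>x. \<bar>x\<bar> ^ l)"
    and tail: "\<And>l. l \<in> {1..2 * k - 1} \<Longrightarrow> (\<integral>x. \<bar>x\<bar> ^ l * indicator {x. A < \<bar>x\<bar>} x \<partial>g) \<le> A ^ l * T"
    and T: "T \<ge> 0" and \<delta>: "\<And>l. l \<in> {1..2 * k - 1} \<Longrightarrow> \<bar>moment g l - v l\<bar> \<le> \<delta>"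
  shows "W1 g \<pi> \<le> ennreal (2 * (1 + 4 * pi) * A / real k
    + 8 * pi * A * real k * 9 ^ k * (4 * real k * (\<delta> + 2 * A ^ (2 * k) * T)) + A * T)"
proof -
  interpret g: real_distribution g by fact
  define cl where "cl = (\<lambda>x. max (-A) (min A x :: real))"
  have clm[measurable]: "cl \<in> borel_measurable borel" unfolding cl_def by measurable
  define g1 where "g1 = distr g borel cl"
  have g1: "real_distribution g1" unfolding g1_def by (rule real_distribution_distr_real[OF g clm])
  have "cl -` {-A..A} = UNIV" using A by (auto simp: cl_def)
  then have g1A: "measure g1 {-A..A} = 1"
    unfolding g1_def using g.prob_space by (subst measure_distr) auto
  have one: "1 \<in> {1..2 * k - 1}" using k by auto
  have \<delta>0: "\<delta> \<ge> 0" using \<delta>[OF one] by linarith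
  have tint: "integrable g (\<lambda>x. \<bar>x\<bar> ^ l * indicator {x. A < \<bar>x\<bar>} x)" if "l \<in> {1..2 * k - 1}" for l
    by (rule integrable_real_mult_indicator[OF _ int[OF that]]) simp
  have mom: "\<bar>moment g1 l - moment g l\<bar> \<le> 2 * A ^ l * T" if l: "l \<in> {1..2 * k - 1}" for l
  proof -
    have m1: "moment g1 l = (\<integral>x. cl x ^ l \<partial>g)"
      unfolding moment_def g1_def by (rule integral_distr) auto
    have i1: "integrable g (\<lambda>x. cl x ^ l)"
    proof (rule g.integrable_const_bound[where B="A ^ l"])
      have "\<bar>cl x\<bar> \<le> A" for x using A by (auto simp: cl_def)
      then show "AE x in g. norm (cl x ^ l) \<le> A ^ l" by (auto simp: power_abs intro!: AE_I2 power_mono)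
    qed simp
    have i2: "integrable g (\<lambda>x. x ^ l)"
      by (rule Bochner_Integration.integrable_bound[OF int[OF l]]) (auto simp: power_abs)
    have "\<bar>moment g1 l - moment g l\<bar> = \<bar>\<integral>x. cl x ^ l - x ^ l \<partial>g\<bar>"
      unfolding m1 moment_def[of g] using i1 i2 by simp
    also have "\<dots> \<le> (\<integral>x. \<bar>cl x ^ l - x ^ l\<bar> \<partial>g)" by (rule integral_abs_bound)
    also have "\<dots> \<le> (\<integral>x. 2 * (\<bar>x\<bar> ^ l * indicator {x. A < \<bar>x\<bar>} x) \<partial>g)"
      unfolding cl_def using i1 i2 tint[OF l] A unfolding cl_def
      by (intro integral_mono clamp_power_diff_le integrable_abs Bochner_Integration.integrable_diff integrable_mult_right) auto
    also have "\<dots> \<le> 2 * (A ^ l * T)" using tail[OF l] by simp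
    finally show ?thesis by simp
  qed
  have W01: "W1 g g1 \<le> ennreal (A * T)"
  proof -
    have "W1 (distr g borel (\<lambda>x. x)) (distr g borel cl) \<le> (\<integral>\<^sup>+x. ennreal \<bar>x - cl x\<bar> \<partial>g)"
      by (rule W1_distr_le[OF g]) auto
    also have "distr g borel (\<lambda>x. x) = g" by (rule distr_id2) simp
    also have "(\<integral>\<^sup>+x. ennreal \<bar>x - cl x\<bar> \<partial>g) \<le> (\<integral>\<^sup>+x. ennreal (\<bar>x\<bar> ^ 1 * indicator {x. A < \<bar>x\<bar>} x) \<partial>g)"
      using A by (intro nn_integral_mono ennreal_leI) (auto simp: cl_def indicator_def)
    also have "\<dots> = ennreal (\<integral>x. \<bar>x\<bar> ^ 1 * indicator {x. A < \<bar>x\<bar>} x \<partial>g)"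
      by (rule nn_integral_eq_integral[OF tint[OF one]]) auto
    also have "\<dots> \<le> ennreal (A * T)" using tail[OF one] by (intro ennreal_leI) simp
    finally show ?thesis unfolding g1_def .
  qed
  from dmm obtain S m where \<pi>: "real_distribution \<pi>" and S: "finite S" "S \<subseteq> {-A..A}" "measure \<pi> S = 1"
    and m: "is_arg_min (\<lambda>m. L2_set (\<lambda>l. m l - v l) {1..2 * k - 1}) (\<lambda>m. m \<in> moment_space (2 * k - 1) A) m"
      "\<And>l. l \<in> {1..2 * k - 1} \<Longrightarrow> moment \<pi> l = m l"
    unfolding is_dmm_def by blast
  interpret \<pi>: real_distribution \<pi> by fact
  have \<pi>A: "measure \<pi> {-A..A} = 1"
  proof -
    have "measure \<pi> S \<le> measure \<pi> {-A..A}" using S(2) by (intro \<pi>.finite_measure_mono) auto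
    then show ?thesis using S(3) \<pi>.prob_le_1[of "{-A..A}"] by simp
  qed
  \<comment> \<open>A bound for the Euclidean distance by the sum of fewer than \<open>2 * k\<close>
    coordinate errors. Comparing \<open>g1\<close> and \<open>\<pi>\<close> through \<open>v\<close>
    then costs at most \<open>2 * \<zeta>\<close> for each moment.\<close>
  define \<zeta> where "\<zeta> = 2 * real k * (\<delta> + 2 * A ^ (2 * k) * T)"
  have close: "\<bar>moment g1 l - v l\<bar> \<le> \<delta> + 2 * A ^ (2 * k) * T" if l: "l \<in> {1..2 * k - 1}" for l
  proof -
    have "2 * A ^ l * T \<le> 2 * A ^ (2 * k) * T"
      using A T l by (intro mult_right_mono mult_left_mono power_increasing) auto
    then show ?thesis using mom[OF l] \<delta>[OF l] by linarith
  qed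
  have "restrict (moment g1) {1..2 * k - 1} \<in> moment_space (2 * k - 1) A"
    unfolding moment_space_def using g1 g1A by blast
  with m(1) have "L2_set (\<lambda>l. m l - v l) {1..2 * k - 1} \<le> L2_set (\<lambda>l. restrict (moment g1) {1..2 * k - 1} l - v l) {1..2 * k - 1}"
    unfolding is_arg_min_linorder by blast
  also have "\<dots> = L2_set (\<lambda>l. moment g1 l - v l) {1..2 * k - 1}" by (intro L2_set_cong) auto
  also have "\<dots> \<le> (\<Sum>l\<in>{1..2 * k - 1}. \<bar>moment g1 l - v l\<bar>)" by (rule L2_set_le_sum_abs)
  also have "\<dots> \<le> (\<Sum>l\<in>{1..2 * k - 1}. \<delta> + 2 * A ^ (2 * k) * T)" by (intro sum_mono close)
  also have "\<dots> \<le> \<zeta>"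
  proof -
    have "real (2 * k - 1) * (\<delta> + 2 * A ^ (2 * k) * T) \<le> (2 * real k) * (\<delta> + 2 * A ^ (2 * k) * T)"
      using \<delta>0 A T by (intro mult_right_mono) auto
    then show ?thesis by (simp add: \<zeta>_def)
  qed
  finally have L2: "L2_set (\<lambda>l. m l - v l) {1..2 * k - 1} \<le> \<zeta>" .
  have "W1 g1 \<pi> \<le> ennreal (2 * (1 + 4 * pi) * A / real k + 8 * pi * A * real k * 9 ^ k * (2 * \<zeta>))"
  proof (rule W1_le_moments[OF g1 g1A \<pi> \<pi>A _ k])
    fix l assume l: "l \<in> {1..2 * k - 1}"
    have "\<bar>m l - v l\<bar> \<le> L2_set (\<lambda>l. m l - v l) {1..2 * k - 1}"
      using member_le_L2_set[of "{1..2 * k - 1}" l "\<lambda>l. \<bar>m l - v l\<bar>"] l by (simp add: L2_set_def)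
    moreover have "\<delta> + 2 * A ^ (2 * k) * T \<le> \<zeta>"
    proof -
      have "1 * (\<delta> + 2 * A ^ (2 * k) * T) \<le> (2 * real k) * (\<delta> + 2 * A ^ (2 * k) * T)"
        using \<delta>0 A T k by (intro mult_right_mono) auto
      then show ?thesis by (simp add: \<zeta>_def)
    qed
    ultimately have "\<bar>moment g1 l - moment \<pi> l\<bar> \<le> 2 * \<zeta>"
      using L2 close[OF l] m(2)[OF l] by linarith
    also have "\<dots> = 2 * \<zeta> * 1" by simp
    \<comment> \<open>Here \<open>A \<ge> 1\<close> turns an absolute error into the relative one
      that \<open>W1_le_moments\<close> expects.\<close>
    also have "\<dots> \<le> 2 * \<zeta> * A ^ l"
      using A \<delta>0 T by (intro mult_left_mono one_le_power) (auto simp: \<zeta>_def)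
    finally show "\<bar>moment g1 l - moment \<pi> l\<bar> \<le> 2 * \<zeta> * A ^ l" .
  qed (use A in simp)
  then have "W1 g \<pi> \<le> ennreal (A * T) + ennreal (2 * (1 + 4 * pi) * A / real k + 8 * pi * A * real k * 9 ^ k * (2 * \<zeta>))"
    using W1_triangle[OF g g1 \<pi>] W01 by (meson add_mono order_trans)
  also have "\<dots> = ennreal (A * T + (2 * (1 + 4 * pi) * A / real k + 8 * pi * A * real k * 9 ^ k * (2 * \<zeta>)))"
    using A T \<delta>0 by (intro ennreal_plus[symmetric]) (auto simp: \<zeta>_def)
  finally show ?thesis by (simp add: \<zeta>_def mult_ac add_ac)
qed

section \<open>Error propagation in the moment recursion\<close>

lemma card_compositions2_le: "card (compositions2 l t) \<le> (l + 1) ^ t"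
proof -
  have "compositions2 l t \<subseteq> {xs. set xs \<subseteq> {..l} \<and> length xs = t}"
    by (auto simp: compositions2_def dest: member_le_sum_list)
  then have "card (compositions2 l t) \<le> card {xs. set xs \<subseteq> {..l} \<and> length xs = t}"
    by (intro card_mono finite_lists_length_eq) auto
  also have "\<dots> = (l + 1) ^ t" by (subst card_lists_length_eq) auto
  finally show ?thesis .
qed

lemma prod_list_bounds:
  assumes "K \<ge> (1::real)"
  shows "(\<Prod>d\<leftarrow>ds. K ^ d * fact d) \<le> K ^ sum_list ds * fact (sum_list ds)"
proof -
  have "(\<Prod>d\<leftarrow>ds. K ^ d * fact d) = K ^ sum_list ds * (\<Prod>d\<leftarrow>ds. fact d)"
    by (induction ds) (auto simp: power_add)
  also have "\<dots> \<le> K ^ sum_list ds * fact (sum_list ds)"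
    using assms prod_fact_le_fact[of ds] by (intro mult_left_mono) auto
  finally show ?thesis .
qed

text \<open>As long as the errors of lower order are at most 1, true and estimated moments obey the
  same bound \<open>K ^ d * fact d\<close>; this is the purpose of the \<open>+ 1\<close> in its
  hypothesis and of \<open>small\<close>. A product of at most \<open>L\<close> moments then changes
  by \<open>L * (K ^ L * fact L)\<close> times the error \<open>\<delta>\<close>, and there are at
  most \<open>L * (L + 1) ^ L\<close> products. So the new error is at most s + G \<delta>, which
  iterates to powers of 1 + G.\<close>

lemma mu_hat_error_le:
  fixes \<mu> E :: "nat \<Rightarrow> real"
  assumes K: "K \<ge> 1" and s: "s \<ge> 0" and \<Gamma>: "\<Gamma> \<ge> 0"
    and \<mu>: "\<And>d. 2 \<le> d \<Longrightarrow> d \<le> L \<Longrightarrow> \<bar>\<mu> d\<bar> + 1 \<le> K ^ d * fact d"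
    and Apos: "\<And>l. 2 \<le> l \<Longrightarrow> l \<le> L \<Longrightarrow> gram_sum n p X l > 0"
    and E: "\<And>l. 2 \<le> l \<Longrightarrow> l \<le> L \<Longrightarrow> E l = \<mu> l * gram_sum n p X l +
        (\<Sum>t\<in>{2..l}. \<Sum>ds\<in>compositions2 l t. (\<Prod>d\<leftarrow>ds. \<mu> d) * gamma_coeff n p X ds)"
    and F: "\<And>l. 2 \<le> l \<Longrightarrow> l \<le> L \<Longrightarrow> \<bar>F_stat n p \<sigma> X l (y_hat n p X y) - E l\<bar> \<le> s * gram_sum n p X l"
    and \<gamma>: "\<And>l t ds. 2 \<le> l \<Longrightarrow> l \<le> L \<Longrightarrow> ds \<in> compositions2 l t \<Longrightarrow> \<bar>gamma_coeff n p X ds\<bar> \<le> \<Gamma> * gram_sum n p X l"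
    and G: "G = real L * (real L + 1) ^ L * real L * (K ^ L * fact L) * \<Gamma>"
    and small: "s * (1 + G) ^ L \<le> 1"
  shows "2 \<le> l \<Longrightarrow> l \<le> L \<Longrightarrow> \<bar>mu_hat n p \<sigma> X y l - \<mu> l\<bar> \<le> s * (1 + G) ^ l"
proof (induction l rule: less_induct)
  case (less l)
  have G0: "G \<ge> 0" unfolding G using K \<Gamma> by simp
  define \<delta> where "\<delta> = s * (1 + G) ^ (l - 1)"
  have \<delta>0: "\<delta> \<ge> 0" using s G0 by (simp add: \<delta>_def)
  have \<delta>1: "\<delta> \<le> 1"
  proof -
    have "s * (1 + G) ^ (l - 1) \<le> s * (1 + G) ^ L"
      using s G0 less.prems by (intro mult_left_mono power_increasing) auto
    then show ?thesis using small by (simp add: \<delta>_def)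
  qed
  let ?A = "gram_sum n p X l" and ?h = "mu_hat n p \<sigma> X y"
  have A: "?A > 0" by (rule Apos[OF less.prems])
  have diff: "\<bar>?h d - \<mu> d\<bar> \<le> \<delta>" if d: "2 \<le> d" "d < l" for d
  proof -
    have "\<bar>?h d - \<mu> d\<bar> \<le> s * (1 + G) ^ d" using less.IH[OF d(2,1)] d less.prems by simp
    also have "\<dots> \<le> \<delta>" unfolding \<delta>_def using s G0 d by (intro mult_left_mono power_increasing) auto
    finally show ?thesis .
  qed
  have summand: "\<bar>((\<Prod>d\<leftarrow>ds. ?h d) - (\<Prod>d\<leftarrow>ds. \<mu> d)) * gamma_coeff n p X ds\<bar>
      \<le> real L * \<delta> * (K ^ L * fact L) * (\<Gamma> * ?A)" if t: "t \<in> {2..l}" and ds: "ds \<in> compositions2 l t" for t ds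
  proof -
    have mem: "2 \<le> d" "d < l" if "d \<in> set ds" for d
      using ds that t compositions2_less[OF ds _ that] by (auto simp: compositions2_def)
    have len: "length ds = t" "sum_list ds = l" using ds by (auto simp: compositions2_def)
    have "\<bar>(\<Prod>d\<leftarrow>ds. ?h d) - (\<Prod>d\<leftarrow>ds. \<mu> d)\<bar> \<le> real (length ds) * \<delta> * (\<Prod>d\<leftarrow>ds. K ^ d * fact d)"
    proof (rule abs_prod_list_diff_le(1))
      fix d assume d: "d \<in> set ds"
      show "\<bar>?h d - \<mu> d\<bar> \<le> \<delta>" by (rule diff[OF mem[OF d]])
      have b: "\<bar>\<mu> d\<bar> + 1 \<le> K ^ d * fact d" using mem[OF d] less.prems by (intro \<mu>) auto
      then show "\<bar>\<mu> d\<bar> \<le> K ^ d * fact d" "1 \<le> K ^ d * fact d" by linarith+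
      show "\<bar>?h d\<bar> \<le> K ^ d * fact d" using b diff[OF mem[OF d]] \<delta>1 by linarith
    qed (rule \<delta>0)
    also have "\<dots> \<le> real L * \<delta> * (K ^ L * fact L)"
    proof (intro mult_mono)
      have "(\<Prod>d\<leftarrow>ds. K ^ d * fact d) \<le> K ^ l * fact l" using prod_list_bounds[OF K, of ds] len by simp
      also have "\<dots> \<le> K ^ L * fact L"
        using K less.prems by (intro mult_mono power_increasing fact_mono) auto
      finally show "(\<Prod>d\<leftarrow>ds. K ^ d * fact d) \<le> K ^ L * fact L" .
      show "0 \<le> (\<Prod>d\<leftarrow>ds. K ^ d * fact d)" using K by (intro prod_list_nonneg) auto
    qed (use len t less.prems \<delta>0 in auto)
    finally have "\<bar>(\<Prod>d\<leftarrow>ds. ?h d) - (\<Prod>d\<leftarrow>ds. \<mu> d)\<bar> \<le> real L * \<delta> * (K ^ L * fact L)" .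
    then show ?thesis
      unfolding abs_mult using \<gamma>[OF less.prems ds] \<delta>0 K by (intro mult_mono) auto
  qed
  have sum: "\<bar>\<Sum>t\<in>{2..l}. \<Sum>ds\<in>compositions2 l t. ((\<Prod>d\<leftarrow>ds. ?h d) - (\<Prod>d\<leftarrow>ds. \<mu> d)) * gamma_coeff n p X ds\<bar> \<le> G * \<delta> * ?A"
  proof -
    define c where "c = real L * \<delta> * (K ^ L * fact L) * (\<Gamma> * ?A)"
    have c0: "c \<ge> 0" unfolding c_def using \<delta>0 K \<Gamma> A by (intro mult_nonneg_nonneg) auto
    have "\<bar>\<Sum>t\<in>{2..l}. \<Sum>ds\<in>compositions2 l t. ((\<Prod>d\<leftarrow>ds. ?h d) - (\<Prod>d\<leftarrow>ds. \<mu> d)) * gamma_coeff n p X ds\<bar>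
       \<le> (\<Sum>t\<in>{2..l}. \<Sum>ds\<in>compositions2 l t. c)"
      unfolding c_def
      by (rule order_trans[OF sum_abs], rule sum_mono, rule order_trans[OF sum_abs], rule sum_mono, rule summand)
    also have "\<dots> = (\<Sum>t\<in>{2..l}. real (card (compositions2 l t)) * c)" by simp
    also have "\<dots> \<le> (\<Sum>t\<in>{2..l}. (real L + 1) ^ L * c)"
    proof (intro sum_mono mult_right_mono c0)
      fix t assume t: "t \<in> {2..l}"
      have "real (card (compositions2 l t)) \<le> real ((l + 1) ^ t)" using card_compositions2_le of_nat_le_iff by blast
      also have "\<dots> \<le> (real L + 1) ^ t" using less.prems by (auto intro!: power_mono)
      also have "\<dots> \<le> (real L + 1) ^ L" using t less.prems by (intro power_increasing) auto
      finally show "real (card (compositions2 l t)) \<le> (real L + 1) ^ L" .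
    qed
    also have "\<dots> = real (l - 1) * ((real L + 1) ^ L * c)" using less.prems by simp
    also have "\<dots> \<le> real L * ((real L + 1) ^ L * c)"
      using less.prems c0 by (intro mult_right_mono) auto
    also have "\<dots> = G * \<delta> * ?A" by (simp add: G c_def)
    finally show ?thesis .
  qed
  have "?h l = (F_stat n p \<sigma> X l (y_hat n p X y)
      - (\<Sum>t\<in>{2..l}. \<Sum>ds\<in>compositions2 l t. (\<Prod>d\<leftarrow>ds. ?h d) * gamma_coeff n p X ds)) / ?A"
    using less.prems by (subst mu_hat.simps) simp
  then have "(?h l - \<mu> l) * ?A = (F_stat n p \<sigma> X l (y_hat n p X y) - E l)
     - (\<Sum>t\<in>{2..l}. \<Sum>ds\<in>compositions2 l t. ((\<Prod>d\<leftarrow>ds. ?h d) - (\<Prod>d\<leftarrow>ds. \<mu> d)) * gamma_coeff n p X ds)"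
    using A E[OF less.prems] by (simp add: left_diff_distrib sum_subtractf field_simps)
  then have "\<bar>?h l - \<mu> l\<bar> * ?A \<le> s * ?A + G * \<delta> * ?A"
    using F[OF less.prems] sum A by (simp add: abs_mult[symmetric] abs_of_pos)
  also have "\<dots> = (s + G * \<delta>) * ?A" by (simp add: algebra_simps)
  finally have "\<bar>?h l - \<mu> l\<bar> \<le> s + G * \<delta>" using A by (simp add: mult_le_cancel_right)
  moreover have "s \<le> \<delta>"
    unfolding \<delta>_def using s G0 mult_left_mono[of 1 "(1 + G) ^ (l - 1)" s] by (simp add: one_le_power)
  moreover have "\<delta> + G * \<delta> = s * (1 + G) ^ Suc (l - 1)" by (simp add: \<delta>_def algebra_simps)
  moreover have "Suc (l - 1) = l" using less.prems by simp
  ultimately show ?case by simp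
qed

lemma sum_power_le:
  fixes a :: "nat \<Rightarrow> real"
  assumes "i \<ge> 1"
  shows "(\<Sum>j<p. (a j ^ i)\<^sup>2) \<le> (\<Sum>j<p. (a j)\<^sup>2) ^ i"
  using assms
proof (induction i rule: dec_induct)
  case (step i)
  have "(\<Sum>j<p. (a j ^ Suc i)\<^sup>2) = (\<Sum>j<p. (a j)\<^sup>2 * (a j ^ i)\<^sup>2)"
    by (simp add: power_mult_distrib)
  also have "\<dots> \<le> (\<Sum>j<p. (\<Sum>j<p. (a j)\<^sup>2) * (a j ^ i)\<^sup>2)"
    by (intro sum_mono mult_right_mono member_le_sum) auto
  also have "\<dots> = (\<Sum>j<p. (a j)\<^sup>2) * (\<Sum>j<p. (a j ^ i)\<^sup>2)" by (simp add: sum_distrib_left)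
  also have "\<dots> \<le> (\<Sum>j<p. (a j)\<^sup>2) * (\<Sum>j<p. (a j)\<^sup>2) ^ i"
    using step by (intro mult_left_mono sum_nonneg) auto
  finally show ?case by simp
qed simp

text \<open>The effect of replacing the true mean by its estimate. The estimation error
  \<open>\<Delta>\<close> depends on all coordinates, so the bound is deterministic: it holds for
  every realisation in which the norms of the Hermite terms are under control. Each order of the
  Appell expansion is treated by Cauchy-Schwarz.\<close>

lemma hermite_hom_shift_le:
  fixes a x v :: "nat \<Rightarrow> real"
  assumes w: "w \<ge> 0" and b: "b \<ge> 0" and u: "u \<ge> 0"
    and W: "\<And>m. m \<le> l \<Longrightarrow> (\<Sum>j<p. (hermite_hom m (v j) (x j))\<^sup>2) \<le> w\<^sup>2 * b ^ (2 * m)"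
    and a: "\<bar>\<Delta>\<bar> * sqrt (\<Sum>j<p. (a j)\<^sup>2) \<le> u * b"
  shows "\<bar>(\<Sum>j<p. hermite_hom l (v j) (x j - \<Delta> * a j)) - (\<Sum>j<p. hermite_hom l (v j) (x j))\<bar> \<le> w * b ^ l * (1 + u) ^ l"
proof -
  define r where "r = sqrt (\<Sum>j<p. (a j)\<^sup>2)"
  have r0: "r \<ge> 0" by (simp add: r_def sum_nonneg)
  have one: "\<bar>\<Sum>j<p. (- \<Delta> * a j) ^ i * hermite_hom (l - i) (v j) (x j)\<bar> \<le> u ^ i * (w * b ^ l)" if i: "i \<in> {1..l}" for i
  proof -
    have "\<bar>\<Sum>j<p. (- \<Delta> * a j) ^ i * hermite_hom (l - i) (v j) (x j)\<bar>
      = \<bar>\<Delta>\<bar> ^ i * \<bar>\<Sum>j<p. a j ^ i * hermite_hom (l - i) (v j) (x j)\<bar>"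
      by (simp only: power_mult_distrib mult.assoc sum_distrib_left[symmetric] abs_mult power_abs abs_minus_cancel)
    also have "\<bar>\<Sum>j<p. a j ^ i * hermite_hom (l - i) (v j) (x j)\<bar> \<le> r ^ i * (w * b ^ (l - i))"
    proof (rule power2_le_imp_le)
      have "\<bar>\<Sum>j<p. a j ^ i * hermite_hom (l - i) (v j) (x j)\<bar>\<^sup>2
         \<le> (\<Sum>j<p. (a j ^ i)\<^sup>2) * (\<Sum>j<p. (hermite_hom (l - i) (v j) (x j))\<^sup>2)"
        unfolding power2_abs by (rule Cauchy_Schwarz_ineq_sum)
      also have "\<dots> \<le> (\<Sum>j<p. (a j)\<^sup>2) ^ i * (w\<^sup>2 * b ^ (2 * (l - i)))"
        using i by (intro mult_mono sum_power_le W) (simp_all add: sum_nonneg)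
      also have "(\<Sum>j<p. (a j)\<^sup>2) ^ i = (r ^ i)\<^sup>2"
        by (simp add: r_def power_mult[symmetric] mult.commute[of i] sum_nonneg) (simp add: power_mult sum_nonneg)
      also have "(r ^ i)\<^sup>2 * (w\<^sup>2 * b ^ (2 * (l - i))) = (r ^ i * (w * b ^ (l - i)))\<^sup>2"
        by (simp add: power_mult_distrib power_mult[symmetric] mult.commute)
      finally show "\<bar>\<Sum>j<p. a j ^ i * hermite_hom (l - i) (v j) (x j)\<bar>\<^sup>2 \<le> (r ^ i * (w * b ^ (l - i)))\<^sup>2" .
    qed (use r0 w b in simp)
    then have "\<bar>\<Delta>\<bar> ^ i * \<bar>\<Sum>j<p. a j ^ i * hermite_hom (l - i) (v j) (x j)\<bar> \<le> \<bar>\<Delta>\<bar> ^ i * (r ^ i * (w * b ^ (l - i)))"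
      by (intro mult_left_mono) auto
    also have "\<dots> = (\<bar>\<Delta>\<bar> * r) ^ i * (w * b ^ (l - i))" by (simp add: power_mult_distrib)
    also have "\<dots> \<le> (u * b) ^ i * (w * b ^ (l - i))"
      using a r0 w b by (intro mult_right_mono power_mono) (auto simp: r_def)
    also have "\<dots> = u ^ i * (w * (b ^ i * b ^ (l - i)))" by (simp add: power_mult_distrib)
    also have "b ^ i * b ^ (l - i) = b ^ l" using i by (simp add: power_add[symmetric])
    finally show ?thesis by (simp add: mult.assoc)
  qed
  have split: "{..l} = insert 0 {1..l}" by auto
  have "(\<Sum>j<p. hermite_hom l (v j) (x j - \<Delta> * a j)) = (\<Sum>j<p. hermite_hom l (v j) (x j + - \<Delta> * a j))" by simp
  also have "\<dots> = (\<Sum>j<p. \<Sum>i\<le>l. real (l choose i) * (- \<Delta> * a j) ^ i * hermite_hom (l - i) (v j) (x j))"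
    by (simp only: hermite_hom_add)
  also have "\<dots> = (\<Sum>i\<le>l. real (l choose i) * (\<Sum>j<p. (- \<Delta> * a j) ^ i * hermite_hom (l - i) (v j) (x j)))"
    by (subst sum.swap) (simp add: sum_distrib_left mult.assoc)
  also have "\<dots> = (\<Sum>j<p. hermite_hom l (v j) (x j)) +
      (\<Sum>i\<in>{1..l}. real (l choose i) * (\<Sum>j<p. (- \<Delta> * a j) ^ i * hermite_hom (l - i) (v j) (x j)))"
    unfolding split by simp
  finally have "(\<Sum>j<p. hermite_hom l (v j) (x j - \<Delta> * a j)) - (\<Sum>j<p. hermite_hom l (v j) (x j))
    = (\<Sum>i\<in>{1..l}. real (l choose i) * (\<Sum>j<p. (- \<Delta> * a j) ^ i * hermite_hom (l - i) (v j) (x j)))" by simp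
  also have "\<bar>\<dots>\<bar> \<le> (\<Sum>i\<in>{1..l}. real (l choose i) * (u ^ i * (w * b ^ l)))"
    by (rule order_trans[OF sum_abs], rule sum_mono) (use one in \<open>simp add: abs_mult mult_left_mono\<close>)
  also have "\<dots> \<le> (\<Sum>i\<le>l. real (l choose i) * (u ^ i * (w * b ^ l)))"
    using u w b by (intro sum_mono2) auto
  also have "\<dots> = (\<Sum>i\<le>l. real (l choose i) * u ^ i * 1 ^ (l - i)) * (w * b ^ l)"
    by (simp add: sum_distrib_right mult.assoc)
  also have "(\<Sum>i\<le>l. real (l choose i) * u ^ i * 1 ^ (l - i)) = (u + 1) ^ l" by (rule binomial_ring[symmetric])
  finally show ?thesis by (simp add: mult_ac add.commute)
qed

section \<open>The regression model\<close>

lemma vec_norm_square: "(vec_norm n v)\<^sup>2 = (\<Sum>i<n. (v i)\<^sup>2)"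
  by (simp add: vec_norm_def L2_set_def sum_nonneg)

text \<open>Shows that the supremum in \<open>op_norm\<close> is over a bounded set, and settles the
  vectors of norm 0, which cannot be normalised.\<close>

lemma vec_norm_mat_vec_le_Frobenius:
  "vec_norm n (mat_vec p X v) \<le> sqrt (\<Sum>i<n. \<Sum>j<p. (X i j)\<^sup>2) * vec_norm p v"
proof -
  have "(vec_norm n (mat_vec p X v))\<^sup>2 \<le> (\<Sum>i<n. (\<Sum>j<p. (X i j)\<^sup>2) * (\<Sum>j<p. (v j)\<^sup>2))"
    unfolding vec_norm_square mat_vec_def by (intro sum_mono Cauchy_Schwarz_ineq_sum)
  also have "\<dots> = (sqrt (\<Sum>i<n. \<Sum>j<p. (X i j)\<^sup>2) * vec_norm p v)\<^sup>2"
    by (simp add: power_mult_distrib vec_norm_square sum_distrib_right sum_nonneg)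
  finally show ?thesis
    by (rule power2_le_imp_le) (simp add: vec_norm_def L2_set_nonneg sum_nonneg)
qed

lemma vec_norm_mat_vec_le: "vec_norm n (mat_vec p X v) \<le> op_norm n p X * vec_norm p v"
proof -
  let ?f = "\<lambda>v. vec_norm n (mat_vec p X v)"
  let ?F = "sqrt (\<Sum>i<n. \<Sum>j<p. (X i j)\<^sup>2)"
  have F0: "?F \<ge> 0" by (simp add: sum_nonneg)
  have bdd: "bdd_above (?f ` {v. vec_norm p v \<le> 1})"
  proof (rule bdd_aboveI)
    fix y assume "y \<in> ?f ` {v. vec_norm p v \<le> 1}"
    then obtain w where w: "vec_norm p w \<le> 1" "y = ?f w" by auto
    then have "?F * vec_norm p w \<le> ?F * 1" using F0 by (intro mult_left_mono) auto
    then show "y \<le> ?F" using vec_norm_mat_vec_le_Frobenius[of n p X w] w(2) by linarith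
  qed
  define r where "r = vec_norm p v"
  have r0: "r \<ge> 0" by (simp add: r_def vec_norm_def L2_set_nonneg)
  show ?thesis
  proof (cases "r = 0")
    case True
    then show ?thesis using vec_norm_mat_vec_le_Frobenius[of n p X v] by (simp add: r_def)
  next
    case False
    define u where "u = (\<lambda>j. v j / r)"
    have "(vec_norm p u)\<^sup>2 = (vec_norm p v)\<^sup>2 / r\<^sup>2"
      unfolding vec_norm_square u_def by (simp add: power_divide sum_divide_distrib)
    then have "(vec_norm p u)\<^sup>2 = 1\<^sup>2" using False by (simp add: r_def)
    then have "vec_norm p u \<le> 1" using power2_le_imp_le[of "vec_norm p u" 1] by simp
    then have le: "?f u \<le> op_norm n p X" unfolding op_norm_def by (intro cSUP_upper bdd) simp
    have "(?f u)\<^sup>2 = (?f v)\<^sup>2 / r\<^sup>2"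
      unfolding vec_norm_square mat_vec_def u_def
      by (simp add: power_divide sum_divide_distrib[symmetric])
    then have "(?f v)\<^sup>2 = (r * ?f u)\<^sup>2" using False by (simp add: power_mult_distrib)
    then have "?f v = r * ?f u"
      by (rule power2_eq_imp_eq) (auto simp: r0 vec_norm_def L2_set_nonneg)
    then show ?thesis using le r0 by (simp add: r_def[symmetric] mult.commute mult_left_mono)
  qed
qed

lemma sum_mat_vec_square_le:
  "(\<Sum>i<n. (\<Sum>j<p. X i j * v j)\<^sup>2) \<le> (op_norm n p X)\<^sup>2 * (\<Sum>j<p. (v j)\<^sup>2)"
proof -
  have "(vec_norm n (mat_vec p X v))\<^sup>2 \<le> (op_norm n p X * vec_norm p v)\<^sup>2"
    by (intro power_mono vec_norm_mat_vec_le) (simp add: vec_norm_def L2_set_nonneg)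
  then show ?thesis by (simp add: power_mult_distrib vec_norm_square) (simp add: mat_vec_def)
qed

text \<open>A matrix bounds its transpose by duality: the image \<open>z\<close> under the transpose
  is tested against the matrix itself, and one factor \<open>Z\<close> cancels.\<close>

lemma sum_transpose_square_le:
  "(\<Sum>j<p. (\<Sum>i<n. X i j * w i)\<^sup>2) \<le> (op_norm n p X)\<^sup>2 * (\<Sum>i<n. (w i)\<^sup>2)"
proof -
  define z where "z = (\<lambda>j. \<Sum>i<n. X i j * w i)"
  define Z where "Z = (\<Sum>j<p. (z j)\<^sup>2)"
  have Z0: "Z \<ge> 0" by (simp add: Z_def sum_nonneg)
  have "Z = (\<Sum>j<p. \<Sum>i<n. z j * (X i j * w i))"
    by (simp add: Z_def power2_eq_square sum_distrib_left[symmetric]) (simp add: z_def)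
  also have "\<dots> = (\<Sum>i<n. w i * (\<Sum>j<p. X i j * z j))"
    by (subst sum.swap) (simp add: sum_distrib_left mult_ac)
  finally have "Z\<^sup>2 = (\<Sum>i<n. w i * (\<Sum>j<p. X i j * z j))\<^sup>2" by simp
  also have "\<dots> \<le> (\<Sum>i<n. (w i)\<^sup>2) * (\<Sum>i<n. (\<Sum>j<p. X i j * z j)\<^sup>2)"
    by (rule Cauchy_Schwarz_ineq_sum)
  also have "\<dots> \<le> (\<Sum>i<n. (w i)\<^sup>2) * ((op_norm n p X)\<^sup>2 * Z)"
    unfolding Z_def by (intro mult_left_mono sum_mat_vec_square_le sum_nonneg) auto
  finally have *: "Z * Z \<le> ((op_norm n p X)\<^sup>2 * (\<Sum>i<n. (w i)\<^sup>2)) * Z"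
    by (simp add: power2_eq_square mult_ac)
  show ?thesis
  proof (cases "Z = 0")
    case True
    then show ?thesis by (simp add: Z_def z_def sum_nonneg)
  next
    case False
    then have "Z \<le> (op_norm n p X)\<^sup>2 * (\<Sum>i<n. (w i)\<^sup>2)" using * Z0 by (simp add: mult_le_cancel_right)
    then show ?thesis by (simp add: Z_def z_def)
  qed
qed

lemma gram_mult_eq: "(\<Sum>j<p. gram n X s j * v j) = (\<Sum>i<n. X i s * (\<Sum>j<p. X i j * v j))"
  unfolding gram_def sum_distrib_right sum_distrib_left by (subst sum.swap) (simp add: mult.assoc)

lemma gram_sym: "gram n X s j = gram n X j s"
  by (simp add: gram_def mult.commute)

text \<open>Elementary Stirling: the ratio of consecutive terms contains (1 + 1/q)^q, which is at
  most e and hence at most 3. It converts moment growth q^q into factorials.\<close>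

lemma power_self_le: "real q ^ q \<le> 3 ^ q * fact q"
proof (induction q)
  case (Suc q)
  show ?case
  proof (cases "q = 0")
    case False
    have "(1 + 1 / real q) ^ q \<le> exp 1" using exp_ge_one_plus_x_over_n_power_n[of q 1] False by simp
    also have "\<dots> \<le> 3" by (rule exp_le)
    finally have "(1 + 1 / real q) ^ q * real q ^ q \<le> 3 * real q ^ q" by (intro mult_right_mono) auto
    moreover have "(1 + 1 / real q) ^ q * real q ^ q = real (Suc q) ^ q"
      using False by (simp add: power_mult_distrib[symmetric] field_simps)
    ultimately have "real (Suc q) ^ q \<le> 3 * (3 ^ q * fact q)" using Suc by linarith
    then have "real (Suc q) * real (Suc q) ^ q \<le> real (Suc q) * (3 * (3 ^ q * fact q))" by (intro mult_left_mono) auto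
    then show ?thesis by (simp add: mult_ac)
  qed simp
qed simp

lemma std_normal_eq_distr:
  assumes "\<sigma> > 0"
  shows "distr (density lborel (normal_density 0 \<sigma>)) borel (\<lambda>x. x / \<sigma>) = density lborel std_normal_density"
proof -
  interpret prob_space "density lborel (normal_density 0 \<sigma>)" by (rule prob_space_normal_density) fact
  have "distributed (density lborel (normal_density 0 \<sigma>)) lborel (\<lambda>x. x) (normal_density 0 \<sigma>)"
    by (auto simp: distributed_def intro!: distr_id2)
  then have "distributed (density lborel (normal_density 0 \<sigma>)) lborel (\<lambda>x. (x - 0) / \<sigma>) std_normal_density"
    by (subst (asm) normal_standard_normal_convert) (use assms in auto)
  then show ?thesis by (simp add: distributed_def cong: distr_cong)
qed

lemma all_moments_std_normal: "all_moments (density lborel std_normal_density) (\<lambda>x. x)"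
  using integrable_normal_moment_abs[of 1 0]
  by (auto simp: all_moments_def integrable_density)

lemma moment_std_normal:
  "(\<integral>x. x ^ i \<partial>density lborel std_normal_density) = (if even i then fact i / (2 ^ (i div 2) * fact (i div 2)) else 0)"
proof -
  have "(\<integral>x. x ^ i \<partial>density lborel std_normal_density) = (\<integral>x. std_normal_density x * x ^ i \<partial>lborel)"
    by (subst integral_density) auto
  also have "\<dots> = (if even i then fact i / (2 ^ (i div 2) * fact (i div 2)) else 0)"
  proof (cases "even i")
    case True
    then obtain m where "i = 2 * m" by (elim evenE)
    then show ?thesis using integral_normal_moment_even[of 1 0 m] by simp
  next
    case False
    then obtain m where "i = 2 * m + 1" by (elim oddE)
    then show ?thesis using integral_normal_moment_odd[of 1 0 m] by simp
  qed
  finally show ?thesis .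
qed

lemma (in prob_space) prob_greater_le:
  fixes f :: "'a \<Rightarrow> real"
  assumes f: "integrable M f" "\<And>x. 0 \<le> f x" and c: "c > 0"
  shows "prob {x\<in>space M. f x > c} \<le> expectation f / c"
proof -
  have [measurable]: "f \<in> borel_measurable M" using f(1) by simp
  have "prob {x\<in>space M. f x > c} \<le> prob {x\<in>space M. f x \<ge> c}"
    by (intro finite_measure_mono) auto
  also have "\<dots> \<le> expectation f / c"
    by (rule integral_Markov_inequality_measure[where A="{}"]) (use f c in auto)
  finally show ?thesis .
qed

text \<open>The independent coordinates are the centered coefficients (\<open>Inl\<close>) and the normalised noise
  (\<open>Inr\<close>). In them \<open>X\<^sup>T (y - m\<^sub>1 X 1)\<close> is linear with the stacked matrix \<open>design = [H; \<sigma> X]\<close>, whose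
  operator norm is at most \<open>b\<close>.\<close>

locale regression_model =
  fixes n p :: nat and \<sigma> c0 m0 :: real and X :: "nat \<Rightarrow> nat \<Rightarrow> real" and g :: "real measure"
  assumes n: "n \<ge> 1" and p: "p \<ge> 1" and \<sigma>: "\<sigma> > 0" and c0: "c0 > 0" and m0: "m0 > 0"
    and snr: "op_norm n p X / \<sigma> \<ge> c0"
    and A1: "gram_sum n p X 1 \<ge> c0 * real (min n p) * op_norm n p X ^ 2"
    and g: "real_distribution g" and sub: "subgaussian m0 g"
begin

abbreviation "opn \<equiv> op_norm n p X"
text \<open>The stacked matrix has squared norm at most
  \<open>opn ^ 4 + \<sigma>\<^sup>2 * opn\<^sup>2\<close>, and
  \<open>\<sigma> \<le> opn / c0\<close> turns this into
  \<open>(\<kappa> * opn\<^sup>2)\<^sup>2\<close>.\<close>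

definition "\<kappa> = sqrt (1 + 1 / c0\<^sup>2)"
definition "b = \<kappa> * opn\<^sup>2"
text \<open>The factor 3 comes from \<open>power_self_le\<close>. The summand 1 gives
  \<open>K \<ge> 1\<close>, which covers the normal coordinates, and provides the room for
  \<open>+ 1\<close> in \<open>\<mu>_bound\<close>.\<close>

definition "K = 1 + 3 * m0"
definition "g0 = distr g borel (\<lambda>x. x - mean g)"
definition "coord_set = {..<p} <+> {..<n}"
definition "coord_law = case_sum (\<lambda>_::nat. g0) (\<lambda>_::nat. density lborel std_normal_density)"
definition "design = case_sum (\<lambda>s j. gram n X s j) (\<lambda>i j. \<sigma> * X i j)"
definition "noise_scale j = \<sigma> * vec_norm n (\<lambda>i. X i j)"
definition "\<mu> d = moment g0 d"

sublocale g: real_distribution g by (rule g)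

lemma g0: "real_distribution g0"
  unfolding g0_def by (rule real_distribution_distr_real[OF g]) simp

lemma integrable_g0:
  "f \<in> borel_measurable borel \<Longrightarrow> integrable g0 f \<longleftrightarrow> integrable g (\<lambda>x. f (x - mean g) :: real)"
  unfolding g0_def by (rule integrable_distr_eq) auto

lemma integral_g0:
  "f \<in> borel_measurable borel \<Longrightarrow> (\<integral>x. f x \<partial>g0) = (\<integral>x. f (x - mean g) \<partial>g :: real)"
  unfolding g0_def by (rule integral_distr) auto

lemma all_moments_g0: "all_moments g0 (\<lambda>x. x)"
  unfolding all_moments_def
proof (intro conjI allI)
  show "(\<lambda>x. x) \<in> borel_measurable g0" by (simp add: g0_def)
  fix m
  show "integrable g0 (\<lambda>x. \<bar>x\<bar> ^ m)"
    using sub by (cases "m = 0") (auto simp: subgaussian_def integrable_g0)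
qed

lemma abs_moment_g0_le:
  assumes "q \<ge> 1"
  shows "(\<integral>x. \<bar>x\<bar> ^ q \<partial>g0) \<le> (m0 * sqrt (real q)) ^ q"
proof -
  have "root q (\<integral>x. \<bar>x - mean g\<bar> ^ q \<partial>g) \<le> m0 * sqrt (real q)"
    using sub assms by (auto simp: subgaussian_def)
  then have "root q (\<integral>x. \<bar>x - mean g\<bar> ^ q \<partial>g) ^ q \<le> (m0 * sqrt (real q)) ^ q"
    by (intro power_mono) (auto simp: real_root_ge_zero)
  then show ?thesis
    using assms by (simp add: integral_g0 real_root_pow_pos2)
qed

lemma mean_g0: "(\<integral>x. x \<partial>g0) = 0"
proof -
  have "integrable g (\<lambda>x. x)" using sub by (simp add: subgaussian_def)
  then have "(\<integral>x. x - mean g \<partial>g) = (\<integral>x. x \<partial>g) - mean g"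
    using g.prob_space by simp
  then show ?thesis by (simp add: integral_g0 mean_def)
qed

lemma K_ge: "K \<ge> 1" using m0 by (simp add: K_def)

text \<open>The square root in the subgaussian bound is given away: growth of order i^i is all that
  \<open>centered_coordinates\<close> asks for.\<close>

lemma moment_g0_le: "\<bar>\<integral>x. x ^ i \<partial>g0\<bar> \<le> (3 * m0) ^ i * fact i"
proof (cases "i = 0")
  case True
  interpret g0: real_distribution g0 by (rule g0)
  show ?thesis using True g0.prob_space by simp
next
  case False
  have "\<bar>\<integral>x. x ^ i \<partial>g0\<bar> \<le> (\<integral>x. \<bar>x\<bar> ^ i \<partial>g0)"
    using integral_abs_bound[of g0 "\<lambda>x. x ^ i"] by (simp add: power_abs)
  also have "\<dots> \<le> (m0 * sqrt (real i)) ^ i" by (rule abs_moment_g0_le) (use False in simp)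
  also have "\<dots> \<le> (m0 * real i) ^ i"
  proof -
    have "sqrt (real i) \<le> sqrt ((real i)\<^sup>2)" using False by (intro real_sqrt_le_mono) (auto simp: power2_eq_square)
    then show ?thesis using m0 by (intro power_mono mult_left_mono) auto
  qed
  also have "\<dots> = m0 ^ i * real i ^ i" by (simp add: power_mult_distrib)
  also have "\<dots> \<le> m0 ^ i * (3 ^ i * fact i)" using m0 power_self_le[of i] by (intro mult_left_mono) auto
  finally show ?thesis by (simp add: power_mult_distrib mult_ac)
qed

lemma opn_pos: "opn > 0"
proof -
  have "0 < c0 * \<sigma>" using c0 \<sigma> by simp
  also have "\<dots> \<le> opn" using snr \<sigma> by (simp add: field_simps)
  finally show ?thesis .
qed

lemma \<sigma>_le: "\<sigma> \<le> opn / c0"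
  using snr \<sigma> c0 by (simp add: field_simps)

lemma \<kappa>_ge: "\<kappa> \<ge> 1" "\<kappa> \<ge> 1 / c0"
proof -
  show "\<kappa> \<ge> 1" by (simp add: \<kappa>_def)
  have "sqrt ((1 / c0)\<^sup>2) \<le> \<kappa>" unfolding \<kappa>_def by (intro real_sqrt_le_mono) (simp add: power_divide)
  then show "\<kappa> \<ge> 1 / c0" using c0 by simp
qed

lemma \<kappa>_square: "\<kappa>\<^sup>2 = 1 + 1 / c0\<^sup>2"
  by (simp add: \<kappa>_def add_nonneg_nonneg)

lemma b_pos: "b > 0" using opn_pos \<kappa>_ge(1) by (simp add: b_def)

lemma sum_coord: "(\<Sum>s\<in>coord_set. f s) = (\<Sum>s<p. f (Inl s)) + (\<Sum>i<n. f (Inr i) :: real)"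
  unfolding coord_set_def by (subst sum.Plus) auto

lemma prob_space_coord_law: "prob_space (coord_law s)"
proof -
  interpret g0: real_distribution g0 by (rule g0)
  show ?thesis
    by (cases s) (simp_all add: coord_law_def g0.prob_space_axioms prob_space_normal_density)
qed

lemma sets_coord_law: "sets (coord_law s) = sets borel"
  by (cases s) (simp_all add: coord_law_def g0_def)

sublocale design_coordinates coord_law coord_set K design p b noise_scale
proof -
  interpret g0: real_distribution g0 by (rule g0)
  interpret product_sigma_finite coord_law
    using prob_space_coord_law by (simp add: product_sigma_finite_def prob_space_imp_sigma_finite)
  show "design_coordinates coord_law coord_set K design p b noise_scale"
  proof
    show "emeasure (coord_law s) (space (coord_law s)) = 1" for s
      by (rule prob_space.emeasure_space_1[OF prob_space_coord_law])
    then show "emeasure (coord_law s) (space (coord_law s)) \<noteq> top" for s by simp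
    show "finite coord_set" by (simp add: coord_set_def)
    show "sets (coord_law s) = sets borel" for s by (rule sets_coord_law)
    show "1 \<le> K" by (rule K_ge)
    show "b > 0" by (rule b_pos)
    show "p \<ge> 1" by (rule p)
  next
    fix s assume "s \<in> coord_set"
    show "all_moments (coord_law s) (\<lambda>x. x)"
      by (cases s) (simp_all add: coord_law_def all_moments_g0 all_moments_std_normal)
    show "(\<integral>x. x \<partial>coord_law s) = 0"
      using moment_std_normal[of 1] by (cases s) (simp_all add: coord_law_def mean_g0)
  next
    fix s i
    show "\<bar>\<integral>x. x ^ i \<partial>coord_law s\<bar> \<le> fact i * K ^ i"
    proof (cases s)
      case (Inl a)
      have "(3 * m0) ^ i \<le> K ^ i" using m0 by (intro power_mono) (auto simp: K_def)
      then have "(3 * m0) ^ i * fact i \<le> K ^ i * fact i" by (intro mult_right_mono) auto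
      then have "\<bar>\<integral>x. x ^ i \<partial>g0\<bar> \<le> K ^ i * fact i" using moment_g0_le[of i] by linarith
      then show ?thesis using Inl by (simp add: coord_law_def mult.commute)
    next
      case (Inr a)
      have "1 * 1 \<le> (2::real) ^ (i div 2) * fact (i div 2)"
        by (intro mult_mono one_le_power fact_ge_1) auto
      then have "fact i / (2 ^ (i div 2) * fact (i div 2)) \<le> (fact i / 1 :: real)"
        by (intro divide_left_mono) auto
      also have "\<dots> \<le> fact i * K ^ i" using one_le_power[OF K_ge, of i] by simp
      finally show ?thesis using K_ge Inr by (auto simp: coord_law_def moment_std_normal)
    qed
  next
    fix v :: "nat \<Rightarrow> real"
    have "(\<Sum>s\<in>coord_set. (\<Sum>j<p. design s j * v j)\<^sup>2)
       = (\<Sum>s<p. (\<Sum>i<n. X i s * (\<Sum>j<p. X i j * v j))\<^sup>2) + \<sigma>\<^sup>2 * (\<Sum>i<n. (\<Sum>j<p. X i j * v j)\<^sup>2)"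
      by (simp add: sum_coord design_def gram_mult_eq mult.assoc sum_distrib_left[symmetric] power_mult_distrib)
    also have "\<dots> \<le> opn\<^sup>2 * (\<Sum>i<n. (\<Sum>j<p. X i j * v j)\<^sup>2) + (opn / c0)\<^sup>2 * (\<Sum>i<n. (\<Sum>j<p. X i j * v j)\<^sup>2)"
      using \<sigma>_le \<sigma> by (intro add_mono sum_transpose_square_le mult_right_mono power_mono sum_nonneg) auto
    also have "\<dots> = (opn\<^sup>2 * \<kappa>\<^sup>2) * (\<Sum>i<n. (\<Sum>j<p. X i j * v j)\<^sup>2)"
      by (simp add: \<kappa>_square algebra_simps power_divide)
    also have "\<dots> \<le> (opn\<^sup>2 * \<kappa>\<^sup>2) * (opn\<^sup>2 * (\<Sum>j<p. (v j)\<^sup>2))"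
      by (intro mult_left_mono sum_mat_vec_square_le) auto
    also have "\<dots> = b\<^sup>2 * (\<Sum>j<p. (v j)\<^sup>2)" by (simp add: b_def power_mult_distrib power2_eq_square)
    finally show "(\<Sum>s\<in>coord_set. (\<Sum>j<p. design s j * v j)\<^sup>2) \<le> b\<^sup>2 * (\<Sum>j<p. (v j)\<^sup>2)" .
  next
    fix j assume j: "j < p"
    have "vec_norm n (\<lambda>i. X i j) \<le> opn"
    proof (rule power2_le_imp_le)
      let ?e = "\<lambda>i. if i = j then 1 else 0 :: real"
      have 1: "(\<Sum>i<p. X r i * ?e i) = X r j" for r
        using j by (simp add: if_distrib[of "\<lambda>z. _ * z"] cong: if_cong)
      have "(\<Sum>i<p. (?e i)\<^sup>2) = (\<Sum>i<p. ?e i)" by (intro sum.cong) auto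
      also have "\<dots> = 1" using j by simp
      finally show "(vec_norm n (\<lambda>i. X i j))\<^sup>2 \<le> opn\<^sup>2"
        using sum_mat_vec_square_le[where n=n and p=p and X=X and v="?e"] unfolding 1 vec_norm_square by simp
    qed (use opn_pos in simp)
    then have "noise_scale j \<le> opn / c0 * opn"
      unfolding noise_scale_def using \<sigma>_le \<sigma> c0 opn_pos by (intro mult_mono) (auto simp: vec_norm_def L2_set_nonneg)
    also have "\<dots> = 1 / c0 * opn\<^sup>2" by (simp add: power2_eq_square)
    also have "\<dots> \<le> b" unfolding b_def using \<kappa>_ge by (intro mult_right_mono) auto
    finally show "0 \<le> noise_scale j \<and> noise_scale j \<le> b"
      using \<sigma> by (auto simp: noise_scale_def vec_norm_def L2_set_nonneg)
  qed
qed


section \<open>Passage from the model to the independent coordinates\<close>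

definition "coords \<omega> = (\<lambda>s\<in>coord_set. case s of Inl j \<Rightarrow> fst \<omega> j - mean g | Inr i \<Rightarrow> snd \<omega> i / \<sigma>)"
definition "row_sum = mat_vec p X (\<lambda>_. 1)"
definition "centered_response \<omega> i = (\<Sum>j<p. X i j * (fst \<omega> j - mean g)) + snd \<omega> i"
definition "mean_coeff = case_sum (\<lambda>s. (\<Sum>i<n. X i s * row_sum i) / gram_sum n p X 1) (\<lambda>i. \<sigma> * row_sum i / gram_sum n p X 1)"

lemma prob_space_model: "prob_space (model n p \<sigma> g)"
proof -
  have "prob_space (\<Pi>\<^sub>M j\<in>{..<p}. g)" by (rule prob_space_PiM) (rule g.prob_space_axioms)
  moreover have "prob_space (\<Pi>\<^sub>M i\<in>{..<n}. density lborel (normal_density 0 \<sigma>))"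
    by (rule prob_space_PiM) (rule prob_space_normal_density[OF \<sigma>])
  ultimately show ?thesis unfolding model_def by (rule prob_space_pair)
qed

lemma measurable_model_component:
  "j < p \<Longrightarrow> (\<lambda>\<omega>. fst \<omega> j) \<in> borel_measurable (model n p \<sigma> g)"
  "i < n \<Longrightarrow> (\<lambda>\<omega>. snd \<omega> i) \<in> borel_measurable (model n p \<sigma> g)"
proof -
  show "(\<lambda>\<omega>. fst \<omega> j) \<in> borel_measurable (model n p \<sigma> g)" if "j < p"
  proof -
    have c: "(\<lambda>x. x j) \<in> (\<Pi>\<^sub>M j\<in>{..<p}. g) \<rightarrow>\<^sub>M g" by (rule measurable_component_singleton) (use that in simp)
    have "(\<lambda>\<omega>. fst \<omega> j) \<in> model n p \<sigma> g \<rightarrow>\<^sub>M g"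
      unfolding model_def by (rule measurable_compose[OF measurable_fst c])
    then show ?thesis by (simp only: measurable_cong_sets[OF refl g.events_eq_borel])
  qed
  show "(\<lambda>\<omega>. snd \<omega> i) \<in> borel_measurable (model n p \<sigma> g)" if "i < n"
  proof -
    let ?N = "density lborel (normal_density 0 \<sigma>)"
    have c: "(\<lambda>x. x i) \<in> (\<Pi>\<^sub>M i\<in>{..<n}. ?N) \<rightarrow>\<^sub>M ?N"
      by (rule measurable_component_singleton) (use that in simp)
    have "(\<lambda>\<omega>. snd \<omega> i) \<in> model n p \<sigma> g \<rightarrow>\<^sub>M ?N"
      unfolding model_def by (rule measurable_compose[OF measurable_snd c])
    moreover have "sets ?N = sets borel" by simp
    ultimately show ?thesis by (simp only: measurable_cong_sets[OF refl \<open>sets ?N = sets borel\<close>])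
  qed
qed

lemma measurable_response: "i < n \<Longrightarrow> (\<lambda>\<omega>. response p X \<omega> i) \<in> borel_measurable (model n p \<sigma> g)"
  unfolding response_def mat_vec_def split_beta
  by (intro borel_measurable_add borel_measurable_sum borel_measurable_times borel_measurable_const measurable_model_component) auto

lemma measurable_coords: "coords \<in> model n p \<sigma> g \<rightarrow>\<^sub>M PiM coord_set coord_law"
  unfolding coords_def
proof (rule measurable_restrict)
  fix s assume s: "s \<in> coord_set"
  have "(\<lambda>\<omega>. case s of Inl j \<Rightarrow> fst \<omega> j - mean g | Inr i \<Rightarrow> snd \<omega> i / \<sigma>) \<in> borel_measurable (model n p \<sigma> g)"
    using s measurable_model_component
    by (cases s) (auto simp: coord_set_def intro!: borel_measurable_diff borel_measurable_divide)
  then show "(\<lambda>\<omega>. case s of Inl j \<Rightarrow> fst \<omega> j - mean g | Inr i \<Rightarrow> snd \<omega> i / \<sigma>) \<in> model n p \<sigma> g \<rightarrow>\<^sub>M coord_law s"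
    by (simp cong: measurable_cong_sets)
qed

text \<open>Carries every probability from the model to the product measure on which Efron-Stein was
  proved. It is enough to compare boxes, whose preimages are products of boxes.\<close>

lemma distr_coords: "distr (model n p \<sigma> g) (PiM coord_set coord_law) coords = PiM coord_set coord_law"
proof (rule PiM_eqI)
  show "finite coord_set" by (simp add: coord_set_def)
  show "sets (distr (model n p \<sigma> g) (PiM coord_set coord_law) coords) = sets (PiM coord_set coord_law)" by simp
  fix A assume A: "\<And>s. s \<in> coord_set \<Longrightarrow> A s \<in> sets (coord_law s)"
  let ?N = "density lborel (normal_density 0 \<sigma>)"
  let ?P1 = "\<Pi>\<^sub>M j\<in>{..<p}. g" and ?P2 = "\<Pi>\<^sub>M i\<in>{..<n}. ?N"
  interpret N: prob_space ?N by (rule prob_space_normal_density[OF \<sigma>])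
  interpret g1: product_prob_space "\<lambda>_::nat. g" "{..<p}" by standard
  interpret g2: product_prob_space "\<lambda>_::nat. ?N" "{..<n}" by standard
  have Am: "A s \<in> sets borel" if "s \<in> coord_set" for s using A[OF that] by simp
  define C where "C = (\<lambda>j. (\<lambda>x. x - mean g) -` A (Inl j))"
  define D where "D = (\<lambda>i. (\<lambda>x. x / \<sigma>) -` A (Inr i))"
  have vim: "f -` B \<in> sets borel" if "f \<in> borel_measurable borel" "B \<in> sets borel" for f :: "real \<Rightarrow> real" and B
    using measurable_sets[OF that] by simp
  have Cm: "C j \<in> sets g" if "j < p" for j
    unfolding C_def g.events_eq_borel by (rule vim) (use that Am in \<open>auto simp: coord_set_def\<close>)
  have Dm: "D i \<in> sets ?N" if "i < n" for i
    unfolding D_def by simp (rule vim, use that Am in \<open>auto simp: coord_set_def\<close>)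
  have pre: "coords -` Pi\<^sub>E coord_set A \<inter> space (model n p \<sigma> g) = Pi\<^sub>E {..<p} C \<times> Pi\<^sub>E {..<n} D"
  proof (intro equalityI subsetI)
    fix \<omega> assume \<omega>: "\<omega> \<in> coords -` Pi\<^sub>E coord_set A \<inter> space (model n p \<sigma> g)"
    then have mem: "coords \<omega> s \<in> A s" if "s \<in> coord_set" for s using that by auto
    have "fst \<omega> j \<in> C j" if "j < p" for j
      using mem[of "Inl j"] that by (auto simp: coords_def coord_set_def C_def)
    moreover have "snd \<omega> i \<in> D i" if "i < n" for i
      using mem[of "Inr i"] that by (auto simp: coords_def coord_set_def D_def)
    moreover have "fst \<omega> \<in> extensional {..<p}" "snd \<omega> \<in> extensional {..<n}"
      using \<omega> by (auto simp: model_def space_pair_measure space_PiM PiE_iff)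
    ultimately show "\<omega> \<in> Pi\<^sub>E {..<p} C \<times> Pi\<^sub>E {..<n} D" by (auto simp: PiE_iff mem_Times_iff)
  next
    fix \<omega> assume \<omega>: "\<omega> \<in> Pi\<^sub>E {..<p} C \<times> Pi\<^sub>E {..<n} D"
    then have "\<omega> \<in> space (model n p \<sigma> g)"
      by (auto simp: model_def space_pair_measure space_PiM PiE_iff)
    moreover have "coords \<omega> s \<in> A s" if "s \<in> coord_set" for s
      using \<omega> that by (cases s) (auto simp: coords_def coord_set_def C_def D_def PiE_iff mem_Times_iff)
    then have "coords \<omega> \<in> Pi\<^sub>E coord_set A" by (auto simp: PiE_iff coords_def)
    ultimately show "\<omega> \<in> coords -` Pi\<^sub>E coord_set A \<inter> space (model n p \<sigma> g)" by auto
  qed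
  have "emeasure (distr (model n p \<sigma> g) (PiM coord_set coord_law) coords) (Pi\<^sub>E coord_set A)
     = emeasure (model n p \<sigma> g) (Pi\<^sub>E {..<p} C \<times> Pi\<^sub>E {..<n} D)"
    unfolding pre[symmetric]
    by (rule emeasure_distr[OF measurable_coords]) (rule sets_PiM_I_finite, simp add: coord_set_def, rule A)
  also have "\<dots> = emeasure ?P1 (Pi\<^sub>E {..<p} C) * emeasure ?P2 (Pi\<^sub>E {..<n} D)"
    unfolding model_def
    by (rule g2.P.emeasure_pair_measure_Times) (auto intro!: sets_PiM_I_finite Cm Dm)
  also have "emeasure ?P1 (Pi\<^sub>E {..<p} C) = (\<Prod>j<p. emeasure g (C j))"
    by (rule g1.emeasure_PiM) (use Cm in auto)
  also have "\<dots> = (\<Prod>j<p. emeasure (coord_law (Inl j)) (A (Inl j)))"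
  proof (rule prod.cong[OF refl])
    fix j assume "j \<in> {..<p}"
    then have "A (Inl j) \<in> sets borel" by (intro Am) (auto simp: coord_set_def)
    then show "emeasure g (C j) = emeasure (coord_law (Inl j)) (A (Inl j))"
      unfolding coord_law_def g0_def C_def by (simp add: emeasure_distr)
  qed
  also have "emeasure ?P2 (Pi\<^sub>E {..<n} D) = (\<Prod>i<n. emeasure ?N (D i))"
    by (rule g2.emeasure_PiM) (use Dm in auto)
  also have "\<dots> = (\<Prod>i<n. emeasure (coord_law (Inr i)) (A (Inr i)))"
  proof (rule prod.cong[OF refl])
    fix i assume "i \<in> {..<n}"
    then have "A (Inr i) \<in> sets borel" by (intro Am) (auto simp: coord_set_def)
    then show "emeasure ?N (D i) = emeasure (coord_law (Inr i)) (A (Inr i))"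
      unfolding coord_law_def D_def std_normal_eq_distr[OF \<sigma>, symmetric] by (simp add: emeasure_distr)
  qed
  also have "(\<Prod>j<p. emeasure (coord_law (Inl j)) (A (Inl j))) * (\<Prod>i<n. emeasure (coord_law (Inr i)) (A (Inr i)))
     = (\<Prod>s\<in>coord_set. emeasure (coord_law s) (A s))"
    unfolding coord_set_def by (subst prod.Plus) auto
  finally show "emeasure (distr (model n p \<sigma> g) (PiM coord_set coord_law) coords) (Pi\<^sub>E coord_set A)
    = (\<Prod>s\<in>coord_set. emeasure (coord_law s) (A s))" .
qed

lemma gram_sum_1: "gram_sum n p X 1 = (\<Sum>i<n. (row_sum i)\<^sup>2)"
proof -
  have "gram_sum n p X 1 = (\<Sum>s<p. \<Sum>i<n. X i s * (\<Sum>j<p. X i j))"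
    using gram_mult_eq[where v="\<lambda>_. 1"] by (simp add: gram_sum_def)
  also have "\<dots> = (\<Sum>i<n. (row_sum i)\<^sup>2)"
    by (subst sum.swap) (simp add: row_sum_def mat_vec_def power2_eq_square sum_distrib_right)
  finally show ?thesis .
qed

lemma gram_sum_1_pos: "gram_sum n p X 1 > 0"
proof -
  have "0 < c0 * real (min n p) * opn ^ 2" using c0 n p opn_pos by simp
  then show ?thesis using A1 by simp
qed

lemma response_eq: "response p X \<omega> i = centered_response \<omega> i + mean g * row_sum i"
  by (simp add: response_def split_beta centered_response_def row_sum_def mat_vec_def right_diff_distrib
      sum_subtractf sum_distrib_left mult_ac)

lemma coords_Inl: "j < p \<Longrightarrow> coords \<omega> (Inl j) = fst \<omega> j - mean g"
  and coords_Inr: "i < n \<Longrightarrow> coords \<omega> (Inr i) = snd \<omega> i / \<sigma>"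
  by (auto simp: coords_def coord_set_def)

lemma S_coords: "S j (coords \<omega>) = (\<Sum>i<n. X i j * centered_response \<omega> i)"
proof -
  have "S j (coords \<omega>) = (\<Sum>s<p. gram n X j s * (fst \<omega> s - mean g)) + (\<Sum>i<n. X i j * snd \<omega> i)"
    unfolding S_def linear_form_def sum_coord using \<sigma>
    by (simp add: design_def coords_Inl coords_Inr gram_sym[of _ _ _ j])
  then show ?thesis unfolding gram_mult_eq by (simp add: centered_response_def algebra_simps sum.distrib)
qed

text \<open>The least squares estimate along \<open>row_sum\<close> is unbiased and linear in the
  response, so its error is a linear form in the centered coordinates.\<close>

lemma mean_error_eq: "m1_hat n p X (response p X \<omega>) - mean g = linear_form mean_coeff coord_set (coords \<omega>)"
proof -
  define G where "G = gram_sum n p X 1"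
  have G: "G > 0" "G = (\<Sum>i<n. (row_sum i)\<^sup>2)" using gram_sum_1_pos gram_sum_1 by (auto simp: G_def)
  have mc: "mean_coeff (Inl s) = (\<Sum>i<n. X i s * row_sum i) / G" "mean_coeff (Inr i) = \<sigma> * row_sum i / G" for s i
    by (simp_all only: mean_coeff_def G_def sum.case)
  have "linear_form mean_coeff coord_set (coords \<omega>)
    = (\<Sum>s<p. (\<Sum>i<n. X i s * row_sum i) / G * (fst \<omega> s - mean g)) + (\<Sum>i<n. row_sum i * snd \<omega> i / G)"
    unfolding linear_form_def sum_coord using \<sigma> G(1)
    by (simp add: mc coords_Inl coords_Inr)
  also have "(\<Sum>s<p. (\<Sum>i<n. X i s * row_sum i) / G * (fst \<omega> s - mean g))
    = (\<Sum>s<p. \<Sum>i<n. row_sum i * (X i s * (fst \<omega> s - mean g))) / G"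
    by (simp add: sum_distrib_right sum_distrib_left sum_divide_distrib mult_ac)
  also have "(\<Sum>s<p. \<Sum>i<n. row_sum i * (X i s * (fst \<omega> s - mean g)))
    = (\<Sum>i<n. row_sum i * (\<Sum>s<p. X i s * (fst \<omega> s - mean g)))"
    by (subst sum.swap) (simp add: sum_distrib_left)
  also have "(\<Sum>i<n. row_sum i * (\<Sum>s<p. X i s * (fst \<omega> s - mean g))) / G + (\<Sum>i<n. row_sum i * snd \<omega> i / G)
    = (\<Sum>i<n. row_sum i * centered_response \<omega> i) / G"
    by (simp add: centered_response_def algebra_simps sum.distrib add_divide_distrib sum_divide_distrib)
  also have "\<dots> = (\<Sum>i<n. row_sum i * response p X \<omega> i) / G - mean g"
  proof -
    have "(\<Sum>i<n. row_sum i * response p X \<omega> i) = (\<Sum>i<n. row_sum i * centered_response \<omega> i) + mean g * G"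
      by (simp add: response_eq G(2) algebra_simps sum.distrib sum_distrib_left power2_eq_square)
    then show ?thesis using G(1) by (simp add: add_divide_distrib)
  qed
  also have "(\<Sum>i<n. row_sum i * response p X \<omega> i) / G = m1_hat n p X (response p X \<omega>)"
    by (simp add: m1_hat_def row_sum_def[symmetric] vec_norm_square G(2))
  finally show ?thesis ..
qed

text \<open>Signal and noise together contribute \<open>\<kappa>\<^sup>2 * opn\<^sup>2\<close>
  divided by \<open>gram_sum n p X 1\<close>; here the lower bound \<open>A1\<close> becomes the
  rate 1 / N.\<close>

lemma sum_mean_coeff_square_le: "(\<Sum>s\<in>coord_set. (mean_coeff s)\<^sup>2) \<le> \<kappa>\<^sup>2 / (c0 * real (min n p))"
proof -
  define G where "G = gram_sum n p X 1"
  have G: "G > 0" "G = (\<Sum>i<n. (row_sum i)\<^sup>2)" using gram_sum_1_pos gram_sum_1 by (auto simp: G_def)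
  have mc: "mean_coeff (Inl s) = (\<Sum>i<n. X i s * row_sum i) / G" "mean_coeff (Inr i) = \<sigma> * row_sum i / G" for s i
    by (simp_all only: mean_coeff_def G_def sum.case)
  have "(\<Sum>s\<in>coord_set. (mean_coeff s)\<^sup>2) = ((\<Sum>s<p. (\<Sum>i<n. X i s * row_sum i)\<^sup>2) + \<sigma>\<^sup>2 * G) / G\<^sup>2"
    by (simp add: sum_coord mc power_divide power_mult_distrib sum_divide_distrib[symmetric]
        sum_distrib_left[symmetric] add_divide_distrib) (simp add: G(2))
  also have "\<dots> \<le> (opn\<^sup>2 * G + (opn / c0)\<^sup>2 * G) / G\<^sup>2"
    unfolding G(2) using \<sigma>_le \<sigma>
    by (intro divide_right_mono add_mono sum_transpose_square_le mult_right_mono power_mono sum_nonneg) auto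
  also have "\<dots> = \<kappa>\<^sup>2 * opn\<^sup>2 / G"
  proof -
    have "opn\<^sup>2 * G + (opn / c0)\<^sup>2 * G = \<kappa>\<^sup>2 * opn\<^sup>2 * G"
      by (simp add: \<kappa>_square power_divide algebra_simps)
    then show ?thesis using G(1) by (simp add: power2_eq_square[of G])
  qed
  also have "\<dots> \<le> \<kappa>\<^sup>2 * opn\<^sup>2 / (c0 * real (min n p) * opn\<^sup>2)"
    using A1 c0 n p opn_pos G(1) by (intro divide_left_mono) (auto simp: G_def)
  also have "\<dots> = \<kappa>\<^sup>2 / (c0 * real (min n p))" using opn_pos by simp
  finally show ?thesis .
qed

lemma second_moment_mean_error_le:
  "(\<integral>x. (linear_form mean_coeff coord_set x)\<^sup>2 \<partial>PiM coord_set coord_law) \<le> 16 * K\<^sup>2 * \<kappa>\<^sup>2 / (c0 * real (min n p))"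
proof -
  define R where "R = 2 * K * sqrt (\<kappa>\<^sup>2 / (c0 * real (min n p)))"
  have "\<kappa>\<^sup>2 / (c0 * real (min n p)) > 0" using \<kappa>_ge(1) c0 n p by auto
  then have R: "R > 0" "R\<^sup>2 = 4 * K\<^sup>2 * (\<kappa>\<^sup>2 / (c0 * real (min n p)))"
    using K_ge by (auto simp: R_def power_mult_distrib)
  have "\<bar>\<integral>x. linear_form mean_coeff coord_set x ^ 2 \<partial>PiM coord_set coord_law\<bar> \<le> 2 * fact 2 * R ^ 2"
  proof (rule moment_linear_form_le[OF R(1)])
    show "4 * K\<^sup>2 * (\<Sum>s\<in>coord_set. (mean_coeff s)\<^sup>2) \<le> R\<^sup>2"
      unfolding R(2) by (intro mult_left_mono sum_mean_coeff_square_le) simp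
  qed
  then show ?thesis unfolding R(2) by (simp add: fact_2)
qed

text \<open>For column \<open>j\<close> the noise coordinates multiply to the exponential series
  with variance \<open>(noise_scale j)\<^sup>2\<close>, the exact inverse of the Hermite factor.
  What is left is the product over the signal coordinates, to which \<open>sum_gamma_coeff\<close>
  applies.\<close>

lemma expectation_Fsum:
  assumes "l \<ge> 2"
  shows "(\<integral>x. Fsum l x \<partial>PiM coord_set coord_law) = \<mu> l * gram_sum n p X l +
     (\<Sum>t\<in>{2..l}. \<Sum>ds\<in>compositions2 l t. (\<Prod>d\<leftarrow>ds. \<mu> d) * gamma_coeff n p X ds)"
proof -
  interpret g0: real_distribution g0 by (rule g0)
  have noise: "coordinate_fps (\<lambda>s. design s j) (Inr i) = gauss_fps (- (\<sigma> * X i j)\<^sup>2)" for i j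
  proof (rule fps_ext)
    fix d
    show "coordinate_fps (\<lambda>s. design s j) (Inr i) $ d = gauss_fps (- (\<sigma> * X i j)\<^sup>2) $ d"
      unfolding coordinate_fps_def
      by (auto simp: coord_law_def design_def moment_std_normal gauss_fps_nth power_divide
          power_mult[symmetric] elim!: evenE)
  qed
  have signal: "coordinate_fps (\<lambda>s. design s j) (Inl s) = Abs_fps (\<lambda>d. gram n X j s ^ d * \<mu> d / fact d)" for s j
    unfolding coordinate_fps_def by (simp add: coord_law_def design_def \<mu>_def moment_def gram_sym[of _ _ s])
  have prod: "(\<Prod>s\<in>coord_set. coordinate_fps (\<lambda>s. design s j) s) * gauss_fps ((noise_scale j)\<^sup>2)
     = (\<Prod>s<p. Abs_fps (\<lambda>d. gram n X j s ^ d * \<mu> d / fact d))" for j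
  proof -
    have "(\<Prod>s\<in>coord_set. coordinate_fps (\<lambda>s. design s j) s)
      = (\<Prod>s<p. Abs_fps (\<lambda>d. gram n X j s ^ d * \<mu> d / fact d)) * (\<Prod>i<n. gauss_fps (- (\<sigma> * X i j)\<^sup>2))"
      unfolding coord_set_def by (subst prod.Plus) (auto simp: noise signal)
    also have "(\<Prod>i<n. gauss_fps (- (\<sigma> * X i j)\<^sup>2)) = gauss_fps (- (noise_scale j)\<^sup>2)"
      by (subst gauss_fps_prod) (auto simp: noise_scale_def power_mult_distrib vec_norm_square sum_negf sum_distrib_left)
    finally show ?thesis by (simp add: mult.assoc gauss_fps_mult gauss_fps_0)
  qed
  have "(\<integral>x. Fsum l x \<partial>PiM coord_set coord_law) = (\<Sum>j<p. \<integral>x. hterm l j x \<partial>PiM coord_set coord_law)"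
    unfolding Fsum_def by (rule Bochner_Integration.integral_sum) (rule all_moments_integrable[OF all_moments_hterm])
  also have "\<dots> = (\<Sum>j<p. fact l * (\<Prod>s<p. Abs_fps (\<lambda>d. gram n X j s ^ d * \<mu> d / fact d)) $ l)"
    unfolding hterm_def S_def by (simp only: hermite_hom_linear_form prod)
  also have "\<dots> = \<mu> l * gram_sum n p X l +
     (\<Sum>t\<in>{2..l}. \<Sum>ds\<in>compositions2 l t. (\<Prod>d\<leftarrow>ds. \<mu> d) * gamma_coeff n p X ds)"
    by (rule sum_gamma_coeff)
      (use assms g0.prob_space mean_g0 in \<open>auto simp: \<mu>_def moment_def\<close>)
  finally show ?thesis .
qed

lemma F_stat_y_hat_eq:
  assumes "l \<ge> 1"
  shows "F_stat n p \<sigma> X l (y_hat n p X (response p X \<omega>)) =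
    (\<Sum>j<p. hermite_hom l ((noise_scale j)\<^sup>2)
      (S j (coords \<omega>) - (m1_hat n p X (response p X \<omega>) - mean g) * (\<Sum>i<n. X i j * row_sum i)))"
proof -
  define m where "m = m1_hat n p X (response p X \<omega>)"
  have "(\<Sum>i<n. X i j * y_hat n p X (response p X \<omega>) i) = S j (coords \<omega>) - (m - mean g) * (\<Sum>i<n. X i j * row_sum i)" for j
  proof -
    have "(\<Sum>i<n. X i j * y_hat n p X (response p X \<omega>) i)
      = (\<Sum>i<n. X i j * centered_response \<omega> i - (m - mean g) * (X i j * row_sum i))"
      by (intro sum.cong refl) (simp add: y_hat_def response_eq row_sum_def[symmetric] m_def[symmetric] algebra_simps)
    then show ?thesis by (simp add: S_coords sum_subtractf sum_distrib_left)
  qed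
  then show ?thesis using F_stat_eq[OF assms \<sigma>] by (simp add: noise_scale_def[symmetric] m_def)
qed

lemma Wsum_nonneg: "0 \<le> Wsum l x"
  by (simp add: Wsum_def sum_nonneg)

text \<open>Three families of events, each controlled by Markov's inequality: a large mean error,
  large norms \<open>Wsum\<close> of the Hermite terms, and large fluctuations of
  \<open>Fsum\<close>. They are set up in the independent coordinates and pulled back along
  \<open>coords\<close>. Outside them all bounds are deterministic, so the dependence of
  \<open>m1_hat\<close> on the same data does no harm.\<close>

lemma good_event:
  fixes L :: nat and U \<theta> \<Omega> :: real
  assumes L: "L \<ge> 1" and U: "U > 0" and \<theta>: "\<theta> > 0" and \<Omega>: "\<Omega> = (48 * real L * K) ^ L"
  obtains Bad where "Bad \<in> sets (model n p \<sigma> g)"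
    "measure (model n p \<sigma> g) Bad \<le> 16 * K\<^sup>2 * \<kappa>\<^sup>2 / (c0 * U\<^sup>2) + (real L + 1) * (\<Omega>\<^sup>2 / \<theta>) + real L * (2 * real L * 4 ^ L * \<Omega> ^ 6 / \<theta>)"
    "\<And>\<omega>. \<omega> \<in> space (model n p \<sigma> g) \<Longrightarrow> \<omega> \<notin> Bad \<Longrightarrow>
       \<bar>m1_hat n p X (response p X \<omega>) - mean g\<bar> \<le> U / sqrt (real (min n p))"
    "\<And>\<omega> l. \<omega> \<in> space (model n p \<sigma> g) \<Longrightarrow> \<omega> \<notin> Bad \<Longrightarrow> l \<in> {2..L} \<Longrightarrow>
       \<bar>F_stat n p \<sigma> X l (y_hat n p X (response p X \<omega>)) - (\<integral>x. Fsum l x \<partial>PiM coord_set coord_law)\<bar>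
       \<le> sqrt (\<theta> * real p) * b ^ l * (1 + U * sqrt (real p / real (min n p))) ^ l + sqrt (\<theta> * (real p * sqrt (real p))) * b ^ l"
proof -
  let ?P = "PiM coord_set coord_law"
  define N where "N = real (min n p)"
  have N: "N > 0" using n p by (simp add: N_def)
  define lf where "lf = linear_form mean_coeff coord_set"
  define E where "E = (\<lambda>l. \<integral>x. Fsum l x \<partial>?P)"
  define B1 where "B1 = {x\<in>space ?P. (lf x)\<^sup>2 > U\<^sup>2 / N}"
  define B2 where "B2 = (\<lambda>l. {x\<in>space ?P. Wsum l x > \<theta> * real p * b ^ (2 * l)})"
  define B3 where "B3 = (\<lambda>l. {x\<in>space ?P. (Fsum l x - E l)\<^sup>2 > \<theta> * (real p * sqrt (real p)) * b ^ (2 * l)})"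
  have p0: "real p > 0" using p by simp
  have [measurable]: "lf \<in> borel_measurable ?P"
    unfolding lf_def by (rule all_moments_measurable[OF all_moments_linear_form]) simp
  have [measurable]: "Wsum l \<in> borel_measurable ?P" for l by (rule all_moments_measurable[OF all_moments_Wsum])
  have [measurable]: "Fsum l \<in> borel_measurable ?P" for l by (rule all_moments_measurable[OF all_moments_Fsum])
  have sets: "B1 \<in> sets ?P" "B2 l \<in> sets ?P" "B3 l \<in> sets ?P" for l
    unfolding B1_def B2_def B3_def by measurable
  have m1: "measure ?P B1 \<le> 16 * K\<^sup>2 * \<kappa>\<^sup>2 / (c0 * U\<^sup>2)"
  proof -
    have "measure ?P B1 \<le> (\<integral>x. (lf x)\<^sup>2 \<partial>?P) / (U\<^sup>2 / N)"
      unfolding B1_def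
      by (rule P.prob_greater_le) (use U N all_moments_integrable_power[OF all_moments_linear_form[OF subset_refl]] in \<open>auto simp: lf_def\<close>)
    also have "\<dots> \<le> (16 * K\<^sup>2 * \<kappa>\<^sup>2 / (c0 * N)) / (U\<^sup>2 / N)"
      unfolding lf_def N_def using second_moment_mean_error_le by (intro divide_right_mono) auto
    also have "\<dots> = 16 * K\<^sup>2 * \<kappa>\<^sup>2 / (c0 * U\<^sup>2)" using N U by (simp add: field_simps)
    finally show ?thesis .
  qed
  have m2: "measure ?P (B2 l) \<le> \<Omega>\<^sup>2 / \<theta>" if "l \<le> L" for l
  proof -
    have "measure ?P (B2 l) \<le> (\<integral>x. Wsum l x \<partial>?P) / (\<theta> * real p * b ^ (2 * l))"
      unfolding B2_def
      by (rule P.prob_greater_le)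
        (use \<theta> p0 b_pos all_moments_integrable[OF all_moments_Wsum] in \<open>auto intro: Wsum_nonneg\<close>)
    also have "\<dots> \<le> (real p * \<Omega>\<^sup>2 * b ^ (2 * l)) / (\<theta> * real p * b ^ (2 * l))"
      using expectation_Wsum_le[OF L \<Omega> that] \<theta> p0 b_pos by (intro divide_right_mono) auto
    also have "\<dots> = \<Omega>\<^sup>2 / \<theta>" using p0 b_pos by simp
    finally show ?thesis .
  qed
  have m3: "measure ?P (B3 l) \<le> 2 * real L * 4 ^ L * \<Omega> ^ 6 / \<theta>" if l: "l \<in> {1..L}" for l
  proof -
    have amF: "all_moments ?P (\<lambda>x. Fsum l x - E l)"
      by (rule P.all_moments_diff[OF all_moments_Fsum P.all_moments_const])
    have "measure ?P (B3 l) \<le> (\<integral>x. (Fsum l x - E l)\<^sup>2 \<partial>?P) / (\<theta> * (real p * sqrt (real p)) * b ^ (2 * l))"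
      unfolding B3_def
      by (rule P.prob_greater_le) (use \<theta> p0 b_pos all_moments_integrable_power[OF amF, of 2] in auto)
    also have "\<dots> \<le> (2 * real l * 4 ^ l * \<Omega> ^ 6 * (real p * sqrt (real p)) * b ^ (2 * l)) / (\<theta> * (real p * sqrt (real p)) * b ^ (2 * l))"
      unfolding E_def using variance_Fsum_le[OF L \<Omega>, of l] l \<theta> p0 b_pos by (intro divide_right_mono) auto
    also have "\<dots> = 2 * real l * 4 ^ l * \<Omega> ^ 6 / \<theta>" using p0 b_pos by simp
    also have "\<dots> \<le> 2 * real L * 4 ^ L * \<Omega> ^ 6 / \<theta>"
      using l \<theta> \<Omega>_ge_1[OF L \<Omega>] by (intro divide_right_mono mult_right_mono mult_mono power_increasing) auto
    finally show ?thesis .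
  qed
  define Bd where "Bd = B1 \<union> ((\<Union>l\<in>{..L}. B2 l) \<union> (\<Union>l\<in>{1..L}. B3 l))"
  have Bds: "Bd \<in> sets ?P" unfolding Bd_def using sets by auto
  have mB: "measure ?P Bd \<le> 16 * K\<^sup>2 * \<kappa>\<^sup>2 / (c0 * U\<^sup>2) + (real L + 1) * (\<Omega>\<^sup>2 / \<theta>) + real L * (2 * real L * 4 ^ L * \<Omega> ^ 6 / \<theta>)"
  proof -
    have "measure ?P (\<Union>l\<in>{..L}. B2 l) \<le> (\<Sum>l\<in>{..L}. measure ?P (B2 l))"
      by (rule P.finite_measure_subadditive_finite) (use sets in auto)
    also have "\<dots> \<le> (\<Sum>l\<in>{..L}. \<Omega>\<^sup>2 / \<theta>)" by (intro sum_mono m2) auto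
    finally have 2: "measure ?P (\<Union>l\<in>{..L}. B2 l) \<le> (real L + 1) * (\<Omega>\<^sup>2 / \<theta>)" by (simp add: algebra_simps)
    have "measure ?P (\<Union>l\<in>{1..L}. B3 l) \<le> (\<Sum>l\<in>{1..L}. measure ?P (B3 l))"
      by (rule P.finite_measure_subadditive_finite) (use sets in auto)
    also have "\<dots> \<le> (\<Sum>l\<in>{1..L}. 2 * real L * 4 ^ L * \<Omega> ^ 6 / \<theta>)" by (intro sum_mono m3) auto
    finally have 3: "measure ?P (\<Union>l\<in>{1..L}. B3 l) \<le> real L * (2 * real L * 4 ^ L * \<Omega> ^ 6 / \<theta>)" by simp
    have s23: "(\<Union>l\<in>{..L}. B2 l) \<in> sets ?P" "(\<Union>l\<in>{1..L}. B3 l) \<in> sets ?P" using sets by auto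
    have "measure ?P Bd \<le> measure ?P B1 + measure ?P ((\<Union>l\<in>{..L}. B2 l) \<union> (\<Union>l\<in>{1..L}. B3 l))"
      unfolding Bd_def by (rule measure_Un_le) (use sets s23 in auto)
    also have "\<dots> \<le> measure ?P B1 + (measure ?P (\<Union>l\<in>{..L}. B2 l) + measure ?P (\<Union>l\<in>{1..L}. B3 l))"
      by (intro add_left_mono measure_Un_le s23)
    finally show ?thesis using m1 2 3 by linarith
  qed
  define Bad where "Bad = coords -` Bd \<inter> space (model n p \<sigma> g)"
  show thesis
  proof (rule that[of Bad])
    show "Bad \<in> sets (model n p \<sigma> g)"
      unfolding Bad_def by (rule measurable_sets[OF measurable_coords Bds])
    have "measure (model n p \<sigma> g) Bad = measure (distr (model n p \<sigma> g) ?P coords) Bd"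
      unfolding Bad_def by (rule measure_distr[OF measurable_coords Bds, symmetric])
    then show "measure (model n p \<sigma> g) Bad \<le> 16 * K\<^sup>2 * \<kappa>\<^sup>2 / (c0 * U\<^sup>2) + (real L + 1) * (\<Omega>\<^sup>2 / \<theta>) + real L * (2 * real L * 4 ^ L * \<Omega> ^ 6 / \<theta>)"
      using mB by (simp add: distr_coords)
  next
    fix \<omega> assume \<omega>: "\<omega> \<in> space (model n p \<sigma> g)" "\<omega> \<notin> Bad"
    define x where "x = coords \<omega>"
    define \<Delta> where "\<Delta> = m1_hat n p X (response p X \<omega>) - mean g"
    have x: "x \<in> space ?P" unfolding x_def by (rule measurable_space[OF measurable_coords \<omega>(1)])
    have xB: "x \<notin> Bd" using \<omega> by (simp add: Bad_def x_def)
    have \<Delta>x: "\<Delta> = lf x" by (simp add: \<Delta>_def lf_def x_def mean_error_eq)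
    have "\<Delta>\<^sup>2 \<le> U\<^sup>2 / N" using xB x unfolding Bd_def B1_def \<Delta>x by auto
    also have "\<dots> = (U / sqrt N)\<^sup>2" using N by (simp add: power_divide)
    finally have "\<bar>\<Delta>\<bar>\<^sup>2 \<le> (U / sqrt N)\<^sup>2" by simp
    then have \<Delta>le: "\<bar>\<Delta>\<bar> \<le> U / sqrt N" by (rule power2_le_imp_le) (use U N in simp)
    then show "\<bar>m1_hat n p X (response p X \<omega>) - mean g\<bar> \<le> U / sqrt (real (min n p))"
      by (simp only: \<Delta>_def N_def)
    fix l assume l: "l \<in> {2..L}"
    \<comment> \<open>The direction in which the linear forms move when the mean changes: the Gram
      matrix applied to the all-ones vector, so two applications of the operator norm bound
      it.\<close>
    define a where "a = (\<lambda>j. \<Sum>i<n. X i j * row_sum i)"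
    have asq: "(\<Sum>j<p. (a j)\<^sup>2) \<le> (b * sqrt (real p))\<^sup>2"
    proof -
      have "(\<Sum>j<p. (a j)\<^sup>2) \<le> opn\<^sup>2 * (\<Sum>i<n. (row_sum i)\<^sup>2)"
        unfolding a_def by (rule sum_transpose_square_le)
      also have "(\<Sum>i<n. (row_sum i)\<^sup>2) \<le> opn\<^sup>2 * (\<Sum>j<p. 1\<^sup>2)"
        unfolding row_sum_def mat_vec_def by (rule sum_mat_vec_square_le)
      then have "opn\<^sup>2 * (\<Sum>i<n. (row_sum i)\<^sup>2) \<le> opn\<^sup>2 * (opn\<^sup>2 * real p)"
        by (intro mult_left_mono) auto
      also have "\<dots> = 1 * (opn\<^sup>2)\<^sup>2 * real p" by (simp add: power2_eq_square)
      also have "\<dots> \<le> \<kappa>\<^sup>2 * (opn\<^sup>2)\<^sup>2 * real p"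
        using \<kappa>_ge(1) by (intro mult_right_mono) (auto simp: one_le_power)
      also have "\<dots> = (b * sqrt (real p))\<^sup>2" by (simp add: b_def power_mult_distrib)
      finally show ?thesis by simp
    qed
    have rt: "sqrt (\<Sum>j<p. (a j)\<^sup>2) \<le> b * sqrt (real p)"
      using real_sqrt_le_mono[OF asq] b_pos by simp
    have shift: "\<bar>(\<Sum>j<p. hermite_hom l ((noise_scale j)\<^sup>2) (S j x - \<Delta> * a j)) - (\<Sum>j<p. hermite_hom l ((noise_scale j)\<^sup>2) (S j x))\<bar>
      \<le> sqrt (\<theta> * real p) * b ^ l * (1 + U * sqrt (real p / N)) ^ l"
    proof (rule hermite_hom_shift_le)
      show "sqrt (\<theta> * real p) \<ge> 0" "b \<ge> 0" "0 \<le> U * sqrt (real p / N)"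
        using \<theta> b_pos U N by auto
      fix m assume "m \<le> l"
      then have "m \<le> L" using l by simp
      then have "Wsum m x \<le> \<theta> * real p * b ^ (2 * m)" using xB x unfolding Bd_def B2_def by (auto simp: not_less)
      then show "(\<Sum>j<p. (hermite_hom m ((noise_scale j)\<^sup>2) (S j x))\<^sup>2) \<le> (sqrt (\<theta> * real p))\<^sup>2 * b ^ (2 * m)"
        using \<theta> by (simp add: Wsum_def hterm_def)
    next
      have "\<bar>\<Delta>\<bar> * sqrt (\<Sum>j<p. (a j)\<^sup>2) \<le> U / sqrt N * (b * sqrt (real p))"
        using \<Delta>le rt U N by (intro mult_mono) (auto simp: sum_nonneg)
      also have "\<dots> = U * sqrt (real p / N) * b" by (simp add: real_sqrt_divide)
      finally show "\<bar>\<Delta>\<bar> * sqrt (\<Sum>j<p. (a j)\<^sup>2) \<le> U * sqrt (real p / N) * b" .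
    qed
    have "(Fsum l x - E l)\<^sup>2 \<le> \<theta> * (real p * sqrt (real p)) * b ^ (2 * l)"
      using xB x l unfolding Bd_def B3_def by (auto simp: not_less)
    also have "\<dots> = (sqrt (\<theta> * (real p * sqrt (real p))) * b ^ l)\<^sup>2"
      using \<theta> by (simp add: power_mult_distrib power_mult[symmetric] mult.commute[of l 2])
    finally have "\<bar>Fsum l x - E l\<bar>\<^sup>2 \<le> (sqrt (\<theta> * (real p * sqrt (real p))) * b ^ l)\<^sup>2" by simp
    then have fluct: "\<bar>Fsum l x - E l\<bar> \<le> sqrt (\<theta> * (real p * sqrt (real p))) * b ^ l"
      by (rule power2_le_imp_le) (use \<theta> b_pos in simp)
    have "F_stat n p \<sigma> X l (y_hat n p X (response p X \<omega>)) = (\<Sum>j<p. hermite_hom l ((noise_scale j)\<^sup>2) (S j x - \<Delta> * a j))"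
      using l by (subst F_stat_y_hat_eq) (auto simp: x_def \<Delta>_def a_def)
    moreover have "Fsum l x = (\<Sum>j<p. hermite_hom l ((noise_scale j)\<^sup>2) (S j x))" by (simp add: Fsum_def hterm_def)
    ultimately show "\<bar>F_stat n p \<sigma> X l (y_hat n p X (response p X \<omega>)) - (\<integral>x. Fsum l x \<partial>?P)\<bar>
       \<le> sqrt (\<theta> * real p) * b ^ l * (1 + U * sqrt (real p / real (min n p))) ^ l + sqrt (\<theta> * (real p * sqrt (real p))) * b ^ l"
      using shift fluct unfolding E_def N_def by linarith
  qed
qed

lemma gram_row_square_le: "(\<Sum>s<p. (gram n X j s)\<^sup>2) \<le> b\<^sup>2" if "j < p"
proof -
  have "(\<Sum>s<p. (gram n X j s)\<^sup>2) = (\<Sum>s<p. (design (Inl s) j)\<^sup>2)" by (simp add: design_def gram_sym[of _ _ j])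
  also have "\<dots> \<le> (\<Sum>s\<in>coord_set. (design s j)\<^sup>2)" unfolding sum_coord by (simp add: sum_nonneg)
  also have "\<dots> \<le> b\<^sup>2" by (rule B_col[OF that])
  finally show ?thesis .
qed

lemma \<mu>_bound: "\<bar>\<mu> d\<bar> + 1 \<le> K ^ d * fact d" if "d \<ge> 1"
proof -
  have "(3 * m0) ^ d + 1 ^ d \<le> (3 * m0 + 1) ^ d"
    using that
  proof (induction d rule: dec_induct)
    case (step d)
    have "(3 * m0) ^ Suc d + 1 ^ Suc d \<le> (3 * m0 + 1) * ((3 * m0) ^ d + 1 ^ d)"
      using m0 by (simp add: algebra_simps add_nonneg_nonneg)
    also have "\<dots> \<le> (3 * m0 + 1) * (3 * m0 + 1) ^ d" using m0 step by (intro mult_left_mono) auto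
    finally show ?case by simp
  qed simp
  then have "(3 * m0) ^ d + 1 \<le> K ^ d" by (simp add: K_def add.commute)
  then have "((3 * m0) ^ d + 1) * fact d \<le> K ^ d * fact d" by (intro mult_right_mono) auto
  moreover have "\<bar>\<mu> d\<bar> \<le> (3 * m0) ^ d * fact d" using moment_g0_le[of d] by (simp add: \<mu>_def moment_def)
  moreover have "(1::real) \<le> fact d" by (rule fact_ge_1)
  moreover have "((3 * m0) ^ d + 1) * fact d = (3 * m0) ^ d * fact d + fact d" by (simp only: distrib_right mult_1)
  ultimately show ?thesis by linarith
qed


lemma real_distribution_model_parts: "g = distr g0 borel (\<lambda>x. x + mean g)"
  unfolding g0_def by (subst distr_distr) (auto simp: comp_def intro!: distr_id2[symmetric])

text \<open>Markov with a free exponent \<open>q\<close>; \<open>truncation_tail_le\<close> chooses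
  \<open>q\<close> of order k log k.\<close>

lemma tail_g0_le:
  assumes A: "A > 0" and q: "1 \<le> q" "l \<le> q"
  shows "(\<integral>x. \<bar>x\<bar> ^ l * indicator {x. A < \<bar>x\<bar>} x \<partial>g0) \<le> A ^ l * (m0 * sqrt (real q) / A) ^ q"
proof -
  have int: "integrable g0 (\<lambda>x. \<bar>x\<bar> ^ i)" for i
    using all_moments_g0 by (simp add: all_moments_def)
  have "(\<integral>x. \<bar>x\<bar> ^ l * indicator {x. A < \<bar>x\<bar>} x \<partial>g0) \<le> (\<integral>x. A ^ l / A ^ q * \<bar>x\<bar> ^ q \<partial>g0)"
  proof (rule integral_mono)
    show "integrable g0 (\<lambda>x. \<bar>x\<bar> ^ l * indicator {x. A < \<bar>x\<bar>} x)"
      by (rule integrable_real_mult_indicator[OF _ int]) (simp add: g0_def)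
    show "integrable g0 (\<lambda>x. A ^ l / A ^ q * \<bar>x\<bar> ^ q)" by (intro integrable_mult_right int)
    fix x :: real
    show "\<bar>x\<bar> ^ l * indicator {x. A < \<bar>x\<bar>} x \<le> A ^ l / A ^ q * \<bar>x\<bar> ^ q"
    proof (cases "A < \<bar>x\<bar>")
      case True
      obtain d where d: "q = l + d" using q(2) le_Suc_ex by blast
      have "A ^ d \<le> \<bar>x\<bar> ^ d" using True A by (intro power_mono) auto
      then have "\<bar>x\<bar> ^ l * A ^ d \<le> \<bar>x\<bar> ^ l * \<bar>x\<bar> ^ d" by (intro mult_left_mono) auto
      then show ?thesis using True A by (simp add: d power_add field_simps)
    qed (use A in simp)
  qed
  also have "\<dots> = A ^ l / A ^ q * (\<integral>x. \<bar>x\<bar> ^ q \<partial>g0)" by simp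
  also have "\<dots> \<le> A ^ l / A ^ q * (m0 * sqrt (real q)) ^ q"
    using A abs_moment_g0_le[OF q(1)] by (intro mult_left_mono) auto
  finally show ?thesis by (simp add: power_divide)
qed

text \<open>With r = p / N the factor min(n / p, 1) is 1 / r, and all lower bounds are weakened to
  the common form \<open>(c1 / r) ^ l * (opn ^ (2 * l) * real p)\<close>. For \<open>l = 2\<close>
  this uses that \<open>c1\<^sup>2 \<le> c0\<close> and 1 / r^2 is at most 1 / r.\<close>

lemma gram_sum_lower:
  assumes A2: "gram_sum n p X 2 \<ge> c0 * real (min n p) * opn ^ 4"
    and Aj: "\<And>j. 3 \<le> j \<Longrightarrow> j \<le> L \<Longrightarrow> gram_sum n p X j \<ge> c0 ^ j * opn ^ (2 * j) * real p * (min (real n / real p) 1) ^ j"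
    and l: "2 \<le> l" "l \<le> L"
  shows "real p * b ^ l \<le> (\<kappa> * (real p / real (min n p)) / min c0 1) ^ L * gram_sum n p X l" "gram_sum n p X l > 0"
proof -
  define r where "r = real p / real (min n p)"
  define c1 where "c1 = min c0 1"
  have N: "real (min n p) > 0" using n p by simp
  have p0: "real p > 0" using p by simp
  have r1: "r \<ge> 1" using N by (auto simp: r_def field_simps)
  have c1: "0 < c1" "c1 \<le> 1" "c1 \<le> c0" using c0 by (auto simp: c1_def)
  have minr: "min (real n / real p) 1 = 1 / r"
    using p0 N by (auto simp: r_def min_def field_simps)
  have low: "gram_sum n p X l \<ge> (c1 / r) ^ l * (opn ^ (2 * l) * real p)"
  proof (cases "l = 2")
    case True
    have Np: "real (min n p) = real p * (1 / r)" using N p0 by (simp add: r_def)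
    have "(c1 / r) ^ 2 = c1 * c1 * (1 / r * (1 / r))" by (simp add: power2_eq_square)
    also have "\<dots> \<le> c0 * 1 * (1 / r * 1)" using c1 c0 r1 by (intro mult_mono) auto
    finally have "(c1 / r) ^ 2 * (opn ^ 4 * real p) \<le> c0 * 1 * (1 / r * 1) * (opn ^ 4 * real p)"
      by (intro mult_right_mono) auto
    also have "\<dots> = c0 * real (min n p) * opn ^ 4" unfolding Np by simp
    finally show ?thesis using A2 True by simp
  next
    case False
    have "(c1 / r) ^ l * (opn ^ (2 * l) * real p) \<le> (c0 / r) ^ l * (opn ^ (2 * l) * real p)"
      using c1 r1 by (intro mult_right_mono power_mono divide_right_mono) auto
    also have "\<dots> = c0 ^ l * opn ^ (2 * l) * real p * (min (real n / real p) 1) ^ l"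
      by (simp add: minr power_divide)
    also have "\<dots> \<le> gram_sum n p X l" by (rule Aj) (use l False in auto)
    finally show ?thesis .
  qed
  have "0 < (c1 / r) ^ l * (opn ^ (2 * l) * real p)" using c1 r1 opn_pos p0 by simp
  then show pos: "gram_sum n p X l > 0" using low by linarith
  define \<rho> where "\<rho> = \<kappa> * r / c1"
  have "1 * 1 / 1 \<le> \<kappa> * r / c1" using \<kappa>_ge(1) r1 c1 by (intro frac_le mult_mono) auto
  then have \<rho>1: "\<rho> \<ge> 1" by (simp add: \<rho>_def)
  have "real p * b ^ l = \<rho> ^ l * ((c1 / r) ^ l * (opn ^ (2 * l) * real p))"
  proof -
    have "\<rho> ^ l * (c1 / r) ^ l = \<kappa> ^ l" using c1 r1 by (simp add: \<rho>_def power_mult_distrib[symmetric])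
    moreover have "b ^ l = \<kappa> ^ l * opn ^ (2 * l)" by (simp add: b_def power_mult_distrib power_mult)
    ultimately show ?thesis by (simp add: mult_ac)
  qed
  also have "\<dots> \<le> \<rho> ^ l * gram_sum n p X l" using low \<rho>1 by (intro mult_left_mono) auto
  also have "\<dots> \<le> \<rho> ^ L * gram_sum n p X l" using \<rho>1 pos l by (intro mult_right_mono power_increasing) auto
  finally show "real p * b ^ l \<le> (\<kappa> * (real p / real (min n p)) / min c0 1) ^ L * gram_sum n p X l"
    by (simp add: \<rho>_def r_def c1_def)
qed

text \<open>Every error term is a power of \<open>Y\<close> with exponent \<open>O(k\<^sup>2)\<close> divided by a power of
  \<open>\<nu> = N\<^bsup>1/8\<^esup>\<close>; the exponent 66 leaves room for all of them.\<close>

lemma moment_estimates: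
  fixes k :: nat and Q Y \<nu> r :: real
  assumes k: "k \<ge> 1" and r: "r = real p / real (min n p)" and Y: "Y = Q * real k * r"
    and Q: "Q \<ge> 96 * K" "Q \<ge> \<kappa> / min c0 1" "Q\<^sup>2 \<ge> 64 * K\<^sup>2 * \<kappa>\<^sup>2 / c0"
    and \<nu>: "\<nu> > 0" "\<nu> ^ 8 = real (min n p)" "Y ^ (66 * k\<^sup>2) \<le> \<nu>"
    and A2: "gram_sum n p X 2 \<ge> c0 * real (min n p) * opn ^ 4"
    and Aj: "\<And>j. 3 \<le> j \<Longrightarrow> j \<le> 2 * k - 1 \<Longrightarrow> gram_sum n p X j \<ge> c0 ^ j * opn ^ (2 * j) * real p * (min (real n / real p) 1) ^ j"
  obtains Bad where "Bad \<in> sets (model n p \<sigma> g)" "measure (model n p \<sigma> g) Bad \<le> 1 / real k"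
    "\<And>\<omega>. \<omega> \<in> space (model n p \<sigma> g) \<Longrightarrow> \<omega> \<notin> Bad \<Longrightarrow> \<bar>m1_hat n p X (response p X \<omega>) - mean g\<bar> \<le> 1 / real k"
    "\<And>\<omega> l. \<omega> \<in> space (model n p \<sigma> g) \<Longrightarrow> \<omega> \<notin> Bad \<Longrightarrow> l \<in> {1..2 * k - 1} \<Longrightarrow>
        \<bar>\<mu> l - mu_hat n p \<sigma> X (response p X \<omega>) l\<bar> \<le> 1 / Y ^ (40 * k\<^sup>2)"
proof -
  define L where "L = 2 * k - 1"
  define N where "N = real (min n p)"
  \<comment> \<open>The mean error in units of 1 / sqrt N. Growing with \<open>k\<close>, it brings
    the probability of its bad event down to 1 / (4 k); this is the third condition on
    \<open>Q\<close>.\<close>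
  define U where "U = Q * real k"
  define \<Omega> where "\<Omega> = (48 * real L * K) ^ L"
  \<comment> \<open>Markov gains \<open>1 / \<theta>\<close> in probability and costs
    \<open>sqrt \<theta> = \<nu>\<close> in size. With \<nu> = N^(1/8) the cost is half of the
    available gain N^(1/4), in the exponent.\<close>
  define \<theta> where "\<theta> = \<nu>\<^sup>2"
  have L: "L \<ge> 1" "real L + 1 = 2 * real k" "L + 1 = 2 * k" using k by (auto simp: L_def of_nat_diff)
  have N0: "N > 0" using n p by (simp add: N_def)
  have r1: "r \<ge> 1" using N0 p by (auto simp: r N_def field_simps)
  have k1: "real k \<ge> 1" using k by simp
  have Q96: "Q \<ge> 96" using Q(1) K_ge by linarith
  have U0: "U > 0" using Q96 k1 by (simp add: U_def)
  have UY: "U \<le> Y" using mult_left_mono[OF r1, of U] U0 by (simp add: Y U_def)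
  have kr: "1 * 1 \<le> real k * r" using k1 r1 by (intro mult_mono) auto
  have QY: "Q \<le> Y" using mult_left_mono[OF kr, of Q] Q96 by (simp add: Y mult.assoc)
  have Y2: "Y \<ge> 96" using QY Q96 by linarith
  have kY: "96 * real k \<le> Y"
  proof -
    have "96 * real k \<le> U" unfolding U_def using Q96 by (intro mult_right_mono) auto
    then show ?thesis using UY by linarith
  qed
  have LY: "real L + 1 \<le> Y" using L(2) kY k1 by linarith
  have KY: "48 * real L * K \<le> Y"
  proof -
    have "48 * real L * K \<le> 48 * (2 * real k) * K" using L K_ge by (intro mult_mono) auto
    also have "\<dots> = 96 * K * real k" by simp
    also have "\<dots> \<le> U" unfolding U_def using Q(1) by (intro mult_right_mono) auto
    finally show ?thesis using UY by linarith
  qed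
  have KY': "K \<le> Y"
  proof -
    have "K \<le> 96 * K" using K_ge by simp
    then show ?thesis using Q(1) QY by linarith
  qed
  define \<rho> where "\<rho> = \<kappa> * r / min c0 1"
  have c1: "0 < min c0 1" using c0 by simp
  have \<rho>0: "\<rho> \<ge> 0" using \<kappa>_ge(1) r1 c1 by (simp add: \<rho>_def)
  have \<rho>Y: "\<rho> \<le> Y"
  proof -
    have "\<rho> = \<kappa> / min c0 1 * r" by (simp add: \<rho>_def)
    also have "\<dots> \<le> Q * r" using Q(2) r1 by (intro mult_right_mono) auto
    also have "\<dots> \<le> Q * r * real k" using k1 r1 Q96 by (intro mult_right_mono_neg[of 1 _ 1, simplified] mult_left_mono[of 1 "real k" "Q * r", simplified]) auto
    finally show ?thesis by (simp add: Y mult_ac)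
  qed
  have \<Omega>Y: "\<Omega> \<le> Y ^ L" unfolding \<Omega>_def using KY K_ge by (intro power_mono) auto
  have \<Omega>0: "\<Omega> \<ge> 0" unfolding \<Omega>_def using K_ge by simp
  have \<theta>: "\<theta> > 0" using \<nu> by (simp add: \<theta>_def)
  have Ypow: "Y ^ a \<le> Y ^ b'" if "a \<le> b'" for a b' :: nat using that Y2 by (intro power_increasing) auto
  have kk: "k \<le> k\<^sup>2" using k by (simp add: power2_eq_square)
  have k2: "1 \<le> k\<^sup>2" using k by simp
  have Y1: "Y \<ge> 1" using Y2 by linarith
  have \<nu>1: "\<nu> \<ge> 1" using \<nu>(3) one_le_power[OF Y1, of "66 * k\<^sup>2"] by linarith
  obtain Bad where Bad: "Bad \<in> sets (model n p \<sigma> g)"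
    "measure (model n p \<sigma> g) Bad \<le> 16 * K\<^sup>2 * \<kappa>\<^sup>2 / (c0 * U\<^sup>2) + (real L + 1) * (\<Omega>\<^sup>2 / \<theta>) + real L * (2 * real L * 4 ^ L * \<Omega> ^ 6 / \<theta>)"
    "\<And>\<omega>. \<omega> \<in> space (model n p \<sigma> g) \<Longrightarrow> \<omega> \<notin> Bad \<Longrightarrow>
       \<bar>m1_hat n p X (response p X \<omega>) - mean g\<bar> \<le> U / sqrt (real (min n p))"
    "\<And>\<omega> l. \<omega> \<in> space (model n p \<sigma> g) \<Longrightarrow> \<omega> \<notin> Bad \<Longrightarrow> l \<in> {2..L} \<Longrightarrow>
       \<bar>F_stat n p \<sigma> X l (y_hat n p X (response p X \<omega>)) - (\<integral>x. Fsum l x \<partial>PiM coord_set coord_law)\<bar>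
       \<le> sqrt (\<theta> * real p) * b ^ l * (1 + U * sqrt (real p / real (min n p))) ^ l + sqrt (\<theta> * (real p * sqrt (real p))) * b ^ l"
    using good_event[OF L(1) U0 \<theta> \<Omega>_def] by blast
  show thesis
  proof (rule that[OF Bad(1)])
    have "16 * K\<^sup>2 * \<kappa>\<^sup>2 / (c0 * U\<^sup>2) \<le> 1 / (4 * real k)"
    proof -
      have "64 * K\<^sup>2 * \<kappa>\<^sup>2 / c0 * (real k)\<^sup>2 \<le> Q\<^sup>2 * (real k)\<^sup>2" using Q(3) by (intro mult_right_mono) auto
      then have "64 * K\<^sup>2 * \<kappa>\<^sup>2 * (real k)\<^sup>2 \<le> c0 * U\<^sup>2" using c0 by (simp add: U_def power_mult_distrib field_simps)
      moreover have "real k \<le> (real k)\<^sup>2" using k1 by (simp add: power2_eq_square)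
      then have "64 * K\<^sup>2 * \<kappa>\<^sup>2 * real k \<le> 64 * K\<^sup>2 * \<kappa>\<^sup>2 * (real k)\<^sup>2" by (intro mult_left_mono) auto
      ultimately have "64 * K\<^sup>2 * \<kappa>\<^sup>2 * real k \<le> c0 * U\<^sup>2" by linarith
      then show ?thesis using c0 U0 k1 by (simp add: divide_le_eq field_simps)
    qed
    \<comment> \<open>\<open>4 ^ L\<close> and \<open>\<Omega> ^ 6\<close> account for
      \<open>8 * L\<close> powers of \<open>Y\<close>; with the prefactors these are at most
      \<open>16 * k\<^sup>2\<close>, against 66 in the denominator.\<close>
    moreover have "(real L + 1) * (\<Omega>\<^sup>2 / \<theta>) + real L * (2 * real L * 4 ^ L * \<Omega> ^ 6 / \<theta>) \<le> 1 / (4 * real k)"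
    proof -
      have "(real L + 1) * \<Omega>\<^sup>2 \<le> Y * (Y ^ L)\<^sup>2"
        using LY \<Omega>Y \<Omega>0 Y1 by (intro mult_mono power_mono) auto
      also have "\<dots> = Y ^ (1 + 2 * L)" by (simp add: power_mult[symmetric] mult.commute)
      also have "\<dots> \<le> Y ^ (3 + 8 * L)" by (rule Ypow) simp
      finally have 1: "(real L + 1) * \<Omega>\<^sup>2 \<le> Y ^ (3 + 8 * L)" .
      have "real L * (2 * real L * 4 ^ L * \<Omega> ^ 6) \<le> Y * (Y * Y * (Y ^ 2) ^ L * (Y ^ L) ^ 6)"
        using LY \<Omega>Y \<Omega>0 Y2 Y1 mult_mono[of 4 Y 1 Y] by (intro mult_mono power_mono) (auto simp: power2_eq_square)
      also have "\<dots> = Y ^ (3 + 8 * L)"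
      proof -
        have "3 + 8 * L = Suc (Suc (Suc (2 * L + 6 * L)))" by simp
        then have "Y ^ (3 + 8 * L) = Y * (Y * (Y * (Y ^ (2 * L) * Y ^ (6 * L))))" by (simp only: power_Suc power_add)
        moreover have "(Y\<^sup>2) ^ L = Y ^ (2 * L)" "(Y ^ L) ^ 6 = Y ^ (6 * L)"
          by (simp_all only: power_mult[symmetric] mult.commute[of L 6])
        ultimately show ?thesis by (simp only: mult.assoc)
      qed
      finally have 2: "real L * (2 * real L * 4 ^ L * \<Omega> ^ 6) \<le> Y ^ (3 + 8 * L)" .
      have "(real L + 1) * (\<Omega>\<^sup>2 / \<theta>) + real L * (2 * real L * 4 ^ L * \<Omega> ^ 6 / \<theta>)
        = ((real L + 1) * \<Omega>\<^sup>2 + real L * (2 * real L * 4 ^ L * \<Omega> ^ 6)) / \<theta>"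
        by (simp add: add_divide_distrib)
      also have "\<dots> \<le> (Y ^ (3 + 8 * L) + Y ^ (3 + 8 * L)) / \<theta>"
        using 1 2 \<theta> by (intro divide_right_mono add_mono) auto
      also have "\<dots> \<le> Y * Y ^ (3 + 8 * L) / \<theta>"
        using Y2 \<theta> mult_right_mono[of 2 Y "Y ^ (3 + 8 * L)"] by (intro divide_right_mono) auto
      also have "\<dots> = Y ^ Suc (3 + 8 * L) / \<theta>" by (simp only: power_Suc)
      also have "\<dots> \<le> Y ^ (16 * k\<^sup>2) / \<theta>"
        using kk L(3) \<theta> by (intro divide_right_mono Ypow) auto
      also have "\<dots> \<le> Y ^ (16 * k\<^sup>2) / (Y ^ (66 * k\<^sup>2))"
      proof -
        have "\<nu> * 1 \<le> \<nu> * \<nu>" using \<nu>1 by (intro mult_left_mono) auto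
        then have "Y ^ (66 * k\<^sup>2) \<le> \<theta>" using \<nu>(3) by (simp add: \<theta>_def power2_eq_square)
        then show ?thesis using Y2 \<theta> by (intro divide_left_mono) auto
      qed
      also have "\<dots> = 1 / Y ^ (50 * k\<^sup>2)"
        using Y2 power_add[of Y "16 * k\<^sup>2" "50 * k\<^sup>2"] by simp
      also have "\<dots> \<le> 1 / Y ^ 1" using k2 Y2 by (intro divide_left_mono Ypow) auto
      also have "\<dots> \<le> 1 / (4 * real k)" using kY k1 by (intro divide_left_mono) auto
      finally show ?thesis .
    qed
    ultimately have "measure (model n p \<sigma> g) Bad \<le> 1 / (4 * real k) + 1 / (4 * real k)" using Bad(2) by linarith
    also have "\<dots> \<le> 1 / real k" using k1 by (simp add: field_simps)
    finally show "measure (model n p \<sigma> g) Bad \<le> 1 / real k" .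
  next
    fix \<omega> assume \<omega>: "\<omega> \<in> space (model n p \<sigma> g)" "\<omega> \<notin> Bad"
    have sN: "sqrt N = \<nu> ^ 4"
    proof (rule real_sqrt_unique)
      show "(\<nu> ^ 4)\<^sup>2 = N" using \<nu>(2) by (simp add: N_def power_mult[symmetric])
    qed (use \<nu>(1) in simp)
    have "U / sqrt N \<le> Y / \<nu>"
    proof -
      have "\<nu> ^ 1 \<le> \<nu> ^ 4" using \<nu>1 by (intro power_increasing) auto
      then show ?thesis unfolding sN using UY U0 \<nu> by (intro frac_le) auto
    qed
    also have "\<dots> \<le> Y / Y ^ 2"
    proof -
      have "Y ^ 2 \<le> Y ^ (66 * k\<^sup>2)" using k2 by (intro Ypow) auto
      then have "Y ^ 2 \<le> \<nu>" using \<nu>(3) by (rule order_trans)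
      then show ?thesis using \<nu> Y2 by (intro divide_left_mono) auto
    qed
    also have "\<dots> = 1 / Y" using Y2 by (simp add: power2_eq_square)
    also have "\<dots> \<le> 1 / real k" using kY k1 by (intro divide_left_mono) auto
    finally show "\<bar>m1_hat n p X (response p X \<omega>) - mean g\<bar> \<le> 1 / real k"
      using Bad(3)[OF \<omega>] by (simp add: N_def)
    fix l assume l: "l \<in> {1..2 * k - 1}"
    \<comment> \<open>The relative error of the statistic. Of the \<open>1 + 3 * L\<close> powers of
      \<open>Y\<close> one absorbs a factor 2, \<open>2 * L\<close> come from the mean shift and
      \<open>L\<close> from \<open>\<rho> ^ L\<close>; \<open>1 + 3 * L \<le> 6 * k\<close>.\<close>
    define s where "s = Y ^ (6 * k) / \<nu>"
    define \<Gamma> where "\<Gamma> = fact L * \<rho> ^ L"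
    define G where "G = real L * (real L + 1) ^ L * real L * (K ^ L * fact L) * \<Gamma>"
    have s0: "s \<ge> 0" using Y2 \<nu> by (simp add: s_def)
    have \<Gamma>0: "\<Gamma> \<ge> 0" using \<rho>0 by (simp add: \<Gamma>_def)
    have factY: "(fact L :: real) \<le> Y ^ L"
    proof -
      have "(fact L :: real) \<le> real L ^ L" using fact_le_power[of L, where 'a=real] by simp
      also have "\<dots> \<le> Y ^ L" using LY by (intro power_mono) auto
      finally show ?thesis .
    qed
    \<comment> \<open>Two factors \<open>L\<close> and the five \<open>L\<close>-th powers behind
      the number of compositions, \<open>K ^ L\<close>, two factorials and
      \<open>\<rho> ^ L\<close>; one more power of \<open>Y\<close> makes room for the summand
      1.\<close>
    have GY: "1 + G \<le> Y ^ (10 * k)"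
    proof -
      have "G \<le> Y * Y ^ L * Y * (Y ^ L * Y ^ L) * (Y ^ L * Y ^ L)"
        unfolding G_def \<Gamma>_def using LY KY' factY \<rho>Y \<rho>0 K_ge Y1
        by (intro mult_mono power_mono) (auto intro!: mult_nonneg_nonneg)
      also have "\<dots> = Y ^ (1 + L + 1 + (L + L) + (L + L))" by (simp only: power_add power_one_right)
      also have "1 + L + 1 + (L + L) + (L + L) = 2 + 5 * L" by simp
      finally have "G \<le> Y ^ (2 + 5 * L)" .
      moreover have "1 \<le> Y ^ (2 + 5 * L)" using Y1 by (rule one_le_power)
      moreover have "2 * Y ^ (2 + 5 * L) \<le> Y * Y ^ (2 + 5 * L)" using Y2 by (intro mult_right_mono) auto
      moreover have "Y * Y ^ (2 + 5 * L) = Y ^ Suc (2 + 5 * L)" by (simp only: power_Suc)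
      moreover have "Y ^ Suc (2 + 5 * L) \<le> Y ^ (10 * k)" using L(3) by (intro Ypow) auto
      ultimately show ?thesis by linarith
    qed
    have G0: "G \<ge> 0" unfolding G_def using \<Gamma>0 K_ge by simp
    \<comment> \<open>\<open>6 * k\<close> powers of \<open>Y\<close> from \<open>s\<close> and at
      most \<open>20 * k\<^sup>2\<close> from the recursion make 26; the 66 in the hypothesis on
      \<nu> leaves 40.\<close>
    have err: "s * (1 + G) ^ m \<le> 1 / Y ^ (40 * k\<^sup>2)" if "m \<le> L" for m
    proof -
      have "(1 + G) ^ m \<le> (1 + G) ^ L" using that G0 by (intro power_increasing) auto
      also have "\<dots> \<le> (Y ^ (10 * k)) ^ L" using GY G0 by (intro power_mono) auto
      also have "\<dots> = Y ^ (10 * k * L)" by (simp add: power_mult)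
      also have "\<dots> \<le> Y ^ (20 * k\<^sup>2)"
      proof (rule Ypow)
        have "10 * k * L \<le> 10 * k * (2 * k)" using L(3) by (intro mult_left_mono) auto
        then show "10 * k * L \<le> 20 * k\<^sup>2" by (simp add: power2_eq_square)
      qed
      finally have "s * (1 + G) ^ m \<le> Y ^ (6 * k) / \<nu> * Y ^ (20 * k\<^sup>2)"
        unfolding s_def[symmetric] using s0 by (intro mult_left_mono)
      also have "\<dots> = Y ^ (6 * k + 20 * k\<^sup>2) / \<nu>" by (simp add: power_add)
      also have "\<dots> \<le> Y ^ (26 * k\<^sup>2) / \<nu>" using kk \<nu> by (intro divide_right_mono Ypow) auto
      also have "\<dots> \<le> Y ^ (26 * k\<^sup>2) / Y ^ (66 * k\<^sup>2)" using \<nu> Y2 by (intro divide_left_mono) auto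
      also have "\<dots> = 1 / Y ^ (40 * k\<^sup>2)" using Y2 power_add[of Y "26 * k\<^sup>2" "40 * k\<^sup>2"] by simp
      finally show ?thesis .
    qed
    have small: "s * (1 + G) ^ L \<le> 1"
    proof -
      have "1 / Y ^ (40 * k\<^sup>2) \<le> 1" using one_le_power[OF Y1, of "40 * k\<^sup>2"] by simp
      then show ?thesis using err[of L] by simp
    qed
    have Aj': "\<And>j. 3 \<le> j \<Longrightarrow> j \<le> L \<Longrightarrow> gram_sum n p X j \<ge> c0 ^ j * opn ^ (2 * j) * real p * (min (real n / real p) 1) ^ j"
      using Aj by (simp add: L_def)
    have Ferr: "\<bar>F_stat n p \<sigma> X m (y_hat n p X (response p X \<omega>)) - (\<integral>x. Fsum m x \<partial>PiM coord_set coord_law)\<bar>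
        \<le> s * gram_sum n p X m" if m: "2 \<le> m" "m \<le> L" for m
    proof -
      \<comment> \<open>z = p^(1/4). The fluctuation has size \<open>\<nu> * z ^ 3 * b ^ m\<close>,
        that is, \<open>\<nu> / z\<close> times \<open>real p * b ^ m\<close>. As \<open>z\<close>
        is at least N^(1/4) = \<nu>^2, the quotient is at most \<open>1 / \<nu>\<close>.\<close>
      define z where "z = sqrt (sqrt (real p))"
      have z2: "z * z = sqrt (real p)" "z > 0" using p by (auto simp: z_def)
      have z4: "real p = z * z * (z * z)" unfolding z2(1) by simp
      have \<nu>z: "\<nu>\<^sup>2 \<le> z"
      proof -
        have "sqrt (sqrt N) = \<nu>\<^sup>2" unfolding sN
          by (rule real_sqrt_unique) (simp_all add: power_mult[symmetric])
        then have "\<nu>\<^sup>2 = sqrt (sqrt N)" by simp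
        also have "\<dots> \<le> z" unfolding z_def by (intro real_sqrt_le_mono) (simp add: N_def)
        finally show ?thesis .
      qed
      have sq1: "sqrt (\<theta> * real p) = \<nu> * (z * z)"
        using \<nu>(1) by (simp add: \<theta>_def real_sqrt_mult z2(1))
      have sq2: "sqrt (\<theta> * (real p * sqrt (real p))) = \<nu> * (z * z) * z"
        using \<nu>(1) by (simp add: \<theta>_def real_sqrt_mult z2(1)) (simp add: z_def)
      have z1: "z \<ge> 1" using \<nu>z one_le_power[OF \<nu>1, of 2] by linarith
      have uY: "1 + U * sqrt r \<le> Y ^ 2"
      proof -
        have "sqrt r \<le> sqrt (r\<^sup>2)" using r1 by (intro real_sqrt_le_mono) (simp add: power2_eq_square)
        then have "U * sqrt r \<le> U * r" using U0 r1 by (intro mult_left_mono) auto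
        also have "\<dots> = Y" by (simp add: U_def Y)
        finally have "1 + U * sqrt r \<le> 2 * Y" using Y2 by linarith
        also have "\<dots> \<le> Y * Y" using Y2 by (intro mult_right_mono) auto
        finally show ?thesis by (simp add: power2_eq_square)
      qed
      have u0: "0 \<le> U * sqrt r" using U0 r1 by simp
      have "\<bar>F_stat n p \<sigma> X m (y_hat n p X (response p X \<omega>)) - (\<integral>x. Fsum m x \<partial>PiM coord_set coord_law)\<bar>
        \<le> \<nu> * (z * z) * b ^ m * (1 + U * sqrt r) ^ m + \<nu> * (z * z) * z * b ^ m"
        using Bad(4)[OF \<omega>, of m] m unfolding sq1 sq2 r by auto
      also have "\<dots> \<le> \<nu> * (z * z) * b ^ m * Y ^ (2 * L) * z + \<nu> * (z * z) * z * b ^ m * Y ^ (2 * L)"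
      proof (rule add_mono)
        have "(1 + U * sqrt r) ^ m \<le> (Y ^ 2) ^ m" using uY u0 by (intro power_mono) auto
        also have "\<dots> = Y ^ (2 * m)" by (simp add: power_mult)
        also have "\<dots> \<le> Y ^ (2 * L)" using m by (intro Ypow) auto
        finally have "(1 + U * sqrt r) ^ m * 1 \<le> Y ^ (2 * L) * z" using z1 Y1 by (intro mult_mono) auto
        then have "\<nu> * (z * z) * b ^ m * ((1 + U * sqrt r) ^ m * 1) \<le> \<nu> * (z * z) * b ^ m * (Y ^ (2 * L) * z)"
          using \<nu>(1) z2 b_pos by (intro mult_left_mono) auto
        then show "\<nu> * (z * z) * b ^ m * (1 + U * sqrt r) ^ m \<le> \<nu> * (z * z) * b ^ m * Y ^ (2 * L) * z"
          by (simp add: mult.assoc)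
        have "\<nu> * (z * z) * z * b ^ m * 1 \<le> \<nu> * (z * z) * z * b ^ m * Y ^ (2 * L)"
          using \<nu>(1) z2 b_pos Y1 by (intro mult_left_mono one_le_power) auto
        then show "\<nu> * (z * z) * z * b ^ m \<le> \<nu> * (z * z) * z * b ^ m * Y ^ (2 * L)" by simp
      qed
      also have "\<dots> = 2 * Y ^ (2 * L) * (\<nu> / z) * (real p * b ^ m)"
        using z2(2) by (simp add: z4 field_simps)
      also have "\<dots> \<le> Y * Y ^ (2 * L) * (1 / \<nu>) * (\<rho> ^ L * gram_sum n p X m)"
      proof (rule mult_mono)
        have "\<nu> * \<nu> \<le> z" using \<nu>z by (simp add: power2_eq_square)
        then have "\<nu> / z \<le> 1 / \<nu>" using \<nu>(1) z2(2) by (simp add: field_simps)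
        then show "2 * Y ^ (2 * L) * (\<nu> / z) \<le> Y * Y ^ (2 * L) * (1 / \<nu>)"
          using Y2 \<nu>(1) z2(2) by (intro mult_mono[OF mult_right_mono]) auto
        show "real p * b ^ m \<le> \<rho> ^ L * gram_sum n p X m"
          using gram_sum_lower(1)[OF A2 Aj' m] by (simp add: \<rho>_def r)
      qed (use Y2 \<nu> z2 b_pos in auto)
      also have "\<dots> \<le> Y * Y ^ (2 * L) * (1 / \<nu>) * (Y ^ L * gram_sum n p X m)"
        using \<rho>Y \<rho>0 Y1 \<nu> gram_sum_lower(2)[OF A2 Aj' m]
        by (intro mult_left_mono mult_right_mono power_mono) auto
      also have "\<dots> = Y ^ (1 + 3 * L) / \<nu> * gram_sum n p X m"
        by (simp add: power_add[symmetric] mult_ac)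
      also have "\<dots> \<le> s * gram_sum n p X m"
        unfolding s_def using L(3) \<nu> gram_sum_lower(2)[OF A2 Aj' m]
        by (intro mult_right_mono divide_right_mono Ypow) auto
      finally show ?thesis .
    qed
    have gam: "\<bar>gamma_coeff n p X ds\<bar> \<le> \<Gamma> * gram_sum n p X m"
      if m: "2 \<le> m" "m \<le> L" and ds: "ds \<in> compositions2 m t" for m t ds
    proof -
      have "\<bar>gamma_coeff n p X ds\<bar> \<le> fact m * (real p * b ^ m)"
        by (rule abs_gamma_coeff_le[OF gram_row_square_le _ ds]) (use b_pos in auto)
      also have "\<dots> \<le> fact L * (\<rho> ^ L * gram_sum n p X m)"
      proof (rule mult_mono)
        show "real p * b ^ m \<le> \<rho> ^ L * gram_sum n p X m"
          using gram_sum_lower(1)[OF A2 Aj' m] by (simp add: \<rho>_def r)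
      qed (use m b_pos in \<open>auto intro!: fact_mono\<close>)
      finally show ?thesis by (simp add: \<Gamma>_def)
    qed
    show "\<bar>\<mu> l - mu_hat n p \<sigma> X (response p X \<omega>) l\<bar> \<le> 1 / Y ^ (40 * k\<^sup>2)"
    \<comment> \<open>The centered moment vector has first entry 0, which is exact because
      \<open>g0\<close> is centered.\<close>
    proof (cases "l = 1")
      case True
      have "mu_hat n p \<sigma> X (response p X \<omega>) 1 = 0" by (subst mu_hat.simps) simp
      then show ?thesis using True Y1 mean_g0 by (simp add: \<mu>_def moment_def)
    next
      case False
      then have l2: "2 \<le> l" "l \<le> L" using l by (auto simp: L_def)
      have "\<bar>mu_hat n p \<sigma> X (response p X \<omega>) l - \<mu> l\<bar> \<le> s * (1 + G) ^ l"
      proof (rule mu_hat_error_le[where E="\<lambda>m. \<integral>x. Fsum m x \<partial>PiM coord_set coord_law" and L=L, OF K_ge s0 \<Gamma>0 _ _ _ Ferr gam G_def small l2])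
        show "\<bar>\<mu> d\<bar> + 1 \<le> K ^ d * fact d" if "2 \<le> d" for d using that by (intro \<mu>_bound) simp
        show "gram_sum n p X m > 0" if "2 \<le> m" "m \<le> L" for m by (rule gram_sum_lower(2)[OF A2 Aj' that])
        show "(\<integral>x. Fsum m x \<partial>PiM coord_set coord_law) = \<mu> m * gram_sum n p X m +
          (\<Sum>t\<in>{2..m}. \<Sum>ds\<in>compositions2 m t. (\<Prod>d\<leftarrow>ds. \<mu> d) * gamma_coeff n p X ds)" if "2 \<le> m" for m
          by (rule expectation_Fsum[OF that])
      qed
      then show ?thesis using err[OF l2(2)] by (simp add: abs_minus_commute)
    qed
  qed
qed

end

section \<open>Choice of the degree\<close>

lemma ln_ge_two_thirds: "k \<ge> (2::nat) \<Longrightarrow> 2 / 3 \<le> ln (real k)"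
proof -
  assume k: "k \<ge> 2"
  have "2 / 3 \<le> ln (2::real)" by (rule ln2_ge_two_thirds)
  also have "\<dots> \<le> ln (real k)" using k by simp
  finally show ?thesis .
qed

text \<open>Lets every error of order 1 / k be absorbed into the final rate.\<close>

lemma sqrt_ln_ratio_ge:
  assumes "k \<ge> (2::nat)"
  shows "1 / real k \<le> 2 * sqrt (ln (real k) / real k)"
proof (rule power2_le_imp_le)
  have ln: "2 / 3 \<le> ln (real k)" by (rule ln_ge_two_thirds[OF assms])
  have "1 * 1 \<le> (4 * ln (real k)) * real k" using ln assms by (intro mult_mono) auto
  then show "(1 / real k)\<^sup>2 \<le> (2 * sqrt (ln (real k) / real k))\<^sup>2"
    using ln assms by (simp add: power_mult_distrib power2_eq_square field_simps)
qed (use assms in simp)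

text \<open>\<open>q\<close> is the largest integer for which the ratio
  \<open>m0 * sqrt (real q) / A\<close> stays below 1/3, so that the tail is at most 3^(-q). As
  \<open>q\<close> is about t k log k with \<open>t = CA / (9 * m0\<^sup>2)\<close>, a large
  \<open>CA\<close> beats the factors \<open>A ^ (2 * k + 1)\<close>,
  \<open>(real k)\<^sup>2\<close> and \<open>9 ^ k\<close>, whose logarithms are multiples of k log
  k.\<close>

lemma truncation_tail_le:
  fixes k :: nat and A CA m0 :: real
  assumes k: "k \<ge> 2" and m0: "m0 > 0" and CA: "CA \<ge> 1" "CA / (9 * m0\<^sup>2) \<ge> 9 / 2 * ln CA + 19 / 2"
    and A: "A = sqrt (CA * real k * ln (real k))"
  defines "q \<equiv> nat \<lfloor>A\<^sup>2 / (9 * m0\<^sup>2)\<rfloor>"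
  shows "1 \<le> A" "A \<le> CA * real k" "2 * k \<le> q"
    "A ^ (2 * k + 1) * (real k)\<^sup>2 * 9 ^ k * (m0 * sqrt (real q) / A) ^ q \<le> 3 / real k"
proof -
  define x where "x = ln (real k)"
  have x: "2 / 3 \<le> x" unfolding x_def by (rule ln_ge_two_thirds[OF k])
  have xk: "x \<le> real k" using ln_le_minus_one[of "real k"] k by (simp add: x_def)
  have k2: "real k \<ge> 2" using k by simp
  have A2: "A\<^sup>2 = CA * real k * x" using CA x k2 by (simp add: A x_def)
  have A0: "A \<ge> 0" using CA x k2 by (simp add: A x_def[symmetric])
  have "1 * 1 \<le> CA * (real k * x)"
  proof (rule mult_mono)
    have "2 * (2 / 3) \<le> real k * x" using k2 x by (intro mult_mono) auto
    then show "1 \<le> real k * x" by simp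
  qed (use CA in auto)
  then have "1\<^sup>2 \<le> A\<^sup>2" unfolding A2 by (simp add: mult.assoc)
  then show A1: "1 \<le> A" using A0 by (rule power2_le_imp_le)
  show AC: "A \<le> CA * real k"
  proof (rule power2_le_imp_le)
    have "CA * (real k * x) \<le> CA * CA * (real k * real k)"
      using CA xk k2 x by (intro mult_mono) (auto simp: mult_le_cancel_left1)
    then show "A\<^sup>2 \<le> (CA * real k)\<^sup>2" unfolding A2 by (simp add: power2_eq_square mult_ac)
  qed (use CA in simp)
  define t where "t = CA / (9 * m0\<^sup>2)"
  have lnCA: "ln CA \<ge> 0" using CA by simp
  have t: "t \<ge> 9 / 2 * ln CA + 19 / 2" using CA by (simp add: t_def)
  have At: "A\<^sup>2 / (9 * m0\<^sup>2) = t * real k * x" unfolding A2 t_def by simp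
  have tk: "t * real k * x \<ge> 3 * real k"
  proof -
    have "(9 / 2) * (real k * (2 / 3)) \<le> t * (real k * x)"
      using t lnCA x k2 by (intro mult_mono) auto
    then show ?thesis by (simp add: mult.assoc)
  qed
  have tk0: "t * real k * x \<ge> 0" using tk k2 by linarith
  have q_le: "real q \<le> t * real k * x"
    unfolding q_def At using tk0 by (rule of_nat_floor)
  have q_ge: "real q \<ge> t * real k * x - 1"
    unfolding q_def At using tk k2 by linarith
  show q2k: "2 * k \<le> q"
  proof -
    have "real (2 * k) \<le> t * real k * x - 1" using tk k2 by linarith
    then have "real (2 * k) \<le> real q" using q_ge by linarith
    then show ?thesis by simp
  qed
  have ratio: "m0 * sqrt (real q) / A \<le> 1 / 3"
  proof -
    have "m0\<^sup>2 * real q \<le> m0\<^sup>2 * (A\<^sup>2 / (9 * m0\<^sup>2))" using q_le unfolding At by (intro mult_left_mono) auto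
    also have "\<dots> = (A / 3)\<^sup>2" using m0 by (simp add: power_divide)
    finally have "(m0 * sqrt (real q))\<^sup>2 \<le> (A / 3)\<^sup>2" by (simp add: power_mult_distrib)
    then have "m0 * sqrt (real q) \<le> A / 3" by (rule power2_le_imp_le) (use A1 in simp)
    then show ?thesis using A1 by (simp add: field_simps)
  qed
  have tail: "(m0 * sqrt (real q) / A) ^ q \<le> exp (1 - t * real k * x)"
  proof -
    have "(m0 * sqrt (real q) / A) ^ q \<le> (1 / 3) ^ q" using ratio m0 A1 by (intro power_mono) auto
    also have "\<dots> \<le> (exp (- 1)) ^ q"
    proof (rule power_mono)
      have "exp 1 \<le> (3::real)" by (rule exp_le)
      then show "1 / 3 \<le> exp (- 1 :: real)" by (simp add: exp_minus field_simps)
    qed simp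
    also have "\<dots> = exp (- real q)" by (simp add: exp_of_nat_mult[symmetric])
    also have "\<dots> \<le> exp (1 - t * real k * x)" using q_ge by simp
    finally show ?thesis .
  qed
  have "A ^ (2 * k + 1) \<le> (CA * real k) ^ (2 * k + 1)" using AC A1 by (intro power_mono) auto
  also have "\<dots> = exp (real (2 * k + 1) * (ln CA + x))"
  proof -
    have "CA * real k = exp (ln CA + x)" using CA k2 by (simp add: x_def exp_add)
    then show ?thesis by (simp only: exp_of_nat_mult)
  qed
  finally have 1: "A ^ (2 * k + 1) \<le> exp (real (2 * k + 1) * (ln CA + x))" .
  have 2: "(real k)\<^sup>2 = exp (2 * x)" using k2 exp_of_nat_mult[of 2 x] by (simp add: x_def)
  have 3: "(9::real) ^ k \<le> exp (real k * 3)"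
  proof -
    have "(9::real) \<le> exp 3"
    proof -
      have "(5/2 :: real) ^ 3 \<le> exp 1 ^ 3" using e_approx_32 by (intro power_mono) (auto simp: abs_if split: if_splits)
      also have "\<dots> = exp (3::real)" using exp_of_nat_mult[of 3 "1::real"] by simp
      finally show ?thesis by (simp add: eval_nat_numeral)
    qed
    then have "(9::real) ^ k \<le> exp 3 ^ k" by (intro power_mono) auto
    then show ?thesis by (simp add: exp_of_nat_mult)
  qed
  have "A ^ (2 * k + 1) * (real k)\<^sup>2 * 9 ^ k * (m0 * sqrt (real q) / A) ^ q
     \<le> exp (real (2 * k + 1) * (ln CA + x)) * exp (2 * x) * exp (real k * 3) * exp (1 - t * real k * x)"
    using 1 3 tail A1 m0 unfolding 2 by (intro mult_mono) auto
  also have "\<dots> = exp (real (2 * k + 1) * (ln CA + x) + 2 * x + real k * 3 + (1 - t * real k * x))"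
    by (simp add: exp_add)
  also have "\<dots> \<le> exp (1 - x)"
  proof -
    have kx: "real k * x \<ge> 2 * x" using k2 x by (intro mult_right_mono) auto
    have kx': "x \<le> real k * x" using k2 x by simp
    have "real (2 * k + 1) * (ln CA + x) \<le> 3 * real k * (ln CA + x)"
      using lnCA x k2 by (intro mult_right_mono) auto
    then have a': "real (2 * k + 1) * (ln CA + x) \<le> 3 * (real k * ln CA) + 3 * (real k * x)"
      by (simp only: distrib_left mult.assoc)
    have b: "real k * ln CA \<le> real k * (3 / 2 * ln CA * x)"
    proof (rule mult_left_mono)
      have "3 / 2 * ln CA * (2 / 3) \<le> 3 / 2 * ln CA * x" using lnCA x by (intro mult_left_mono) auto
      then show "ln CA \<le> 3 / 2 * ln CA * x" by simp
    qed simp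
    have c: "real k * 3 \<le> real k * (9 / 2 * x)" using x by (intro mult_left_mono) auto
    have d: "(9 / 2 * ln CA + 19 / 2) * (real k * x) \<le> t * (real k * x)" using t x k2 by (intro mult_right_mono) auto
    \<comment> \<open>The origin of the threshold for \<open>CA\<close>. The term 9/2 ln CA pays for
      the powers of \<open>CA\<close> in \<open>A\<close>; 19/2 = 3 + 1 + 9/2 + 1 pays for the
      powers of \<open>k\<close> in \<open>A\<close>, for \<open>(real k)\<^sup>2\<close>, for
      \<open>9 ^ k\<close> and for the target 1 / k. Constants are compared with \<open>x\<close>
      through \<open>x \<ge> 2 / 3\<close>.\<close>
    have "real (2 * k + 1) * (ln CA + x) + 2 * x + real k * 3 + x
      \<le> 3 * (real k * (3 / 2 * ln CA * x)) + 3 * (real k * x) + real k * x + real k * (9 / 2 * x) + real k * x"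
      using a' b c kx kx' by linarith
    also have "\<dots> = (9 / 2 * ln CA + 19 / 2) * (real k * x)" by (simp add: algebra_simps)
    also have "\<dots> \<le> t * real k * x" using d by (simp add: mult.assoc)
    finally show ?thesis by simp
  qed
  also have "\<dots> = exp 1 / real k" using k2 by (simp add: exp_diff x_def)
  also have "\<dots> \<le> 3 / real k" using exp_le by (intro divide_right_mono) auto
  finally show "A ^ (2 * k + 1) * (real k)\<^sup>2 * 9 ^ k * (m0 * sqrt (real q) / A) ^ q \<le> 3 / real k" .
qed

text \<open>528 is 8 * 66, from the requirement that \<open>Y ^ (66 * k\<^sup>2)\<close> be at most
  N^(1/8) in \<open>moment_estimates\<close>. After taking logarithms, ln k is controlled by the
  second bound on \<open>k\<close>, ln r by the first one and \<open>\<epsilon>\<close>, and ln Q by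
  comparison with ln k.\<close>

lemma degree_growth:
  fixes k N n p :: nat and c \<epsilon> Q r :: real
  assumes n: "n \<ge> 1" and p: "p \<ge> 1" and N: "N = min n p" "N \<ge> 3" and k: "k \<ge> 2"
    and c: "0 < c" "c\<^sup>2 \<le> ln (ln 3)" "c\<^sup>2 * (528 * (3 / 4 * ln Q + 5 / 2)) \<le> 1" and Q: "Q \<ge> 1"
    and \<epsilon>: "0 < \<epsilon>" "\<epsilon> \<le> 1 / 2" "real n \<ge> real p powr (1 - \<epsilon>)"
    and k_le: "real k \<le> c * min (1 / sqrt \<epsilon>) (sqrt (ln (real N) / ln (ln (real N))))"
    and r: "r = real p / real N"
  shows "(Q * real k * r) ^ (528 * k\<^sup>2) \<le> real N"
proof -
  define u where "u = ln (real N)"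
  note ln3 = ln3_gt_1
  have u3: "u \<ge> ln 3" unfolding u_def using N(2) by simp
  have u1: "u > 1" using u3 ln3 by simp
  have lnu: "ln u \<ge> ln (ln 3)" using u3 ln3 u1 by simp
  have lnln3: "ln (ln (3::real)) > 0" using ln3 by simp
  have lnu0: "ln u > 0" using lnu lnln3 by linarith
  have k1: "\<epsilon> * (real k)\<^sup>2 \<le> c\<^sup>2"
  proof -
    have "real k \<le> c * (1 / sqrt \<epsilon>)" using k_le c(1) by (meson min.cobounded1 mult_left_mono order_trans less_imp_le)
    then have "(real k)\<^sup>2 \<le> (c * (1 / sqrt \<epsilon>))\<^sup>2" by (intro power_mono) auto
    also have "\<dots> = c\<^sup>2 / \<epsilon>" using \<epsilon>(1) by (simp add: power_mult_distrib power_divide)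
    finally show ?thesis using \<epsilon>(1) by (simp add: field_simps)
  qed
  have k2: "(real k)\<^sup>2 * ln u \<le> c\<^sup>2 * u"
  proof -
    have "real k \<le> c * sqrt (u / ln u)" using k_le c(1) unfolding u_def by (meson min.cobounded2 mult_left_mono order_trans less_imp_le)
    then have "(real k)\<^sup>2 \<le> (c * sqrt (u / ln u))\<^sup>2" by (intro power_mono) auto
    also have "\<dots> = c\<^sup>2 * (u / ln u)" using u1 lnu0 by (simp add: power_mult_distrib)
    finally show ?thesis using lnu0 by (simp add: field_simps)
  qed
  \<comment> \<open>Since \<open>c\<^sup>2 \<le> ln (ln 3) \<le> ln u\<close>, the factor
    \<open>c\<^sup>2\<close> cancels. The outcome says that 2 ln k is at most ln u, which converts
    the bound on k^2 ln u into one on k^2 ln k.\<close>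
  have ku: "(real k)\<^sup>2 \<le> u"
  proof -
    have "(real k)\<^sup>2 * c\<^sup>2 \<le> (real k)\<^sup>2 * ln u" using c(2) lnu by (intro mult_left_mono) auto
    also have "\<dots> \<le> u * c\<^sup>2" using k2 by (simp add: mult.commute)
    finally show ?thesis using c(1) by (simp add: mult_le_cancel_right)
  qed
  have k0: "real k \<ge> 2" using k by simp
  have lnk: "(real k)\<^sup>2 * ln (real k) \<le> c\<^sup>2 * u / 2"
  proof -
    have "ln ((real k)\<^sup>2) \<le> ln u" using ku k0 u1 by simp
    then have "2 * ln (real k) \<le> ln u" using k0 by (simp add: ln_realpow)
    then have "(real k)\<^sup>2 * (2 * ln (real k)) \<le> (real k)\<^sup>2 * ln u" by (intro mult_left_mono) auto
    then show ?thesis using k2 by simp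
  qed
  have N0: "real N > 0" using N(2) by simp
  have r1: "r \<ge> 1" using N0 N(1) by (auto simp: r field_simps)
  \<comment> \<open>If n < p, the condition on \<open>n\<close> says that ln r is at most
    \<open>\<epsilon>\<close> ln p, and \<open>\<epsilon> \<le> 1 / 2\<close> gives ln p at most 2
    ln N.\<close>
  have lnr: "ln r \<le> 2 * \<epsilon> * u"
  proof (cases "p \<le> n")
    case True
    then have "r = 1" using N N0 by (simp add: r)
    then show ?thesis using \<epsilon>(1) u1 by simp
  next
    case False
    then have Nn: "N = n" using N by simp
    have p0: "real p > 0" using p by simp
    have "ln (real p powr (1 - \<epsilon>)) \<le> ln (real n)" using \<epsilon>(3) p0 n by (subst ln_le_cancel_iff) auto
    then have "(1 - \<epsilon>) * ln (real p) \<le> u" using p0 by (simp add: ln_powr u_def Nn)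
    then have 1: "ln (real p) - u \<le> \<epsilon> * ln (real p)" by (simp add: algebra_simps)
    have "1 / 2 * ln (real p) \<le> (1 - \<epsilon>) * ln (real p)" using \<epsilon>(2) p by (intro mult_right_mono) auto
    then have "ln (real p) \<le> 2 * u" using \<open>(1 - \<epsilon>) * ln (real p) \<le> u\<close> by linarith
    then have "\<epsilon> * ln (real p) \<le> \<epsilon> * (2 * u)" using \<epsilon>(1) by (intro mult_left_mono) auto
    moreover have "ln r = ln (real p) - u" unfolding r u_def using p0 N0 by (simp add: ln_div)
    ultimately show ?thesis using 1 by simp
  qed
  have lnrk: "(real k)\<^sup>2 * ln r \<le> 2 * c\<^sup>2 * u"
  proof -
    have "(real k)\<^sup>2 * ln r \<le> (real k)\<^sup>2 * (2 * \<epsilon> * u)" using lnr by (intro mult_left_mono) auto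
    also have "\<dots> = 2 * (\<epsilon> * (real k)\<^sup>2) * u" by (simp add: mult_ac)
    also have "\<dots> \<le> 2 * c\<^sup>2 * u" using k1 u1 by (intro mult_right_mono) auto
    finally show ?thesis .
  qed
  have lnQ: "(real k)\<^sup>2 * ln Q \<le> 3 / 4 * ln Q * (c\<^sup>2 * u)"
  proof -
    have "3 / 2 * ln Q * (2 / 3) \<le> 3 / 2 * ln Q * ln (real k)"
      using Q ln_ge_two_thirds[OF k] by (intro mult_left_mono) auto
    then have "(real k)\<^sup>2 * ln Q \<le> (real k)\<^sup>2 * (3 / 2 * ln Q * ln (real k))" by (intro mult_left_mono) auto
    also have "\<dots> = 3 / 2 * ln Q * ((real k)\<^sup>2 * ln (real k))" by (simp add: mult_ac)
    also have "\<dots> \<le> 3 / 2 * ln Q * (c\<^sup>2 * u / 2)" using lnk Q by (intro mult_left_mono) auto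
    finally show ?thesis by simp
  qed
  have "ln (Q * real k * r) = ln Q + ln (real k) + ln r"
    using Q k0 r1 by (simp add: ln_mult)
  then have "(real k)\<^sup>2 * ln (Q * real k * r) = (real k)\<^sup>2 * ln Q + (real k)\<^sup>2 * ln (real k) + (real k)\<^sup>2 * ln r"
    by (simp add: algebra_simps)
  also have "\<dots> \<le> 3 / 4 * ln Q * (c\<^sup>2 * u) + c\<^sup>2 * u / 2 + 2 * c\<^sup>2 * u"
    using lnQ lnk lnrk by linarith
  also have "\<dots> = c\<^sup>2 * (3 / 4 * ln Q + 5 / 2) * u" by (simp add: algebra_simps)
  finally have "528 * ((real k)\<^sup>2 * ln (Q * real k * r)) \<le> 528 * (c\<^sup>2 * (3 / 4 * ln Q + 5 / 2) * u)" by linarith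
  also have "\<dots> = c\<^sup>2 * (528 * (3 / 4 * ln Q + 5 / 2)) * u" by (simp only: mult_ac)
  also have "\<dots> \<le> 1 * u" using c(3) u1 by (intro mult_right_mono) auto
  finally have "real (528 * k\<^sup>2) * ln (Q * real k * r) \<le> ln (real N)" by (simp add: u_def)
  moreover have pos: "Q * real k * r > 0" using Q k0 r1 by simp
  ultimately have "ln ((Q * real k * r) ^ (528 * k\<^sup>2)) \<le> ln (real N)" by (simp add: ln_realpow)
  then show ?thesis using pos N0 by (subst (asm) ln_le_cancel_iff) auto
qed

section \<open>Assembly of the error bound\<close>

text \<open>The Jackson error A / k is exactly \<open>sqrt CA\<close> times the rate. All other
  terms are of order 1 / k: the huge power of \<open>Y\<close> in the bound on
  \<open>\<delta>\<close> dominates \<open>real k ^ 3 * 9 ^ k\<close>, because \<open>Y\<close> is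
  at least 9 and at least \<open>k\<close>.\<close>

lemma final_error_le:
  fixes k :: nat and A CA Y T \<delta> d m0 :: real
  assumes k: "k \<ge> 2" and A: "1 \<le> A" "A \<le> CA * real k" "A = sqrt (CA * real k * ln (real k))" and CA: "CA \<ge> 1"
    and T: "T \<ge> 0" "A ^ (2 * k + 1) * (real k)\<^sup>2 * 9 ^ k * T \<le> 3 / real k"
    and Y: "Y \<ge> 9" "Y \<ge> real k" and \<delta>: "0 \<le> \<delta>" "\<delta> \<le> 1 / Y ^ (40 * k\<^sup>2)" and d: "d \<le> 1 / real k"
  shows "2 * (1 + 4 * pi) * A / real k
    + 8 * pi * A * real k * 9 ^ k * (4 * real k * (\<delta> + 2 * A ^ (2 * k) * T)) + A * T + d
    \<le> (2 * (1 + 4 * pi) * sqrt CA + 2 * (32 * pi * CA + 3 * (64 * pi + 1) + 1)) * sqrt (ln (real k) / real k)"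
proof -
  define w where "w = sqrt (ln (real k) / real k)"
  have k2: "real k \<ge> 2" using k by simp
  have w: "1 / real k \<le> 2 * w" unfolding w_def by (rule sqrt_ln_ratio_ge[OF k])
  have "A / real k = sqrt CA * w"
  proof -
    have "A / real k = sqrt (CA * real k * ln (real k)) / sqrt ((real k)\<^sup>2)" using k2 by (simp add: A(3))
    also have "\<dots> = sqrt (CA * real k * ln (real k) / (real k)\<^sup>2)" by (rule real_sqrt_divide[symmetric])
    also have "CA * real k * ln (real k) / (real k)\<^sup>2 = CA * (ln (real k) / real k)" using k2 by (simp add: power2_eq_square)
    also have "sqrt \<dots> = sqrt CA * w" unfolding w_def by (rule real_sqrt_mult)
    finally show ?thesis .
  qed
  then have 1: "2 * (1 + 4 * pi) * A / real k = 2 * (1 + 4 * pi) * sqrt CA * w" by (simp only: mult.assoc times_divide_eq_right[symmetric])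
  have 2: "32 * pi * (A * (real k)\<^sup>2 * 9 ^ k * \<delta>) \<le> 32 * pi * (CA / real k)"
  proof (rule mult_left_mono)
    have "A * (real k)\<^sup>2 * 9 ^ k * \<delta> \<le> (CA * real k) * (real k)\<^sup>2 * 9 ^ k * (1 / Y ^ (40 * k\<^sup>2))"
      using A \<delta> CA by (intro mult_mono) auto
    also have "\<dots> = CA * (real k ^ 3 * 9 ^ k) / Y ^ (40 * k\<^sup>2)" by (simp add: eval_nat_numeral)
    also have "\<dots> \<le> CA * (Y ^ 3 * Y ^ k) / Y ^ (40 * k\<^sup>2)"
      using Y CA by (intro divide_right_mono mult_left_mono mult_mono power_mono) auto
    also have "\<dots> = CA * (Y ^ (3 + k)) / Y ^ (40 * k\<^sup>2)" by (simp add: power_add)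
    also have "\<dots> \<le> CA * (Y ^ (3 + k)) / Y ^ (3 + k + 1)"
    proof (intro divide_left_mono power_increasing)
      have "k \<le> k\<^sup>2" "1 \<le> k\<^sup>2" using k by (auto simp: power2_eq_square)
      then show "3 + k + 1 \<le> 40 * k\<^sup>2" by linarith
    qed (use Y CA in auto)
    also have "\<dots> = CA / Y" using Y by (simp add: power_add field_simps eval_nat_numeral)
    also have "\<dots> \<le> CA / real k" using Y CA k2 by (intro divide_left_mono) auto
    finally show "A * (real k)\<^sup>2 * 9 ^ k * \<delta> \<le> CA / real k" .
  qed simp
  have 3: "64 * pi * (A ^ (2 * k + 1) * (real k)\<^sup>2 * 9 ^ k * T) \<le> 64 * pi * (3 / real k)"
    using T by (intro mult_left_mono) auto
  have 4: "A * T \<le> 3 / real k"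
  proof -
    have "A ^ 1 \<le> A ^ (2 * k + 1)" using A by (intro power_increasing) auto
    moreover have "1 * 1 \<le> (real k)\<^sup>2 * 9 ^ k" using k2 by (intro mult_mono one_le_power) auto
    ultimately have "A ^ 1 * (1 * 1) \<le> A ^ (2 * k + 1) * ((real k)\<^sup>2 * 9 ^ k)"
      using A(1) by - (rule mult_mono, auto)
    then have "A ^ 1 * (1 * 1) * T \<le> A ^ (2 * k + 1) * ((real k)\<^sup>2 * 9 ^ k) * T" using T by (intro mult_right_mono) auto
    then show ?thesis using T(2) by (simp add: mult.assoc)
  qed
  have split: "8 * pi * A * real k * 9 ^ k * (4 * real k * (\<delta> + 2 * A ^ (2 * k) * T))
    = 32 * pi * (A * (real k)\<^sup>2 * 9 ^ k * \<delta>) + 64 * pi * (A ^ (2 * k + 1) * (real k)\<^sup>2 * 9 ^ k * T)"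
    by (simp add: power2_eq_square algebra_simps)
  have "2 * (1 + 4 * pi) * A / real k
    + 8 * pi * A * real k * 9 ^ k * (4 * real k * (\<delta> + 2 * A ^ (2 * k) * T)) + A * T + d
    \<le> 2 * (1 + 4 * pi) * sqrt CA * w + 32 * pi * (CA / real k) + 64 * pi * (3 / real k) + 3 / real k + 1 / real k"
    unfolding split 1 using 2 3 4 d by linarith
  also have "\<dots> = 2 * (1 + 4 * pi) * sqrt CA * w + (32 * pi * CA + 3 * (64 * pi + 1) + 1) * (1 / real k)"
    by (simp add: algebra_simps add_divide_distrib)
  also have "\<dots> \<le> 2 * (1 + 4 * pi) * sqrt CA * w + (32 * pi * CA + 3 * (64 * pi + 1) + 1) * (2 * w)"
    using w CA by (intro add_left_mono mult_left_mono) auto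
  also have "\<dots> = (2 * (1 + 4 * pi) * sqrt CA + 2 * (32 * pi * CA + 3 * (64 * pi + 1) + 1)) * w"
    by (simp add: algebra_simps)
  finally show ?thesis by (simp add: w_def)
qed

text \<open>Translating both distributions by the true mean leaves the distance unchanged, so
  replacing the estimated shift by the true one adds only \<open>d\<close>.\<close>

lemma (in regression_model) W1_g_hat_le:
  fixes k :: nat and A CA T \<delta> :: real
  assumes D: "is_dmm A k (mu_hat n p \<sigma> X y) (D (mu_hat n p \<sigma> X y))" and A: "A \<ge> 1" and k: "k \<ge> 1"
    and q: "2 * k \<le> q" and T: "T = (m0 * sqrt (real q) / A) ^ q"
    and \<delta>: "\<And>l. l \<in> {1..2 * k - 1} \<Longrightarrow> \<bar>\<mu> l - mu_hat n p \<sigma> X y l\<bar> \<le> \<delta>"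
    and mean: "\<bar>m1_hat n p X y - mean g\<bar> \<le> d"
  shows "W1 g (g_hat D n p \<sigma> X y) \<le> ennreal (2 * (1 + 4 * pi) * A / real k
    + 8 * pi * A * real k * 9 ^ k * (4 * real k * (\<delta> + 2 * A ^ (2 * k) * T)) + A * T + d)"
proof -
  define \<pi> where "\<pi> = D (mu_hat n p \<sigma> X y)"
  define m where "m = m1_hat n p X y"
  have \<pi>: "real_distribution \<pi>" using D by (simp add: \<pi>_def is_dmm_def)
  interpret \<pi>: real_distribution \<pi> by (rule \<pi>)
  have T0: "T \<ge> 0" using m0 A by (simp add: T)
  have d0: "d \<ge> 0" using mean by linarith
  have "1 \<in> {1..2 * k - 1}" using k by auto
  then have \<delta>0: "\<delta> \<ge> 0" using \<delta>[of 1] by linarith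
  have W: "W1 g0 \<pi> \<le> ennreal (2 * (1 + 4 * pi) * A / real k
    + 8 * pi * A * real k * 9 ^ k * (4 * real k * (\<delta> + 2 * A ^ (2 * k) * T)) + A * T)"
  proof (rule W1_dmm_le[OF g0 _ A k _ _ T0])
    show "is_dmm A k (mu_hat n p \<sigma> X y) \<pi>" using D by (simp add: \<pi>_def)
    show "integrable g0 (\<lambda>x. \<bar>x\<bar> ^ l)" for l using all_moments_g0 by (simp add: all_moments_def)
    show "(\<integral>x. \<bar>x\<bar> ^ l * indicator {x. A < \<bar>x\<bar>} x \<partial>g0) \<le> A ^ l * T" if "l \<in> {1..2 * k - 1}" for l
      unfolding T by (rule tail_g0_le) (use A q that k in auto)
    show "\<bar>moment g0 l - mu_hat n p \<sigma> X y l\<bar> \<le> \<delta>" if "l \<in> {1..2 * k - 1}" for l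
      using \<delta>[OF that] by (simp add: \<mu>_def)
  qed
  define g1 where "g1 = distr \<pi> borel (\<lambda>x. x + mean g)"
  define g2 where "g2 = distr \<pi> borel (\<lambda>x. x + m)"
  have g12: "real_distribution g1" "real_distribution g2"
    unfolding g1_def g2_def by (rule real_distribution_distr_real[OF \<pi>]; simp)+
  have "W1 g g1 = W1 (distr g0 borel (\<lambda>x. x + mean g)) (distr \<pi> borel (\<lambda>x. x + mean g))"
    unfolding g1_def by (simp only: real_distribution_model_parts[symmetric])
  also have "\<dots> = W1 g0 \<pi>" by (rule W1_translate[OF g0 \<pi>])
  finally have 1: "W1 g g1 = W1 g0 \<pi>" .
  have "W1 g1 g2 \<le> (\<integral>\<^sup>+x. ennreal \<bar>(x + mean g) - (x + m)\<bar> \<partial>\<pi>)"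
    unfolding g1_def g2_def by (rule W1_distr_le[OF \<pi>]) auto
  also have "\<dots> = ennreal \<bar>mean g - m\<bar>" using \<pi>.emeasure_space_1 by simp
  also have "\<dots> \<le> ennreal d" using mean by (intro ennreal_leI) (simp add: m_def abs_minus_commute)
  finally have 2: "W1 g1 g2 \<le> ennreal d" .
  have "g_hat D n p \<sigma> X y = g2" by (simp add: g_hat_def g2_def \<pi>_def m_def)
  then have "W1 g (g_hat D n p \<sigma> X y) \<le> W1 g g1 + W1 g1 g2" using W1_triangle[OF g g12] by simp
  also have "\<dots> \<le> ennreal (2 * (1 + 4 * pi) * A / real k
    + 8 * pi * A * real k * 9 ^ k * (4 * real k * (\<delta> + 2 * A ^ (2 * k) * T)) + A * T) + ennreal d"
    unfolding 1 by (intro add_mono W 2)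
  also have "\<dots> = ennreal (2 * (1 + 4 * pi) * A / real k
    + 8 * pi * A * real k * 9 ^ k * (4 * real k * (\<delta> + 2 * A ^ (2 * k) * T)) + A * T + d)"
    using A T0 d0 \<delta>0 by (intro ennreal_plus[symmetric]) auto
  finally show ?thesis .
qed

theorem corollary4:
  fixes c0 M :: real
  assumes "c0 > 0" and "M > 0"
  shows "\<exists>c_max>0. \<exists>CA_min>0. \<forall>c CA :: real. 0 < c \<and> c \<le> c_max \<and> CA \<ge> CA_min \<longrightarrow>
    (\<exists>C1>0. \<exists>C2>0. \<exists>C>0.
      \<forall>(n::nat) (p::nat) (k0::nat) (\<sigma>::real) (X :: nat \<Rightarrow> nat \<Rightarrow> real) (g :: real measure)
        (\<epsilon>::real) (N::nat) (k::nat) (A::real) (D :: (nat \<Rightarrow> real) \<Rightarrow> real measure).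
        n \<ge> 1 \<longrightarrow> p \<ge> 1 \<longrightarrow> k0 \<ge> 1 \<longrightarrow> \<sigma> > 0 \<longrightarrow>
        op_norm n p X / \<sigma> \<ge> c0 \<longrightarrow>
        gram_sum n p X 1 \<ge> c0 * real (min n p) * op_norm n p X ^ 2 \<longrightarrow>
        gram_sum n p X 2 \<ge> c0 * real (min n p) * op_norm n p X ^ 4 \<longrightarrow>
        (\<forall>j::nat. 3 \<le> j \<and> j \<le> k0 \<longrightarrow>
           gram_sum n p X j \<ge>
             c0 ^ j * op_norm n p X ^ (2 * j) * real p * (min (real n / real p) 1) ^ j) \<longrightarrow>
        real_distribution g \<longrightarrow> subgaussian M g \<longrightarrow>
        0 < \<epsilon> \<longrightarrow> \<epsilon> \<le> 1 / 2 \<longrightarrow> real n \<ge> real p powr (1 - \<epsilon>) \<longrightarrow>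
        N = min n p \<longrightarrow>
        k = nat \<lfloor>c * min (1 / sqrt \<epsilon>) (sqrt (ln (real N) / ln (ln (real N))))\<rfloor> \<longrightarrow>
        N \<ge> 3 \<longrightarrow> k \<ge> 1 \<longrightarrow> 2 * k - 1 \<le> k0 \<longrightarrow>
        A = sqrt (CA * real k * ln (real k)) \<longrightarrow>
        (\<forall>v. is_dmm A k v (D v)) \<longrightarrow>
        Measurable.pred (model n p \<sigma> g)
          (\<lambda>\<omega>. W1 g (g_hat D n p \<sigma> X (response p X \<omega>)) > ennreal (C * sqrt (ln (real k) / real k))) \<and>
        \<P>(\<omega> in model n p \<sigma> g.
            W1 g (g_hat D n p \<sigma> X (response p X \<omega>)) > ennreal (C * sqrt (ln (real k) / real k)))
          \<le> real k powr (C1 * (real k)\<^sup>2) / real N + real k powr (- C2))"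
proof -
  define K0 where "K0 = 1 + 3 * M"
  define kap where "kap = sqrt (1 + 1 / c0\<^sup>2)"
  \<comment> \<open>One summand for each of the three conditions on \<open>Q\<close> in
    \<open>moment_estimates\<close>; \<open>K0\<close> and \<open>kap\<close> are the values that
    \<open>K\<close> and \<open>\<kappa>\<close> take in the locale.\<close>
  define Q where "Q = 96 * K0 + kap / min c0 1 + 8 * K0 * kap / sqrt c0"
  have K1: "K0 \<ge> 1" using assms by (simp add: K0_def)
  have kap0: "kap \<ge> 0" by (simp add: kap_def add_nonneg_nonneg)
  have parts: "0 \<le> kap / min c0 1" "0 \<le> 8 * K0 * kap / sqrt c0" using K1 kap0 assms by auto
  have Q: "Q \<ge> 96 * K0" "Q \<ge> kap / min c0 1" "Q \<ge> 8 * K0 * kap / sqrt c0" using parts K1 by (auto simp: Q_def)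
  have Q2: "Q\<^sup>2 \<ge> 64 * K0\<^sup>2 * kap\<^sup>2 / c0"
  proof -
    have "(8 * K0 * kap / sqrt c0)\<^sup>2 \<le> Q\<^sup>2" using Q(3) parts(2) by (intro power_mono) auto
    then show ?thesis using assms by (simp add: power_divide power_mult_distrib)
  qed
  have Q1: "Q \<ge> 1" using Q(1) K1 by linarith
  define B where "B = 528 * (3 / 4 * ln Q + 5 / 2)"
  have B: "B > 0" using Q1 by (simp add: B_def add_nonneg_pos)
  have ln3: "ln (3::real) > 1"
  proof -
    have "exp 1 < (3::real)" using e_less_272 by simp
    then have "ln (exp 1) < ln (3::real)" by (subst ln_less_cancel_iff) auto
    then show ?thesis by simp
  qed
  \<comment> \<open>The two smallness conditions on \<open>c\<close> in
    \<open>degree_growth\<close>, with \<open>B\<close> the factor of the second.\<close>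
  define c_max where "c_max = sqrt (min (ln (ln 3)) (1 / B))"
  have min0: "min (ln (ln 3)) (1 / B) > 0" using ln3 B by simp
  have cm: "c_max > 0" using min0 by (simp add: c_max_def)
  \<comment> \<open>A linear function overtakes the logarithm; this yields the threshold that
    \<open>truncation_tail_le\<close> requires.\<close>
  have "eventually (\<lambda>CA. CA / (9 * M\<^sup>2) \<ge> 9 / 2 * ln CA + 19 / 2) at_top"
    using assms(2) by real_asymp
  then obtain CA0 where CA0: "\<And>CA. CA \<ge> CA0 \<Longrightarrow> CA / (9 * M\<^sup>2) \<ge> 9 / 2 * ln CA + 19 / 2"
    unfolding eventually_at_top_linorder by blast
  define CA_min where "CA_min = max 1 CA0"
  have CA_min: "CA_min > 0" by (simp add: CA_min_def)
  show ?thesis (is "\<exists>c_max>0. \<exists>CA_min>0. \<forall>c CA. ?H c CA c_max CA_min \<longrightarrow> (\<exists>C1>0. \<exists>C2>0. \<exists>C>0. ?P c CA C1 C2 C)")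
  proof (rule exI[of _ c_max], rule conjI[OF cm], rule exI[of _ CA_min], rule conjI[OF CA_min], intro allI impI)
    fix c CA :: real
    assume cCA: "0 < c \<and> c \<le> c_max \<and> CA \<ge> CA_min"
    then have c: "0 < c" "c \<le> c_max" and CA: "CA \<ge> 1" "CA / (9 * M\<^sup>2) \<ge> 9 / 2 * ln CA + 19 / 2"
      using CA0[of CA] by (auto simp: CA_min_def)
    have "c\<^sup>2 \<le> c_max\<^sup>2" using c by (intro power_mono) auto
    also have "\<dots> = min (ln (ln 3)) (1 / B)" using min0 by (simp add: c_max_def)
    finally have c2: "c\<^sup>2 \<le> ln (ln 3)" "c\<^sup>2 * B \<le> 1" using B by (auto simp: field_simps)
    define C where "C = 2 * (1 + 4 * pi) * sqrt CA + 2 * (32 * pi * CA + 3 * (64 * pi + 1) + 1)"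
    have C0: "C > 0" using CA by (simp add: C_def add_nonneg_pos add_pos_nonneg)
    show "\<exists>C1>0. \<exists>C2>0. \<exists>C>0. ?P c CA C1 C2 C"
    \<comment> \<open>\<open>C2 = 1\<close> reflects that the bad event has probability at most 1 /
      k; \<open>C\<close> is the factor produced by \<open>final_error_le\<close>.\<close>
    proof (rule exI[of _ 1], rule conjI[OF zero_less_one], rule exI[of _ 1], rule conjI[OF zero_less_one],
        rule exI[of _ C], rule conjI[OF C0], intro allI impI)
      fix n p k0 :: nat and \<sigma> :: real and X :: "nat \<Rightarrow> nat \<Rightarrow> real" and g :: "real measure"
        and \<epsilon> :: real and N k :: nat and A :: real and D :: "(nat \<Rightarrow> real) \<Rightarrow> real measure"
      assume n: "n \<ge> 1" and p: "p \<ge> 1" and \<sigma>: "\<sigma> > 0" and snr: "op_norm n p X / \<sigma> \<ge> c0"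
        and A1: "gram_sum n p X 1 \<ge> c0 * real (min n p) * op_norm n p X ^ 2"
        and A2: "gram_sum n p X 2 \<ge> c0 * real (min n p) * op_norm n p X ^ 4"
        and Aj: "\<forall>j::nat. 3 \<le> j \<and> j \<le> k0 \<longrightarrow>
           gram_sum n p X j \<ge> c0 ^ j * op_norm n p X ^ (2 * j) * real p * (min (real n / real p) 1) ^ j"
        and g: "real_distribution g" "subgaussian M g"
        and \<epsilon>: "0 < \<epsilon>" "\<epsilon> \<le> 1 / 2" "real n \<ge> real p powr (1 - \<epsilon>)"
        and N: "N = min n p" and k_def: "k = nat \<lfloor>c * min (1 / sqrt \<epsilon>) (sqrt (ln (real N) / ln (ln (real N))))\<rfloor>"
        and N3: "N \<ge> 3" and k: "k \<ge> 1" and kk0: "2 * k - 1 \<le> k0"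
        and A: "A = sqrt (CA * real k * ln (real k))" and D: "\<forall>v. is_dmm A k v (D v)"
      interpret rm: regression_model n p \<sigma> c0 M X g
        by (rule regression_model.intro[OF n p \<sigma> assms snr A1 g])
      interpret mod: prob_space "model n p \<sigma> g" by (rule rm.prob_space_model)
      let ?bad = "\<lambda>\<omega>. W1 g (g_hat D n p \<sigma> X (response p X \<omega>)) > ennreal (C * sqrt (ln (real k) / real k))"
      have "A \<ge> 0" using CA k by (simp add: A)
      then have meas: "Measurable.pred (model n p \<sigma> g) ?bad"
        by (intro measurable_W1_g_hat[where y="response p X"] rm.measurable_response) (use g D \<sigma> in auto)
      have N0: "real N > 0" using N3 by simp
      have "\<P>(\<omega> in model n p \<sigma> g. ?bad \<omega>) \<le> real k powr (- 1)"
      \<comment> \<open>For \<open>k = 1\<close> the claimed bound is 1, whereas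
        \<open>A = 0\<close> and the approximation argument, which needs \<open>A \<ge> 1\<close>,
        does not apply.\<close>
      proof (cases "k = 1")
        case True
        then show ?thesis by simp
      next
        case False
        then have k2: "k \<ge> 2" using k by simp
        define r where "r = real p / real (min n p)"
        define Y where "Y = Q * real k * r"
        define \<nu> where "\<nu> = root 8 (real N)"
        have \<nu>: "\<nu> > 0" "\<nu> ^ 8 = real N" using N0 by (auto simp: \<nu>_def real_root_gt_zero)
        have r1: "r \<ge> 1" using N0 N by (auto simp: r_def field_simps)
        have k_le: "real k \<le> c * min (1 / sqrt \<epsilon>) (sqrt (ln (real N) / ln (ln (real N))))"
          using k unfolding k_def by linarith
        have Y0: "Y \<ge> 0" using Q1 r1 by (simp add: Y_def)
        have "Y ^ (528 * k\<^sup>2) \<le> real N"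
          unfolding Y_def
          by (rule degree_growth[OF n p N N3 k2 c(1) c2(1) _ Q1 \<epsilon> k_le]) (use c2(2) in \<open>auto simp: B_def r_def N\<close>)
        then have "(Y ^ (66 * k\<^sup>2)) ^ 8 \<le> \<nu> ^ 8" unfolding \<nu>(2) by (simp add: power_mult[symmetric])
        then have Y\<nu>: "Y ^ (66 * k\<^sup>2) \<le> \<nu>" using \<nu>(1) Y0 by (subst (asm) power_mono_iff) auto
        obtain Bad where Bad: "Bad \<in> sets (model n p \<sigma> g)" "measure (model n p \<sigma> g) Bad \<le> 1 / real k"
          "\<And>\<omega>. \<omega> \<in> space (model n p \<sigma> g) \<Longrightarrow> \<omega> \<notin> Bad \<Longrightarrow> \<bar>m1_hat n p X (response p X \<omega>) - mean g\<bar> \<le> 1 / real k"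
          "\<And>\<omega> l. \<omega> \<in> space (model n p \<sigma> g) \<Longrightarrow> \<omega> \<notin> Bad \<Longrightarrow> l \<in> {1..2 * k - 1} \<Longrightarrow>
            \<bar>rm.\<mu> l - mu_hat n p \<sigma> X (response p X \<omega>) l\<bar> \<le> 1 / Y ^ (40 * k\<^sup>2)"
        proof (rule rm.moment_estimates[OF k r_def Y_def _ _ _ \<nu>(1) _ Y\<nu> A2])
          show "Q \<ge> 96 * rm.K" "Q \<ge> rm.\<kappa> / min c0 1" "Q\<^sup>2 \<ge> 64 * rm.K\<^sup>2 * rm.\<kappa>\<^sup>2 / c0"
            using Q(1,2) Q2 by (simp_all add: K0_def kap_def rm.K_def rm.\<kappa>_def)
          show "\<nu> ^ 8 = real (min n p)" using \<nu>(2) N by simp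
          show "gram_sum n p X j \<ge> c0 ^ j * op_norm n p X ^ (2 * j) * real p * (min (real n / real p) 1) ^ j"
            if "3 \<le> j" "j \<le> 2 * k - 1" for j using Aj that kk0 by simp
        qed blast
        define q where "q = nat \<lfloor>A\<^sup>2 / (9 * M\<^sup>2)\<rfloor>"
        define T where "T = (M * sqrt (real q) / A) ^ q"
        note trunc = truncation_tail_le[OF k2 assms(2) CA A, folded q_def, folded T_def]
        have QY: "96 * real k \<le> Y"
        proof -
          have "96 * real k * 1 \<le> Q * real k * r"
            using Q(1) K1 r1 k by (intro mult_mono mult_right_mono) auto
          then show ?thesis by (simp add: Y_def)
        qed
        have good: "\<not> ?bad \<omega>" if \<omega>: "\<omega> \<in> space (model n p \<sigma> g)" "\<omega> \<notin> Bad" for \<omega>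
        proof -
          have "W1 g (g_hat D n p \<sigma> X (response p X \<omega>)) \<le> ennreal (2 * (1 + 4 * pi) * A / real k
            + 8 * pi * A * real k * 9 ^ k * (4 * real k * (1 / Y ^ (40 * k\<^sup>2) + 2 * A ^ (2 * k) * T)) + A * T + 1 / real k)"
            by (rule rm.W1_g_hat_le[OF _ trunc(1) k trunc(3) T_def Bad(4)[OF \<omega>] Bad(3)[OF \<omega>]]) (use D in blast)+
          also have "\<dots> \<le> ennreal (C * sqrt (ln (real k) / real k))"
            unfolding C_def
            by (intro ennreal_leI final_error_le[where Y=Y, OF k2 trunc(1,2) A CA(1) _ trunc(4)])
              (use QY k2 assms(2) trunc(1) in \<open>auto simp: T_def\<close>)
          finally show ?thesis by (simp add: not_less)
        qed
        have "\<P>(\<omega> in model n p \<sigma> g. ?bad \<omega>) \<le> measure (model n p \<sigma> g) Bad"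
          by (rule mod.finite_measure_mono[OF _ Bad(1)]) (use good in blast)
        also have "\<dots> \<le> 1 / real k" by (rule Bad(2))
        also have "\<dots> = real k powr (- 1)" using k by (simp add: powr_minus inverse_eq_divide)
        finally show ?thesis .
      qed
      moreover have "0 \<le> real k powr (1 * (real k)\<^sup>2) / real N" by simp
      ultimately show "Measurable.pred (model n p \<sigma> g) ?bad \<and>
        \<P>(\<omega> in model n p \<sigma> g. ?bad \<omega>) \<le> real k powr (1 * (real k)\<^sup>2) / real N + real k powr (- 1)"
        using meas by (intro conjI) linarith+
    qed
  qed
qed

end
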